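(* Fix one of the three graphical flows (MCF) with $n\ge 1$, (SD) with $n\ge 1$, or (WF) with $n=2$, written as $\partial_t u+Au=N[u]$ on $\mathbb{R}^n\times(0,\infty)$, with $\alpha=2$ for (MCF) and $\alpha=4$ for (SD), (WF), and let $\beta>0$. There exists $\varepsilon>0$ such that the following holds. Let $v_0:\mathbb{R}^n\to\mathbb{R}$ be self-similar, i.e. $v_0(x)=\lambda^{-1}v_0(\lambda x)$ for all $\lambda>0$, $x\in\mathbb{R}^n$, and let $p:\mathbb{R}^n\to\mathbb{R}$ satisfy $\|p\|_{L^\infty(\mathbb{R}^n)}<\infty$ and $$\|\nabla v_0\|_{L^\infty(\mathbb{R}^n)}+\|(1+|x|^\beta)\nabla p\|_{L^\infty(\mathbb{R}^n)}<\varepsilon .$$ Let $u$ be the global mild solution with initial data $u_0=v_0+p$, let $v$ be the global mild solution with initial data $v_0$, and let $\Psi(x):=v(x,1)$ be the self-similar profile, so that $v(x,t)=t^{1/\alpha}\Psi(xt^{-1/\alpha})$. Then $$\lim_{t\to\infty}\left\|t^{-\frac1\alpha}u(t^{\frac1\alpha}x,t)-\Psi(x)\right\|_{C^1(\mathbb{R}^n)}=0,$$ where the $C^1(\mathbb{R}^n)$ norm (sum of the sup norms of the function and of its gradient) is taken in the variable $x$.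
   Context: Flows. For $u=u(x,t)$ on $\mathbb{R}^n\times(0,\infty)$ let $w=\sqrt{1+|\nabla u|^2}$ and $\mathcal H=\mathrm{div}(\nabla u/w)$. (MCF) graphical mean curvature flow: $\partial_t u=w\,\mathrm{div}(\nabla u/w)$. Here $A=-\Delta$, $N[u]=-w^{-2}\sum_{i,j}\nabla_iu\nabla_ju\nabla_{ij}u$. (SD) graphical surface diffusion: $\partial_t u=-\mathrm{div}\left[w\left(I-\frac{\nabla u\otimes\nabla u}{w^2}\right)\nabla\mathcal H\right]$. (WF) graphical Willmore flow: $\partial_t u=-w\,\mathrm{div}\left[\frac1w\left(\left(I-\frac{\nabla u\otimes\nabla u}{w^2}\right)\nabla(w\mathcal H)-\frac12\mathcal H^2\nabla u\right)\right]$. For (SD) and (WF), $A=\Delta^2$ and the equation is rewritten (Koch–Lamm) as $\partial_tu+\Delta^2u=N[u]:=f_0[u]+\nabla_if_1^i[u]+\nabla_{ij}f_2^{ij}[u]$ (summation convention; $f_0=0$ for SD), where each component of $f_0,f_1,f_2$ is a fixed constant-coefficient linear combination of terms of the respective forms $\nabla^2u\star\nabla^2u\star\nabla^2u\star w^{-2k}P_{2k-2}(\nabla u)$ $(1\le k\le4)$; $\nabla^2u\star\nabla^2u\star w^{-2k}P_{2k-1}(\nabla u)$ $(1\le k\le 4)$; $\nabla^2u\star w^{-2k}P_{2k}(\nabla u)$ $(1\le k\le2)$. Here $\star$ denotes a product of components and $P_j(\nabla u)$ a product of $j$ first partial derivatives of $u$. Mild solution. $u$ is a (global) mild solution with initial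 data $u_0$ if $u(x,t)=e^{-tA}u_0(x)+\int_0^te^{-(t-s)A}N[u](x,s)\,ds$ for all $(x,t)\in\mathbb{R}^n\times(0,\infty)$, where $e^{-tA}$ is convolution with the heat kernel ($A=-\Delta$) or the biharmonic heat kernel ($A=\Delta^2$), and for $A=\Delta^2$ the derivatives in front of $f_1,f_2$ are moved onto the kernel by integration by parts. Function space. With $0<T\le\infty$, for (MCF): $\|f\|_{X_T}=\sup_{0<t<T}\|\nabla f(\cdot,t)\|_{L^\infty}+\sup_{x\in\mathbb{R}^n}\sup_{0<R^2<T}R^{\frac2{n+4}}\|\nabla^2f\|_{L^{n+4}(B_R(x)\times(R^2/2,R^2))}$; for (SD), (WF): $\|f\|_{X_T}=\sup_{0<t<T}\|\nabla f(\cdot,t)\|_{L^\infty}+\sup_{x\in\mathbb{R}^n}\sup_{0<R^4<T}R^{\frac2{n+6}}\|\nabla^2f\|_{L^{n+6}(B_R(x)\times(R^4/2,R^4))}$. Known well-posedness (Koch–Lamm), used to specify the solutions: there are $\varepsilon_0,C>0$ such that for every $u_0$ with $\|\nabla u_0\|_{L^\infty}<\varepsilon_0$ there is a solution $u$ with $u(\cdot,0)=u_0$ and $\|u\|_{X_\infty}\le C\|\nabla u_0\|_{L^\infty}$, unique in $\{\|u\|_{X_\infty}\le C\varepsilon_0\}$; moreover it is analytic for $t>0$ and there are $c,R>0$ with $\sup_{x}\sup_{t>0}|(t^{1/\alpha}\nabla)^\gamma(t\partial_t)^k\nabla u(x,t)|\le c\|\nabla u_0\|_{L^\infty}R^{|\gamma|+k}(|\gamma|+k)!$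 for all $k\in\mathbb{N}_0$, $\gamma\in\mathbb{N}_0^n$. "The global mild solution" always means this solution. By scale invariance and uniqueness, the solution $v$ with self-similar data $v_0$ satisfies $v(x,t)=\lambda^{-1}v(\lambda x,\lambda^\alpha t)$ for all $\lambda>0$. *)

theory Defs
  imports "HOL-Probability.Essential_Supremum"
begin

section \<open>Classical derivatives on \<open>\<real>\<^sup>n\<close>\<close>

definition pd :: "'n::finite \<Rightarrow> (real^'n \<Rightarrow> real) \<Rightarrow> real^'n \<Rightarrow> real" where
  "pd i f x = deriv (\<lambda>h. f (x + h *\<^sub>R axis i 1)) 0"

definition pd_list :: "'n::finite list \<Rightarrow> (real^'n \<Rightarrow> real) \<Rightarrow> real^'n \<Rightarrow> real" where
  "pd_list is f = foldr pd is f"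

definition Ck :: "nat \<Rightarrow> (real^'n::finite \<Rightarrow> real) \<Rightarrow> bool" where
  "Ck k f \<longleftrightarrow>
     (\<forall>is. length is \<le> k \<longrightarrow> continuous_on UNIV (pd_list is f)) \<and>
     (\<forall>is i x. length is < k \<longrightarrow> (\<lambda>h. pd_list is f (x + h *\<^sub>R axis i 1)) differentiable (at 0))"

definition smooth :: "(real^'n::finite \<Rightarrow> real) \<Rightarrow> bool" where
  "smooth f \<longleftrightarrow> (\<forall>k. Ck k f)"

definition grad :: "(real^'n::finite \<Rightarrow> real) \<Rightarrow> real^'n \<Rightarrow> real^'n" where
  "grad f x = (\<chi> i. pd i f x)"

definition hess :: "(real^'n::finite \<Rightarrow> real) \<Rightarrow> real^'n \<Rightarrow> real^'n^'n" where
  "hess f x = (\<chi> i j. pd i (pd j f) x)"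

definition dvg :: "(real^'n::finite \<Rightarrow> real^'n) \<Rightarrow> real^'n \<Rightarrow> real" where
  "dvg X x = (\<Sum>i\<in>UNIV. pd i (\<lambda>y. X y $ i) x)"

definition lap :: "(real^'n::finite \<Rightarrow> real) \<Rightarrow> real^'n \<Rightarrow> real" where
  "lap f x = (\<Sum>i\<in>UNIV. pd i (pd i f) x)"


section \<open>The flows\<close>

datatype flow = MCF | SD | WF

primrec alpha :: "flow \<Rightarrow> real" where
  "alpha MCF = 2" | "alpha SD = 4" | "alpha WF = 4"

definition wfac :: "(real^'n::finite \<Rightarrow> real) \<Rightarrow> real^'n \<Rightarrow> real" where
  "wfac u x = sqrt (1 + (norm (grad u x))\<^sup>2)"

definition mcurv :: "(real^'n::finite \<Rightarrow> real) \<Rightarrow> real^'n \<Rightarrow> real" where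
  "mcurv u = dvg (\<lambda>y. (1 / wfac u y) *\<^sub>R grad u y)"

text \<open>\<open>tproj u x z\<close> is \<open>(I - \<nabla>u \<otimes> \<nabla>u / w\<^sup>2) z\<close> at the point \<open>x\<close>.\<close>

definition tproj :: "(real^'n::finite \<Rightarrow> real) \<Rightarrow> real^'n \<Rightarrow> real^'n \<Rightarrow> real^'n" where
  "tproj u x z = z - ((grad u x \<bullet> z) / (wfac u x)\<^sup>2) *\<^sub>R grad u x"

primrec flow_rhs :: "flow \<Rightarrow> (real^'n::finite \<Rightarrow> real) \<Rightarrow> real^'n \<Rightarrow> real" where
  "flow_rhs MCF u x = wfac u x * dvg (\<lambda>y. (1 / wfac u y) *\<^sub>R grad u y) x"
| "flow_rhs SD u x = - dvg (\<lambda>y. wfac u y *\<^sub>R tproj u y (grad (mcurv u) y)) x"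
| "flow_rhs WF u x = - (wfac u x * dvg (\<lambda>y. (1 / wfac u y) *\<^sub>R
      (tproj u y (grad (\<lambda>z. wfac u z * mcurv u z) y) - ((1/2) * (mcurv u y)\<^sup>2) *\<^sub>R grad u y)) x)"

primrec lin_op :: "flow \<Rightarrow> (real^'n::finite \<Rightarrow> real) \<Rightarrow> real^'n \<Rightarrow> real" where
  "lin_op MCF u = (\<lambda>x. - lap u x)"
| "lin_op SD u = lap (lap u)"
| "lin_op WF u = lap (lap u)"


section \<open>The nonlinearity\<close>

text \<open>
  \<open>N[u] = f\<^sub>0 + \<nabla>\<^sub>i f\<^sub>1\<^sup>i + \<nabla>\<^sub>i\<^sub>j f\<^sub>2\<^sup>i\<^sup>j\<close>, where the components are functions of
  the gradient and the Hessian of \<open>u\<close>.  For MCF the parts \<open>f\<^sub>1\<close> and \<open>f\<^sub>2\<close> vanish.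
\<close>

record ('n::finite) nonlin =
  nl0 :: "real^'n \<Rightarrow> real^'n^'n \<Rightarrow> real"
  nl1 :: "'n \<Rightarrow> real^'n \<Rightarrow> real^'n^'n \<Rightarrow> real"
  nl2 :: "'n \<Rightarrow> 'n \<Rightarrow> real^'n \<Rightarrow> real^'n^'n \<Rightarrow> real"

definition nonlin_apply :: "('n::finite) nonlin \<Rightarrow> (real^'n \<Rightarrow> real) \<Rightarrow> real^'n \<Rightarrow> real" where
  "nonlin_apply N u x =
     nl0 N (grad u x) (hess u x)
     + (\<Sum>i\<in>UNIV. pd i (\<lambda>y. nl1 N i (grad u y) (hess u y)) x)
     + (\<Sum>i\<in>UNIV. \<Sum>j\<in>UNIV. pd i (pd j (\<lambda>y. nl2 N i j (grad u y) (hess u y))) x)"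

definition lin_combs ::
    "(real^'n::finite \<Rightarrow> real^'n^'n \<Rightarrow> real) set \<Rightarrow> (real^'n \<Rightarrow> real^'n^'n \<Rightarrow> real) set" where
  "lin_combs S = {f. \<exists>T c. finite T \<and> T \<subseteq> S \<and> f = (\<lambda>p M. \<Sum>g\<in>T. c g * g p M)}"

text \<open>\<open>w\<^sup>-\<^sup>2\<^sup>k\<close> times the product of the components of \<open>p = \<nabla>u\<close> listed in \<open>is\<close>.\<close>

definition grad_mono :: "nat \<Rightarrow> 'n::finite list \<Rightarrow> real^'n \<Rightarrow> real" where
  "grad_mono k is p = prod_list (map (\<lambda>i. p $ i) is) / (1 + (norm p)\<^sup>2) ^ k"

definition terms0 :: "(real^'n::finite \<Rightarrow> real^'n^'n \<Rightarrow> real) set" where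
  "terms0 = {(\<lambda>p M. M $ a $ b * M $ c $ d * M $ e $ f * grad_mono k is p) | a b c d e f k is.
               1 \<le> k \<and> k \<le> 4 \<and> length is = 2 * k - 2}"

definition terms1 :: "(real^'n::finite \<Rightarrow> real^'n^'n \<Rightarrow> real) set" where
  "terms1 = {(\<lambda>p M. M $ a $ b * M $ c $ d * grad_mono k is p) | a b c d k is.
               1 \<le> k \<and> k \<le> 4 \<and> length is = 2 * k - 1}"

definition terms2 :: "(real^'n::finite \<Rightarrow> real^'n^'n \<Rightarrow> real) set" where
  "terms2 = {(\<lambda>p M. M $ a $ b * grad_mono k is p) | a b k is.
               1 \<le> k \<and> k \<le> 2 \<and> length is = 2 * k}"

definition mcf_nonlin :: "('n::finite) nonlin" where
  "mcf_nonlin = \<lparr>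
     nl0 = (\<lambda>p M. - (\<Sum>i\<in>UNIV. \<Sum>j\<in>UNIV. p $ i * p $ j * M $ i $ j) / (1 + (norm p)\<^sup>2)),
     nl1 = (\<lambda>_ _ _. 0),
     nl2 = (\<lambda>_ _ _ _. 0)\<rparr>"

primrec nonlin_form :: "flow \<Rightarrow> ('n::finite) nonlin \<Rightarrow> bool" where
  "nonlin_form MCF N \<longleftrightarrow> N = mcf_nonlin"
| "nonlin_form SD N \<longleftrightarrow> nl0 N = (\<lambda>_ _. 0) \<and>
     (\<forall>i. nl1 N i \<in> lin_combs terms1) \<and> (\<forall>i j. nl2 N i j \<in> lin_combs terms2)"
| "nonlin_form WF N \<longleftrightarrow> nl0 N \<in> lin_combs terms0 \<and>
     (\<forall>i. nl1 N i \<in> lin_combs terms1) \<and> (\<forall>i j. nl2 N i j \<in> lin_combs terms2)"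

text \<open>
  \<open>\<partial>\<^sub>t u + A u = N[u]\<close> is a rewriting of the flow equation, with \<open>N\<close> of the prescribed form.
  Such \<open>N\<close> exist: with \<open>P = I - \<nabla>u \<otimes> \<nabla>u / w\<^sup>2\<close>, \<open>Q = w H = P\<^sub>k\<^sub>l u\<^sub>k\<^sub>l\<close> and
  \<open>f\<^sub>2\<^sup>i\<^sup>j = \<delta>\<^sub>i\<^sub>j \<Delta>u - P\<^sub>i\<^sub>j Q\<close> in both fourth order cases, one may take \<open>f\<^sub>1 = - H\<^sup>2 \<nabla>u\<close> for SD and
  \<open>f\<^sub>1\<^sup>i = Q \<nabla>\<^sub>j P\<^sub>i\<^sub>j + w\<^sup>-\<^sup>2 Q\<^sup>2 u\<^sub>i / 2 + w\<^sup>-\<^sup>2 u\<^sub>k u\<^sub>k\<^sub>l P\<^sub>l\<^sub>j P\<^sub>i\<^sub>m u\<^sub>m\<^sub>j - w\<^sup>-\<^sup>2 u\<^sub>i P\<^sub>a\<^sub>b P\<^sub>c\<^sub>d u\<^sub>a\<^sub>c u\<^sub>b\<^sub>d / 2\<close> for WF, the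
  remaining terms of WF being cubic in the second derivatives.
\<close>

definition rewriting :: "flow \<Rightarrow> ('n::finite) nonlin \<Rightarrow> bool" where
  "rewriting F N \<longleftrightarrow> nonlin_form F N \<and>
     (\<forall>u. smooth u \<longrightarrow> (\<forall>x. flow_rhs F u x = - lin_op F u x + nonlin_apply N u x))"


section \<open>Mild solutions\<close>

text \<open>The biharmonic heat kernel is the inverse Fourier transform of \<open>exp (- |\<xi>|\<^sup>4 t)\<close>.\<close>

definition heat_kernel :: "real^'n::finite \<Rightarrow> real \<Rightarrow> real" where
  "heat_kernel x t = exp (- (norm x)\<^sup>2 / (4 * t)) / (4 * pi * t) powr (real CARD('n) / 2)"

definition biharmonic_kernel :: "real^'n::finite \<Rightarrow> real \<Rightarrow> real" where
  "biharmonic_kernel x t =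
     (LINT \<xi>|lebesgue. cos (x \<bullet> \<xi>) * exp (- (norm \<xi> ^ 4 * t))) / (2 * pi) ^ CARD('n)"

primrec kernel :: "flow \<Rightarrow> real^'n::finite \<Rightarrow> real \<Rightarrow> real" where
  "kernel MCF = heat_kernel"
| "kernel SD = biharmonic_kernel"
| "kernel WF = biharmonic_kernel"

text \<open>
  Integrand of \<open>e\<^sup>-\<^sup>(\<^sup>t\<^sup>-\<^sup>s\<^sup>)\<^sup>A N[u](x,s)\<close> at \<open>y\<close>, with the derivatives in front of \<open>f\<^sub>1\<close>, \<open>f\<^sub>2\<close> moved onto the
  kernel.  The sign of the integration by parts cancels against \<open>\<nabla>\<^sub>y [K (x - y)] = - (\<nabla>K) (x - y)\<close>.
\<close>

definition duhamel_integrand ::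
    "flow \<Rightarrow> ('n::finite) nonlin \<Rightarrow> (real^'n \<Rightarrow> real \<Rightarrow> real) \<Rightarrow>
     real^'n \<Rightarrow> real \<Rightarrow> real \<Rightarrow> real^'n \<Rightarrow> real" where
  "duhamel_integrand F N u x t s y =
     (let K = (\<lambda>z. kernel F z (t - s));
          p = grad (\<lambda>z. u z s) y;
          M = hess (\<lambda>z. u z s) y
      in K (x - y) * nl0 N p M
         + (\<Sum>i\<in>UNIV. pd i K (x - y) * nl1 N i p M)
         + (\<Sum>i\<in>UNIV. \<Sum>j\<in>UNIV. pd i (pd j K) (x - y) * nl2 N i j p M))"

definition spatially_C2 :: "(real^'n::finite \<Rightarrow> real \<Rightarrow> real) \<Rightarrow> bool" where
  "spatially_C2 u \<longleftrightarrow>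
     (\<forall>t>0. Ck 2 (\<lambda>x. u x t)) \<and>
     continuous_on (UNIV \<times> {0<..}) (\<lambda>(x, t). u x t) \<and>
     continuous_on (UNIV \<times> {0<..}) (\<lambda>(x, t). grad (\<lambda>y. u y t) x) \<and>
     continuous_on (UNIV \<times> {0<..}) (\<lambda>(x, t). hess (\<lambda>y. u y t) x)"

definition mild_solution ::
    "flow \<Rightarrow> ('n::finite) nonlin \<Rightarrow> (real^'n \<Rightarrow> real) \<Rightarrow> (real^'n \<Rightarrow> real \<Rightarrow> real) \<Rightarrow> bool" where
  "mild_solution F N u0 u \<longleftrightarrow> spatially_C2 u \<and> (\<forall>x. u x 0 = u0 x) \<and>
     (\<forall>x. \<forall>t>0.
        integrable lebesgue (\<lambda>y. kernel F (x - y) t * u0 y) \<and>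
        set_integrable lebesgue ({0<..<t} \<times> UNIV) (\<lambda>(s, y). duhamel_integrand F N u x t s y) \<and>
        u x t = (LINT y|lebesgue. kernel F (x - y) t * u0 y)
                + (LINT s:{0<..<t}|lebesgue. (LINT y|lebesgue. duhamel_integrand F N u x t s y)))"


section \<open>Norms\<close>

definition Linf :: "(real^'n::finite \<Rightarrow> 'b::real_normed_vector) \<Rightarrow> ennreal" where
  "Linf f = esssup lebesgue (\<lambda>x. ennreal (norm (f x)))"

definition Lq_norm :: "real \<Rightarrow> ((real^'n::finite) \<times> real) set \<Rightarrow>
    ((real^'n) \<times> real \<Rightarrow> 'b::real_normed_vector) \<Rightarrow> ennreal" where
  "Lq_norm q S f =
     (let I = (\<integral>\<^sup>+ z\<in>S. ennreal (norm (f z) powr q) \<partial>lebesgue)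
      in if I = \<infinity> then \<infinity> else ennreal (enn2real I powr (1 / q)))"

text \<open>
  The exponent is \<open>n + \<alpha> + 2\<close>, that is \<open>n + 4\<close> for MCF and \<open>n + 6\<close> for SD and WF.
\<close>

definition X_norm :: "flow \<Rightarrow> ereal \<Rightarrow> (real^'n::finite \<Rightarrow> real \<Rightarrow> real) \<Rightarrow> ennreal" where
  "X_norm F T f =
     (let q = real CARD('n) + alpha F + 2
      in (SUP t\<in>{t. 0 < t \<and> ereal t < T}. Linf (grad (\<lambda>x. f x t)))
         + (SUP x\<in>UNIV. SUP R\<in>{R. 0 < R \<and> ereal (R powr alpha F) < T}.
              ennreal (R powr (2 / q)) *
              Lq_norm q (ball x R \<times> {R powr alpha F / 2 <..< R powr alpha F})
                (\<lambda>(y, t). hess (\<lambda>z. f z t) y)))"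

definition weak_gradient :: "(real^'n::finite \<Rightarrow> real) \<Rightarrow> (real^'n \<Rightarrow> real^'n) \<Rightarrow> bool" where
  "weak_gradient f G \<longleftrightarrow>
     (\<forall>K. compact K \<longrightarrow> set_integrable lebesgue K f \<and> set_integrable lebesgue K G) \<and>
     (\<forall>\<phi> i. smooth \<phi> \<and> compact (closure {x. \<phi> x \<noteq> 0}) \<longrightarrow>
        (LINT x|lebesgue. f x * pd i \<phi> x) = - (LINT x|lebesgue. G x $ i * \<phi> x))"

text \<open>
  \<open>\<parallel>\<omega> \<nabla>f\<parallel>\<close> in \<open>L\<^sup>\<infinity>\<close> for the weak gradient.  The weak gradient is unique up to null sets, so the
  infimum is over at most one value; it is \<open>\<infinity>\<close> if \<open>f\<close> has no weak gradient.
\<close>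

definition weighted_grad_norm :: "(real^'n::finite \<Rightarrow> real) \<Rightarrow> (real^'n \<Rightarrow> real) \<Rightarrow> ennreal" where
  "weighted_grad_norm \<omega> f = (INF G\<in>{G. weak_gradient f G}. Linf (\<lambda>x. \<omega> x *\<^sub>R G x))"

abbreviation grad_norm :: "(real^'n::finite \<Rightarrow> real) \<Rightarrow> ennreal" where
  "grad_norm f \<equiv> weighted_grad_norm (\<lambda>_. 1) f"

definition C1_norm :: "(real^'n::finite \<Rightarrow> real) \<Rightarrow> ennreal" where
  "C1_norm f = (SUP x. ennreal \<bar>f x\<bar>) + (SUP x. ennreal (norm (grad f x)))"


section \<open>The global mild solution\<close>

definition analytic_pos_time :: "(real^'n::finite \<Rightarrow> real \<Rightarrow> real) \<Rightarrow> bool" where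
  "analytic_pos_time u \<longleftrightarrow>
     (\<forall>x. \<forall>t>0. \<exists>r>0. \<exists>a :: ('n \<Rightarrow> nat) \<times> nat \<Rightarrow> real.
        \<forall>y s. dist (y, s) (x, t) < r \<longrightarrow>
          ((\<lambda>(m, k). a (m, k) * (\<Prod>i\<in>UNIV. (y $ i - x $ i) ^ m i) * (s - t) ^ k)
             has_sum u y s) UNIV)"

definition t_dt :: "(real^'n::finite \<Rightarrow> real \<Rightarrow> real) \<Rightarrow> real^'n \<Rightarrow> real \<Rightarrow> real" where
  "t_dt g x t = t * deriv (\<lambda>s. g x s) t"

text \<open>A multi-index \<open>\<gamma>\<close> is given by a list of \<open>|\<gamma>|\<close> coordinate directions.\<close>

definition analytic_bounds ::
    "flow \<Rightarrow> real \<Rightarrow> real \<Rightarrow> real \<Rightarrow> (real^'n::finite \<Rightarrow> real \<Rightarrow> real) \<Rightarrow> bool" where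
  "analytic_bounds F c R m u \<longleftrightarrow>
     (\<forall>\<gamma> k x t. 0 < t \<longrightarrow>
        norm (\<chi> j. t powr (real (length \<gamma>) / alpha F) *
                pd_list \<gamma> (\<lambda>y. (t_dt ^^ k) (\<lambda>z s. pd j (\<lambda>z'. u z' s) z) y t) x)
        \<le> c * m * R ^ (length \<gamma> + k) * fact (length \<gamma> + k))"

text \<open>
  \<open>eps0\<close> and \<open>C\<close> are constants for which the Koch--Lamm well-posedness theorem holds.
  A solution is a function on \<open>\<real>\<^sup>n \<times> [0,\<infinity>)\<close>, so uniqueness ignores negative times.
\<close>

definition koch_lamm :: "flow \<Rightarrow> ('n::finite) nonlin \<Rightarrow> real \<Rightarrow> real \<Rightarrow> bool" where
  "koch_lamm F N eps0 C \<longleftrightarrow> 0 < eps0 \<and> 0 < C \<and>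
     (\<exists>c>0. \<exists>R>0. \<forall>u0. grad_norm u0 < ennreal eps0 \<longrightarrow>
        (\<exists>u. mild_solution F N u0 u \<and>
             X_norm F \<infinity> u \<le> ennreal C * grad_norm u0 \<and>
             (\<forall>u'. mild_solution F N u0 u' \<and> X_norm F \<infinity> u' \<le> ennreal (C * eps0) \<longrightarrow>
                   (\<forall>x. \<forall>t\<ge>0. u' x t = u x t)) \<and>
             analytic_pos_time u \<and>
             analytic_bounds F c R (enn2real (grad_norm u0)) u))"

definition global_mild_solution :: "flow \<Rightarrow> ('n::finite) nonlin \<Rightarrow> real \<Rightarrow>
    (real^'n \<Rightarrow> real) \<Rightarrow> (real^'n \<Rightarrow> real \<Rightarrow> real) \<Rightarrow> bool" where
  "global_mild_solution F N C u0 u \<longleftrightarrow>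
     mild_solution F N u0 u \<and> X_norm F \<infinity> u \<le> ennreal C * grad_norm u0"

definition self_similar :: "(real^'n::finite \<Rightarrow> real) \<Rightarrow> bool" where
  "self_similar v0 \<longleftrightarrow> (\<forall>c>0. \<forall>x. v0 x = (1 / c) * v0 (c *\<^sub>R x))"

end

theory Submission
  imports Defs "HOL-Library.Diagonal_Subsequence"
begin

text \<open>
  The flow is invariant under \<open>u \<mapsto> u\<^sub>\<lambda>\<close>, \<open>u\<^sub>\<lambda> (y, s) = u (\<lambda> y, \<lambda>\<^sup>\<alpha> s) / \<lambda>\<close>, and with \<open>\<lambda> = t powr (1 / \<alpha>)\<close>
  the function \<open>t powr (- 1 / \<alpha>) * u (t powr (1 / \<alpha>) x) t\<close> of the theorem is the time-one slice of
  \<open>u\<^sub>\<lambda>\<close>.  Rescaling leaves the self-similar datum \<open>v\<^sub>0\<close> alone and replaces the perturbation \<open>p\<close> by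
  \<open>p (\<lambda> y) / \<lambda>\<close>, which tends to zero uniformly because \<open>p\<close> is bounded.  So \<open>u\<^sub>\<lambda>\<close> and \<open>v\<^sub>\<lambda> = v\<close> solve
  the same equation with data whose difference vanishes in the limit, and the assertion is a
  continuity statement for the solution map at \<open>v\<^sub>0\<close>.  It is proved by compactness and uniqueness.

  The compactness comes from scale invariance.  The analytic bounds of the well-posedness theorem
  say that the gradient is at most \<open>\<delta>\<close>, the Hessian at most \<open>\<delta> t powr (- 1 / \<alpha>)\<close>, and control one
  more derivative in space and the time derivative of the gradient (\<open>analytic_consequences\<close>).  All
  of these bounds are preserved by translations, by adding constants and by the scaling
  (\<open>solves_rescale\<close>), so every sequence of translated, shifted and rescaled solutions has a
  subsequence whose gradients and Hessians converge pointwise.  In the Duhamel formula the limit can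
  be taken under the integral: the kernel derivatives of order \<open>l\<close> have \<open>L\<^sup>1\<close> norm
  \<open>c (t - s) powr (- l / \<alpha>)\<close>, the corresponding part of the nonlinearity is homogeneous of degree
  \<open>d = \<alpha> - 1 - l\<close> in the Hessian and hence at most \<open>c s powr (- d / \<alpha>)\<close>, and
  \<open>(t - s) powr (- l / \<alpha>) s powr (- d / \<alpha>)\<close> is integrable on \<open>(0, t)\<close>.  The limit is therefore
  again a mild solution (\<open>solutions_compact\<close>), and it is small enough to lie in the class where mild
  solutions are unique (\<open>solutions_unique\<close>).

  Uniformity in \<open>x\<close> is obtained by contradiction.  If \<open>u\<close> and \<open>v\<close> differed by a fixed amount at
  points \<open>(x\<^sub>k, t\<^sub>k)\<close> with \<open>t\<^sub>k \<longlonglongrightarrow> \<infinity>\<close>, then both solutions can be recentred at \<open>x\<^sub>k\<close> and rescaled by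
  \<open>t\<^sub>k powr (1 / \<alpha>)\<close>, and the same constants subtracted from both.  Along a subsequence the two
  families converge to solutions with the same datum, hence to the same solution, and their
  difference at the recentred point tends to zero together with its gradient, a contradiction
  (\<open>rescaled_solutions_merge\<close>, \<open>solutions_merge\<close>).  The self-similarity of \<open>v\<close> is uniqueness again
  (\<open>self_similar_solution\<close>).

  Two bridges connect this with the weak formulation of the data.  A function with bounded weak
  gradient agrees almost everywhere with a Lipschitz function, by mollification
  (\<open>weak_gradient_imp_lipschitz_representative\<close>), which gives data for which compactness is Ascoli's
  theorem.  Conversely the Lipschitz limits of these data have bounded weak gradients, by weak-star
  compactness of difference quotients (\<open>lipschitz_imp_weak_gradient\<close>), so that the uniqueness
  statement applies to them.  The integrability of the kernels rests on their faster than polynomial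
  decay; for the biharmonic kernel this follows from its Fourier representation
  (\<open>fourier_class_decay\<close>).
\<close>

section \<open>Partial derivatives and Lipschitz bounds\<close>

definition has_pd :: "'n::finite \<Rightarrow> (real^'n \<Rightarrow> real) \<Rightarrow> real^'n \<Rightarrow> real \<Rightarrow> bool" where
  "has_pd i f x D \<longleftrightarrow> ((\<lambda>h. f (x + h *\<^sub>R axis i 1)) has_real_derivative D) (at 0)"

lemma has_pd_imp_pd: "has_pd i f x D \<Longrightarrow> pd i f x = D"
  unfolding has_pd_def pd_def by (rule DERIV_imp_deriv)

lemma has_pd_line:
  assumes "has_pd i f (x + h *\<^sub>R axis i 1) D"
  shows "((\<lambda>h. f (x + h *\<^sub>R axis i 1)) has_real_derivative D) (at h)"
proof -
  have "((\<lambda>k. f (x + (h + k) *\<^sub>R axis i 1)) has_real_derivative D) (at 0)"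
    using assms unfolding has_pd_def by (simp add: scaleR_add_left add.assoc)
  then show ?thesis
    using DERIV_shift[of "\<lambda>k. f (x + k *\<^sub>R axis i 1)" D 0 h] by (simp add: add.commute)
qed

lemma line_bound:
  assumes "\<And>x. has_pd i f x (D x)" "\<And>x. \<bar>D x\<bar> \<le> B"
  shows "\<bar>f (x + h *\<^sub>R axis i 1) - f x\<bar> \<le> B * \<bar>h\<bar>"
proof -
  have "norm (f (x + h *\<^sub>R axis i 1) - f (x + 0 *\<^sub>R axis i 1)) \<le> B * norm (h - 0)"
    by (rule field_differentiable_bound[of UNIV _ "\<lambda>h. D (x + h *\<^sub>R axis i 1)"])
      (auto intro: has_pd_line assms)
  then show ?thesis by simp
qed

lemma sum_axis: "(\<Sum>i\<in>UNIV. (z $ i) *\<^sub>R axis i 1) = (z :: real^'n::finite)"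
  by (simp add: vec_eq_iff axis_def if_distrib cong: if_cong)

lemma partials_bounded_imp_lipschitz:
  fixes f :: "real^'n::finite \<Rightarrow> real"
  fixes B :: real
  assumes "\<And>i x. has_pd i f x (D i x)" "\<And>i x. \<bar>D i x\<bar> \<le> B"
  shows "\<bar>f y - f x\<bar> \<le> CARD('n) * B * norm (y - x)"
proof -
  define z where "z = y - x"
  have B: "B \<ge> 0" using assms(2)[of undefined undefined] by linarith
  have *: "\<bar>f (x + (\<Sum>i\<in>S. (z $ i) *\<^sub>R axis i 1)) - f x\<bar> \<le> card S * B * norm z" if "finite S" for S
    using that
  proof induction
    case (insert i S)
    let ?s = "(\<Sum>i\<in>S. (z $ i) *\<^sub>R axis i 1)"
    have "\<bar>f ((x + ?s) + (z $ i) *\<^sub>R axis i 1) - f (x + ?s)\<bar> \<le> B * \<bar>z $ i\<bar>"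
      by (rule line_bound[OF assms])
    also have "\<dots> \<le> B * norm z" using B component_le_norm_cart[of z i] by (simp add: mult_left_mono)
    finally show ?case using insert by (simp add: algebra_simps)
  qed simp
  from *[of UNIV] show ?thesis unfolding sum_axis by (simp add: z_def)
qed

text \<open>
  Compare with the indicators of the balls of integer radius: the volume of the ball of radius
  \<open>1 + k\<close> grows like \<open>(1 + k) ^ DIM('a)\<close>, and two spare powers make the resulting series converge.
\<close>

lemma integrable_decay:
  fixes m :: nat
  assumes m: "m \<ge> DIM('a) + 2"
  shows "integrable lborel (\<lambda>x::'a::euclidean_space. 1 / (1 + norm x) ^ m)"
proof -
  let ?n = "DIM('a)"
  define V where "V = unit_ball_vol ?n"
  have V: "V \<ge> 0" by (simp add: V_def)
  have b: "ennreal (1 / (1 + norm x) ^ m) \<le> (\<Sum>k. ennreal (1 / (1 + real k) ^ m) * indicator (ball 0 (1 + real k)) x)"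
    (is "_ \<le> suminf ?f") for x :: 'a
  proof -
    define k where "k = nat \<lfloor>norm x\<rfloor>"
    have "real k = of_int \<lfloor>norm x\<rfloor>" by (simp add: k_def)
    then have k: "real k \<le> norm x" "norm x < 1 + real k" by linarith+
    have "ennreal (1 / (1 + norm x) ^ m) \<le> ?f k"
      using k by (auto intro!: ennreal_leI divide_left_mono power_mono mult_pos_pos)
    also have "?f k = (\<Sum>j\<in>{k}. ?f j)" by (simp only: sum.insert sum.empty finite.intros empty_iff not_False_eq_True add_0_right)
    also have "\<dots> \<le> suminf ?f"
      by (rule sum_le_suminf) auto
    finally show ?thesis .
  qed
  have "(\<integral>\<^sup>+(x::'a). ennreal (norm (1 / (1 + norm x) ^ m)) \<partial>lborel)
      \<le> (\<integral>\<^sup>+(x::'a). (\<Sum>k. ennreal (1 / (1 + real k) ^ m) * indicator (ball 0 (1 + real k)) x) \<partial>lborel)"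
    using b by (intro nn_integral_mono) auto
  also have "\<dots> = (\<Sum>k. ennreal (1 / (1 + real k) ^ m) * ennreal (V * (1 + real k) ^ ?n))"
    by (subst nn_integral_suminf)
      (auto simp: nn_integral_cmult_indicator emeasure_ball V_def
        intro!: borel_measurable_times_ennreal borel_measurable_indicator borel_open)
  also have "\<dots> = (\<Sum>k. ennreal (1 / (1 + real k) ^ m * (V * (1 + real k) ^ ?n)))"
    using V by (simp flip: ennreal_mult)
  also have "\<dots> \<le> (\<Sum>k. ennreal (V * (1 / (real (Suc k)) ^ 2)))"
  proof (intro suminf_le ennreal_leI)
    fix k
    have "(1 + real k) ^ m = (1 + real k) ^ ?n * (1 + real k) ^ (m - ?n)"
      using m by (simp flip: power_add)
    then have "1 / (1 + real k) ^ m * (V * (1 + real k) ^ ?n) = V * (1 / (1 + real k) ^ (m - ?n))"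
      by simp
    also have "\<dots> \<le> V * (1 / (1 + real k) ^ 2)"
      using m V by (intro mult_left_mono divide_left_mono power_increasing) auto
    finally show "1 / (1 + real k) ^ m * (V * (1 + real k) ^ ?n) \<le> V * (1 / (real (Suc k)) ^ 2)"
      by (simp add: add.commute)
  qed auto
  also have "\<dots> < \<infinity>"
  proof -
    have "summable (\<lambda>k. V * (1 / (real (Suc k)) ^ 2))"
      using inverse_power_summable[of 2, where 'a=real]
      by (intro summable_mult) (simp add: inverse_eq_divide summable_Suc_iff[of "\<lambda>n. 1 / real n ^ 2", simplified])
    then show ?thesis using V by (simp add: suminf_ennreal2)
  qed
  finally show ?thesis by (intro integrableI_bounded) auto
qed

section \<open>Weak-star limits of bounded functions\<close>

text \<open>
  Dyadic convex combinations of the tail \<open>g m, g (m + 1), \<dots>\<close>.  Closure under midpoints suffices for the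
  parallelogram identity and makes statements about the hull provable by rule induction.
\<close>

inductive_set midhull :: "(nat \<Rightarrow> 'a \<Rightarrow> real) \<Rightarrow> nat \<Rightarrow> ('a \<Rightarrow> real) set" for g m where
  base: "k \<ge> m \<Longrightarrow> g k \<in> midhull g m"
| mid: "a \<in> midhull g m \<Longrightarrow> b \<in> midhull g m \<Longrightarrow> (\<lambda>x. (a x + b x) / 2) \<in> midhull g m"

lemma midhull_antimono: "h \<in> midhull g m \<Longrightarrow> l \<le> m \<Longrightarrow> h \<in> midhull g l"
  by (induction rule: midhull.induct) (auto intro: midhull.intros)

text \<open>
  A bounded sequence has a weak-star limit along every pairing that converges.  As in Mazur's lemma
  the limit is found among convex combinations of the tails, chosen to nearly minimise a weighted
  \<open>L\<^sup>2\<close> norm: by the parallelogram identity such minimisers form a Cauchy sequence, so a subsequence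
  converges almost everywhere.  Since convex combinations of tails have the same limiting pairings,
  the pointwise limit has the pairings prescribed by the sequence.
\<close>

lemma weak_star_limit:
  fixes g :: "nat \<Rightarrow> 'a \<Rightarrow> real" and w :: "'a \<Rightarrow> real"
  assumes meas: "\<And>k. g k \<in> borel_measurable M" and bd: "\<And>k x. \<bar>g k x\<bar> \<le> L"
    and w: "integrable M w" "\<And>x. 0 < w x"
  obtains G where "G \<in> borel_measurable M" "\<And>x. \<bar>G x\<bar> \<le> L"
    "\<And>\<phi> T. integrable M \<phi> \<Longrightarrow> (\<lambda>k. \<integral>x. g k x * \<phi> x \<partial>M) \<longlonglongrightarrow> T \<Longrightarrow> (\<integral>x. G x * \<phi> x \<partial>M) = T"
proof -
  have wm[measurable]: "w \<in> borel_measurable M" using w by auto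
  have hull: "h \<in> borel_measurable M \<and> (\<forall>x. \<bar>h x\<bar> \<le> L)" if "h \<in> midhull g m" for h m
    using that
  proof induction
    case (mid a b)
    have "\<bar>(a x + b x) / 2\<bar> \<le> L" for x
      using mid.IH(1)[THEN conjunct2, rule_format, of x] mid.IH(2)[THEN conjunct2, rule_format, of x]
      by (auto simp: abs_le_iff field_simps)
    then show ?case using mid by auto
  qed (use meas bd in auto)
  have int1: "integrable M (\<lambda>x. w x * f x)"
    if "f \<in> borel_measurable M" "\<And>x. \<bar>f x\<bar> \<le> K" for f K
  proof (rule Bochner_Integration.integrable_bound[of M "\<lambda>x. K * w x"])
    show "AE x in M. norm (w x * f x) \<le> norm (K * w x)"
      using that(2) w(2) by (auto simp: abs_mult mult.commute intro!: mult_right_mono AE_I2 order_trans[OF that(2)])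
  qed (use w that in auto)
  have L0: "L \<ge> 0" using bd[of 0 undefined] by linarith
  have sq: "\<bar>(f x)\<^sup>2\<bar> \<le> K\<^sup>2" if "\<And>x. \<bar>f x\<bar> \<le> K" for f :: "'a \<Rightarrow> real" and x K
    using power_mono[OF that[of x], of 2] by simp
  have int2: "integrable M (\<lambda>x. w x * (f x)\<^sup>2)"
    if "f \<in> borel_measurable M" "\<And>x. \<bar>f x\<bar> \<le> K" for f K
    using that by (intro int1[of _ "K\<^sup>2"] sq) auto
  define Q where "Q h = (\<integral>x. w x * (h x)\<^sup>2 \<partial>M)" for h
  have Q0: "Q h \<ge> 0" for h
    unfolding Q_def using w by (intro integral_nonneg_AE) (auto simp: less_imp_le)
  define c where "c m = Inf (Q ` midhull g m)" for m
  have ne: "midhull g m \<noteq> {}" for m using base[of m m g] by blast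
  have bb: "bdd_below (Q ` midhull g m)" for m using Q0 by (intro bdd_belowI[of _ 0]) auto
  have cle: "c m \<le> Q h" if "h \<in> midhull g m" for h m
    unfolding c_def using that bb by (auto intro: cInf_lower)
  have cmono: "c m \<le> c l" if "m \<le> l" for m l
    unfolding c_def[of l] using ne
    by (intro cInf_greatest) (auto intro!: cle midhull_antimono[OF _ that])
  have cbd: "c m \<le> (\<integral>x. w x * L\<^sup>2 \<partial>M)" for m
  proof -
    have "c m \<le> Q (g m)" by (intro cle base) simp
    also have "\<dots> \<le> (\<integral>x. w x * L\<^sup>2 \<partial>M)"
      unfolding Q_def using w(2) sq[OF bd] L0
      by (intro integral_mono int2[OF meas bd] int1[where K="L\<^sup>2"] mult_left_mono) (auto simp: less_imp_le)
    finally show ?thesis .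
  qed
  have "convergent c"
  proof (rule Bseq_mono_convergent)
    show "Bseq c"
    proof (rule BseqI')
      show "norm (c n) \<le> \<bar>c 0\<bar> + \<bar>\<integral>x. w x * L\<^sup>2 \<partial>M\<bar>" for n
        using cmono[of 0 n] cbd[of n] unfolding real_norm_def by linarith
    qed
  qed (use cmono in auto)
  then have "Cauchy c" by (simp add: Cauchy_convergent_iff)
  have "\<exists>h\<in>midhull g m. Q h < c m + 1 / real (Suc m)" for m
    using cInf_lessD[of "Q ` midhull g m" "c m + 1 / real (Suc m)"] ne by (auto simp: c_def)
  then obtain h where h: "\<And>m. h m \<in> midhull g m" "\<And>m. Q (h m) < c m + 1 / real (Suc m)"
    by metis
  have hm[measurable]: "h m \<in> borel_measurable M" and hb: "\<bar>h m x\<bar> \<le> L" for m x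
    using hull[OF h(1)] by auto
  have d2: "\<bar>h i x - h j x\<bar> \<le> 2 * L" for i j x using hb[of i x] hb[of j x] by linarith
  \<comment> \<open>The midpoint of \<open>h m\<close> and \<open>h l\<close> is in the hull of the earlier tail, so its energy is at least
    \<open>c m\<close>; the parallelogram identity turns this into closeness of \<open>h m\<close> and \<open>h l\<close>.\<close>
  have para: "Q (\<lambda>x. h m x - h l x) \<le> 2 * (c l - c m) + 4 / real (Suc m)" if "m \<le> l" for m l
  proof -
    let ?p = "\<lambda>x. (h m x + h l x) / 2"
    have pin: "?p \<in> midhull g m" using h(1)[of m] midhull_antimono[OF h(1)[of l] that] by (rule mid)
    have "Q (\<lambda>x. h m x - h l x) = 2 * Q (h m) + 2 * Q (h l) - 4 * Q ?p"
    proof -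
      have "2 * Q (h m) + 2 * Q (h l) - 4 * Q ?p
        = (\<integral>x. 2 * (w x * (h m x)\<^sup>2) + 2 * (w x * (h l x)\<^sup>2) - 4 * (w x * (?p x)\<^sup>2) \<partial>M)"
        unfolding Q_def using int2[OF hm hb] int2[of ?p L] hull[OF pin] by simp
      also have "\<dots> = Q (\<lambda>x. h m x - h l x)"
        unfolding Q_def by (intro Bochner_Integration.integral_cong) (auto simp: power2_eq_square field_simps)
      finally show ?thesis by simp
    qed
    also have "\<dots> \<le> 2 * (c m + 1 / real (Suc m)) + 2 * (c l + 1 / real (Suc l)) - 4 * c m"
    proof -
      have "2 * q + 2 * q' - 4 * p \<le> 2 * a + 2 * a' - 4 * b"
        if "q < a" "q' < a'" "b \<le> p" for q q' p a a' b :: real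
        using that by linarith
      from this[OF h(2)[of m] h(2)[of l] cle[OF pin]] show ?thesis .
    qed
    also have "1 / real (Suc l) \<le> 1 / real (Suc m)" using that by (intro divide_left_mono) auto
    finally show ?thesis by simp
  qed
  have conv: "\<exists>N. \<forall>i\<ge>N. \<forall>j\<ge>N. LINT x|M. norm (w x * h i x - w x * h j x) < e" if e: "e > 0" for e
  proof -
    define W where "W = (\<integral>x. w x \<partial>M)"
    have W0: "W \<ge> 0" unfolding W_def using w by (intro integral_nonneg_AE) (auto simp: less_imp_le)
    define \<eta> where "\<eta> = e / (2 * (W + 1))"
    have \<eta>: "\<eta> > 0" using e W0 by (simp add: \<eta>_def)
    have \<eta>W: "\<eta> * W \<le> e / 2" using e W0 unfolding \<eta>_def by (simp add: field_simps)
    obtain N1 where N1: "\<And>i j. i \<ge> N1 \<Longrightarrow> j \<ge> N1 \<Longrightarrow> dist (c i) (c j) < e * \<eta> / 8"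
      using \<open>Cauchy c\<close> e \<eta> unfolding Cauchy_def by (meson divide_pos_pos mult_pos_pos zero_less_numeral)
    obtain N2 :: nat where N2: "real N2 > 16 / (e * \<eta>)" using reals_Archimedean2 by blast
    have Qs: "Q (\<lambda>x. h i x - h j x) < e * \<eta> / 2" if ij: "i \<ge> max N1 N2" "i \<le> j" for i j
    proof -
      have "real (Suc i) > 16 / (e * \<eta>)" using N2 ij by linarith
      then have "4 / real (Suc i) < e * \<eta> / 4" using e \<eta> by (simp add: field_simps)
      moreover have "c j - c i < e * \<eta> / 8" 
        by (rule order.strict_trans1[OF abs_ge_self N1[of j i, unfolded dist_real_def]]) (use ij in auto)
      moreover have "q < b / 2" if "f < b / 4" "d < b / 8" "q \<le> 2 * d + f" for q f d b :: real
        using that by linarith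
      ultimately show ?thesis using para[OF ij(2)] by blast
    qed
    have main: "(LINT x|M. norm (w x * h i x - w x * h j x)) < e" if ij: "i \<ge> max N1 N2" "i \<le> j" for i j
    proof -
      let ?d = "\<lambda>x. h i x - h j x"
      \<comment> \<open>Weighted arithmetic-geometric mean inequality: it trades the \<open>L\<^sup>1\<close> distance for the \<open>L\<^sup>2\<close>
        distance \<open>Q\<close> at the price of \<open>\<eta> / 2\<close> times the total weight.\<close>
      have am: "\<bar>d\<bar> \<le> \<eta> / 2 + d\<^sup>2 / (2 * \<eta>)" for d
      proof -
        have "0 \<le> (\<bar>d\<bar> - \<eta>)\<^sup>2" by simp
        then have "2 * \<eta> * \<bar>d\<bar> \<le> \<eta>\<^sup>2 + d\<^sup>2" by (simp add: power2_diff algebra_simps)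
        then show ?thesis using \<eta> by (simp add: field_simps power2_eq_square)
      qed
      have "(LINT x|M. norm (w x * h i x - w x * h j x)) = (LINT x|M. w x * \<bar>?d x\<bar>)"
        using w(2) by (intro Bochner_Integration.integral_cong) (auto simp: abs_mult less_imp_le abs_of_pos simp flip: right_diff_distrib)
      also have "\<dots> \<le> (LINT x|M. \<eta> / 2 * w x + 1 / (2 * \<eta>) * (w x * (?d x)\<^sup>2))"
      proof (intro integral_mono)
        show "integrable M (\<lambda>x. w x * \<bar>?d x\<bar>)" by (rule int1[of _ "2 * L"]) (use d2 in auto)
        show "integrable M (\<lambda>x. \<eta> / 2 * w x + 1 / (2 * \<eta>) * (w x * (?d x)\<^sup>2))"
          using w(1) int2[of ?d "2 * L"] d2 by auto
        show "w x * \<bar>?d x\<bar> \<le> \<eta> / 2 * w x + 1 / (2 * \<eta>) * (w x * (?d x)\<^sup>2)" for x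
          using mult_left_mono[OF am[of "?d x"], of "w x"] w(2)[of x] by (simp add: algebra_simps)
      qed
      also have "\<dots> = \<eta> / 2 * W + 1 / (2 * \<eta>) * Q ?d"
        unfolding W_def Q_def using w(1) int2[of ?d "2 * L"] d2 by simp
      also have "\<dots> < e"
      proof -
        have "1 / (2 * \<eta>) * Q ?d \<le> 1 / (2 * \<eta>) * (e * \<eta> / 2)"
          using Qs[OF ij] \<eta> by (intro mult_left_mono) auto
        also have "\<dots> = e / 4" using \<eta> by simp
        finally show ?thesis using \<eta>W e by linarith
      qed
      finally show ?thesis .
    qed
    show ?thesis
    proof (intro exI[of _ "max N1 N2"] allI impI)
      fix i j assume ij: "max N1 N2 \<le> i" "max N1 N2 \<le> j"
      show "(LINT x|M. norm (w x * h i x - w x * h j x)) < e"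
      proof (cases "i \<le> j")
        case False
        then show ?thesis using main[of j i] ij by (simp add: abs_minus_commute)
      qed (use main ij in auto)
    qed
  qed
  obtain r where r: "strict_mono r" "AE x in M. Cauchy (\<lambda>i. w x * h (r i) x)"
    using cauchy_L1_AE_cauchy_subseq[of M "\<lambda>m x. w x * h m x", OF int1[OF hm hb] conv] by blast
  \<comment> \<open>Truncation at \<open>L\<close> makes the bound hold everywhere, also where the sequence diverges.\<close>
  define G where "G x = max (- L) (min L (lim (\<lambda>i. h (r i) x)))" for x
  have Gm: "G \<in> borel_measurable M"
    unfolding G_def by (intro borel_measurable_max borel_measurable_min borel_measurable_const borel_measurable_lim_metric hm)
  have lim: "AE x in M. (\<lambda>i. h (r i) x) \<longlonglongrightarrow> G x"
    using r(2)
  proof eventually_elim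
    case (elim x)
    then have "convergent (\<lambda>i. w x * h (r i) x)" by (simp add: Cauchy_convergent_iff)
    then have "convergent (\<lambda>i. h (r i) x)" using convergent_mult_const_iff[of "w x"] w(2)[of x] by simp
    then obtain l where l: "(\<lambda>i. h (r i) x) \<longlonglongrightarrow> l" by (auto simp: convergent_def)
    moreover have "\<bar>l\<bar> \<le> L"
      by (rule LIMSEQ_le_const2[OF tendsto_rabs[OF l]]) (use hb in auto)
    ultimately show ?case using limI[OF l] by (simp add: G_def)
  qed
  have Gb: "\<bar>G x\<bar> \<le> L" for x
    using L0 by (auto simp: G_def)
  have Gp: "(\<integral>x. G x * \<phi> x \<partial>M) = T"
    if \<phi>: "integrable M \<phi>" and T: "(\<lambda>k. \<integral>x. g k x * \<phi> x \<partial>M) \<longlonglongrightarrow> T" for \<phi> T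
  proof (rule LIMSEQ_unique)
    have \<phi>m[measurable]: "\<phi> \<in> borel_measurable M" using \<phi> by auto
    show "(\<lambda>i. \<integral>x. h (r i) x * \<phi> x \<partial>M) \<longlonglongrightarrow> (\<integral>x. G x * \<phi> x \<partial>M)"
    proof (rule integral_dominated_convergence[where w="\<lambda>x. L * \<bar>\<phi> x\<bar>"])
      show "AE x in M. (\<lambda>i. h (r i) x * \<phi> x) \<longlonglongrightarrow> G x * \<phi> x"
        using lim by eventually_elim (auto intro: tendsto_intros)
      show "AE x in M. norm (h (r i) x * \<phi> x) \<le> L * \<bar>\<phi> x\<bar>" for i
        using hb by (intro AE_I2) (auto simp: abs_mult intro!: mult_right_mono)
    qed (use Gm \<phi> in auto)
    have inthull: "integrable M (\<lambda>x. f x * \<phi> x)" if "f \<in> midhull g m" for f m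
    proof (rule Bochner_Integration.integrable_bound[of M "\<lambda>x. L * \<phi> x"])
      show "AE x in M. norm (f x * \<phi> x) \<le> norm (L * \<phi> x)"
        using hull[OF that] L0 by (intro AE_I2) (auto simp: abs_mult intro!: mult_right_mono)
    qed (use \<phi> hull[OF that] in auto)
    show "(\<lambda>i. \<integral>x. h (r i) x * \<phi> x \<partial>M) \<longlonglongrightarrow> T"
    proof (rule LIMSEQ_I)
      fix e :: real assume "e > 0"
      then obtain m where m: "\<And>k. k \<ge> m \<Longrightarrow> \<bar>(\<integral>x. g k x * \<phi> x \<partial>M) - T\<bar> < e"
        using LIMSEQ_D[OF T] by (auto simp: real_norm_def)
      have *: "\<bar>(\<integral>x. f x * \<phi> x \<partial>M) - T\<bar> < e" if "f \<in> midhull g m" for f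
        using that
      proof induction
        case (mid a b)
        have "(\<integral>x. (a x + b x) / 2 * \<phi> x \<partial>M) = (\<integral>x. (a x * \<phi> x + b x * \<phi> x) / 2 \<partial>M)"
          by (intro Bochner_Integration.integral_cong) (auto simp: field_simps)
        also have "\<dots> = ((\<integral>x. a x * \<phi> x \<partial>M) + (\<integral>x. b x * \<phi> x \<partial>M)) / 2"
          using inthull[OF mid(1)] inthull[OF mid(2)] by simp
        moreover have "\<bar>(A + B) / 2 - T\<bar> < e" if "\<bar>A - T\<bar> < e" "\<bar>B - T\<bar> < e" for A B :: real
          using that by (simp add: abs_less_iff field_simps)
        ultimately show ?case using mid.IH by simp
      qed (use m in auto)
      have "h (r i) \<in> midhull g m" if "i \<ge> m" for i
        using h(1)[of "r i"] seq_suble[OF r(1), of i] that by (auto intro: midhull_antimono)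
      then show "\<exists>no. \<forall>n\<ge>no. norm ((\<integral>x. h (r n) x * \<phi> x \<partial>M) - T) < e"
        using * by auto
    qed
  qed
  show ?thesis by (rule that[OF Gm Gb Gp])
qed

section \<open>Lipschitz functions have weak gradients\<close>

lemma borel_measurable_vec:
  fixes f :: "'a \<Rightarrow> real^'n::finite"
  assumes "\<And>i. (\<lambda>x. f x $ i) \<in> borel_measurable M"
  shows "f \<in> borel_measurable M"
proof -
  have "\<forall>i\<in>Basis. (\<lambda>x. f x \<bullet> i) \<in> borel_measurable M"
    using assms by (auto simp: Basis_vec_def inner_axis)
  then show ?thesis using borel_measurable_euclidean_space[of f M] by simp
qed

lemma lborel_affine_integral:
  fixes f :: "'a::euclidean_space \<Rightarrow> real"
  assumes [measurable]: "f \<in> borel_measurable borel" and c: "c \<noteq> 0"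
  shows "(\<integral>x. f x \<partial>lborel) = \<bar>c\<bar> ^ DIM('a) * (\<integral>x. f (t + c *\<^sub>R x) \<partial>lborel)"
    and "integrable lborel (\<lambda>x. f (t + c *\<^sub>R x)) \<longleftrightarrow> integrable lborel f"
proof -
  have "(\<integral>x. f x \<partial>lborel) = (\<integral>x. f x \<partial>density (distr lborel borel (\<lambda>x. t + c *\<^sub>R x)) (\<lambda>_. ennreal (\<bar>c\<bar>^DIM('a))))"
    using lborel_affine[OF c, of t] by (simp add: ennreal_power)
  also have "\<dots> = \<bar>c\<bar> ^ DIM('a) * (\<integral>x. f (t + c *\<^sub>R x) \<partial>lborel)"
    by (subst integral_real_density) (auto simp: integral_distr)
  finally show "(\<integral>x. f x \<partial>lborel) = \<bar>c\<bar> ^ DIM('a) * (\<integral>x. f (t + c *\<^sub>R x) \<partial>lborel)" .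
  have "integrable lborel f \<longleftrightarrow> integrable (density (distr lborel borel (\<lambda>x. t + c *\<^sub>R x)) (\<lambda>_. ennreal (\<bar>c\<bar>^DIM('a)))) f"
    using lborel_affine[OF c, of t] by (simp add: ennreal_power)
  also have "\<dots> \<longleftrightarrow> integrable lborel (\<lambda>x. f (t + c *\<^sub>R x))"
    using c by (subst integrable_real_density) (auto simp: integrable_distr_eq)
  finally show "integrable lborel (\<lambda>x. f (t + c *\<^sub>R x)) \<longleftrightarrow> integrable lborel f" by simp
qed

lemma lborel_translate:
  fixes f :: "'a::euclidean_space \<Rightarrow> real"
  assumes "f \<in> borel_measurable borel"
  shows "(\<integral>x. f (t + x) \<partial>lborel) = (\<integral>x. f x \<partial>lborel)"
    and "integrable lborel (\<lambda>x. f (t + x)) \<longleftrightarrow> integrable lborel f"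
  using lborel_affine_integral[OF assms, of 1 t] by auto

lemma smooth_imp:
  assumes "smooth \<phi>"
  shows "has_pd i \<phi> x (pd i \<phi> x)" "continuous_on UNIV \<phi>" "continuous_on UNIV (pd i \<phi>)"
proof -
  have C: "Ck 1 \<phi>" using assms by (simp add: smooth_def)
  then have "(\<lambda>h. \<phi> (x + h *\<^sub>R axis i 1)) differentiable (at 0)"
    unfolding Ck_def by (force simp: pd_list_def)
  then show "has_pd i \<phi> x (pd i \<phi> x)"
    unfolding has_pd_def pd_def using DERIV_deriv_iff_real_differentiable by blast
  have "continuous_on UNIV (pd_list [] \<phi>)" using C unfolding Ck_def by auto
  then show "continuous_on UNIV \<phi>" by (simp add: pd_list_def)
  have "continuous_on UNIV (pd_list [i] \<phi>)" using C unfolding Ck_def by auto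
  then show "continuous_on UNIV (pd i \<phi>)" by (simp add: pd_list_def)
qed

lemma smooth_measurable:
  assumes "smooth \<phi>"
  shows "\<phi> \<in> borel_measurable borel" "pd i \<phi> \<in> borel_measurable borel"
  using smooth_imp(2,3)[OF assms] by (auto intro: borel_measurable_continuous_onI)

lemma test_function_bounds:
  assumes s: "smooth \<phi>" and c: "compact (closure {x. \<phi> x \<noteq> 0})"
  obtains R B where "R > 0" "B > 0" "\<And>x. norm x > R \<Longrightarrow> \<phi> x = 0" "\<And>x. \<bar>\<phi> x\<bar> \<le> B"
    "\<And>i x. norm x > R \<Longrightarrow> pd i \<phi> x = 0" "\<And>i x. \<bar>pd i \<phi> x\<bar> \<le> B"
proof -
  let ?S = "closure {x. \<phi> x \<noteq> 0}"
  obtain R where R: "R > 0" "\<And>x. x \<in> ?S \<Longrightarrow> norm x \<le> R"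
    using compact_imp_bounded[OF c] bounded_pos by blast
  have z: "\<phi> x = 0" if "norm x > R" for x
  proof (rule ccontr)
    assume "\<phi> x \<noteq> 0"
    then have "x \<in> ?S" by (intro subsetD[OF closure_subset]) simp
    from R(2)[OF this] that show False by linarith
  qed
  have pz: "pd i \<phi> x = 0" if "norm x > R" for i x
  proof -
    have "((\<lambda>h. 0) has_real_derivative pd i \<phi> x) (at 0)"
    proof (rule has_field_derivative_transform_within_open)
      show "((\<lambda>h. \<phi> (x + h *\<^sub>R axis i 1)) has_real_derivative pd i \<phi> x) (at 0)"
        using smooth_imp(1)[OF s] by (simp add: has_pd_def)
      show "open {h. norm (x + h *\<^sub>R axis i 1) > R}"
        by (intro open_Collect_less continuous_intros)
      show "0 \<in> {h. norm (x + h *\<^sub>R axis i 1) > R}" using that by simp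
    qed (use z in auto)
    then show ?thesis using DERIV_unique DERIV_const by blast
  qed
  have bdd: "\<exists>B>0. \<forall>x. \<bar>f x\<bar> \<le> B" if "continuous_on UNIV f" "\<And>x. norm x > R \<Longrightarrow> f x = 0" for f :: "real^'a \<Rightarrow> real"
  proof -
    have "bounded (f ` cball 0 R)"
      using that(1) by (intro compact_imp_bounded compact_continuous_image) (auto intro: continuous_on_subset)
    then obtain B where B: "B > 0" "\<And>x. x \<in> cball 0 R \<Longrightarrow> \<bar>f x\<bar> \<le> B" unfolding bounded_pos by auto
    have "\<bar>f x\<bar> \<le> B" for x using B that(2)[of x] by (cases "norm x > R") auto
    then show ?thesis using B by auto
  qed
  obtain B0 where B0: "B0 > 0" "\<And>x. \<bar>\<phi> x\<bar> \<le> B0" using bdd[OF smooth_imp(2)[OF s] z] by auto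
  have "\<forall>i. \<exists>B>0. \<forall>x. \<bar>pd i \<phi> x\<bar> \<le> B" using bdd[OF smooth_imp(3)[OF s] pz] by auto
  then obtain B1 where B1: "\<And>i. B1 i > 0" "\<And>i x. \<bar>pd i \<phi> x\<bar> \<le> B1 i" by metis
  have le: "B1 i \<le> B0 + sum B1 UNIV" for i
    using B1(1) B0(1) member_le_sum[of i UNIV B1] by (auto simp: less_imp_le intro: add_increasing)
  show ?thesis
  proof (rule that[of R "B0 + sum B1 UNIV"])
    show "B0 + sum B1 UNIV > 0" using B0 B1 by (simp add: add_pos_nonneg sum_nonneg less_imp_le)
    show "\<bar>\<phi> x\<bar> \<le> B0 + sum B1 UNIV" for x using B0(2)[of x] B1(1) by (smt (verit) sum_nonneg)
    show "\<bar>pd i \<phi> x\<bar> \<le> B0 + sum B1 UNIV" for i x using B1(2)[of i x] le[of i] by linarith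
  qed (use R z pz in auto)
qed

lemma integrable_bounded_support:
  fixes f :: "'a::euclidean_space \<Rightarrow> real"
  assumes "f \<in> borel_measurable borel" "\<And>x. \<bar>f x\<bar> \<le> B" "\<And>x. norm x > R \<Longrightarrow> f x = 0"
  shows "integrable lborel f"
proof (rule Bochner_Integration.integrable_bound[of lborel "\<lambda>x. B * indicator (cball 0 R) x"])
  show "integrable lborel (\<lambda>x. B * indicator (cball 0 R) x :: real)"
    by (intro integrable_mult_right integrable_real_indicator) (use emeasure_lborel_cball_finite in auto)
  show "AE x in lborel. norm (f x) \<le> norm (B * indicator (cball 0 R) x)"
    using assms(2,3) by (intro AE_I2) (auto simp: indicator_def not_le order_trans[OF _ abs_ge_self])
qed (use assms in auto)

lemma set_integrable_lebesgue_compact: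
  fixes f :: "'a::euclidean_space \<Rightarrow> 'b::euclidean_space"
  assumes "continuous_on UNIV f" "compact K"
  shows "set_integrable lebesgue K f"
  unfolding set_integrable_def
  using borel_integrable_compact[OF assms(2) continuous_on_subset[OF assms(1)]]
    assms borel_compact[OF assms(2)] borel_measurable_continuous_onI[OF assms(1)]
  by (subst integrable_completion) auto

lemma set_integrable_bounded_compact:
  fixes f :: "'a::euclidean_space \<Rightarrow> 'b::euclidean_space"
  assumes [measurable]: "f \<in> borel_measurable borel" and b: "\<And>x. norm (f x) \<le> B" and K: "compact K"
  shows "set_integrable lebesgue K f"
proof -
  have [measurable]: "K \<in> sets borel" using borel_compact[OF K] .
  have "integrable lborel (\<lambda>x. indicator K x *\<^sub>R f x)"
    by (rule integrableI_bounded_set_indicator[where B=B])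
      (use b emeasure_bounded_finite[OF compact_imp_bounded[OF K]] in auto)
  then show ?thesis unfolding set_integrable_def by (subst integrable_completion) auto
qed

text \<open>
  The difference quotients in a coordinate direction are bounded by \<open>L\<close>.  Paired with a test
  function they can be moved onto it by translation invariance, and there they converge to the
  derivative of the test function.  Their weak-star limit is thus a weak partial derivative.
\<close>

lemma lipschitz_imp_weak_gradient:
  fixes f :: "real^'n::finite \<Rightarrow> real" and L :: real
  assumes L: "\<And>x y. \<bar>f x - f y\<bar> \<le> L * norm (x - y)"
  shows "\<exists>G. weak_gradient f G \<and> G \<in> borel_measurable lebesgue \<and> (\<forall>x. norm (G x) \<le> CARD('n) * L)"
proof -
  have "0 \<le> L"
    using L[of "axis undefined 1" 0] by simp
  then have "L-lipschitz_on UNIV f" using L by (intro lipschitz_onI) (auto simp: dist_norm)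
  then have cf: "continuous_on UNIV f" by (rule lipschitz_on_continuous_on)
  have fm[measurable]: "f \<in> borel_measurable borel" using cf by (rule borel_measurable_continuous_onI)
  define h where "h k = 1 / real (Suc k)" for k
  have h: "h k > 0" "h k \<le> 1" for k by (auto simp: h_def)
  have h0: "h \<longlonglongrightarrow> 0" unfolding h_def by (rule LIMSEQ_Suc[OF lim_1_over_n])
  have "\<exists>G\<in>borel_measurable borel. (\<forall>x. \<bar>G x\<bar> \<le> L) \<and>
     (\<forall>\<phi>. smooth \<phi> \<and> compact (closure {x. \<phi> x \<noteq> 0}) \<longrightarrow>
        (\<integral>x. G x * \<phi> x \<partial>lborel) = - (\<integral>x. f x * pd i \<phi> x \<partial>lborel))" for i :: 'n
  proof -
    let ?e = "axis i (1::real) :: real^'n"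
    define g where "g k x = (f (x + h k *\<^sub>R ?e) - f x) / h k" for k x
    have gm: "g k \<in> borel_measurable lborel" for k unfolding g_def by measurable
    have gb: "\<bar>g k x\<bar> \<le> L" for k x
    proof -
      have "\<bar>f (x + h k *\<^sub>R ?e) - f x\<bar> \<le> L * h k"
        using L[of "x + h k *\<^sub>R ?e" x] h[of k] by (simp add: norm_axis_1)
      then show ?thesis using h[of k] by (simp add: g_def field_simps)
    qed
    \<comment> \<open>A positive integrable weight; its precise form is immaterial.\<close>
    have wi: "integrable lborel (\<lambda>x::real^'n. 1 / (1 + norm x) ^ (DIM(real^'n) + 2))"
      by (rule integrable_decay) simp
    have wp: "1 / (1 + norm x) ^ (DIM(real^'n) + 2) > 0" for x :: "real^'n"
      by (intro divide_pos_pos zero_less_power) (auto simp: add_pos_nonneg)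
    obtain G where G: "G \<in> borel_measurable lborel" "\<And>x. \<bar>G x\<bar> \<le> L"
      "\<And>\<phi> T. integrable lborel \<phi> \<Longrightarrow> (\<lambda>k. \<integral>x. g k x * \<phi> x \<partial>lborel) \<longlonglongrightarrow> T \<Longrightarrow> (\<integral>x. G x * \<phi> x \<partial>lborel) = T"
    proof (rule weak_star_limit[of g lborel L, OF _ _ wi wp])
      show "g k \<in> borel_measurable lborel" "\<bar>g k x\<bar> \<le> L" for k x by (fact gm, fact gb)
    qed (rule that)
    have "(\<integral>x. G x * \<phi> x \<partial>lborel) = - (\<integral>x. f x * pd i \<phi> x \<partial>lborel)"
      if \<phi>: "smooth \<phi>" "compact (closure {x. \<phi> x \<noteq> 0})" for \<phi>
    proof -
      obtain R B where RB: "R > 0" "B > 0" "\<And>x. norm x > R \<Longrightarrow> \<phi> x = 0" "\<And>x. \<bar>\<phi> x\<bar> \<le> B"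
        "\<And>i x. norm x > R \<Longrightarrow> pd i \<phi> x = 0" "\<And>i x. \<bar>pd i \<phi> x\<bar> \<le> B"
        using test_function_bounds[OF \<phi>] by blast
      have \<phi>m[measurable]: "\<phi> \<in> borel_measurable borel" "pd i \<phi> \<in> borel_measurable borel"
        by (fact smooth_measurable[OF \<phi>(1)])+
      have \<phi>i: "integrable lborel \<phi>" by (rule integrable_bounded_support[OF \<phi>m(1) RB(4,3)])
      define q :: "nat \<Rightarrow> real^'n \<Rightarrow> real" where "q k x = (\<phi> (x - h k *\<^sub>R ?e) - \<phi> x) / h k" for k x
      have qm[measurable]: "q k \<in> borel_measurable borel" for k unfolding q_def by measurable
      have qz: "q k x = 0" if "norm x > R + 1" for k x
      proof -
        have "norm (h k *\<^sub>R ?e) \<le> 1" using h[of k] by (simp add: norm_axis_1)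
        then have "norm (x - h k *\<^sub>R ?e) > R" using that norm_triangle_ineq2[of x "h k *\<^sub>R ?e"] by linarith
        then show ?thesis using that RB(3) by (simp add: q_def)
      qed
      have qb: "\<bar>q k x\<bar> \<le> B" for k x
      proof -
        have "\<bar>\<phi> (x + (- h k) *\<^sub>R ?e) - \<phi> x\<bar> \<le> B * \<bar>- h k\<bar>"
          by (rule line_bound[OF smooth_imp(1)[OF \<phi>(1)] RB(6)])
        then show ?thesis using h[of k] by (simp add: q_def field_simps)
      qed
      have ql: "(\<lambda>k. q k x) \<longlonglongrightarrow> - pd i \<phi> x" for x
      proof -
        have "((\<lambda>s. (\<phi> (x + s *\<^sub>R ?e) - \<phi> x) / s) \<longlongrightarrow> pd i \<phi> x) (at 0)"
          using smooth_imp(1)[OF \<phi>(1), of i x] unfolding has_pd_def has_field_derivative_iff by simp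
        moreover have "filterlim (\<lambda>k. - h k) (at 0) sequentially"
          unfolding filterlim_at
          using h(1) tendsto_minus[OF h0] by (auto intro!: always_eventually simp: less_imp_neq[symmetric])
        ultimately have "(\<lambda>k. (\<phi> (x + (- h k) *\<^sub>R ?e) - \<phi> x) / (- h k)) \<longlonglongrightarrow> pd i \<phi> x"
          by (rule filterlim_compose)
        from tendsto_minus[OF this] show ?thesis by (simp add: q_def)
      qed
      obtain Bf where Bf: "\<And>x. norm x \<le> R + 1 \<Longrightarrow> \<bar>f x\<bar> \<le> Bf"
      proof -
        have "bounded (f ` cball 0 (R + 1))"
          using cf by (intro compact_imp_bounded compact_continuous_image) (auto intro: continuous_on_subset)
        then obtain K where "\<forall>y\<in>f ` cball 0 (R + 1). norm y \<le> K" unfolding bounded_iff by blast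
        then show ?thesis by (intro that[of K]) auto
      qed
      have fint: "integrable lborel (\<lambda>x. f x * p x)"
        if [measurable]: "p \<in> borel_measurable borel" and p: "\<And>x. \<bar>p x\<bar> \<le> K" "\<And>x. norm x > R + 1 \<Longrightarrow> p x = 0" for p K
      proof (rule integrable_bounded_support[where R="R+1" and B="Bf * K"])
        show "\<bar>f x * p x\<bar> \<le> Bf * K" for x
        proof (cases "norm x > R + 1")
          case True
          have "0 \<le> Bf" using Bf[of 0] RB(1) by fastforce
          moreover have "0 \<le> K" using p(1)[of 0] by linarith
          ultimately show ?thesis using p True by simp
        next
          case False
          then show ?thesis using Bf[of x] p(1)[of x] by (auto simp: abs_mult intro!: mult_mono)
        qed
      qed (use p in auto)
      have eq: "(\<integral>x. g k x * \<phi> x \<partial>lborel) = (\<integral>x. f x * q k x \<partial>lborel)" for k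
      proof -
        have m1: "(\<lambda>x. f (x + h k *\<^sub>R ?e) * \<phi> x) \<in> borel_measurable borel" by measurable
        let ?F = "\<lambda>x. f x * \<phi> (x - h k *\<^sub>R ?e)"
        have Fm: "?F \<in> borel_measurable borel" by measurable
        have Fi: "integrable lborel ?F"
        proof (rule fint[where K=B])
          show "\<phi> (x - h k *\<^sub>R ?e) = 0" if "norm x > R + 1" for x
            using qz[OF that, of k] RB(3)[of x] that h[of k] by (simp add: q_def)
        qed (use RB in auto)
        have Fi2: "integrable lborel (\<lambda>x. f x * \<phi> x)" by (rule fint[where K=B]) (use RB in auto)
        have tr: "integrable lborel (\<lambda>x. f (x + h k *\<^sub>R ?e) * \<phi> x)"
          "(\<integral>x. f (x + h k *\<^sub>R ?e) * \<phi> x \<partial>lborel) = (\<integral>x. ?F x \<partial>lborel)"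
          using lborel_translate[OF Fm, of "h k *\<^sub>R ?e"] Fi by (simp_all add: add.commute)
        have "(\<integral>x. g k x * \<phi> x \<partial>lborel) = (\<integral>x. (f (x + h k *\<^sub>R ?e) * \<phi> x - f x * \<phi> x) / h k \<partial>lborel)"
          by (intro Bochner_Integration.integral_cong) (auto simp: g_def field_simps)
        also have "\<dots> = ((\<integral>x. ?F x \<partial>lborel) - (\<integral>x. f x * \<phi> x \<partial>lborel)) / h k"
          using tr Fi2 by simp
        also have "\<dots> = (\<integral>x. (?F x - f x * \<phi> x) / h k \<partial>lborel)"
          using Fi Fi2 by simp
        also have "\<dots> = (\<integral>x. f x * q k x \<partial>lborel)"
          by (intro Bochner_Integration.integral_cong) (auto simp: q_def field_simps)
        finally show ?thesis .
      qed
      have "(\<lambda>k. \<integral>x. f x * q k x \<partial>lborel) \<longlonglongrightarrow> (\<integral>x. f x * (- pd i \<phi> x) \<partial>lborel)"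
      proof (rule integral_dominated_convergence[where w="\<lambda>x. \<bar>f x * (B * indicator (cball 0 (R+1)) x)\<bar>"])
        show "integrable lborel (\<lambda>x. \<bar>f x * (B * indicator (cball 0 (R+1)) x)\<bar>)"
          using RB by (intro integrable_abs fint[where K=B]) (auto simp: indicator_def)
        show "AE x in lborel. (\<lambda>k. f x * q k x) \<longlonglongrightarrow> f x * (- pd i \<phi> x)"
          using ql by (intro AE_I2 tendsto_mult_left)
        show "AE x in lborel. norm (f x * q k x) \<le> \<bar>f x * (B * indicator (cball 0 (R+1)) x)\<bar>" for k
          using qb[of k] qz[of _ k] RB(2) by (intro AE_I2) (auto simp: indicator_def abs_mult not_le intro!: mult_left_mono)
      qed auto
      then show ?thesis using G(3)[OF \<phi>i] eq by simp
    qed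
    then show ?thesis using G(1,2) by (intro bexI[of _ G]) auto
  qed
  then have "\<forall>i. \<exists>G. G \<in> borel_measurable borel \<and> (\<forall>x. \<bar>G x\<bar> \<le> L) \<and>
     (\<forall>\<phi>. smooth \<phi> \<and> compact (closure {x. \<phi> x \<noteq> 0}) \<longrightarrow>
        (\<integral>x. G x * \<phi> x \<partial>lborel) = - (\<integral>x. f x * pd i \<phi> x \<partial>lborel))"
    by blast
  from choice[OF this] obtain G where G: "\<And>i. G i \<in> borel_measurable borel" "\<And>i x. \<bar>G i x\<bar> \<le> L"
    "\<And>i \<phi>. smooth \<phi> \<Longrightarrow> compact (closure {x. \<phi> x \<noteq> 0}) \<Longrightarrow>
        (\<integral>x. G i x * \<phi> x \<partial>lborel) = - (\<integral>x. f x * pd i \<phi> x \<partial>lborel)"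
    by blast
  define H :: "real^'n \<Rightarrow> real^'n" where "H x = (\<chi> i. G i x)" for x
  have Hm[measurable]: "H \<in> borel_measurable borel"
    using G(1) by (intro borel_measurable_vec) (simp add: H_def)
  have Hb: "norm (H x) \<le> CARD('n) * L" for x
  proof -
    have "norm (H x) \<le> (\<Sum>i\<in>UNIV. \<bar>H x $ i\<bar>)" by (rule norm_le_l1_cart)
    also have "\<dots> \<le> (\<Sum>i\<in>(UNIV::'n set). L)" by (intro sum_mono) (simp add: H_def G)
    finally show ?thesis by simp
  qed
  have "weak_gradient f H"
    unfolding weak_gradient_def
  proof (intro conjI allI impI)
    fix K :: "(real^'n) set" assume "compact K"
    then show "set_integrable lebesgue K f" "set_integrable lebesgue K H"
      using set_integrable_lebesgue_compact[OF cf] set_integrable_bounded_compact[OF Hm Hb] by auto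
  next
    fix \<phi> :: "real^'n \<Rightarrow> real" and i assume \<phi>: "smooth \<phi> \<and> compact (closure {x. \<phi> x \<noteq> 0})"
    have [measurable]: "\<phi> \<in> borel_measurable borel" "pd i \<phi> \<in> borel_measurable borel" "G i \<in> borel_measurable borel"
      using smooth_measurable[of \<phi>] \<phi> G by auto
    show "(LINT x|lebesgue. f x * pd i \<phi> x) = - (LINT x|lebesgue. H x $ i * \<phi> x)"
      using G(3)[of \<phi> i] \<phi> by (simp add: H_def integral_completion)
  qed
  moreover have "H \<in> borel_measurable lebesgue"
    by (rule measurable_completion) (use Hm in simp)
  ultimately show ?thesis using Hb by blast
qed

section \<open>Decay and scaling of the kernels\<close>

lemma deriv_under_integral:
  fixes f f' :: "'a \<Rightarrow> real \<Rightarrow> real"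
  assumes int: "\<And>h. \<bar>h\<bar> < 1 \<Longrightarrow> integrable M (\<lambda>x. f x h)"
    and der: "\<And>x h. \<bar>h\<bar> < 1 \<Longrightarrow> (f x has_real_derivative f' x h) (at h)"
    and bd: "\<And>x h. \<bar>h\<bar> < 1 \<Longrightarrow> \<bar>f' x h\<bar> \<le> w x"
    and w: "integrable M w"
  shows "integrable M (\<lambda>x. f' x 0)"
    and "((\<lambda>h. \<integral>x. f x h \<partial>M) has_real_derivative (\<integral>x. f' x 0 \<partial>M)) (at 0)"
proof -
  define U where "U = {-1<..<1::real}"
  have U: "open U" "0 \<in> U" "convex U" by (auto simp: U_def)
  have lip: "\<bar>f x h - f x 0\<bar> \<le> w x * \<bar>h\<bar>" if h: "h \<in> U" for x h
  proof -
    have 1: "(f x has_field_derivative f' x z) (at z within U)" if "z \<in> U" for z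
      by (rule has_field_derivative_at_within[OF der]) (use that in \<open>simp add: U_def abs_less_iff\<close>)
    have 2: "norm (f' x z) \<le> w x" if "z \<in> U" for z
      unfolding real_norm_def by (rule bd) (use that in \<open>simp add: U_def abs_less_iff\<close>)
    have "norm (f x h - f x 0) \<le> w x * norm (h - 0)"
      by (rule field_differentiable_bound[OF U(3) 1 2 h U(2)])
    then show ?thesis by simp
  qed
  have atU: "at 0 within U = at (0::real)" by (rule at_within_open[OF U(2,1)])
  have quot: "((\<lambda>h. (f x h - f x 0) / h) \<longlongrightarrow> f' x 0) (at 0 within U)" for x
  proof -
    have "(f x has_real_derivative f' x 0) (at 0)" by (rule der) simp
    then show ?thesis unfolding has_field_derivative_iff atU by simp
  qed
  have seq: "(\<lambda>i. (f x (X i) - f x 0) / X i) \<longlonglongrightarrow> f' x 0"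
    if "\<And>i. X i \<in> U - {0}" "X \<longlonglongrightarrow> 0" for X x
    using quot[of x, unfolded tendsto_at_iff_sequentially comp_def, rule_format, OF that] .
  let ?X = "\<lambda>i. 1 / real (Suc (Suc i))"
  have X: "?X i \<in> U - {0}" for i
  proof -
    have "0 < ?X i" "?X i < 1" by simp_all
    then show ?thesis unfolding U_def Diff_iff greaterThanLessThan_iff singleton_iff by linarith
  qed
  have X0: "?X \<longlonglongrightarrow> 0" by (intro LIMSEQ_Suc[of "\<lambda>i. 1 / real (Suc i)"] LIMSEQ_Suc[OF lim_1_over_n])
  have Ui: "integrable M (\<lambda>x. f x h)" if "h \<in> U" for h
    by (rule int) (use that in \<open>simp add: U_def abs_less_iff\<close>)
  have m: "(\<lambda>x. f' x 0) \<in> borel_measurable M"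
  proof (rule borel_measurable_LIMSEQ_real)
    show "(\<lambda>i. (f x (?X i) - f x 0) / ?X i) \<longlonglongrightarrow> f' x 0" for x by (rule seq[OF X X0])
    show "(\<lambda>x. (f x (?X i) - f x 0) / ?X i) \<in> borel_measurable M" for i
      by (intro borel_measurable_divide borel_measurable_diff borel_measurable_const
          borel_measurable_integrable[OF Ui] U(2)) (use X[of i] in blast)
  qed
  have bd0: "\<bar>f' x 0\<bar> \<le> w x" for x by (rule bd) simp
  show "integrable M (\<lambda>x. f' x 0)"
  proof (rule Bochner_Integration.integrable_bound[OF w m], intro AE_I2)
    show "norm (f' x 0) \<le> norm (w x)" for x using bd0[of x] by simp
  qed
  have "((\<lambda>h. ((\<integral>x. f x h \<partial>M) - (\<integral>x. f x 0 \<partial>M)) / h) \<longlongrightarrow> (\<integral>x. f' x 0 \<partial>M)) (at 0 within U)"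
    unfolding tendsto_at_iff_sequentially comp_def
  proof (intro allI impI)
    fix X :: "nat \<Rightarrow> real" assume X: "\<forall>i. X i \<in> U - {0}" "X \<longlonglongrightarrow> 0"
    have XU: "X i \<in> U" "X i \<noteq> 0" for i using X(1) by blast+
    note i = Ui[OF XU(1)] Ui[OF U(2)]
    have lim: "(\<lambda>i. \<integral>x. (f x (X i) - f x 0) / X i \<partial>M) \<longlonglongrightarrow> (\<integral>x. f' x 0 \<partial>M)"
    proof (rule integral_dominated_convergence[OF m _ w])
      show "(\<lambda>x. (f x (X i) - f x 0) / X i) \<in> borel_measurable M" for i
        by (intro borel_measurable_divide borel_measurable_diff borel_measurable_const
          borel_measurable_integrable i)
      show "AE x in M. (\<lambda>i. (f x (X i) - f x 0) / X i) \<longlonglongrightarrow> f' x 0"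
        by (intro AE_I2 seq X(2)) (use X(1) in blast)
      show "AE x in M. norm ((f x (X i) - f x 0) / X i) \<le> w x" for i
      proof (intro AE_I2)
        show "norm ((f x (X i) - f x 0) / X i) \<le> w x" for x
          using lip[OF XU(1)[of i], of x] XU(2)[of i] by (simp add: pos_divide_le_eq)
      qed
    qed
    have eq: "(\<integral>x. (f x (X i) - f x 0) / X i \<partial>M) = ((\<integral>x. f x (X i) \<partial>M) - (\<integral>x. f x 0 \<partial>M)) / X i" for i
      by (simp add: i Bochner_Integration.integral_diff)
    show "(\<lambda>i. ((\<integral>x. f x (X i) \<partial>M) - (\<integral>x. f x 0 \<partial>M)) / X i) \<longlonglongrightarrow> (\<integral>x. f' x 0 \<partial>M)"
      using lim unfolding eq .
  qed
  then show "((\<lambda>h. \<integral>x. f x h \<partial>M) has_real_derivative (\<integral>x. f' x 0 \<partial>M)) (at 0)"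
    by (simp add: has_field_derivative_iff atU)
qed

lemma one_plus_norm_shift:
  fixes x :: "'a::real_normed_vector"
  assumes "norm y \<le> 1"
  shows "1 / (1 + norm (x + y)) ^ m \<le> 2 ^ m / (1 + norm x) ^ m"
proof -
  have "1 + norm x \<le> 2 * (1 + norm (x + y))"
  proof -
    have "norm x \<le> norm (x + y) + norm y" using norm_triangle_ineq4[of "x + y" y] by simp
    then show ?thesis using assms norm_ge_zero[of "x + y"] by argo
  qed
  then have "(1 + norm x) ^ m \<le> (2 * (1 + norm (x + y))) ^ m" by (intro power_mono) auto
  then have "(1 + norm x) ^ m \<le> 2 ^ m * (1 + norm (x + y)) ^ m" by (simp only: power_mult_distrib)
  moreover have "(1 + norm x) ^ m > 0" "(1 + norm (x + y)) ^ m > 0" by (simp_all add: add_pos_nonneg)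
  ultimately show ?thesis by (simp add: divide_simps)
qed

text \<open>
  The integral of \<open>g (x + h e\<^sub>i)\<close> is independent of \<open>h\<close>; differentiate under the integral.
\<close>

lemma integral_pd_eq_0:
  fixes g g' :: "real^'n::finite \<Rightarrow> real"
  assumes g: "\<And>x. has_pd i g x (g' x)" and int: "integrable lborel g"
    and bd: "\<And>x. \<bar>g' x\<bar> \<le> C / (1 + norm x) ^ m" and m: "m \<ge> CARD('n) + 2"
  shows "(\<integral>x. g' x \<partial>lborel) = 0"
proof -
  let ?e = "axis i 1 :: real^'n"
  have C: "C \<ge> 0" using order_trans[OF abs_ge_zero bd[of 0]] by simp
  have tr: "integrable lborel (\<lambda>x. g (x + h *\<^sub>R ?e))" "(\<integral>x. g (x + h *\<^sub>R ?e) \<partial>lborel) = (\<integral>x. g x \<partial>lborel)" for h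
    using lborel_translate[of g "h *\<^sub>R ?e"] int by (simp_all add: add.commute)
  have "((\<lambda>h. \<integral>x. g (x + h *\<^sub>R ?e) \<partial>lborel) has_real_derivative (\<integral>x. g' (x + 0 *\<^sub>R ?e) \<partial>lborel)) (at 0)"
  proof (rule deriv_under_integral(2)[where w = "\<lambda>x. C * 2 ^ m * (1 / (1 + norm x) ^ m)"])
    show "((\<lambda>h. g (x + h *\<^sub>R ?e)) has_real_derivative g' (x + h *\<^sub>R ?e)) (at h)" for x h
      by (rule has_pd_line[OF g])
    show "\<bar>g' (x + h *\<^sub>R ?e)\<bar> \<le> C * 2 ^ m * (1 / (1 + norm x) ^ m)" if "\<bar>h\<bar> < 1" for x h
    proof -
      have "\<bar>g' (x + h *\<^sub>R ?e)\<bar> \<le> C * (1 / (1 + norm (x + h *\<^sub>R ?e)) ^ m)" using bd[of "x + h *\<^sub>R ?e"] by simp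
      also have "\<dots> \<le> C * (2 ^ m / (1 + norm x) ^ m)"
        using that by (intro mult_left_mono C one_plus_norm_shift) simp
      finally show ?thesis by simp
    qed
    show "integrable lborel (\<lambda>x::real^'n. C * 2 ^ m * (1 / (1 + norm x) ^ m))"
      using m by (intro integrable_mult_right integrable_decay) simp
  qed (use tr in auto)
  then have "((\<lambda>h::real. \<integral>x. g x \<partial>lborel) has_real_derivative (\<integral>x. g' x \<partial>lborel)) (at 0)"
    using tr(2) by simp
  then show ?thesis using DERIV_unique DERIV_const by blast
qed

inductive_set polys :: "(real^'n::finite \<Rightarrow> real) set" where
  const: "(\<lambda>_. c) \<in> polys"
| coord: "(\<lambda>x. x $ i) \<in> polys"
| add: "p \<in> polys \<Longrightarrow> q \<in> polys \<Longrightarrow> (\<lambda>x. p x + q x) \<in> polys"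
| mult: "p \<in> polys \<Longrightarrow> q \<in> polys \<Longrightarrow> (\<lambda>x. p x * q x) \<in> polys"

lemma has_pd_const: "has_pd i (\<lambda>_. c) x 0"
  by (simp add: has_pd_def)

lemma has_pd_coord: "has_pd i (\<lambda>x. x $ j) x (if i = j then 1 else 0)"
  by (auto simp: has_pd_def axis_def intro!: derivative_eq_intros)

lemma has_pd_add: "has_pd i p x a \<Longrightarrow> has_pd i q x b \<Longrightarrow> has_pd i (\<lambda>x. p x + q x) x (a + b)"
  unfolding has_pd_def by (rule DERIV_add)

lemma has_pd_mult: "has_pd i p x a \<Longrightarrow> has_pd i q x b \<Longrightarrow> has_pd i (\<lambda>x. p x * q x) x (a * q x + b * p x)"
  unfolding has_pd_def by (drule (1) DERIV_mult) simp

lemma has_pd_compose: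
  assumes "has_pd i p x a" "(f has_real_derivative d) (at (p x))"
  shows "has_pd i (\<lambda>x. f (p x)) x (d * a)"
  unfolding has_pd_def
  by (rule DERIV_chain2[of f _ "\<lambda>h. p (x + h *\<^sub>R axis i 1)"]) (use assms in \<open>auto simp: has_pd_def\<close>)

lemma polys_pd: "p \<in> polys \<Longrightarrow> \<exists>d\<in>polys. \<forall>x. has_pd i p x (d x)"
proof (induction rule: polys.induct)
  case (coord j)
  show ?case
    by (intro bexI[of _ "\<lambda>_. if i = j then 1 else 0"] allI has_pd_coord polys.const)
next
  case (add p q)
  then obtain a b where "a \<in> polys" "\<forall>x. has_pd i p x (a x)" "b \<in> polys" "\<forall>x. has_pd i q x (b x)" by blast
  then show ?case by (intro bexI[of _ "\<lambda>x. a x + b x"]) (auto intro: has_pd_add polys.add)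
next
  case (mult p q)
  then obtain a b where "a \<in> polys" "\<forall>x. has_pd i p x (a x)" "b \<in> polys" "\<forall>x. has_pd i q x (b x)" by blast
  then show ?case using mult
    by (intro bexI[of _ "\<lambda>x. a x * q x + b x * p x"]) (auto intro: has_pd_mult polys.add polys.mult)
qed (auto intro: polys.const has_pd_const)

lemma polys_continuous: "p \<in> polys \<Longrightarrow> continuous_on UNIV p"
  by (induction rule: polys.induct) (auto intro!: continuous_intros)

lemma polys_bound: "p \<in> polys \<Longrightarrow> \<exists>C k. C \<ge> 0 \<and> (\<forall>x. \<bar>p x\<bar> \<le> C * (1 + norm x) ^ k)"
proof (induction rule: polys.induct)
  case (const c)
  then show ?case by (intro exI[of _ "\<bar>c\<bar>"] exI[of _ 0]) auto
next
  case (coord i)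
  have "\<bar>x $ i\<bar> \<le> 1 * (1 + norm x) ^ 1" for x :: "real^'a"
    using component_le_norm_cart[of x i] by simp
  then show ?case by (intro exI[of _ 1] exI[of _ 1] conjI allI) auto
next
  case (add p q)
  then obtain C k D l where *: "C \<ge> 0" "\<And>x. \<bar>p x\<bar> \<le> C * (1 + norm x) ^ k" "D \<ge> 0" "\<And>x. \<bar>q x\<bar> \<le> D * (1 + norm x) ^ l"
    by blast
  have "\<bar>p x + q x\<bar> \<le> (C + D) * (1 + norm x) ^ (k + l)" for x
  proof -
    have "C * (1 + norm x) ^ k \<le> C * (1 + norm x) ^ (k + l)" "D * (1 + norm x) ^ l \<le> D * (1 + norm x) ^ (k + l)"
      using * by (auto intro!: mult_left_mono power_increasing)
    then show ?thesis using *(2)[of x] *(4)[of x] by (simp add: distrib_right)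
  qed
  then show ?case using * by (intro exI[of _ "C + D"] exI[of _ "k + l"]) auto
next
  case (mult p q)
  then obtain C k D l where *: "C \<ge> 0" "\<And>x. \<bar>p x\<bar> \<le> C * (1 + norm x) ^ k" "D \<ge> 0" "\<And>x. \<bar>q x\<bar> \<le> D * (1 + norm x) ^ l"
    by blast
  have "\<bar>p x * q x\<bar> \<le> (C * D) * (1 + norm x) ^ (k + l)" for x
    using mult_mono[OF *(2)[of x] *(4)[of x]] * by (simp add: abs_mult power_add mult_ac)
  then show ?case using * by (intro exI[of _ "C * D"] exI[of _ "k + l"]) auto
qed

text \<open>
  From \<open>(1 + y / n) ^ n \<le> exp y\<close> with \<open>n = j + 1\<close>.
\<close>

lemma power_le_exp: "(1 + r) ^ j \<le> (real (Suc j)) ^ Suc j * exp (1 + r)" if "r \<ge> 0" for r :: real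
proof -
  let ?n = "Suc j"
  have "(1 + r) ^ j \<le> (1 + r) ^ ?n" using that by (intro power_increasing) auto
  also have "\<dots> = real ?n ^ ?n * ((1 + r) / real ?n) ^ ?n"
    by (simp add: power_divide del: power_Suc of_nat_Suc)
  also have "\<dots> \<le> real ?n ^ ?n * (1 + (1 + r) / real ?n) ^ ?n"
    using that by (intro mult_left_mono power_mono) auto
  also have "\<dots> \<le> real ?n ^ ?n * exp (1 + r)"
    using that by (intro mult_left_mono exp_ge_one_plus_x_over_n_power_n) auto
  finally show ?thesis .
qed

text \<open>
  Polynomial multiples of the symbol \<open>exp (- |\<xi>|\<^sup>4)\<close> of the biharmonic semigroup at time one.  The
  class is closed under multiplication by coordinates and under partial derivatives, which under the
  Fourier transform exchange roles.
\<close>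

definition quartic_gauss :: "(real^'n::finite \<Rightarrow> real) \<Rightarrow> bool" where
  "quartic_gauss g \<longleftrightarrow> (\<exists>p\<in>polys. g = (\<lambda>x. p x * exp (- (norm x ^ 4))))"

lemma quartic_gauss_decay:
  assumes "quartic_gauss g"
  shows "\<exists>C\<ge>0. \<forall>x. \<bar>g x\<bar> \<le> C / (1 + norm x) ^ m"
proof -
  obtain p where p: "p \<in> polys" and g: "g = (\<lambda>x. p x * exp (- (norm x ^ 4)))"
    using assms by (auto simp: quartic_gauss_def)
  obtain C k where C: "C \<ge> 0" "\<And>x. \<bar>p x\<bar> \<le> C * (1 + norm x) ^ k" using polys_bound[OF p] by blast
  define j where "j = k + m"
  define D where "D = C * real (Suc j) ^ Suc j * exp 2"
  have "\<bar>g x\<bar> * (1 + norm x) ^ m \<le> D" for x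
  proof -
    have r: "norm x \<le> 1 + norm x ^ 4"
    proof (cases "norm x \<le> 1")
      case False
      then have "norm x ^ 1 \<le> norm x ^ 4" by (intro power_increasing) auto
      then show ?thesis by simp
    qed (auto intro: order_trans)
    have "\<bar>g x\<bar> * (1 + norm x) ^ m = \<bar>p x\<bar> * (1 + norm x) ^ m * exp (- (norm x ^ 4))"
      by (simp add: g abs_mult)
    also have "\<dots> \<le> C * (1 + norm x) ^ k * (1 + norm x) ^ m * exp (- (norm x ^ 4))"
      by (intro mult_right_mono C) auto
    also have "\<dots> = C * (1 + norm x) ^ j * exp (- (norm x ^ 4))"
      by (simp add: j_def power_add)
    also have "\<dots> \<le> C * (real (Suc j) ^ Suc j * exp (1 + norm x)) * exp (- (norm x ^ 4))"
      by (intro mult_right_mono mult_left_mono power_le_exp C) auto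
    also have "\<dots> = C * real (Suc j) ^ Suc j * exp (1 + norm x - norm x ^ 4)"
      by (simp add: exp_add exp_diff exp_minus field_simps)
    also have "\<dots> \<le> D"
      unfolding D_def using r C by (intro mult_left_mono) (auto simp del: power_Suc)
    finally show ?thesis .
  qed
  then show ?thesis
    using C by (intro exI[of _ D]) (auto simp: pos_le_divide_eq add_pos_nonneg D_def)
qed

lemma quartic_gauss_coord: "quartic_gauss g \<Longrightarrow> quartic_gauss (\<lambda>x. x $ i * g x)"
  unfolding quartic_gauss_def by (auto simp flip: mult.assoc intro!: bexI[OF _ polys.mult[OF polys.coord]])

lemma quartic_gauss_measurable: "quartic_gauss g \<Longrightarrow> g \<in> borel_measurable borel"
  unfolding quartic_gauss_def using polys_continuous by (auto intro!: borel_measurable_continuous_onI continuous_intros)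

lemma quartic_gauss_integrable:
  fixes g :: "real^'n::finite \<Rightarrow> real"
  assumes "quartic_gauss g" shows "integrable lborel g"
proof -
  obtain C where C: "\<And>x. \<bar>g x\<bar> \<le> C / (1 + norm x) ^ (CARD('n) + 2)"
    using quartic_gauss_decay[OF assms] by blast
  show ?thesis
  proof (rule Bochner_Integration.integrable_bound[of lborel "\<lambda>x. C * (1 / (1 + norm x) ^ (CARD('n) + 2))"])
    show "integrable lborel (\<lambda>x::real^'n. C * (1 / (1 + norm x) ^ (CARD('n) + 2)))"
      by (intro integrable_mult_right integrable_decay) simp
    show "AE x in lborel. norm (g x) \<le> norm (C * (1 / (1 + norm x) ^ (CARD('n) + 2)))"
    proof (intro AE_I2)
      fix x :: "real^'n"
      have "norm (g x) \<le> C * (1 / (1 + norm x) ^ (CARD('n) + 2))" using C[of x] by (simp only: real_norm_def times_divide_eq_right mult_1_right)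
      also have "\<dots> \<le> norm (C * (1 / (1 + norm x) ^ (CARD('n) + 2)))" unfolding real_norm_def by (rule abs_ge_self)
      finally show "norm (g x) \<le> norm (C * (1 / (1 + norm x) ^ (CARD('n) + 2)))" .
    qed
  qed (use quartic_gauss_measurable[OF assms] in simp)
qed

lemma quartic_gauss_pd:
  fixes g :: "real^'n::finite \<Rightarrow> real"
  assumes "quartic_gauss g"
  shows "\<exists>g'. quartic_gauss g' \<and> (\<forall>x. has_pd i g x (g' x))"
proof -
  obtain p where p: "p \<in> polys" and g: "g = (\<lambda>x. p x * exp (- (norm x ^ 4)))"
    using assms by (auto simp: quartic_gauss_def)
  have sq: "(\<lambda>x::real^'n. \<Sum>j\<in>S. x $ j * x $ j) \<in> polys" if "finite S" for S
    using that by induction (simp_all add: polys.const polys.add[OF polys.mult[OF polys.coord polys.coord]])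
  define N where "N x = (\<Sum>j\<in>UNIV. x $ j * x $ j)" for x :: "real^'n"
  have N: "N \<in> polys" unfolding N_def using sq by simp
  have n4: "norm x ^ 4 = N x * N x" for x
  proof -
    have "N x = (norm x)\<^sup>2" by (simp add: N_def norm_vec_def L2_set_def sum_nonneg power2_eq_square)
    then show ?thesis by (simp flip: power_add power2_eq_square power_mult)
  qed
  define q where "q x = - 1 * (N x * N x)" for x
  have q: "q \<in> polys" unfolding q_def by (intro polys.mult polys.const N)
  have g2: "g = (\<lambda>x. p x * exp (q x))" by (simp add: g n4 q_def)
  obtain a b where ab: "a \<in> polys" "\<And>x. has_pd i p x (a x)" "b \<in> polys" "\<And>x. has_pd i q x (b x)"
    using polys_pd[OF p] polys_pd[OF q] by metis
  have "has_pd i g x (a x * exp (q x) + (exp (q x) * b x) * p x)" for x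
    unfolding g2 by (intro has_pd_mult ab has_pd_compose) (rule DERIV_exp)
  moreover have "quartic_gauss (\<lambda>x. a x * exp (q x) + (exp (q x) * b x) * p x)"
    unfolding quartic_gauss_def using ab p
    by (intro bexI[of _ "\<lambda>x. a x + b x * p x"]) (auto simp: n4 q_def algebra_simps intro: polys.intros)
  ultimately show ?thesis by blast
qed

text \<open>
  The real part of a phase-shifted Fourier transform.  The phase \<open>\<theta>\<close> keeps everything real: a
  derivative in \<open>z\<close> or an integration by parts in \<open>\<xi>\<close> turns cosine into sine, which is a shift
  of \<open>\<theta>\<close> by \<open>\<pi> / 2\<close>.
\<close>

definition fourier_cos :: "real \<Rightarrow> (real^'n::finite \<Rightarrow> real) \<Rightarrow> real^'n \<Rightarrow> real" where
  "fourier_cos \<theta> g z = (\<integral>\<xi>. cos (z \<bullet> \<xi> + \<theta>) * g \<xi> \<partial>lborel)"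

lemma integrable_cos_quartic_gauss:
  assumes "quartic_gauss g" shows "integrable lborel (\<lambda>\<xi>. cos (z \<bullet> \<xi> + \<theta>) * g \<xi>)"
  using quartic_gauss_measurable[OF assms]
  by (intro Bochner_Integration.integrable_bound[OF quartic_gauss_integrable[OF assms]])
    (auto intro!: AE_I2 simp: abs_mult mult_left_le_one_le)

lemma fourier_cos_bounded:
  assumes "quartic_gauss g" shows "\<bar>fourier_cos \<theta> g z\<bar> \<le> (\<integral>\<xi>. \<bar>g \<xi>\<bar> \<partial>lborel)"
proof -
  have "\<bar>fourier_cos \<theta> g z\<bar> \<le> (\<integral>\<xi>. \<bar>cos (z \<bullet> \<xi> + \<theta>) * g \<xi>\<bar> \<partial>lborel)"
    unfolding fourier_cos_def using integral_abs_bound by blast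
  also have "\<dots> \<le> (\<integral>\<xi>. \<bar>g \<xi>\<bar> \<partial>lborel)"
    by (intro integral_mono integrable_abs integrable_cos_quartic_gauss quartic_gauss_integrable assms)
      (auto simp: abs_mult mult_left_le_one_le)
  finally show ?thesis .
qed

lemma fourier_cos_pd:
  fixes g :: "real^'n::finite \<Rightarrow> real"
  assumes g: "quartic_gauss g"
  shows "has_pd i (fourier_cos \<theta> g) z (fourier_cos (\<theta> + pi / 2) (\<lambda>\<xi>. \<xi> $ i * g \<xi>) z)"
proof -
  let ?e = "axis i 1 :: real^'n"
  have "((\<lambda>h. \<integral>\<xi>. cos ((z + h *\<^sub>R ?e) \<bullet> \<xi> + \<theta>) * g \<xi> \<partial>lborel) has_real_derivative
      (\<integral>\<xi>. cos ((z + 0 *\<^sub>R ?e) \<bullet> \<xi> + (\<theta> + pi / 2)) * (\<xi> $ i * g \<xi>) \<partial>lborel)) (at 0)"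
  proof (rule deriv_under_integral(2)[where w = "\<lambda>\<xi>. \<bar>\<xi> $ i * g \<xi>\<bar>"])
    show "integrable lborel (\<lambda>\<xi>. cos ((z + h *\<^sub>R ?e) \<bullet> \<xi> + \<theta>) * g \<xi>)" for h
      by (rule integrable_cos_quartic_gauss[OF g])
    show "((\<lambda>h. cos ((z + h *\<^sub>R ?e) \<bullet> \<xi> + \<theta>) * g \<xi>) has_real_derivative
        cos ((z + h *\<^sub>R ?e) \<bullet> \<xi> + (\<theta> + pi / 2)) * (\<xi> $ i * g \<xi>)) (at h)" for \<xi> h
    proof -
      have "cos ((z + h *\<^sub>R ?e) \<bullet> \<xi> + (\<theta> + pi / 2)) = - sin ((z + h *\<^sub>R ?e) \<bullet> \<xi> + \<theta>)"
        using minus_sin_cos_eq[of "(z + h *\<^sub>R ?e) \<bullet> \<xi> + \<theta>"] by (simp add: add.assoc)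
      moreover have "?e \<bullet> \<xi> = \<xi> $ i" by (simp add: inner_axis inner_commute)
      ultimately show ?thesis
        by (auto intro!: derivative_eq_intros simp: inner_add_left)
    qed
    show "\<bar>cos ((z + h *\<^sub>R ?e) \<bullet> \<xi> + (\<theta> + pi / 2)) * (\<xi> $ i * g \<xi>)\<bar> \<le> \<bar>\<xi> $ i * g \<xi>\<bar>" for \<xi> h
      by (simp add: abs_mult mult_left_le_one_le)
    show "integrable lborel (\<lambda>\<xi>. \<bar>\<xi> $ i * g \<xi>\<bar>)"
      by (intro integrable_abs quartic_gauss_integrable quartic_gauss_coord g)
  qed
  then show ?thesis by (simp add: has_pd_def fourier_cos_def)
qed

text \<open>
  The factor \<open>z $ i\<close> is produced by differentiating the cosine in \<open>\<xi> $ i\<close>; the integral of the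
  derivative of the whole product vanishes.
\<close>

lemma fourier_cos_coord:
  fixes g :: "real^'n::finite \<Rightarrow> real"
  assumes g: "quartic_gauss g" and g': "quartic_gauss g'" "\<And>x. has_pd i g x (g' x)"
  shows "z $ i * fourier_cos \<theta> g z = - fourier_cos (\<theta> - pi / 2) g' z"
proof -
  let ?m = "CARD('n) + 2"
  let ?G = "\<lambda>\<xi>. cos (z \<bullet> \<xi> + (\<theta> - pi / 2)) * g \<xi>"
  let ?D = "\<lambda>\<xi>. z $ i * (cos (z \<bullet> \<xi> + \<theta>) * g \<xi>) + cos (z \<bullet> \<xi> + (\<theta> - pi / 2)) * g' \<xi>"
  obtain C where C: "C \<ge> 0" "\<And>x. \<bar>g x\<bar> \<le> C / (1 + norm x) ^ ?m" using quartic_gauss_decay[OF g] by blast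
  obtain C' where C': "C' \<ge> 0" "\<And>x. \<bar>g' x\<bar> \<le> C' / (1 + norm x) ^ ?m" using quartic_gauss_decay[OF g'(1)] by blast
  have "(\<integral>\<xi>. ?D \<xi> \<partial>lborel) = 0"
  proof (rule integral_pd_eq_0[where g = ?G and i = i and m = ?m and C = "\<bar>z $ i\<bar> * C + C'"])
    show "has_pd i ?G \<xi> (?D \<xi>)" for \<xi>
    proof -
      have "has_pd i (\<lambda>\<xi>. cos (z \<bullet> \<xi> + (\<theta> - pi / 2))) \<xi> (z $ i * cos (z \<bullet> \<xi> + \<theta>))"
      proof -
        have "- sin (z \<bullet> \<xi> + (\<theta> - pi / 2)) = cos (z \<bullet> \<xi> + \<theta>)"
          using minus_sin_cos_eq[of "z \<bullet> \<xi> + \<theta> - pi / 2"] by (simp add: algebra_simps)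
        then show ?thesis
          unfolding has_pd_def by (auto intro!: derivative_eq_intros simp: inner_add_right inner_axis)
      qed
      from has_pd_mult[OF this g'(2)] show ?thesis by (simp add: mult_ac)
    qed
    show "integrable lborel ?G" by (rule integrable_cos_quartic_gauss[OF g])
    show "\<bar>?D x\<bar> \<le> (\<bar>z $ i\<bar> * C + C') / (1 + norm x) ^ ?m" for x
    proof -
      have "\<bar>?D x\<bar> \<le> \<bar>z $ i\<bar> * \<bar>g x\<bar> + \<bar>g' x\<bar>"
        by (intro order_trans[OF abs_triangle_ineq] add_mono)
          (auto simp: abs_mult mult_left_le_one_le intro!: mult_left_mono)
      also have "\<dots> \<le> \<bar>z $ i\<bar> * (C / (1 + norm x) ^ ?m) + C' / (1 + norm x) ^ ?m"
        by (intro add_mono mult_left_mono C C') auto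
      finally show ?thesis by (simp add: add_divide_distrib)
    qed
  qed simp
  moreover have "(\<integral>\<xi>. ?D \<xi> \<partial>lborel) = z $ i * fourier_cos \<theta> g z + fourier_cos (\<theta> - pi / 2) g' z"
    unfolding fourier_cos_def
    by (subst Bochner_Integration.integral_add) (auto intro: integrable_mult_right integrable_cos_quartic_gauss g g')
  ultimately show ?thesis by simp
qed

text \<open>
  Closed under differentiation and, up to sign, under multiplication by coordinates; since its
  members are bounded, all of them decay faster than every power.
\<close>

definition fourier_class :: "(real^'n::finite \<Rightarrow> real) set" where
  "fourier_class = {fourier_cos \<theta> g | \<theta> g. quartic_gauss g}"

lemma fourier_class_pd: "f \<in> fourier_class \<Longrightarrow> \<exists>f'\<in>fourier_class. \<forall>z. has_pd i f z (f' z)"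
  unfolding fourier_class_def using fourier_cos_pd quartic_gauss_coord by blast

lemma fourier_class_bounded: "f \<in> fourier_class \<Longrightarrow> \<exists>C. \<forall>z. \<bar>f z\<bar> \<le> C"
  unfolding fourier_class_def using fourier_cos_bounded by blast

lemma fourier_class_coord: "f \<in> fourier_class \<Longrightarrow> \<exists>f'\<in>fourier_class. \<forall>z. z $ i * f z = - f' z"
  unfolding fourier_class_def using fourier_cos_coord quartic_gauss_pd by blast

lemma fourier_class_power: "f \<in> fourier_class \<Longrightarrow> \<exists>f'\<in>fourier_class. \<forall>z. \<bar>z $ i\<bar> ^ k * \<bar>f z\<bar> = \<bar>f' z\<bar>"
proof (induction k)
  case (Suc k)
  then obtain f' where f': "f' \<in> fourier_class" "\<And>z. \<bar>z $ i\<bar> ^ k * \<bar>f z\<bar> = \<bar>f' z\<bar>" by blast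
  obtain f'' where f'': "f'' \<in> fourier_class" "\<And>z. z $ i * f' z = - f'' z" using fourier_class_coord[OF f'(1)] by blast
  have "\<bar>z $ i\<bar> ^ Suc k * \<bar>f z\<bar> = \<bar>f'' z\<bar>" for z
    using f'(2)[of z] arg_cong[OF f''(2)[of z], of abs] by (simp add: abs_mult mult.assoc)
  then show ?case using f'' by blast
qed auto

text \<open>
  Estimate \<open>norm z\<close> by its largest coordinate and use that \<open>z $ i ^ m * f z\<close> is bounded.
\<close>

lemma fourier_class_decay:
  fixes f :: "real^'n::finite \<Rightarrow> real"
  assumes f: "f \<in> fourier_class"
  shows "\<exists>C\<ge>0. \<forall>z. \<bar>f z\<bar> \<le> C / (1 + norm z) ^ m"
proof -
  let ?n = "real (CARD('n) + 1)"
  obtain C0 where C0: "\<And>z. \<bar>f z\<bar> \<le> C0" using fourier_class_bounded[OF f] by blast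
  have "\<forall>i. \<exists>C. \<forall>z. \<bar>z $ i\<bar> ^ m * \<bar>f z\<bar> \<le> C"
    using fourier_class_power[OF f] fourier_class_bounded by (metis (no_types, opaque_lifting))
  then obtain C where C: "\<And>i z. \<bar>z $ i\<bar> ^ m * \<bar>f z\<bar> \<le> C i" by metis
  have C0': "C0 \<ge> 0" using C0[of 0] by linarith
  have C': "C i \<ge> 0" for i by (rule order_trans[OF _ C[of 0]]) simp
  define D where "D = ?n ^ m * (C0 + sum C UNIV)"
  have "(1 + norm z) ^ m * \<bar>f z\<bar> \<le> D" for z
  proof -
    obtain i where i: "\<And>j. \<bar>z $ j\<bar> \<le> \<bar>z $ i\<bar>"
    proof -
      have "Max (range (\<lambda>j. \<bar>z $ j\<bar>)) \<in> range (\<lambda>j. \<bar>z $ j\<bar>)" by (rule Max_in) auto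
      then obtain i where "Max (range (\<lambda>j. \<bar>z $ j\<bar>)) = \<bar>z $ i\<bar>" by blast
      then show ?thesis using Max_ge[of "range (\<lambda>j. \<bar>z $ j\<bar>)"] by (intro that[of i]) (metis finite rangeI finite_imageI)
    qed
    have nz: "norm z \<le> CARD('n) * \<bar>z $ i\<bar>"
    proof -
      have "norm z \<le> (\<Sum>j\<in>UNIV. \<bar>z $ j\<bar>)" by (rule norm_le_l1_cart)
      also have "\<dots> \<le> (\<Sum>j\<in>(UNIV::'n set). \<bar>z $ i\<bar>)" by (intro sum_mono i)
      finally show ?thesis by simp
    qed
    have Ci: "C i \<le> sum C UNIV" using C' by (intro member_le_sum) auto
    show ?thesis
    proof (cases "\<bar>z $ i\<bar> \<le> 1")
      case True
      have "real CARD('n) * \<bar>z $ i\<bar> \<le> real CARD('n) * 1" using True by (intro mult_left_mono) auto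
      then have "1 + norm z \<le> ?n" using nz unfolding of_nat_add of_nat_1 by linarith
      then have "(1 + norm z) ^ m * \<bar>f z\<bar> \<le> ?n ^ m * C0"
        using C0[of z] by (intro mult_mono power_mono) auto
      also have "\<dots> \<le> D" unfolding D_def using C' by (intro mult_left_mono) (auto simp: sum_nonneg)
      finally show ?thesis .
    next
      case False
      then have "1 + norm z \<le> ?n * \<bar>z $ i\<bar>" using nz by (simp add: distrib_right)
      then have "(1 + norm z) ^ m * \<bar>f z\<bar> \<le> (?n * \<bar>z $ i\<bar>) ^ m * \<bar>f z\<bar>"
        by (intro mult_right_mono power_mono) auto
      also have "\<dots> = ?n ^ m * (\<bar>z $ i\<bar> ^ m * \<bar>f z\<bar>)" by (simp only: power_mult_distrib mult.assoc)
      also have "\<dots> \<le> ?n ^ m * C i" by (intro mult_left_mono C) auto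
      also have "\<dots> \<le> D" unfolding D_def using C0' Ci by (intro mult_left_mono) auto
      finally show ?thesis .
    qed
  qed
  moreover have "D \<ge> 0" unfolding D_def using C0' C' by (auto intro!: mult_nonneg_nonneg sum_nonneg add_nonneg_nonneg)
  ultimately show ?thesis
    by (intro exI[of _ D]) (auto simp: pos_le_divide_eq add_pos_nonneg mult.commute)
qed

lemma fourier_class_continuous:
  fixes f :: "real^'n::finite \<Rightarrow> real"
  assumes f: "f \<in> fourier_class" shows "continuous_on UNIV f"
proof -
  have "\<forall>i. \<exists>f' C. \<forall>z. has_pd i f z (f' z) \<and> \<bar>f' z\<bar> \<le> C"
    using fourier_class_pd[OF f] fourier_class_bounded by (metis (no_types, lifting))
  then obtain f' C where *: "\<And>i z. has_pd i f z (f' i z)" "\<And>i z. \<bar>f' i z\<bar> \<le> C i" by metis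
  have C: "C i \<ge> 0" for i by (rule order_trans[OF _ *(2)[of _ 0]]) simp
  have b: "\<bar>f' i z\<bar> \<le> sum C UNIV" for i z
    by (rule order_trans[OF *(2)]) (use C in \<open>auto intro: member_le_sum\<close>)
  have "(CARD('n) * sum C UNIV)-lipschitz_on UNIV f"
    using partials_bounded_imp_lipschitz[OF *(1) b] C
    by (intro lipschitz_onI) (auto simp: dist_norm sum_nonneg)
  then show ?thesis by (rule lipschitz_on_continuous_on)
qed

lemma fourier_class_pd_list:
  assumes f: "f \<in> fourier_class" shows "pd_list l f \<in> fourier_class"
proof (induction l)
  case (Cons i l)
  obtain f' where f': "f' \<in> fourier_class" "\<And>z. has_pd i (pd_list l f) z (f' z)" using fourier_class_pd[OF Cons] by blast
  then have "pd i (pd_list l f) = f'" using has_pd_imp_pd by blast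
  then show ?case using f' by (simp add: pd_list_def)
qed (use f in \<open>simp add: pd_list_def\<close>)

lemma has_pd_scale:
  assumes "has_pd i f (c *\<^sub>R z) D"
  shows "has_pd i (\<lambda>z. a * f (c *\<^sub>R z)) z (a * c * D)"
proof -
  have "((\<lambda>h. f (c *\<^sub>R z + (c * h) *\<^sub>R axis i 1)) has_real_derivative D * c) (at 0)"
    by (rule DERIV_chain2[of "\<lambda>h. f (c *\<^sub>R z + h *\<^sub>R axis i 1)"])
      (use assms in \<open>auto simp: has_pd_def intro!: derivative_eq_intros\<close>)
  from DERIV_cmult[OF this, of a] show ?thesis
    by (simp add: has_pd_def scaleR_add_right mult_ac)
qed

lemma fourier_class_pd_list_scale:
  assumes f: "f \<in> fourier_class"
  shows "pd_list l (\<lambda>z. a * f (c *\<^sub>R z)) = (\<lambda>z. a * c ^ length l * pd_list l f (c *\<^sub>R z))"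
proof (induction l)
  case (Cons i l)
  obtain f' where f': "\<And>z. has_pd i (pd_list l f) z (f' z)" using fourier_class_pd[OF fourier_class_pd_list[OF f]] by blast
  have 1: "pd_list (i # l) f = f'" using has_pd_imp_pd[OF f'] by (auto simp: pd_list_def)
  have "pd_list (i # l) (\<lambda>z. a * f (c *\<^sub>R z)) = pd i (\<lambda>z. a * c ^ length l * pd_list l f (c *\<^sub>R z))"
    using Cons by (simp add: pd_list_def)
  also have "\<dots> = (\<lambda>z. a * c ^ length l * c * f' (c *\<^sub>R z))"
    using has_pd_imp_pd[OF has_pd_scale[OF f']] by blast
  finally show ?case using 1 by (simp add: mult_ac)
qed (simp add: pd_list_def)

lemma biharmonic_kernel_fourier: "(\<lambda>z::real^'n::finite. biharmonic_kernel z 1) \<in> fourier_class"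
proof -
  let ?g = "\<lambda>x::real^'n. (1 / (2 * pi) ^ CARD('n)) * exp (- (norm x ^ 4))"
  have s: "quartic_gauss ?g" unfolding quartic_gauss_def by (intro bexI[of _ "\<lambda>_. 1 / (2 * pi) ^ CARD('n)"] polys.const) simp
  have m: "(\<lambda>\<xi>::real^'n. cos (z \<bullet> \<xi>) * exp (- (norm \<xi> ^ 4 * 1))) \<in> borel_measurable lborel" for z
    by measurable
  have "biharmonic_kernel z 1 = fourier_cos 0 ?g z" for z :: "real^'n"
    unfolding biharmonic_kernel_def fourier_cos_def by (simp add: integral_completion[OF m, simplified])
  then show ?thesis unfolding fourier_class_def using s by auto
qed

lemma biharmonic_kernel_scale:
  assumes t: "t > 0"
  shows "biharmonic_kernel (z::real^'n::finite) t =
    t powr (- real CARD('n) / 4) * biharmonic_kernel (t powr (- 1 / 4) *\<^sub>R z) 1"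
proof -
  let ?c = "t powr (- 1 / 4)"
  have c: "?c > 0" using t by simp
  have "?c ^ 4 = t powr (- 1)" using t by (simp add: powr_power)
  then have c4: "?c ^ 4 * t = 1" using t by (simp add: powr_minus)
  have cn: "?c ^ CARD('n) = t powr (- real CARD('n) / 4)"
    using t by (simp add: powr_power)
  have m: "(\<lambda>\<xi>::real^'n. cos (z \<bullet> \<xi>) * exp (- (norm \<xi> ^ 4 * t))) \<in> borel_measurable lborel" for z t
    by measurable
  have "(LINT \<xi>|lborel. cos (z \<bullet> \<xi>) * exp (- (norm \<xi> ^ 4 * t)))
      = ?c ^ CARD('n) * (LINT \<xi>|lborel. cos (z \<bullet> (0 + ?c *\<^sub>R \<xi>)) * exp (- (norm (0 + ?c *\<^sub>R \<xi>) ^ 4 * t)))"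
    using c lborel_affine_integral(1)[of "\<lambda>\<xi>. cos (z \<bullet> \<xi>) * exp (- (norm \<xi> ^ 4 * t))" ?c 0] by simp
  also have "(\<lambda>\<xi>::real^'n. cos (z \<bullet> (0 + ?c *\<^sub>R \<xi>)) * exp (- (norm (0 + ?c *\<^sub>R \<xi>) ^ 4 * t))) =
     (\<lambda>\<xi>. cos ((?c *\<^sub>R z) \<bullet> \<xi>) * exp (- (norm \<xi> ^ 4 * 1)))"
  proof
    fix \<xi> :: "real^'n"
    have "norm (0 + ?c *\<^sub>R \<xi>) ^ 4 * t = norm \<xi> ^ 4 * (?c ^ 4 * t)" using c by (simp add: power_mult_distrib)
    then show "cos (z \<bullet> (0 + ?c *\<^sub>R \<xi>)) * exp (- (norm (0 + ?c *\<^sub>R \<xi>) ^ 4 * t)) =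
      cos ((?c *\<^sub>R z) \<bullet> \<xi>) * exp (- (norm \<xi> ^ 4 * 1))" unfolding c4 by simp
  qed
  finally show ?thesis
    unfolding biharmonic_kernel_def integral_completion[OF m] cn by simp
qed

text \<open>
  The derivatives that fall on the kernel in the Duhamel term, as lists of directions: none for
  MCF, up to two for the fourth order flows.
\<close>

definition deriv_lists :: "flow \<Rightarrow> 'n::finite list set" where
  "deriv_lists F = (if F = MCF then {[]} else {l. length l \<le> 2})"

lemma heat_kernel_decay: "\<exists>C\<ge>0. \<forall>z::real^'n::finite. \<bar>heat_kernel z 1\<bar> \<le> C / (1 + norm z) ^ m"
proof -
  let ?P = "(4 * pi * 1) powr (real CARD('n) / 2)"
  define D where "D = real (Suc m) ^ Suc m * exp 2 / ?P"
  have P: "?P > 0" by simp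
  have "(1 + norm z) ^ m * \<bar>heat_kernel z 1\<bar> \<le> D" for z :: "real^'n"
  proof -
    have "0 \<le> (norm z / 2 - 1)\<^sup>2" by simp
    then have r: "1 + norm z - (norm z)\<^sup>2 / 4 \<le> 2" by (simp add: power2_eq_square algebra_simps)
    have "(1 + norm z) ^ m * exp (- (norm z)\<^sup>2 / (4 * 1)) \<le>
      (real (Suc m) ^ Suc m * exp (1 + norm z)) * exp (- (norm z)\<^sup>2 / (4 * 1))"
      by (intro mult_right_mono power_le_exp) auto
    also have "\<dots> = real (Suc m) ^ Suc m * exp (1 + norm z - (norm z)\<^sup>2 / 4)"
      by (simp add: mult.assoc flip: exp_add)
    also have "\<dots> \<le> real (Suc m) ^ Suc m * exp 2"
      using r by (intro mult_left_mono) (auto simp del: power_Suc)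
    finally show ?thesis
      unfolding heat_kernel_def D_def using P by (simp add: divide_right_mono del: power_Suc)
  qed
  moreover have "D \<ge> 0" by (simp add: D_def)
  ultimately show ?thesis
    by (intro exI[of _ D]) (auto simp: pos_le_divide_eq add_pos_nonneg mult.commute)
qed

lemma heat_kernel_scale:
  assumes t: "t > 0"
  shows "heat_kernel (z::real^'n::finite) t =
    t powr (- real CARD('n) / 2) * heat_kernel (t powr (- 1 / 2) *\<^sub>R z) 1"
proof -
  have "(t powr (- 1 / 2))\<^sup>2 = t powr (- 1)"
    using t by (simp add: powr_power)
  also have "\<dots> = 1 / t" using t by (rule powr_neg_one)
  finally have "(t powr (- 1 / 2))\<^sup>2 = 1 / t" .
  then have "(norm (t powr (- 1 / 2) *\<^sub>R z))\<^sup>2 = (norm z)\<^sup>2 / t"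
    by (simp add: power_mult_distrib)
  moreover have "(4 * pi * t) powr (real CARD('n) / 2) = (4 * pi) powr (real CARD('n) / 2) * t powr (real CARD('n) / 2)"
    using t powr_mult[of "4 * pi" t "real CARD('n) / 2"] by simp
  moreover have "t powr (- real CARD('n) / 2) = 1 / t powr (real CARD('n) / 2)"
    using t by (simp add: powr_minus_divide)
  ultimately show ?thesis
    by (simp add: heat_kernel_def mult.commute)
qed

text \<open>
  For MCF the only list is empty and the heat kernel is a Gaussian; otherwise the kernel and its
  derivatives belong to the Fourier class.
\<close>

lemma kernel_decay:
  fixes l :: "'n::finite list"
  assumes "l \<in> deriv_lists F"
  shows "\<exists>C\<ge>0. \<forall>z. \<bar>pd_list l (\<lambda>z. kernel F z 1) z\<bar> \<le> C / (1 + norm z) ^ m"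
  using assms heat_kernel_decay[of m, where 'n='n] fourier_class_decay[OF fourier_class_pd_list[OF biharmonic_kernel_fourier], of l m]
  by (cases F) (auto simp: deriv_lists_def pd_list_def)

lemma kernel_measurable:
  assumes "l \<in> deriv_lists F"
  shows "pd_list l (\<lambda>z. kernel F z 1) \<in> borel_measurable borel"
proof (cases F)
  case MCF
  then show ?thesis using assms
    by (auto simp: deriv_lists_def pd_list_def heat_kernel_def intro!: borel_measurable_continuous_onI continuous_intros)
qed (use fourier_class_continuous[OF fourier_class_pd_list[OF biharmonic_kernel_fourier], of l] in
    \<open>auto intro: borel_measurable_continuous_onI\<close>)

lemma kernel_scale:
  fixes l :: "'n::finite list"
  assumes l: "l \<in> deriv_lists F" and t: "t > 0"
  shows "pd_list l (\<lambda>z. kernel F z t) z =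
    t powr (- (real CARD('n) + length l) / alpha F) *
      pd_list l (\<lambda>z. kernel F z 1) (t powr (- 1 / alpha F) *\<^sub>R z)"
proof -
  have *: ?thesis if F: "kernel F = (biharmonic_kernel :: real^'n \<Rightarrow> _)" "alpha F = 4"
  proof -
    have "pd_list l (\<lambda>z. kernel F z t) z = pd_list l (\<lambda>z. t powr (- real CARD('n) / 4) * biharmonic_kernel (t powr (- 1 / 4) *\<^sub>R z) 1) z"
      using biharmonic_kernel_scale[OF t, where 'n='n] F by simp
    also have "\<dots> = t powr (- real CARD('n) / 4) * (t powr (- 1 / 4)) ^ length l * pd_list l (\<lambda>z. biharmonic_kernel z 1) (t powr (- 1 / 4) *\<^sub>R z)"
      by (subst fourier_class_pd_list_scale[OF biharmonic_kernel_fourier]) simp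
    also have "t powr (- real CARD('n) / 4) * (t powr (- 1 / 4)) ^ length l = t powr (- (real CARD('n) + length l) / 4)"
      using t by (simp add: powr_power add_divide_distrib diff_divide_distrib flip: powr_add)
    finally show ?thesis using F by simp
  qed
  show ?thesis
  proof (cases F)
    case MCF
    then show ?thesis using l heat_kernel_scale[OF t, of z] by (auto simp: deriv_lists_def pd_list_def)
  qed (use * in auto)
qed

section \<open>Smooth bumps\<close>

text \<open>
  With \<open>p = 1\<close> and \<open>k = 0\<close> this is the standard bump \<open>exp (- 1 / (1 - s\<^sup>2))\<close>.  The polynomial \<open>p\<close> and
  the pole of order \<open>k\<close> are there because derivatives of the bump have this form, so smoothness
  reduces to one differentiation formula.
\<close>

definition bump1d :: "real poly \<Rightarrow> nat \<Rightarrow> real \<Rightarrow> real" where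
  "bump1d p k s = (if \<bar>s\<bar> < 1 then poly p s * (1 / (1 - s\<^sup>2)) ^ k * exp (- (1 / (1 - s\<^sup>2))) else 0)"

definition bump1d_d :: "real poly \<Rightarrow> nat \<Rightarrow> real poly" where
  "bump1d_d p k = pderiv p * [:1, 0, -1:] ^ 2 + smult (2 * real k) ([:0, 1:] * p * [:1, 0, -1:]) - smult 2 ([:0, 1:] * p)"

lemma DERIV_quadratic_bound:
  fixes f :: "real \<Rightarrow> real"
  assumes "\<And>h. \<bar>f (s + h) - f s\<bar> \<le> K * h\<^sup>2"
  shows "(f has_real_derivative 0) (at s)"
  unfolding DERIV_def
proof (rule Lim_null_comparison)
  show "\<forall>\<^sub>F h in at 0. norm ((f (s + h) - f s) / h) \<le> K * \<bar>h\<bar>"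
  proof (rule eventually_at_filter[THEN iffD2], rule always_eventually, intro allI impI)
    fix h :: real assume "h \<noteq> 0"
    then show "norm ((f (s + h) - f s) / h) \<le> K * \<bar>h\<bar>"
      using assms[of h] by (simp add: pos_divide_le_eq power2_eq_square mult.assoc)
  qed
  show "((\<lambda>h. K * \<bar>h\<bar>) \<longlongrightarrow> 0) (at 0)" by (auto intro!: tendsto_eq_intros)
qed

text \<open>
  The exponential beats the pole of order \<open>k\<close> with two powers of \<open>1 - s\<^sup>2\<close> to spare; this gives the
  vanishing derivative at the end points.
\<close>

lemma bump1d_decay: "\<exists>K. \<forall>s. \<bar>bump1d p k s\<bar> \<le> K * (1 - s\<^sup>2)\<^sup>2"
proof -
  have "bounded (poly p ` {-1..1})"
    by (intro compact_imp_bounded compact_continuous_image continuous_intros) auto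
  then obtain P where P: "\<And>s. \<bar>s\<bar> \<le> 1 \<Longrightarrow> \<bar>poly p s\<bar> \<le> P" unfolding bounded_iff by force
  have P0: "P \<ge> 0" using P[of 0] abs_ge_zero[of "poly p 0"] by (simp del: abs_ge_zero)
  let ?n = "k + 2"
  have "\<bar>bump1d p k s\<bar> \<le> P * real ?n ^ ?n * (1 - s\<^sup>2)\<^sup>2" for s
  proof (cases "\<bar>s\<bar> < 1")
    case True
    then have s: "0 < 1 - s\<^sup>2" by (simp add: abs_square_less_1)
    define y where "y = 1 / (1 - s\<^sup>2)"
    have y: "y > 0" "(1 - s\<^sup>2)\<^sup>2 * y\<^sup>2 = 1" using s by (auto simp: y_def power_divide)
    have "(y / real ?n) ^ ?n \<le> (1 + y / real ?n) ^ ?n" using y by (intro power_mono) auto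
    also have "\<dots> \<le> exp y" using y by (intro exp_ge_one_plus_x_over_n_power_n) auto
    finally have "y ^ ?n \<le> real ?n ^ ?n * exp y" by (simp add: power_divide pos_divide_le_eq mult.commute)
    then have e: "y ^ ?n * exp (- y) \<le> real ?n ^ ?n"
      by (simp add: exp_minus divide_inverse[symmetric] pos_divide_le_eq)
    have "\<bar>bump1d p k s\<bar> = \<bar>poly p s\<bar> * (y ^ k * exp (- y))"
      using True y by (simp add: bump1d_def y_def[symmetric] abs_mult power_abs)
    also have "\<dots> \<le> P * (y ^ k * exp (- y))" using True y by (intro mult_right_mono P) auto
    also have "\<dots> = P * ((1 - s\<^sup>2)\<^sup>2 * y\<^sup>2 * (y ^ k * exp (- y)))" unfolding y by simp
    also have "\<dots> = P * (y ^ ?n * exp (- y)) * (1 - s\<^sup>2)\<^sup>2" unfolding power_add by (simp only: mult_ac)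
    also have "\<dots> \<le> P * real ?n ^ ?n * (1 - s\<^sup>2)\<^sup>2"
      by (intro mult_right_mono mult_left_mono e P0) auto
    finally show ?thesis .
  qed (use P0 in \<open>simp add: bump1d_def\<close>)
  then show ?thesis by blast
qed

lemma bump1d_deriv: "(bump1d p k has_real_derivative bump1d (bump1d_d p k) (k + 2) s) (at s)"
proof -
  consider "\<bar>s\<bar> < 1" | "\<bar>s\<bar> > 1" | "\<bar>s\<bar> = 1" by linarith
  then show ?thesis
  proof cases
    case 1
    then have s: "1 - s\<^sup>2 \<noteq> 0" by (metis abs_square_less_1 less_irrefl right_minus_eq)
    define y where "y = 1 / (1 - s\<^sup>2)"
    have y: "(1 - s\<^sup>2) * y = 1" using s by (simp add: y_def)
    have Y: "((\<lambda>s. 1 / (1 - s\<^sup>2)) has_real_derivative 2 * s * y\<^sup>2) (at s)"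
      using s by (auto intro!: derivative_eq_intros simp: y_def power2_eq_square)
    have E: "((\<lambda>s. exp (- (1 / (1 - s\<^sup>2)))) has_real_derivative exp (- y) * (- (2 * s * y\<^sup>2))) (at s)"
      unfolding y_def by (rule DERIV_fun_exp[OF DERIV_minus[OF Y[unfolded y_def]]])
    have W: "((\<lambda>s. (1 / (1 - s\<^sup>2)) ^ k) has_real_derivative real k * (2 * s * y\<^sup>2 * y ^ (k - 1))) (at s)"
      using DERIV_power[OF Y, of k] by (simp add: y_def)
    have "((\<lambda>s. poly p s * (1 / (1 - s\<^sup>2)) ^ k * exp (- (1 / (1 - s\<^sup>2)))) has_real_derivative
       (poly (pderiv p) s * y ^ k + poly p s * (real k * y ^ (k - 1) * (2 * s * y\<^sup>2))) * exp (- y)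
         + poly p s * y ^ k * (exp (- y) * (- (2 * s * y\<^sup>2)))) (at s)"
      by (rule DERIV_cong[OF DERIV_mult[OF DERIV_mult[OF poly_DERIV W] E]])
        (simp add: y_def[symmetric] mult_ac)
    also have "(poly (pderiv p) s * y ^ k + poly p s * (real k * y ^ (k - 1) * (2 * s * y\<^sup>2))) * exp (- y)
         + poly p s * y ^ k * (exp (- y) * (- (2 * s * y\<^sup>2))) = bump1d (bump1d_d p k) (k + 2) s"
    proof -
      have k1: "real k * y ^ (k - 1) * y\<^sup>2 = real k * y ^ k * y"
        by (cases k) (auto simp: power2_eq_square)
      have "poly (bump1d_d p k) s * y\<^sup>2 = poly (pderiv p) s * ((1 - s\<^sup>2) * y)\<^sup>2 + 2 * real k * s * poly p s * y * ((1 - s\<^sup>2) * y) - 2 * s * poly p s * y\<^sup>2"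
        by (simp add: bump1d_d_def power2_eq_square algebra_simps)
      then have T: "poly (bump1d_d p k) s * y\<^sup>2 = poly (pderiv p) s + 2 * real k * s * poly p s * y - 2 * s * poly p s * y\<^sup>2"
        unfolding y by simp
      have B: "bump1d (bump1d_d p k) (k + 2) s = poly (bump1d_d p k) s * y\<^sup>2 * (y ^ k * exp (- y))"
      proof -
        have "bump1d (bump1d_d p k) (k + 2) s = poly (bump1d_d p k) s * y ^ (k + 2) * exp (- y)"
          using 1 by (simp add: bump1d_def y_def)
        then show ?thesis unfolding power_add by (simp only: mult_ac)
      qed
      have A: "poly p s * (real k * y ^ (k - 1) * (2 * s * y\<^sup>2)) = 2 * s * poly p s * (real k * y ^ k * y)"
        unfolding k1[symmetric] by (simp add: mult_ac)
      show ?thesis unfolding A B T by (simp add: algebra_simps)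
    qed
    finally show ?thesis
    proof (rule has_field_derivative_transform_within_open)
      show "open {-1<..<1::real}" "s \<in> {-1<..<1}" using 1 by auto
    qed (auto simp: bump1d_def)
  next
    case 2
    have "((\<lambda>_. 0) has_real_derivative bump1d (bump1d_d p k) (k + 2) s) (at s)"
      using 2 by (simp add: bump1d_def)
    then show ?thesis
    proof (rule has_field_derivative_transform_within_open)
      show "open {s::real. \<bar>s\<bar> > 1}" by (intro open_Collect_less continuous_intros)
      show "s \<in> {s. \<bar>s\<bar> > 1}" using 2 by simp
    qed (auto simp: bump1d_def)
  next
    case 3
    obtain K where K: "\<And>s. \<bar>bump1d p k s\<bar> \<le> K * (1 - s\<^sup>2)\<^sup>2" using bump1d_decay by blast
    have K0: "K \<ge> 0" using order_trans[OF abs_ge_zero K[of 0]] by simp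
    have "\<bar>bump1d p k (s + h) - bump1d p k s\<bar> \<le> 9 * K * h\<^sup>2" for h
    proof (cases "\<bar>s + h\<bar> < 1")
      case True
      have s2: "s\<^sup>2 = 1" using 3 by (simp add: power2_eq_1_iff abs_if split: if_splits)
      have h: "\<bar>2 * s + h\<bar> \<le> 3" using True 3 by linarith
      have "1 - (s + h)\<^sup>2 = - h * (2 * s + h)" using s2 by (simp add: power2_eq_square algebra_simps)
      then have "(1 - (s + h)\<^sup>2)\<^sup>2 = h\<^sup>2 * \<bar>2 * s + h\<bar>\<^sup>2" by (simp add: power_mult_distrib)
      also have "\<dots> \<le> h\<^sup>2 * 3\<^sup>2" by (intro mult_left_mono power_mono h) auto
      finally have "K * (1 - (s + h)\<^sup>2)\<^sup>2 \<le> K * (h\<^sup>2 * 3\<^sup>2)" by (intro mult_left_mono K0)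
      then show ?thesis using K[of "s + h"] 3 by (simp add: bump1d_def mult_ac)
    qed (use 3 K0 in \<open>simp add: bump1d_def\<close>)
    moreover have "bump1d (bump1d_d p k) (k + 2) s = 0" using 3 by (simp add: bump1d_def)
    ultimately show ?thesis using DERIV_quadratic_bound[of "bump1d p k" s "9 * K"] by simp
  qed
qed

text \<open>
  Affine reparametrisations are included so that rescaled and translated products of bumps stay in
  the class.
\<close>

definition bumps :: "(real \<Rightarrow> real) set" where
  "bumps = {\<lambda>s. a * bump1d p k (b + c * s) | a p k b c. True}"

lemma bumpsI: "(\<lambda>s. a * bump1d p k (b + c * s)) \<in> bumps"
  unfolding bumps_def
  by (rule CollectI, rule exI[of _ a], rule exI[of _ p], rule exI[of _ k], rule exI[of _ b], rule exI[of _ c]) simp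

lemma bumps_deriv: "f \<in> bumps \<Longrightarrow> \<exists>f'\<in>bumps. \<forall>s. (f has_real_derivative f' s) (at s)"
proof -
  assume "f \<in> bumps"
  then obtain a p k b c where f: "f = (\<lambda>s. a * bump1d p k (b + c * s))" by (auto simp: bumps_def)
  have d: "(f has_real_derivative a * c * bump1d (bump1d_d p k) (k + 2) (b + c * s)) (at s)" for s
  proof -
    have "((\<lambda>s. b + c * s) has_real_derivative c) (at s)" by (auto intro!: derivative_eq_intros)
    from DERIV_cmult[OF DERIV_chain2[OF bump1d_deriv this], of a p k] show ?thesis
      unfolding f by (simp add: mult_ac)
  qed
  have m: "(\<lambda>s. a * c * bump1d (bump1d_d p k) (k + 2) (b + c * s)) \<in> bumps"
    by (rule bumpsI)
  show ?thesis by (rule bexI[OF _ m]) (intro allI d)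
qed

lemma bumps_product_pd:
  assumes c: "\<And>i. c i \<in> bumps"
  shows "\<exists>c'. (\<forall>i. c' i \<in> bumps) \<and> (\<forall>y. has_pd j (\<lambda>y::real^'n::finite. \<Prod>i\<in>UNIV. c i (y $ i)) y (\<Prod>i\<in>UNIV. c' i (y $ i)))"
proof -
  obtain d where d: "d \<in> bumps" "\<And>s. (c j has_real_derivative d s) (at s)" using bumps_deriv[OF c] by blast
  define c' where "c' = c(j := d)"
  have split: "(\<Prod>i\<in>UNIV. f i (y $ i)) = f j (y $ j) * (\<Prod>i\<in>UNIV - {j}. f i (y $ i))" for f :: "'n \<Rightarrow> real \<Rightarrow> real" and y :: "real^'n"
    by (simp add: prod.remove[of UNIV j])
  have "has_pd j (\<lambda>y::real^'n. \<Prod>i\<in>UNIV. c i (y $ i)) y (\<Prod>i\<in>UNIV. c' i (y $ i))" for y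
  proof -
    have "((\<lambda>h. c j (y $ j + h) * (\<Prod>i\<in>UNIV - {j}. c i (y $ i))) has_real_derivative d (y $ j) * (\<Prod>i\<in>UNIV - {j}. c i (y $ i))) (at 0)"
      using d(2)[of "y $ j"] by (intro DERIV_cmult_right) (simp add: DERIV_shift[of "c j" _ 0 "y $ j", symmetric] add.commute)
    also have "(\<lambda>h. c j (y $ j + h) * (\<Prod>i\<in>UNIV - {j}. c i (y $ i))) = (\<lambda>h. \<Prod>i\<in>UNIV. c i ((y + h *\<^sub>R axis j 1) $ i))"
      unfolding split by (auto simp: fun_eq_iff axis_def intro!: prod.cong)
    also have "d (y $ j) * (\<Prod>i\<in>UNIV - {j}. c i (y $ i)) = (\<Prod>i\<in>UNIV. c' i (y $ i))"
      unfolding split[of c'] by (auto simp: c'_def intro!: prod.cong)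
    finally show ?thesis by (simp add: has_pd_def)
  qed
  moreover have "c' i \<in> bumps" for i using c d by (simp add: c'_def)
  ultimately show ?thesis by blast
qed

lemma bumps_product_continuous:
  assumes c: "\<And>i. c i \<in> bumps"
  shows "continuous_on UNIV (\<lambda>y::real^'n::finite. \<Prod>i\<in>UNIV. c i (y $ i))"
proof -
  have "continuous_on UNIV (c i)" for i
    using bumps_deriv[OF c[of i]] by (metis DERIV_continuous_on has_field_derivative_at_within)
  then have "continuous_on UNIV (\<lambda>y::real^'n. c i (y $ i))" for i
    by (rule continuous_on_compose2) (auto intro: continuous_intros)
  then show ?thesis by (intro continuous_on_prod)
qed

lemma bumps_product_smooth:
  assumes c: "\<And>i. c i \<in> bumps"
  shows "smooth (\<lambda>y::real^'n::finite. \<Prod>i\<in>UNIV. c i (y $ i))"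
proof -
  let ?P = "\<lambda>c y::real^'n. \<Prod>i\<in>UNIV. c i (y $ i)"
  have *: "\<exists>c'. (\<forall>i. c' i \<in> bumps) \<and> pd_list l (?P c) = ?P c'" for l
  proof (induction l)
    case Nil
    then show ?case using c by (auto simp: pd_list_def)
  next
    case (Cons j l)
    then obtain c' where c': "\<And>i. c' i \<in> bumps" "pd_list l (?P c) = ?P c'" by blast
    obtain c'' where c'': "\<And>i. c'' i \<in> bumps" "\<And>y. has_pd j (?P c') y (?P c'' y)"
      using bumps_product_pd[of c' j, OF c'(1)] by blast
    have "pd_list (j # l) (?P c) = ?P c''"
    proof -
      have "pd_list (j # l) (?P c) = pd j (?P c')" using c'(2) by (simp add: pd_list_def)
      then show ?thesis using has_pd_imp_pd[OF c''(2)] by auto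
    qed
    then show ?case using c'' by blast
  qed
  have "continuous_on UNIV (pd_list l (?P c))" for l
    using *[of l] bumps_product_continuous by metis
  moreover have "(\<lambda>h. pd_list l (?P c) (x + h *\<^sub>R axis i 1)) differentiable (at 0)" for l i x
  proof -
    obtain c' where c': "\<And>i. c' i \<in> bumps" "pd_list l (?P c) = ?P c'" using * by blast
    from bumps_product_pd[of c' i, OF c'(1)] obtain D where "has_pd i (?P c') x D" by blast
    then show ?thesis unfolding c'(2) has_pd_def using real_differentiable_def by blast
  qed
  ultimately show ?thesis by (simp add: smooth_def Ck_def)
qed

definition bump :: "real^'n::finite \<Rightarrow> real" where
  "bump z = (\<Prod>i\<in>UNIV. bump1d 1 0 (z $ i))"

lemma bump1d_1_0: "0 \<le> bump1d 1 0 s" "bump1d 1 0 s \<le> 1"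
proof -
  have "0 \<le> 1 / (1 - s\<^sup>2)" if "\<bar>s\<bar> < 1"
    using that by (simp add: abs_square_less_1 less_imp_le)
  then show "0 \<le> bump1d 1 0 s" "bump1d 1 0 s \<le> 1" by (auto simp: bump1d_def simp del: zero_le_divide_iff zero_le_divide_1_iff)
qed

lemma bump_nonneg: "bump z \<ge> 0"
  unfolding bump_def by (intro prod_nonneg) (simp add: bump1d_1_0)

lemma bump_zero: "bump z = 0" if "norm z > CARD('n)" for z :: "real^'n::finite"
proof -
  have "\<exists>i. \<bar>z $ i\<bar> \<ge> 1"
  proof (rule ccontr)
    assume "\<not> ?thesis"
    then have "(\<Sum>i\<in>UNIV. \<bar>z $ i\<bar>) \<le> (\<Sum>i\<in>(UNIV::'n set). 1)" by (intro sum_mono) (auto simp: not_le less_imp_le)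
    then show False using norm_le_l1_cart[of z] that by simp
  qed
  then obtain i where "\<bar>z $ i\<bar> \<ge> 1" by blast
  then have "bump1d 1 0 (z $ i) = 0" by (simp add: bump1d_def)
  then show ?thesis unfolding bump_def by (intro prod_zero) auto
qed

lemma bump_le_1: "bump z \<le> 1"
  unfolding bump_def by (intro prod_le_1) (simp add: bump1d_1_0)

lemma bump_scaled_smooth:
  "smooth (\<lambda>y::real^'n::finite. bump ((1 / \<delta>) *\<^sub>R (x - y)))"
proof -
  define c where "c i s = 1 * bump1d 1 0 (x $ i / \<delta> + (- 1 / \<delta>) * s)" for i s
  have "(\<lambda>y::real^'n. bump ((1 / \<delta>) *\<^sub>R (x - y))) = (\<lambda>y. \<Prod>i\<in>UNIV. c i (y $ i))"
    by (simp add: bump_def c_def fun_eq_iff diff_divide_distrib)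
  moreover have "c i \<in> bumps" for i
    unfolding c_def by (rule bumpsI)
  ultimately show ?thesis using bumps_product_smooth[of c] by simp
qed

lemma bump_smooth: "smooth (bump :: real^'n::finite \<Rightarrow> real)"
proof -
  have "(\<lambda>s. 1 * bump1d 1 0 (0 + 1 * s)) \<in> bumps"
    by (rule bumpsI)
  from bumps_product_smooth[of "\<lambda>_. _", OF this] show ?thesis by (simp add: bump_def[abs_def])
qed

lemma bump_measurable[measurable]: "bump \<in> borel_measurable borel"
  by (rule smooth_measurable[OF bump_smooth])

lemma bump_integrable: "integrable lborel (bump :: real^'n::finite \<Rightarrow> real)"
  by (rule integrable_bounded_support[where B=1 and R="CARD('n)"])
    (auto simp: bump_zero bump_nonneg bump_le_1)

lemma bump_integral_pos: "(\<integral>(z::real^'n::finite). bump z \<partial>lborel) > 0"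
proof -
  have pos: "bump z > 0" if "z \<in> ball 0 1" for z :: "real^'n"
  proof -
    have "\<bar>z $ i\<bar> < 1" for i using that component_le_norm_cart[of z i] by simp
    then show ?thesis unfolding bump_def by (intro prod_pos) (simp add: bump1d_def)
  qed
  have "(\<integral>(z::real^'n). bump z \<partial>lborel) \<noteq> 0"
  proof
    assume "(\<integral>(z::real^'n). bump z \<partial>lborel) = 0"
    then have "AE z :: real^'n in lborel. bump z = 0"
      using integral_nonneg_eq_0_iff_AE[OF bump_integrable] bump_nonneg by auto
    then have "AE z :: real^'n in lborel. z \<notin> ball 0 1" by eventually_elim (use pos in force)
    then have "ball 0 1 \<in> null_sets (lborel :: (real^'n) measure)" by (subst AE_iff_null_sets) auto
    then have "emeasure lborel (ball 0 1 :: (real^'n) set) = 0" by auto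
    then show False using content_ball_pos[of 1 "0::real^'n"] by (simp add: measure_def)
  qed
  moreover have "(\<integral>(z::real^'n). bump z \<partial>lborel) \<ge> 0" by (intro integral_nonneg_AE AE_I2 bump_nonneg)
  ultimately show ?thesis by simp
qed

section \<open>Functions with bounded weak gradient are Lipschitz\<close>

lemma abs_integral_le:
  fixes f g :: "'a \<Rightarrow> real"
  assumes g: "integrable M g" and b: "AE x in M. \<bar>f x\<bar> \<le> g x"
  shows "\<bar>\<integral>x. f x \<partial>M\<bar> \<le> (\<integral>x. g x \<partial>M)"
proof (cases "integrable M f")
  case True
  have "\<bar>\<integral>x. f x \<partial>M\<bar> \<le> (\<integral>x. \<bar>f x\<bar> \<partial>M)" by (rule integral_abs_bound)
  also have "\<dots> \<le> (\<integral>x. g x \<partial>M)" by (rule integral_mono_AE[OF integrable_abs[OF True] g b])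
  finally show ?thesis .
next
  case False
  have "0 \<le> (\<integral>x. g x \<partial>M)" by (rule integral_nonneg_AE) (use b in eventually_elim, auto)
  then show ?thesis using False by (simp add: not_integrable_integral_eq)
qed

definition locally_integrable :: "('a::euclidean_space \<Rightarrow> real) \<Rightarrow> bool" where
  "locally_integrable f \<longleftrightarrow> f \<in> borel_measurable borel \<and> (\<forall>R. integrable lborel (\<lambda>y. indicator (cball 0 R) y * f y))"

lemma locally_integrable_mult:
  fixes f k :: "'a::euclidean_space \<Rightarrow> real"
  assumes f: "locally_integrable f" and k: "k \<in> borel_measurable borel" "\<And>x. \<bar>k x\<bar> \<le> B" "\<And>x. norm x > R \<Longrightarrow> k x = 0"
  shows "integrable lborel (\<lambda>y. f y * k y)"
proof (rule Bochner_Integration.integrable_bound[of lborel "\<lambda>y. B * (indicator (cball 0 R) y * f y)"])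
  show "integrable lborel (\<lambda>y. B * (indicator (cball 0 R) y * f y))"
    using f by (intro integrable_mult_right) (simp add: locally_integrable_def)
  have B: "B \<ge> 0" using order_trans[OF abs_ge_zero k(2)[of 0]] .
  show "AE y in lborel. norm (f y * k y) \<le> norm (B * (indicator (cball 0 R) y * f y))"
  proof (intro AE_I2)
    fix y :: 'a
    show "norm (f y * k y) \<le> norm (B * (indicator (cball 0 R) y * f y))"
    proof (cases "norm y > R")
      case False
      have "\<bar>f y\<bar> * \<bar>k y\<bar> \<le> \<bar>f y\<bar> * B" by (intro mult_left_mono k) auto
      then show ?thesis using False B by (simp add: abs_mult mult.commute)
    qed (use k in simp)
  qed
  have "f \<in> borel_measurable lborel" using f by (simp add: locally_integrable_def)
  then show "(\<lambda>y. f y * k y) \<in> borel_measurable lborel"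
    by (rule borel_measurable_times) (use k(1) in simp)
qed

lemma locally_integrable_continuous:
  fixes f :: "'a::euclidean_space \<Rightarrow> real"
  assumes f: "continuous_on UNIV f" shows "locally_integrable f"
  unfolding locally_integrable_def
proof (intro conjI allI)
  show "f \<in> borel_measurable borel" by (rule borel_measurable_continuous_onI[OF f])
  show "integrable lborel (\<lambda>y. indicator (cball 0 R) y * f y)" for R
    using borel_integrable_compact[of "cball 0 R" f] continuous_on_subset[OF f] by simp
qed

lemma locally_integrable_diff:
  assumes "locally_integrable f" "locally_integrable g"
  shows "locally_integrable (\<lambda>x. f x - g x)"
  using assms unfolding locally_integrable_def by (auto simp: right_diff_distrib)

text \<open>
  Continuous approximations of the sign of \<open>h\<close>, truncated to \<open>[-1, 1]\<close> and cut off, turn the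
  vanishing of all pairings into the vanishing of \<open>\<integral> \<bar>h\<bar>\<close> over every ball.
\<close>

lemma AE_zero_if_pairings_zero:
  fixes h :: "'a::euclidean_space \<Rightarrow> real"
  assumes h: "locally_integrable h"
    and p: "\<And>\<psi> R. continuous_on UNIV \<psi> \<Longrightarrow> (\<And>x. \<bar>\<psi> x\<bar> \<le> 1) \<Longrightarrow> (\<And>x. norm x > R \<Longrightarrow> \<psi> x = 0) \<Longrightarrow>
      (\<integral>x. h x * \<psi> x \<partial>lborel) = 0"
  shows "AE x in lborel. h x = 0"
proof -
  have hm[measurable]: "h \<in> borel_measurable borel" using h by (simp add: locally_integrable_def)
  have "(\<lambda>x. sgn (h x)) \<in> borel_measurable lebesgue"
    by (rule measurable_completion) simp
  then have "(\<lambda>x. sgn (h x)) measurable_on UNIV"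
    using measurable_on_iff_borel_measurable[of UNIV "\<lambda>x. sgn (h x)"] by simp
  then obtain N g where N: "negligible N" and g: "\<And>n. continuous_on UNIV (g n)"
    and gl: "\<And>x. x \<notin> N \<Longrightarrow> (\<lambda>n. g n x) \<longlonglongrightarrow> sgn (h x)"
    unfolding measurable_on_def by auto
  have NAE: "AE x in lborel. x \<notin> N"
  proof -
    have "AE x in lebesgue. x \<notin> N"
      using N by (auto simp: negligible_iff_null_sets intro: AE_not_in)
    then show ?thesis by (simp add: AE_completion_iff)
  qed
  have zero: "AE x in lborel. norm x \<le> R \<longrightarrow> h x = 0" for R
  proof -
    define cu :: "'a \<Rightarrow> real" where "cu x = max 0 (min 1 (R + 1 - norm x))" for x
    define \<psi> where "\<psi> n x = max (- 1) (min 1 (g n x)) * cu x" for n x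
    have cu: "0 \<le> cu x" "cu x \<le> 1" for x by (auto simp: cu_def)
    have cu0: "cu x = 0" if "norm x > R + 1" for x using that by (simp add: cu_def)
    have cuc: "continuous_on UNIV cu" unfolding cu_def by (intro continuous_intros)
    have \<psi>c: "continuous_on UNIV (\<psi> n)" for n
      unfolding \<psi>_def by (intro continuous_intros g cuc)
    have \<psi>b: "\<bar>\<psi> n x\<bar> \<le> cu x" for n x
    proof -
      have "\<bar>max (- 1) (min 1 (g n x))\<bar> \<le> 1" by (auto simp: abs_le_iff)
      from mult_right_mono[OF this cu(1)] show ?thesis using cu(1) by (simp add: \<psi>_def abs_mult)
    qed
    have [measurable]: "\<psi> n \<in> borel_measurable borel" "cu \<in> borel_measurable borel" for n
      using \<psi>c cuc by (auto intro: borel_measurable_continuous_onI)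
    have int: "integrable lborel (\<lambda>x. h x * cu x)"
      by (rule locally_integrable_mult[OF h, of _ 1 "R + 1"]) (use cu cu0 in auto)
    have iabs: "integrable lborel (\<lambda>x. \<bar>h x\<bar> * cu x)"
      using integrable_abs[OF int] cu by (simp add: abs_mult)
    have "(\<lambda>n. \<integral>x. h x * \<psi> n x \<partial>lborel) \<longlonglongrightarrow> (\<integral>x. (\<bar>h x\<bar> * cu x) \<partial>lborel)"
    proof (rule integral_dominated_convergence[where w="\<lambda>x. \<bar>h x\<bar> * cu x"])
      show "AE x in lborel. (\<lambda>n. h x * \<psi> n x) \<longlonglongrightarrow> \<bar>h x\<bar> * cu x"
        using NAE
      proof eventually_elim
        case (elim x)
        have "(\<lambda>n. h x * (max (- 1) (min 1 (g n x)) * cu x)) \<longlonglongrightarrow> h x * (max (- 1) (min 1 (sgn (h x))) * cu x)"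
          by (intro tendsto_intros gl elim)
        moreover have "h x * (max (- 1) (min 1 (sgn (h x))) * cu x) = \<bar>h x\<bar> * cu x"
          by (auto simp: sgn_if)
        ultimately show ?case by (simp add: \<psi>_def)
      qed
      show "AE x in lborel. norm (h x * \<psi> n x) \<le> \<bar>h x\<bar> * cu x" for n
        using \<psi>b by (intro AE_I2) (simp add: abs_mult mult_left_mono)
    qed (use iabs in auto)
    moreover have "(\<integral>x. h x * \<psi> n x \<partial>lborel) = 0" for n
    proof (rule p[where R="R + 1"])
      show "\<bar>\<psi> n x\<bar> \<le> 1" for x using order_trans[OF \<psi>b cu(2)] .
      show "\<psi> n x = 0" if "norm x > R + 1" for x using cu0[OF that] by (simp add: \<psi>_def)
    qed (rule \<psi>c)
    ultimately have "(\<integral>x. \<bar>h x\<bar> * cu x \<partial>lborel) = 0" by (simp add: LIMSEQ_const_iff)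
    then have "AE x in lborel. \<bar>h x\<bar> * cu x = 0"
      using integral_nonneg_eq_0_iff_AE[OF iabs] cu by simp
    then show ?thesis by eventually_elim (auto simp: cu_def)
  qed
  have "AE x in lborel. \<forall>k. norm x \<le> real k \<longrightarrow> h x = 0"
    unfolding AE_all_countable using zero by blast
  then show ?thesis
  proof eventually_elim
    case (elim x)
    then show ?case using real_arch_simple[of "norm x"] by blast
  qed
qed

lemma abs_bump: "\<bar>bump z\<bar> = bump z" and abs_bump_le_1: "\<bar>bump z\<bar> \<le> 1"
  using bump_nonneg[of z] bump_le_1[of z] by auto

lemma bump_pd_bounds:
  obtains R B where "R > 0" "B > 0" "\<And>z::real^'n::finite. norm z > R \<Longrightarrow> bump z = 0"
    "\<And>i z::real^'n. norm z > R \<Longrightarrow> pd i bump z = 0" "\<And>i z::real^'n. \<bar>pd i bump z\<bar> \<le> B"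
proof -
  have "bounded {z::real^'n. bump z \<noteq> 0}"
    unfolding bounded_iff
  proof (intro exI ballI)
    fix z :: "real^'n" assume "z \<in> {z. bump z \<noteq> 0}"
    then show "norm z \<le> real CARD('n)" using bump_zero[of z] by (force simp: not_le[symmetric])
  qed
  then have "compact (closure {z::real^'n. bump z \<noteq> 0})" by simp
  from test_function_bounds[OF bump_smooth this] show ?thesis using that by metis
qed

text \<open>
  Mollification of a Borel function with bounded weak gradient.  The mollified functions have partial
  derivatives bounded by \<open>L\<close>, uniformly in the scale, so their limit is Lipschitz.
\<close>

context
  fixes f :: "real^'n::finite \<Rightarrow> real" and G :: "real^'n \<Rightarrow> real^'n" and L :: real
  assumes fm: "f \<in> borel_measurable borel" and W: "weak_gradient f G"
    and GL: "AE x in lebesgue. norm (G x) \<le> L"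
begin

definition bump_mass :: real where "bump_mass = (\<integral>(z::real^'n). bump z \<partial>lborel)"

definition moll :: "real \<Rightarrow> real^'n \<Rightarrow> real" where
  "moll \<delta> x = (\<integral>y. f y * bump ((1 / \<delta>) *\<^sub>R (x - y)) \<partial>lborel) / (\<delta> ^ CARD('n) * bump_mass)"

lemma bump_mass_pos: "bump_mass > 0" unfolding bump_mass_def by (rule bump_integral_pos)

lemma f_loc: "locally_integrable f"
  unfolding locally_integrable_def
proof (intro conjI allI fm)
  fix R
  have "set_integrable lebesgue (cball 0 R) f" using W by (simp add: weak_gradient_def)
  then show "integrable lborel (\<lambda>y. indicator (cball 0 R) y * f y)"
    using fm unfolding set_integrable_def
    by (subst (asm) integrable_completion) (auto intro!: borel_measurable_times borel_measurable_indicator)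
qed

lemma bump_scaled:
  assumes "0 < \<delta>"
  shows "integrable lborel (\<lambda>y::real^'n. bump ((1 / \<delta>) *\<^sub>R (x - y)))"
    "(\<integral>(y::real^'n). bump ((1 / \<delta>) *\<^sub>R (x - y)) \<partial>lborel) = \<delta> ^ CARD('n) * bump_mass"
proof -
  let ?h = "\<lambda>y::real^'n. bump ((1 / \<delta>) *\<^sub>R (x - y))"
  have m: "?h \<in> borel_measurable borel" by measurable
  have e: "?h (x + (- \<delta>) *\<^sub>R z) = bump z" for z using assms by simp
  have d: "- \<delta> \<noteq> 0" using assms by simp
  show "integrable lborel ?h"
    using lborel_affine_integral(2)[OF m d, of x] bump_integrable unfolding e by blast
  show "(\<integral>y. ?h y \<partial>lborel) = \<delta> ^ CARD('n) * bump_mass"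
    using lborel_affine_integral(1)[OF m d, of x] assms unfolding e by (simp add: bump_mass_def)
qed

text \<open>
  The derivative falls on the bump, which is a test function in \<open>y\<close>; the definition of the weak
  gradient moves it onto \<open>f\<close>, and an average of \<open>G\<close> remains.
\<close>

lemma moll_pd:
  assumes \<delta>: "0 < \<delta>" "\<delta> \<le> 1"
  shows "\<exists>D. has_pd i (moll \<delta>) x D \<and> \<bar>D\<bar> \<le> L"
proof -
  let ?e = "axis i 1 :: real^'n"
  obtain R B where RB: "R > 0" "B > 0" "\<And>z::real^'n. norm z > R \<Longrightarrow> bump z = 0"
    "\<And>i z::real^'n. norm z > R \<Longrightarrow> pd i bump z = 0" "\<And>i z::real^'n. \<bar>pd i bump z\<bar> \<le> B"
    using bump_pd_bounds by metis
  have far: "norm ((1 / \<delta>) *\<^sub>R (x + h *\<^sub>R ?e - y)) > R" if "norm y > norm x + 1 + R" "\<bar>h\<bar> < 1" for h y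
  proof -
    have "norm y \<le> norm (x + h *\<^sub>R ?e - y) + norm (x + h *\<^sub>R ?e)" using norm_triangle_sub[of y "x + h *\<^sub>R ?e"] by (simp add: norm_minus_commute add.commute)
    moreover have "norm (x + h *\<^sub>R ?e) \<le> norm x + \<bar>h\<bar>" using norm_triangle_ineq[of x "h *\<^sub>R ?e"] by simp
    ultimately have "norm (x + h *\<^sub>R ?e - y) > R" using that by linarith
    moreover have "norm (x + h *\<^sub>R ?e - y) \<le> norm (x + h *\<^sub>R ?e - y) / \<delta>"
      using \<delta> by (simp add: pos_le_divide_eq mult_left_le)
    ultimately show ?thesis using \<delta> by simp
  qed
  have pm[measurable]: "pd i bump \<in> borel_measurable borel" by (rule smooth_measurable[OF bump_smooth])
  have "((\<lambda>h. \<integral>y. f y * bump ((1 / \<delta>) *\<^sub>R (x + h *\<^sub>R ?e - y)) \<partial>lborel) has_real_derivative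
      (\<integral>y. f y * ((1 / \<delta>) * pd i bump ((1 / \<delta>) *\<^sub>R (x + 0 *\<^sub>R ?e - y))) \<partial>lborel)) (at 0)"
  proof (rule deriv_under_integral(2)[where w = "\<lambda>y. \<bar>f y * ((B / \<delta>) * indicator (cball 0 (norm x + 1 + R)) y)\<bar>"])
    show "integrable lborel (\<lambda>y. f y * bump ((1 / \<delta>) *\<^sub>R (x + h *\<^sub>R ?e - y)))" if "\<bar>h\<bar> < 1" for h
      by (rule locally_integrable_mult[OF f_loc, of _ 1 "norm x + 1 + R"])
        (use RB far that abs_bump_le_1 in auto)
    show "((\<lambda>h. f y * bump ((1 / \<delta>) *\<^sub>R (x + h *\<^sub>R ?e - y))) has_real_derivative
        f y * ((1 / \<delta>) * pd i bump ((1 / \<delta>) *\<^sub>R (x + h *\<^sub>R ?e - y)))) (at h)" for y h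
    proof -
      have "has_pd i bump ((1 / \<delta>) *\<^sub>R (x - y) + (h / \<delta>) *\<^sub>R ?e) (pd i bump ((1 / \<delta>) *\<^sub>R (x - y) + (h / \<delta>) *\<^sub>R ?e))"
        by (rule smooth_imp(1)[OF bump_smooth])
      note has_pd_line[OF this]
      moreover have "((\<lambda>h. h / \<delta>) has_real_derivative 1 / \<delta>) (at h)" using \<delta> by (auto intro!: derivative_eq_intros)
      ultimately have "((\<lambda>h. bump ((1 / \<delta>) *\<^sub>R (x - y) + (h / \<delta>) *\<^sub>R ?e)) has_real_derivative
          pd i bump ((1 / \<delta>) *\<^sub>R (x - y) + (h / \<delta>) *\<^sub>R ?e) * (1 / \<delta>)) (at h)"
        by (rule DERIV_chain2)
      moreover have "(1 / \<delta>) *\<^sub>R (x - y) + (h / \<delta>) *\<^sub>R ?e = (1 / \<delta>) *\<^sub>R (x + h *\<^sub>R ?e - y)" for h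
        by (simp add: scaleR_diff_right scaleR_add_right)
      ultimately have "((\<lambda>h. bump ((1 / \<delta>) *\<^sub>R (x + h *\<^sub>R ?e - y))) has_real_derivative
          (1 / \<delta>) * pd i bump ((1 / \<delta>) *\<^sub>R (x + h *\<^sub>R ?e - y))) (at h)"
        by (simp only: mult.commute)
      then show ?thesis by (rule DERIV_cmult)
    qed
    show "\<bar>f y * ((1 / \<delta>) * pd i bump ((1 / \<delta>) *\<^sub>R (x + h *\<^sub>R ?e - y)))\<bar> \<le>
       \<bar>f y * ((B / \<delta>) * indicator (cball 0 (norm x + 1 + R)) y)\<bar>" if "\<bar>h\<bar> < 1" for y h
    proof (cases "norm y > norm x + 1 + R")
      case True
      then show ?thesis using RB(4)[OF far[OF True that]] by simp
    next
      case False
      have "(1 / \<delta>) * \<bar>pd i bump ((1 / \<delta>) *\<^sub>R (x + h *\<^sub>R ?e - y))\<bar> \<le> (1 / \<delta>) * B"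
        using \<delta> by (intro mult_left_mono RB) auto
      from mult_left_mono[OF this abs_ge_zero[of "f y"]] show ?thesis
        using False \<delta> RB(2) by (simp add: abs_mult)
    qed
    show "integrable lborel (\<lambda>y. \<bar>f y * ((B / \<delta>) * indicator (cball 0 (norm x + 1 + R)) y)\<bar>)"
      by (intro integrable_abs locally_integrable_mult[OF f_loc, of _ "B / \<delta>" "norm x + 1 + R"])
        (use RB \<delta> in \<open>auto simp: indicator_def\<close>)
  qed
  from DERIV_cdivide[OF this, of "\<delta> ^ CARD('n) * bump_mass"] have d: "((\<lambda>h. moll \<delta> (x + h *\<^sub>R ?e)) has_real_derivative
      (\<integral>y. f y * ((1 / \<delta>) * pd i bump ((1 / \<delta>) *\<^sub>R (x - y))) \<partial>lborel) / (\<delta> ^ CARD('n) * bump_mass)) (at 0)"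
    unfolding moll_def by simp
  let ?\<phi> = "\<lambda>y. bump ((1 / \<delta>) *\<^sub>R (x - y))"
  have pd\<phi>: "pd i ?\<phi> y = - ((1 / \<delta>) * pd i bump ((1 / \<delta>) *\<^sub>R (x - y)))" for y
  proof (rule has_pd_imp_pd)
    have "has_pd i bump ((1 / \<delta>) *\<^sub>R (x - y)) (pd i bump ((1 / \<delta>) *\<^sub>R (x - y)))"
      by (rule smooth_imp(1)[OF bump_smooth])
    then have "((\<lambda>h. bump ((1 / \<delta>) *\<^sub>R (x - y) + h *\<^sub>R ?e)) has_real_derivative pd i bump ((1 / \<delta>) *\<^sub>R (x - y))) (at ((- 1 / \<delta>) * 0))"
      by (simp add: has_pd_def)
    moreover have "((\<lambda>h. (- 1 / \<delta>) * h) has_real_derivative - 1 / \<delta>) (at 0)" using \<delta> by (auto intro!: derivative_eq_intros)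
    ultimately have "((\<lambda>h. bump ((1 / \<delta>) *\<^sub>R (x - y) + ((- 1 / \<delta>) * h) *\<^sub>R ?e)) has_real_derivative
        pd i bump ((1 / \<delta>) *\<^sub>R (x - y)) * (- 1 / \<delta>)) (at 0)"
      by (rule DERIV_chain2)
    moreover have "(1 / \<delta>) *\<^sub>R (x - y) + ((- 1 / \<delta>) * h) *\<^sub>R ?e = (1 / \<delta>) *\<^sub>R (x - (y + h *\<^sub>R ?e))" for h
      by (simp add: scaleR_diff_right scaleR_add_right)
    ultimately show "has_pd i ?\<phi> y (- ((1 / \<delta>) * pd i bump ((1 / \<delta>) *\<^sub>R (x - y))))"
      by (simp add: has_pd_def mult.commute)
  qed
  have \<phi>s: "smooth ?\<phi>" by (rule bump_scaled_smooth)
  have "bounded {y. ?\<phi> y \<noteq> 0}"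
    unfolding bounded_iff
  proof (intro exI ballI)
    fix y assume "y \<in> {y. ?\<phi> y \<noteq> 0}"
    then show "norm y \<le> norm x + 1 + R" using RB(3)[OF far[of y 0]] by force
  qed
  then have \<phi>c: "compact (closure {y. ?\<phi> y \<noteq> 0})" by simp
  have wg: "(LINT y|lebesgue. f y * pd i ?\<phi> y) = - (LINT y|lebesgue. G y $ i * ?\<phi> y)"
    using W \<phi>s \<phi>c unfolding weak_gradient_def by blast
  have \<phi>m[measurable]: "pd i ?\<phi> \<in> borel_measurable borel" by (rule smooth_measurable[OF \<phi>s])
  have \<phi>m2[measurable]: "?\<phi> \<in> borel_measurable borel" by (rule smooth_measurable[OF \<phi>s])
  have "(\<integral>y. f y * ((1 / \<delta>) * pd i bump ((1 / \<delta>) *\<^sub>R (x - y))) \<partial>lborel) = - (\<integral>y. f y * pd i ?\<phi> y \<partial>lborel)"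
    unfolding pd\<phi> by simp
  also have "(\<integral>y. f y * pd i ?\<phi> y \<partial>lborel) = (LINT y|lebesgue. f y * pd i ?\<phi> y)"
    using fm by (subst integral_completion) auto
  finally have val: "(\<integral>y. f y * ((1 / \<delta>) * pd i bump ((1 / \<delta>) *\<^sub>R (x - y))) \<partial>lborel) = (LINT y|lebesgue. G y $ i * ?\<phi> y)"
    using wg by simp
  have "\<bar>LINT y|lebesgue. G y $ i * ?\<phi> y\<bar> \<le> (LINT y|lebesgue. L * ?\<phi> y)"
  proof (rule abs_integral_le)
    show "integrable lebesgue (\<lambda>y. L * ?\<phi> y)"
      using bump_scaled(1)[OF \<delta>(1), of x] by (intro integrable_mult_right) (subst integrable_completion, auto)
    show "AE y in lebesgue. \<bar>G y $ i * ?\<phi> y\<bar> \<le> L * ?\<phi> y"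
      using GL
    proof eventually_elim
      case (elim y)
      have "\<bar>G y $ i\<bar> \<le> L" using component_le_norm_cart[of "G y" i] elim by linarith
      from mult_right_mono[OF this bump_nonneg] show ?case unfolding abs_mult abs_bump .
    qed
  qed
  also have "\<dots> = L * (\<delta> ^ CARD('n) * bump_mass)"
    using bump_scaled(2)[OF \<delta>(1), of x] by (subst integral_completion) auto
  finally have "\<bar>LINT y|lebesgue. G y $ i * ?\<phi> y\<bar> \<le> L * (\<delta> ^ CARD('n) * bump_mass)" .
  then have "\<bar>(LINT y|lebesgue. G y $ i * ?\<phi> y) / (\<delta> ^ CARD('n) * bump_mass)\<bar> \<le> L"
    using \<delta> bump_mass_pos by (simp add: abs_mult pos_divide_le_eq)
  then show ?thesis using d unfolding val has_pd_def by blast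
qed

lemma L_nonneg: "L \<ge> 0"
proof -
  obtain D where "\<bar>D\<bar> \<le> L" using moll_pd[of 1 undefined 0] by auto
  then show ?thesis by linarith
qed

lemma moll_lipschitz:
  assumes \<delta>: "0 < \<delta>" "\<delta> \<le> 1"
  shows "\<bar>moll \<delta> y - moll \<delta> x\<bar> \<le> real CARD('n) * L * norm (y - x)"
proof -
  obtain D where "\<And>i x. has_pd i (moll \<delta>) x (D i x)" "\<And>i x. \<bar>D i x\<bar> \<le> L"
    using moll_pd[OF \<delta>] by metis
  from partials_bounded_imp_lipschitz[OF this] show ?thesis .
qed

lemma moll_continuous:
  assumes \<delta>: "0 < \<delta>" "\<delta> \<le> 1" shows "continuous_on UNIV (moll \<delta>)"
proof -
  have "(real CARD('n) * L)-lipschitz_on UNIV (moll \<delta>)"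
    using moll_lipschitz[OF \<delta>] L_nonneg by (intro lipschitz_onI) (auto simp: dist_norm)
  then show ?thesis by (rule lipschitz_on_continuous_on)
qed

definition mesh :: "nat \<Rightarrow> real" where "mesh k = 1 / real (Suc k)"

lemma mesh: "0 < mesh k" "mesh k \<le> 1" "mesh \<longlonglongrightarrow> 0"
proof -
  show "mesh \<longlonglongrightarrow> 0" unfolding mesh_def[abs_def] by (rule LIMSEQ_Suc[OF lim_1_over_n])
qed (auto simp: mesh_def)

text \<open>
  By Fubini the pairing of \<open>\<psi>\<close> with the mollification of \<open>f\<close> is the pairing of \<open>f\<close> with the
  mollification of \<open>\<psi>\<close>, and the latter converges to \<open>\<psi>\<close>.  In the proof \<open>q\<close> is the mollification
  without its normalising factor.
\<close>

lemma moll_pairing: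
  assumes \<psi>: "continuous_on UNIV \<psi>" "\<And>x. \<bar>\<psi> x\<bar> \<le> B" "\<And>x. norm x > R \<Longrightarrow> \<psi> x = 0"
  shows "(\<lambda>k. \<integral>x. moll (mesh k) x * \<psi> x \<partial>lborel) \<longlonglongrightarrow> (\<integral>x. f x * \<psi> x \<partial>lborel)"
proof -
  have B: "B \<ge> 0" using order_trans[OF abs_ge_zero \<psi>(2)[of 0]] .
  have \<psi>m[measurable]: "\<psi> \<in> borel_measurable borel" by (rule borel_measurable_continuous_onI[OF \<psi>(1)])
  define q where "q \<delta> y = (\<integral>z. bump z * \<psi> (y + \<delta> *\<^sub>R z) \<partial>lborel)" for \<delta> and y :: "real^'n"
  have qm[measurable]: "q \<delta> \<in> borel_measurable borel" for \<delta> unfolding q_def by measurable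
  let ?R = "R + CARD('n)"
  have supp: "bump z * \<psi> (y + \<delta> *\<^sub>R z) = 0" if "norm y > ?R" "0 < \<delta>" "\<delta> \<le> 1" for y \<delta> and z :: "real^'n"
  proof (cases "norm z > CARD('n)")
    case False
    have "norm (\<delta> *\<^sub>R z) \<le> norm z" using that by (simp add: mult_left_le_one_le)
    then have "norm (y + \<delta> *\<^sub>R z) > R" using that False norm_triangle_ineq4[of "y + \<delta> *\<^sub>R z" "\<delta> *\<^sub>R z"] by simp
    then show ?thesis using \<psi>(3) by simp
  qed (simp add: bump_zero)
  have q0: "q \<delta> y = 0" if "norm y > ?R" "0 < \<delta>" "\<delta> \<le> 1" for y \<delta>
    unfolding q_def supp[OF that] by simp
  have bB: "\<bar>bump z * \<psi> (y + \<delta> *\<^sub>R z)\<bar> \<le> bump z * B" for y z \<delta>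
    unfolding abs_mult abs_bump by (intro mult_left_mono \<psi>(2) bump_nonneg)
  have qb: "\<bar>q \<delta> y\<bar> \<le> bump_mass * B" for \<delta> y
  proof -
    have "\<bar>q \<delta> y\<bar> \<le> (\<integral>(z::real^'n). bump z * B \<partial>lborel)"
      unfolding q_def by (rule abs_integral_le) (use bump_integrable bB in auto)
    then show ?thesis by (simp add: bump_mass_def)
  qed
  have ql: "(\<lambda>k. q (mesh k) y) \<longlonglongrightarrow> bump_mass * \<psi> y" for y
  proof -
    have "(\<lambda>k. \<integral>z. bump z * \<psi> (y + mesh k *\<^sub>R z) \<partial>lborel) \<longlonglongrightarrow> (\<integral>(z::real^'n). bump z * \<psi> y \<partial>lborel)"
    proof (rule integral_dominated_convergence)
      show "integrable lborel (\<lambda>z::real^'n. bump z * B)" by (intro integrable_mult_left bump_integrable)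
      show "AE z in lborel. norm (bump z * \<psi> (y + mesh k *\<^sub>R z)) \<le> bump z * B" for k using bB by simp
      show "(\<lambda>z. bump z * \<psi> (y + mesh k *\<^sub>R z)) \<in> borel_measurable lborel" for k by measurable
      show "(\<lambda>z::real^'n. bump z * \<psi> y) \<in> borel_measurable lborel" by measurable
      show "AE z in lborel. (\<lambda>k. bump z * \<psi> (y + mesh k *\<^sub>R z)) \<longlonglongrightarrow> bump z * \<psi> y"
      proof (intro AE_I2 tendsto_mult_left)
        fix z
        have "(\<lambda>k. y + mesh k *\<^sub>R z) \<longlonglongrightarrow> y + 0 *\<^sub>R z" by (intro tendsto_intros mesh)
        then have "(\<lambda>k. y + mesh k *\<^sub>R z) \<longlonglongrightarrow> y" by simp
        then show "(\<lambda>k. \<psi> (y + mesh k *\<^sub>R z)) \<longlonglongrightarrow> \<psi> y"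
          using \<psi>(1) by (auto simp: continuous_on_eq_continuous_at isCont_def intro: isCont_tendsto_compose)
      qed
    qed
    then show ?thesis by (simp add: bump_mass_def q_def)
  qed
  have eq: "(\<integral>x. moll \<delta> x * \<psi> x \<partial>lborel) = (\<integral>y. f y * q \<delta> y \<partial>lborel) / bump_mass" if \<delta>: "0 < \<delta>" "\<delta> \<le> 1" for \<delta>
  proof -
    let ?A = "\<delta> ^ CARD('n) * bump_mass"
    let ?k = "\<lambda>(x, y). f y * (bump ((1 / \<delta>) *\<^sub>R (x - y)) * \<psi> x)"
    have far: "bump ((1 / \<delta>) *\<^sub>R (x - y)) * \<psi> x = 0" if "norm y > ?R" for x y
      using supp[OF that \<delta>, of "(1 / \<delta>) *\<^sub>R (x - y)"] \<delta> by simp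
    have km[measurable]: "?k \<in> borel_measurable (lborel \<Otimes>\<^sub>M lborel)" using fm by measurable
    have b1: "\<bar>bump ((1 / \<delta>) *\<^sub>R (x - y)) * \<psi> x\<bar> \<le> B" for x y
      using mult_mono[OF bump_le_1 \<psi>(2) _ abs_ge_zero, of "(1 / \<delta>) *\<^sub>R (x - y)" x] by (simp add: abs_mult abs_bump)
    have ki: "integrable (lborel \<Otimes>\<^sub>M lborel) ?k"
    proof (rule Bochner_Integration.integrable_bound[of _ "\<lambda>(x, y). indicator (cball 0 R) x * (B * (indicator (cball 0 ?R) y * f y))"])
      have "integrable (lborel \<Otimes>\<^sub>M lborel) (\<lambda>z::(real^'n) \<times> (real^'n). indicator (cball 0 R) (fst z) * (B * (indicator (cball 0 ?R) (snd z) * f (snd z))))"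
      proof (rule lborel_pair.Fubini_integrable)
        have *: "integrable lborel (\<lambda>y. indicator (cball 0 ?R) y * f y)" using f_loc by (simp add: locally_integrable_def)
        show "(\<lambda>z::(real^'n) \<times> (real^'n). indicator (cball 0 R) (fst z) * (B * (indicator (cball 0 ?R) (snd z) * f (snd z)))) \<in> borel_measurable (lborel \<Otimes>\<^sub>M lborel)"
        proof -
          have [measurable]: "cball (0::real^'n) r \<in> sets borel" for r by simp
          note fm[measurable]
          show ?thesis
            unfolding measurable_cong_sets[OF sets_pair_measure_cong[OF sets_lborel sets_lborel] refl] by measurable
        qed
        have "integrable lborel (\<lambda>x::real^'n. indicator (cball 0 R) x * (\<integral>y. \<bar>B * (indicator (cball 0 ?R) y * f y)\<bar> \<partial>lborel))"
          by (intro integrable_mult_left integrable_real_indicator) (use emeasure_lborel_cball_finite in auto)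
        then show "integrable lborel (\<lambda>x::real^'n. \<integral>y. norm (indicator (cball 0 R) (fst (x, y)) * (B * (indicator (cball 0 ?R) (snd (x, y)) * f (snd (x, y))))) \<partial>lborel)"
          by (simp add: abs_mult)
        show "AE x::real^'n in lborel. integrable lborel (\<lambda>y. indicator (cball 0 R) (fst (x, y)) * (B * (indicator (cball 0 ?R) (snd (x, y)) * f (snd (x, y)))))"
          using * by simp
      qed
      then show "integrable (lborel \<Otimes>\<^sub>M lborel) (\<lambda>(x::real^'n, y). indicator (cball 0 R) x * (B * (indicator (cball 0 ?R) y * f y)))"
        by (simp add: case_prod_unfold)
      show "AE z in lborel \<Otimes>\<^sub>M lborel. norm (?k z) \<le> norm ((\<lambda>(x, y). indicator (cball 0 R) x * (B * (indicator (cball 0 ?R) y * f y))) z)"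
      proof (intro AE_I2, clarify)
        fix x y :: "real^'n"
        have "\<bar>f y\<bar> * \<bar>bump ((1 / \<delta>) *\<^sub>R (x - y)) * \<psi> x\<bar> \<le> \<bar>f y\<bar> * B" by (intro mult_left_mono b1) auto
        then show "norm (f y * (bump ((1 / \<delta>) *\<^sub>R (x - y)) * \<psi> x)) \<le> norm (indicator (cball 0 R) x * (B * (indicator (cball 0 ?R) y * f y)))"
          using far[of y x] \<psi>(3)[of x] B
          by (cases "norm y > ?R"; cases "norm x > R") (auto simp: abs_mult mult.commute)
      qed
    qed (rule km)
    have inner: "(\<integral>x. f y * (bump ((1 / \<delta>) *\<^sub>R (x - y)) * \<psi> x) \<partial>lborel) = \<delta> ^ CARD('n) * (f y * q \<delta> y)" for y
    proof -
      have "(\<integral>x. bump ((1 / \<delta>) *\<^sub>R (x - y)) * \<psi> x \<partial>lborel) = \<delta> ^ CARD('n) * q \<delta> y"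
        unfolding q_def using lborel_affine_integral(1)[of "\<lambda>x. bump ((1 / \<delta>) *\<^sub>R (x - y)) * \<psi> x" \<delta> y] \<delta> by simp
      then show ?thesis by simp
    qed
    have "(\<integral>x. moll \<delta> x * \<psi> x \<partial>lborel) = (\<integral>x. (\<integral>y. f y * (bump ((1 / \<delta>) *\<^sub>R (x - y)) * \<psi> x) \<partial>lborel) / ?A \<partial>lborel)"
      unfolding moll_def
      by (intro Bochner_Integration.integral_cong refl) (simp flip: mult.assoc)
    also have "\<dots> = (\<integral>x. \<integral>y. f y * (bump ((1 / \<delta>) *\<^sub>R (x - y)) * \<psi> x) \<partial>lborel \<partial>lborel) / ?A"
      by simp
    also have "\<dots> = (\<integral>y. \<integral>x. f y * (bump ((1 / \<delta>) *\<^sub>R (x - y)) * \<psi> x) \<partial>lborel \<partial>lborel) / ?A"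
      using lborel_pair.Fubini_integral[OF ki] by simp
    also have "\<dots> = \<delta> ^ CARD('n) * (\<integral>y. f y * q \<delta> y \<partial>lborel) / ?A"
      unfolding inner by simp
    also have "\<dots> = (\<integral>y. f y * q \<delta> y \<partial>lborel) / bump_mass" using \<delta> by simp
    finally show ?thesis .
  qed
  have "(\<lambda>k. \<integral>y. f y * q (mesh k) y \<partial>lborel) \<longlonglongrightarrow> (\<integral>y. f y * (bump_mass * \<psi> y) \<partial>lborel)"
  proof (rule integral_dominated_convergence[where w="\<lambda>y. \<bar>f y * (bump_mass * B * indicator (cball 0 ?R) y)\<bar>"])
    show "integrable lborel (\<lambda>y. \<bar>f y * (bump_mass * B * indicator (cball 0 ?R) y)\<bar>)"
      by (intro integrable_abs locally_integrable_mult[OF f_loc, of _ "bump_mass * B" ?R])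
        (use B bump_mass_pos in \<open>auto simp: indicator_def\<close>)
    show "AE y in lborel. (\<lambda>k. f y * q (mesh k) y) \<longlonglongrightarrow> f y * (bump_mass * \<psi> y)"
      by (intro AE_I2 tendsto_mult_left ql)
    show "AE y in lborel. norm (f y * q (mesh k) y) \<le> \<bar>f y * (bump_mass * B * indicator (cball 0 ?R) y)\<bar>" for k
    proof (intro AE_I2)
      fix y
      show "norm (f y * q (mesh k) y) \<le> \<bar>f y * (bump_mass * B * indicator (cball 0 ?R) y)\<bar>"
      proof (cases "norm y > ?R")
        case False
        have "\<bar>f y\<bar> * \<bar>q (mesh k) y\<bar> \<le> \<bar>f y\<bar> * (bump_mass * B)" by (intro mult_left_mono qb) auto
        then show ?thesis using False B bump_mass_pos by (simp add: abs_mult)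
      qed (simp add: q0 mesh)
    qed
  qed (use fm in measurable)
  then have "(\<lambda>k. (\<integral>y. f y * q (mesh k) y \<partial>lborel) / bump_mass) \<longlonglongrightarrow> (\<integral>y. f y * (bump_mass * \<psi> y) \<partial>lborel) / bump_mass"
    using bump_mass_pos by (intro tendsto_divide tendsto_const) auto
  moreover have "(\<integral>y. f y * (bump_mass * \<psi> y) \<partial>lborel) / bump_mass = (\<integral>y. f y * \<psi> y \<partial>lborel)"
    using bump_mass_pos by (simp add: mult.left_commute)
  ultimately show ?thesis using eq mesh by simp
qed

text \<open>
  The value at \<open>x\<close> is uniformly close to a local average around \<open>x\<close>, by the uniform Lipschitz
  bound, and the local averages converge by \<open>moll_pairing\<close>.
\<close>

lemma moll_convergent: "convergent (\<lambda>k. moll (mesh k) x)"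
proof -
  let ?n = "real CARD('n)"
  have "Cauchy (\<lambda>k. moll (mesh k) x)"
  proof (rule metric_CauchyI)
    fix e :: real assume e: "e > 0"
    \<comment> \<open>On the support of a bump of scale \<open>r\<close> the mollifications oscillate by at most
      \<open>n L \<cdot> n r \<le> e / 4\<close>, because the bump lives in the ball of radius \<open>n r\<close>.\<close>
    define r where "r = e / (4 * (?n * L * ?n + 1))"
    have nL: "?n * L * ?n \<ge> 0" using L_nonneg by simp
    have r: "r > 0" using e nL by (simp add: r_def)
    have nr: "?n * L * (?n * r) \<le> e / 4"
    proof -
      have "?n * L * (?n * r) = (?n * L * ?n) * r" by simp
      also have "\<dots> \<le> (?n * L * ?n + 1) * r" using r by (intro mult_right_mono) auto
      also have "\<dots> = e / 4"
      proof -
        have "a * (e / (4 * a)) = e / 4" if "a > 0" for a using that by simp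
        from this[of "?n * L * ?n + 1"] show ?thesis unfolding r_def using nL by linarith
      qed
      finally show ?thesis .
    qed
    define \<psi> where "\<psi> y = bump ((1 / r) *\<^sub>R (x - y))" for y
    define c where "c = r ^ CARD('n) * bump_mass"
    have c: "c > 0" using r bump_mass_pos by (simp add: c_def)
    have \<psi>i: "integrable lborel \<psi>" and \<psi>c: "(\<integral>y. \<psi> y \<partial>lborel) = c"
      using bump_scaled[OF r, of x] by (simp_all add: \<psi>_def[abs_def] c_def)
    have \<psi>0: "\<psi> y = 0" if "norm (x - y) > ?n * r" for y
      unfolding \<psi>_def using that r by (intro bump_zero) (simp add: pos_less_divide_eq)
    have \<psi>cont: "continuous_on UNIV \<psi>"
      using smooth_imp(2)[OF bump_scaled_smooth, of r x] by (simp add: \<psi>_def[abs_def])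
    have \<psi>R: "\<psi> y = 0" if "norm y > norm x + ?n * r" for y
      using \<psi>0[of y] that norm_triangle_sub[of y x] by (simp add: norm_minus_commute)
    have \<psi>01: "0 \<le> \<psi> y" "\<psi> y \<le> 1" for y by (simp_all add: \<psi>_def bump_nonneg bump_le_1)
    have close: "\<bar>moll (mesh k) x - (\<integral>y. moll (mesh k) y * \<psi> y \<partial>lborel) / c\<bar> \<le> e / 4" for k
    proof -
      have i1: "integrable lborel (\<lambda>y. moll (mesh k) y * \<psi> y)"
        by (rule locally_integrable_mult[OF locally_integrable_continuous[OF moll_continuous[OF mesh(1,2)]], of _ 1 "norm x + ?n * r"])
          (use \<psi>01 \<psi>R borel_measurable_continuous_onI[OF \<psi>cont] in auto)
      have "moll (mesh k) x * c - (\<integral>y. moll (mesh k) y * \<psi> y \<partial>lborel) = (\<integral>y. (moll (mesh k) x - moll (mesh k) y) * \<psi> y \<partial>lborel)"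
        using i1 \<psi>i \<psi>c by (simp add: left_diff_distrib)
      also have "\<bar>\<dots>\<bar> \<le> (\<integral>y. e / 4 * \<psi> y \<partial>lborel)"
      proof (rule abs_integral_le)
        show "AE y in lborel. \<bar>(moll (mesh k) x - moll (mesh k) y) * \<psi> y\<bar> \<le> e / 4 * \<psi> y"
        proof (intro AE_I2)
          fix y
          show "\<bar>(moll (mesh k) x - moll (mesh k) y) * \<psi> y\<bar> \<le> e / 4 * \<psi> y"
          proof (cases "norm (x - y) > ?n * r")
            case False
            have "\<bar>moll (mesh k) x - moll (mesh k) y\<bar> \<le> ?n * L * norm (x - y)" by (rule moll_lipschitz[OF mesh(1,2)])
            also have "\<dots> \<le> ?n * L * (?n * r)" using False L_nonneg by (intro mult_left_mono) auto
            finally have "\<bar>moll (mesh k) x - moll (mesh k) y\<bar> \<le> e / 4" using nr by linarith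
            from mult_right_mono[OF this \<psi>01(1)] show ?thesis
              unfolding abs_mult abs_of_nonneg[OF \<psi>01(1)] .
          qed (simp add: \<psi>0)
        qed
      qed (use \<psi>i in simp)
      finally have "\<bar>moll (mesh k) x * c - (\<integral>y. moll (mesh k) y * \<psi> y \<partial>lborel)\<bar> \<le> e / 4 * c" using \<psi>c by simp
      moreover have "moll (mesh k) x - (\<integral>y. moll (mesh k) y * \<psi> y \<partial>lborel) / c = (moll (mesh k) x * c - (\<integral>y. moll (mesh k) y * \<psi> y \<partial>lborel)) / c"
        using c by (simp add: diff_divide_distrib)
      ultimately show ?thesis using c by (simp add: abs_divide pos_divide_le_eq)
    qed
    have "(\<lambda>k. (\<integral>y. moll (mesh k) y * \<psi> y \<partial>lborel) / c) \<longlonglongrightarrow> (\<integral>y. f y * \<psi> y \<partial>lborel) / c"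
      by (intro tendsto_divide tendsto_const moll_pairing[OF \<psi>cont, where B=1 and R="norm x + ?n * r"])
        (use \<psi>01 \<psi>R c in auto)
    from LIMSEQ_imp_Cauchy[OF this] e obtain M where M: "\<And>m k. m \<ge> M \<Longrightarrow> k \<ge> M \<Longrightarrow>
       \<bar>(\<integral>y. moll (mesh m) y * \<psi> y \<partial>lborel) / c - (\<integral>y. moll (mesh k) y * \<psi> y \<partial>lborel) / c\<bar> < e / 4"
      unfolding Cauchy_def dist_real_def by (meson divide_pos_pos zero_less_numeral)
    show "\<exists>M. \<forall>m\<ge>M. \<forall>n\<ge>M. dist (moll (mesh m) x) (moll (mesh n) x) < e"
    proof (intro exI allI impI)
      fix m k assume "M \<le> m" "M \<le> k"
      have "\<bar>a - b\<bar> < e" if "\<bar>a - a'\<bar> \<le> e / 4" "\<bar>b - b'\<bar> \<le> e / 4" "\<bar>a' - b'\<bar> < e / 4" for a b a' b' :: real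
        using that e by linarith
      from this[OF close[of m] close[of k] M[OF \<open>M \<le> m\<close> \<open>M \<le> k\<close>]]
      show "dist (moll (mesh m) x) (moll (mesh k) x) < e" by (simp add: dist_real_def)
    qed
  qed
  then show ?thesis by (simp add: Cauchy_convergent_iff)
qed

lemma borel_lipschitz_representative:
  "\<exists>F. (\<forall>x y. \<bar>F x - F y\<bar> \<le> real CARD('n) * L * norm (x - y)) \<and> (AE x in lborel. F x = f x)"
proof -
  define F where "F x = lim (\<lambda>k. moll (mesh k) x)" for x
  have Fl: "(\<lambda>k. moll (mesh k) x) \<longlonglongrightarrow> F x" for x
    unfolding F_def using moll_convergent by (simp add: convergent_LIMSEQ_iff)
  have FL: "\<bar>F x - F y\<bar> \<le> real CARD('n) * L * norm (x - y)" for x y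
    by (rule LIMSEQ_le_const2[OF tendsto_rabs[OF tendsto_diff[OF Fl Fl]]])
      (use moll_lipschitz[OF mesh(1,2)] in auto)
  have "(real CARD('n) * L)-lipschitz_on UNIV F"
    using FL L_nonneg by (intro lipschitz_onI) (auto simp: dist_norm)
  then have Fc: "continuous_on UNIV F" by (rule lipschitz_on_continuous_on)
  obtain K where K: "\<And>k. \<bar>moll (mesh k) 0\<bar> \<le> K"
    using convergent_imp_Bseq[OF moll_convergent[of 0]] by (auto simp: Bseq_def)
  have "AE x in lborel. F x - f x = 0"
  proof (rule AE_zero_if_pairings_zero[OF locally_integrable_diff[OF locally_integrable_continuous[OF Fc] f_loc]])
    fix \<psi> :: "real^'n \<Rightarrow> real" and R assume \<psi>: "continuous_on UNIV \<psi>" "\<And>x. \<bar>\<psi> x\<bar> \<le> 1" "\<And>x. norm x > R \<Longrightarrow> \<psi> x = 0"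
    have \<psi>m[measurable]: "\<psi> \<in> borel_measurable borel" by (rule borel_measurable_continuous_onI[OF \<psi>(1)])
    have mm[measurable]: "moll (mesh k) \<in> borel_measurable borel" for k
      by (rule borel_measurable_continuous_onI[OF moll_continuous[OF mesh(1,2)]])
    have Fm[measurable]: "F \<in> borel_measurable borel" by (rule borel_measurable_continuous_onI[OF Fc])
    let ?w = "\<lambda>x. (K + real CARD('n) * L * R) * \<bar>\<psi> x\<bar>"
    have "(\<lambda>k. \<integral>x. moll (mesh k) x * \<psi> x \<partial>lborel) \<longlonglongrightarrow> (\<integral>x. F x * \<psi> x \<partial>lborel)"
    proof (rule integral_dominated_convergence[where w="?w"])
      show "integrable lborel ?w"
        by (intro integrable_mult_right integrable_abs integrable_bounded_support[OF \<psi>m \<psi>(2,3)])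
      show "AE x in lborel. (\<lambda>k. moll (mesh k) x * \<psi> x) \<longlonglongrightarrow> F x * \<psi> x"
        by (intro AE_I2 tendsto_mult_right Fl)
      show "AE x in lborel. norm (moll (mesh k) x * \<psi> x) \<le> ?w x" for k
      proof (intro AE_I2)
        fix x
        show "norm (moll (mesh k) x * \<psi> x) \<le> ?w x"
        proof (cases "norm x > R")
          case False
          have "\<bar>moll (mesh k) x - moll (mesh k) 0\<bar> \<le> real CARD('n) * L * norm (x - 0)" by (rule moll_lipschitz[OF mesh(1,2)])
          moreover have "real CARD('n) * L * norm (x - 0) \<le> real CARD('n) * L * R"
            using False L_nonneg by (intro mult_left_mono) auto
          ultimately have "\<bar>moll (mesh k) x\<bar> \<le> K + real CARD('n) * L * R" using K[of k] by linarith
          then show ?thesis by (simp add: abs_mult mult_right_mono)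
        qed (simp add: \<psi>(3))
      qed
    qed auto
    with moll_pairing[OF \<psi>] have "(\<integral>x. F x * \<psi> x \<partial>lborel) = (\<integral>x. f x * \<psi> x \<partial>lborel)"
      by (rule LIMSEQ_unique[symmetric])
    moreover have "integrable lborel (\<lambda>x. F x * \<psi> x)"
      by (rule locally_integrable_mult[OF locally_integrable_continuous[OF Fc] \<psi>m \<psi>(2,3)])
    moreover have "integrable lborel (\<lambda>x. f x * \<psi> x)"
      by (rule locally_integrable_mult[OF f_loc \<psi>m \<psi>(2,3)])
    ultimately show "(\<integral>x. (F x - f x) * \<psi> x \<partial>lborel) = 0" by (simp add: left_diff_distrib)
  qed
  then have "AE x in lborel. F x = f x" by eventually_elim simp
  then show ?thesis using FL by blast
qed

end

text \<open>
  A Lebesgue measurable \<open>f\<close> is first replaced by a Borel function, for which the product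
  measurability required by Fubini is available.
\<close>

lemma weak_gradient_imp_lipschitz_representative:
  fixes f :: "real^'n::finite \<Rightarrow> real"
  assumes W: "weak_gradient f G" and GL: "AE x in lebesgue. norm (G x) \<le> L"
  shows "\<exists>F. (\<forall>x y. \<bar>F x - F y\<bar> \<le> real CARD('n) * L * norm (x - y)) \<and> (AE x in lebesgue. F x = f x)
    \<and> f \<in> borel_measurable lebesgue"
proof -
  have fm: "f \<in> borel_measurable lebesgue"
  proof (rule borel_measurable_LIMSEQ_real)
    show "(\<lambda>k. indicator (cball 0 (real k)) x *\<^sub>R f x) \<longlonglongrightarrow> f x" for x
    proof (rule tendsto_eventually)
      obtain k0 :: nat where "norm x \<le> real k0" using real_arch_simple by blast
      then show "\<forall>\<^sub>F k in sequentially. indicator (cball 0 (real k)) x *\<^sub>R f x = f x"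
        by (intro eventually_sequentiallyI[of k0]) auto
    qed
    have "set_integrable lebesgue (cball 0 (real k)) f" for k
      using W by (simp add: weak_gradient_def)
    then show "(\<lambda>x. indicator (cball 0 (real k)) x *\<^sub>R f x) \<in> borel_measurable lebesgue" for k
      unfolding set_integrable_def by (rule borel_measurable_integrable)
  qed
  obtain g where g: "g \<in> borel_measurable lborel" "AE x in lborel. f x = g x"
    using completion_ex_borel_measurable_real[OF fm] by blast
  have gm: "g \<in> borel_measurable borel" using g(1) by simp
  have gm': "g \<in> borel_measurable lebesgue" by (rule measurable_completion[OF g(1)])
  have eq: "AE x in lebesgue. f x = g x" using g(2) by (rule AE_completion)
  have "weak_gradient g G"
    unfolding weak_gradient_def
  proof (intro conjI allI impI)
    fix K :: "(real^'n) set" assume K: "compact K"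
    then show "set_integrable lebesgue K G" using W by (simp add: weak_gradient_def)
    have Km: "K \<in> sets lebesgue" using borel_compact[OF K] by simp
    have 1: "integrable lebesgue (\<lambda>x. indicator K x *\<^sub>R f x)"
      using W K by (simp add: weak_gradient_def set_integrable_def)
    have "integrable lebesgue (\<lambda>x. indicator K x *\<^sub>R f x) \<longleftrightarrow> integrable lebesgue (\<lambda>x. indicator K x *\<^sub>R g x)"
      using eq by (intro integrable_cong_AE borel_measurable_scaleR borel_measurable_indicator Km fm gm')
        (auto elim!: eventually_mono)
    then show "set_integrable lebesgue K g" using 1 by (simp add: set_integrable_def)
  next
    fix \<phi> :: "real^'n \<Rightarrow> real" and i assume \<phi>: "smooth \<phi> \<and> compact (closure {x. \<phi> x \<noteq> 0})"
    have pm: "pd i \<phi> \<in> borel_measurable lebesgue"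
      by (rule measurable_completion) (use smooth_measurable \<phi> in auto)
    have "(LINT x|lebesgue. g x * pd i \<phi> x) = (LINT x|lebesgue. f x * pd i \<phi> x)"
      using eq by (intro integral_cong_AE borel_measurable_times fm gm' pm) (auto elim!: eventually_mono)
    then show "(LINT x|lebesgue. g x * pd i \<phi> x) = - (LINT x|lebesgue. G x $ i * \<phi> x)"
      using W \<phi> unfolding weak_gradient_def by simp
  qed
  from borel_lipschitz_representative[OF gm this GL] obtain F
    where F: "\<forall>x y. \<bar>F x - F y\<bar> \<le> real CARD('n) * L * norm (x - y)" "AE x in lborel. F x = g x" by blast
  have "AE x in lebesgue. F x = g x" using F(2) by (rule AE_completion)
  then have "AE x in lebesgue. F x = f x" using eq by eventually_elim simp
  then show ?thesis using F(1) fm by blast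
qed

section \<open>Derivative bounds from analyticity\<close>

lemma DERIV_quadratic_remainder:
  fixes f :: "real \<Rightarrow> real"
  assumes d: "d > 0" and b: "\<And>h. h \<noteq> 0 \<Longrightarrow> \<bar>h\<bar> < d \<Longrightarrow> \<bar>f (s + h) - f s - h * D\<bar> \<le> K * h\<^sup>2"
  shows "(f has_real_derivative D) (at s)"
  unfolding DERIV_def
proof (rule Lim_transform2)
  show "((\<lambda>h. D) \<longlongrightarrow> D) (at 0)" by simp
  show "((\<lambda>h. D - (f (s + h) - f s) / h) \<longlongrightarrow> 0) (at 0)"
  proof (rule Lim_null_comparison)
    have "norm (D - (f (s + h) - f s) / h) \<le> K * \<bar>h\<bar>" if h: "h \<noteq> 0 \<and> dist h 0 < d" for h
    proof -
      define X where "X = f (s + h) - f s - h * D"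
      have h0: "\<bar>h\<bar> > 0" using h by simp
      have "\<bar>X\<bar> \<le> K * h\<^sup>2" unfolding X_def by (rule b) (use h in \<open>auto simp: dist_real_def\<close>)
      moreover have "K * h\<^sup>2 = K * \<bar>h\<bar> * \<bar>h\<bar>" by (simp add: power2_eq_square)
      ultimately have "\<bar>X\<bar> / \<bar>h\<bar> \<le> K * \<bar>h\<bar>" using h0 by (simp only: pos_divide_le_eq)
      moreover have "D - (f (s + h) - f s) / h = - (X / h)" using h by (simp add: X_def diff_divide_distrib)
      ultimately show ?thesis
        by (simp only: real_norm_def abs_minus_cancel abs_divide)
    qed
    then show "\<forall>\<^sub>F h in at 0. norm (D - (f (s + h) - f s) / h) \<le> K * \<bar>h\<bar>"
      unfolding eventually_at using d by blast
    show "((\<lambda>h. K * \<bar>h\<bar>) \<longlongrightarrow> 0) (at 0)" by (auto intro!: tendsto_eq_intros)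
  qed
qed

lemma square_times_geometric_bounded:
  fixes q :: real assumes "0 \<le> q" "q < 1"
  shows "\<exists>K. \<forall>n. (real n)\<^sup>2 * q ^ n \<le> K"
proof -
  have s: "norm (sqrt q) < 1" using assms by simp
  obtain K where K: "\<And>n. norm (real n * sqrt q ^ n) \<le> K"
    using convergent_imp_Bseq[OF convergentI[OF powser_times_n_limit_0[OF s]]] by (auto simp: Bseq_def)
  have "(real n)\<^sup>2 * q ^ n \<le> K\<^sup>2" for n
  proof -
    have "(real n)\<^sup>2 * q ^ n = (real n * sqrt q ^ n)\<^sup>2"
      using assms by (simp add: power_mult_distrib power2_eq_square flip: power_mult_distrib real_sqrt_mult)
    also have "\<dots> \<le> K\<^sup>2" using power_mono[OF K[of n], of 2] by simp
    finally show ?thesis .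
  qed
  then show ?thesis by blast
qed

lemma abs_has_sum_le:
  fixes f g :: "'a \<Rightarrow> real"
  assumes "(f has_sum x) A" "(g has_sum y) A" "\<And>i. \<bar>f i\<bar> \<le> g i"
  shows "\<bar>x\<bar> \<le> y"
proof -
  have "x \<le> y" by (rule has_sum_mono[OF assms(1,2)]) (use assms(3) abs_le_D1 in blast)
  moreover have "((\<lambda>i. - f i) has_sum - x) A" using assms(1) by (simp add: has_sum_uminus)
  then have "- x \<le> y" by (rule has_sum_mono[OF _ assms(2)]) (use assms(3) abs_le_D2 in blast)
  ultimately show ?thesis by simp
qed

lemma has_sum_minus:
  fixes f g :: "'a \<Rightarrow> real"
  assumes "(f has_sum x) A" "(g has_sum y) A"
  shows "((\<lambda>i. f i - g i) has_sum (x - y)) A"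
  using has_sum_add[OF assms(1) has_sum_cmult_right[OF assms(2), of "- 1"]] by simp

text \<open>
  Termwise differentiation of a multivariate power series in one of its variables \<open>w\<close>.  The index
  set is abstract: \<open>e\<close> is the exponent of \<open>w\<close>, \<open>T\<close> collects the other variables, and \<open>S\<close> raises the
  exponent by one.  The quadratic remainders of the monomials are summable on a slightly smaller disc
  because \<open>n\<^sup>2 (\<rho>1 / \<rho>) ^ n\<close> is bounded.
\<close>

lemma power_series_step:
  fixes a T :: "'k \<Rightarrow> real" and e :: "'k \<Rightarrow> nat" and S :: "'k \<Rightarrow> 'k"
  assumes S: "inj S" "range S = {\<kappa>. e \<kappa> > 0}" "\<And>\<kappa>. e (S \<kappa>) = Suc (e \<kappa>)" "\<And>\<kappa>. T (S \<kappa>) = T \<kappa>"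
    and G: "\<And>w. \<bar>w\<bar> < r \<Longrightarrow> ((\<lambda>\<kappa>. a \<kappa> * (w ^ e \<kappa> * T \<kappa>)) has_sum G w) UNIV"
    and w: "\<bar>w\<bar> < r"
  shows "\<exists>D. (G has_real_derivative D) (at w) \<and>
     ((\<lambda>\<kappa>. (real (e \<kappa>) + 1) * a (S \<kappa>) * (w ^ e \<kappa> * T \<kappa>)) has_sum D) UNIV"
proof -
  define b where "b \<kappa> = a \<kappa> * T \<kappa>" for \<kappa>
  \<comment> \<open>Two radii between \<open>\<bar>w\<bar>\<close> and \<open>r\<close>: summability at \<open>\<rho>\<close> yields derivatives up to \<open>\<rho>1\<close>.\<close>
  define \<rho> where "\<rho> = (\<bar>w\<bar> + r) / 2"
  define \<rho>1 where "\<rho>1 = (\<bar>w\<bar> + \<rho>) / 2"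
  have \<rho>: "\<bar>w\<bar> < \<rho>1" "\<rho>1 < \<rho>" "\<rho> < r" "0 < \<rho>1" "0 < \<rho>"
    using w abs_ge_zero[of w] unfolding \<rho>_def \<rho>1_def by (simp_all add: field_simps)
  have Gb: "((\<lambda>\<kappa>. b \<kappa> * w ^ e \<kappa>) has_sum G w) UNIV" if "\<bar>w\<bar> < r" for w
    using G[OF that] by (simp add: b_def mult_ac)
  have "(\<lambda>\<kappa>. b \<kappa> * \<rho> ^ e \<kappa>) summable_on UNIV"
    using Gb[of \<rho>] \<rho> by (auto simp: summable_on_def)
  then have "(\<lambda>\<kappa>. norm (b \<kappa> * \<rho> ^ e \<kappa>)) summable_on UNIV"
    by (rule summable_on_iff_abs_summable_on_real[THEN iffD1])
  then obtain B where B: "((\<lambda>\<kappa>. \<bar>b \<kappa>\<bar> * \<rho> ^ e \<kappa>) has_sum B) UNIV"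
    using \<rho> by (auto simp: summable_on_def abs_mult)
  obtain K where K: "\<And>n. (real n)\<^sup>2 * (\<rho>1 / \<rho>) ^ n \<le> K"
    using square_times_geometric_bounded[of "\<rho>1 / \<rho>"] \<rho> by auto
  have K2: "(real n)\<^sup>2 * \<rho>1 ^ n \<le> K * \<rho> ^ n" for n
    using K[of n] \<rho> by (simp add: power_divide pos_divide_le_eq)
  have e1: "real n * \<bar>z\<bar> ^ (n - 1) \<le> K / \<rho>1 * \<rho> ^ n" if "\<bar>z\<bar> \<le> \<rho>1" for n z
  proof (cases n)
    case 0
    then show ?thesis using K[of 0] \<rho> by simp
  next
    case (Suc j)
    have "real n * \<bar>z\<bar> ^ (n - 1) \<le> (real n)\<^sup>2 * \<rho>1 ^ (n - 1)"
      using that Suc by (intro mult_mono power_mono) (auto simp: power2_eq_square)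
    also have "\<dots> = (real n)\<^sup>2 * \<rho>1 ^ n / \<rho>1" using Suc \<rho> by simp
    also have "\<dots> \<le> K * \<rho> ^ n / \<rho>1" using K2[of n] \<rho> by (intro divide_right_mono) auto
    finally show ?thesis by simp
  qed
  have e2: "real n * real (n - 1) * \<rho>1 ^ (n - 2) \<le> K / \<rho>1\<^sup>2 * \<rho> ^ n" for n
  proof (cases "n \<ge> 2")
    case True
    then obtain j where n: "n = j + 2" by (metis add.commute le_Suc_ex)
    have "real n * real (n - 1) * \<rho>1 ^ (n - 2) \<le> (real n)\<^sup>2 * \<rho>1 ^ (n - 2)"
      using \<rho> by (intro mult_right_mono) (auto simp: power2_eq_square intro: mult_left_mono)
    also have "\<dots> = (real n)\<^sup>2 * \<rho>1 ^ n / \<rho>1\<^sup>2" using \<rho> by (simp add: n power2_eq_square)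
    also have "\<dots> \<le> K * \<rho> ^ n / \<rho>1\<^sup>2" using K2[of n] \<rho> by (intro divide_right_mono) auto
    finally show ?thesis by simp
  next
    case False
    then have "n = 0 \<or> n = 1" by auto
    then have "real n * real (n - 1) * \<rho>1 ^ (n - 2) = 0" by auto
    moreover have "0 \<le> K" using K[of 0] by simp
    then have "0 \<le> K / \<rho>1\<^sup>2 * \<rho> ^ n" using \<rho> by (intro mult_nonneg_nonneg divide_nonneg_nonneg) auto
    ultimately show ?thesis by linarith
  qed
  define d where "d \<kappa> = b \<kappa> * (real (e \<kappa>) * w ^ (e \<kappa> - 1))" for \<kappa>
  have "(\<lambda>\<kappa>. norm (d \<kappa>)) summable_on UNIV"
  proof (rule Infinite_Sum.abs_summable_on_comparison_test)
    show "(\<lambda>\<kappa>. norm (K / \<rho>1 * (\<bar>b \<kappa>\<bar> * \<rho> ^ e \<kappa>))) summable_on UNIV"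
    proof -
      have "(\<lambda>\<kappa>. K / \<rho>1 * (\<bar>b \<kappa>\<bar> * \<rho> ^ e \<kappa>)) summable_on UNIV"
        using has_sum_cmult_right[OF B, of "K / \<rho>1"] by (auto simp: summable_on_def)
      then show ?thesis by (rule summable_on_iff_abs_summable_on_real[THEN iffD1])
    qed
    show "norm (d \<kappa>) \<le> norm (K / \<rho>1 * (\<bar>b \<kappa>\<bar> * \<rho> ^ e \<kappa>))" for \<kappa>
    proof -
      have "norm (d \<kappa>) = \<bar>b \<kappa>\<bar> * (real (e \<kappa>) * \<bar>w\<bar> ^ (e \<kappa> - 1))" by (simp add: d_def abs_mult power_abs)
      also have "\<dots> \<le> \<bar>b \<kappa>\<bar> * (K / \<rho>1 * \<rho> ^ e \<kappa>)" using e1[of w] \<rho> by (intro mult_left_mono) auto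
      also have "\<dots> \<le> norm (K / \<rho>1 * (\<bar>b \<kappa>\<bar> * \<rho> ^ e \<kappa>))" by (simp only: real_norm_def mult.left_commute) (rule abs_ge_self)
      finally show ?thesis .
    qed
  qed
  then have "d summable_on UNIV" by (rule summable_on_iff_abs_summable_on_real[THEN iffD2])
  then obtain D where D: "(d has_sum D) UNIV" by (auto simp: summable_on_def)
  have der: "(G has_real_derivative D) (at w)"
  proof (rule DERIV_quadratic_remainder[where K="K / \<rho>1\<^sup>2 * B"])
    show "0 < \<rho>1 - \<bar>w\<bar>" using \<rho> by simp
    fix h :: real assume h: "h \<noteq> 0" "\<bar>h\<bar> < \<rho>1 - \<bar>w\<bar>"
    have wh: "\<bar>w + h\<bar> \<le> \<rho>1" using h by linarith
    have 1: "((\<lambda>\<kappa>. b \<kappa> * (w + h) ^ e \<kappa> - b \<kappa> * w ^ e \<kappa> - h * d \<kappa>) has_sum (G (w + h) - G w - h * D)) UNIV"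
      using wh \<rho> w by (intro has_sum_minus Gb has_sum_cmult_right D) auto
    have 2: "((\<lambda>\<kappa>. h\<^sup>2 * (K / \<rho>1\<^sup>2) * (\<bar>b \<kappa>\<bar> * \<rho> ^ e \<kappa>)) has_sum (h\<^sup>2 * (K / \<rho>1\<^sup>2) * B)) UNIV"
      by (intro has_sum_cmult_right B)
    have "\<bar>G (w + h) - G w - h * D\<bar> \<le> h\<^sup>2 * (K / \<rho>1\<^sup>2) * B"
    proof (rule abs_has_sum_le[OF 1 2])
      fix \<kappa>
      let ?n = "e \<kappa>"
      define X where "X = (w + h) ^ ?n - w ^ ?n - h * (real ?n * w ^ (?n - 1))"
      have "norm (((w + h) ^ ?n - w ^ ?n) / h - of_nat ?n * w ^ (?n - Suc 0)) \<le> of_nat ?n * of_nat (?n - Suc 0) * \<rho>1 ^ (?n - 2) * norm h"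
        using \<rho> wh by (intro lemma_termdiff3 h) auto
      moreover have "((w + h) ^ ?n - w ^ ?n) / h - of_nat ?n * w ^ (?n - Suc 0) = X / h"
        using h by (simp add: X_def field_simps)
      ultimately have "\<bar>X\<bar> / \<bar>h\<bar> \<le> real ?n * real (?n - 1) * \<rho>1 ^ (?n - 2) * \<bar>h\<bar>" by (simp add: abs_divide)
      also have "\<dots> \<le> K / \<rho>1\<^sup>2 * \<rho> ^ ?n * \<bar>h\<bar>" by (intro mult_right_mono e2) auto
      finally have "\<bar>X\<bar> / \<bar>h\<bar> \<le> K / \<rho>1\<^sup>2 * \<rho> ^ ?n * \<bar>h\<bar>" .
      then have "\<bar>X\<bar> \<le> K / \<rho>1\<^sup>2 * \<rho> ^ ?n * \<bar>h\<bar> * \<bar>h\<bar>"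
        by (rule iffD1[OF pos_divide_le_eq, rotated]) (use h(1) in simp)
      also have "\<dots> = h\<^sup>2 * (K / \<rho>1\<^sup>2) * \<rho> ^ ?n" by (simp add: power2_eq_square mult_ac)
      finally have "\<bar>b \<kappa>\<bar> * \<bar>X\<bar> \<le> \<bar>b \<kappa>\<bar> * (h\<^sup>2 * (K / \<rho>1\<^sup>2) * \<rho> ^ ?n)" by (intro mult_left_mono) auto
      moreover have "b \<kappa> * (w + h) ^ ?n - b \<kappa> * w ^ ?n - h * d \<kappa> = b \<kappa> * X" by (simp add: X_def d_def algebra_simps)
      ultimately show "\<bar>b \<kappa> * (w + h) ^ ?n - b \<kappa> * w ^ ?n - h * d \<kappa>\<bar> \<le> h\<^sup>2 * (K / \<rho>1\<^sup>2) * (\<bar>b \<kappa>\<bar> * \<rho> ^ ?n)"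
        by (simp add: abs_mult mult_ac)
    qed
    then show "\<bar>G (w + h) - G w - h * D\<bar> \<le> K / \<rho>1\<^sup>2 * B * h\<^sup>2" by (simp add: mult_ac)
  qed
  have "(d has_sum D) (range S)"
  proof (rule has_sum_cong_neutral[THEN iffD1, OF _ _ _ D])
    show "d x = 0" if "x \<in> UNIV - range S" for x using that S(2) by (auto simp: d_def)
  qed auto
  then have "((d \<circ> S) has_sum D) UNIV" using has_sum_reindex[OF S(1)] by blast
  moreover have "d \<circ> S = (\<lambda>\<kappa>. (real (e \<kappa>) + 1) * a (S \<kappa>) * (w ^ e \<kappa> * T \<kappa>))"
    by (auto simp: fun_eq_iff d_def b_def S mult_ac add.commute)
  ultimately show ?thesis using der by auto
qed

text \<open>
  Convergence is asked on a cube instead of a ball, so that moving one coordinate at a time stays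
  inside the domain.
\<close>

definition series_at :: "(('n::finite \<Rightarrow> nat) \<times> nat \<Rightarrow> real) \<Rightarrow> real \<Rightarrow> real^'n \<Rightarrow> real \<Rightarrow> (real^'n \<Rightarrow> real \<Rightarrow> real) \<Rightarrow> bool" where
  "series_at a r x t g \<longleftrightarrow> (\<forall>y s. (\<forall>i. \<bar>y $ i - x $ i\<bar> < r) \<and> \<bar>s - t\<bar> < r \<longrightarrow>
     ((\<lambda>(m, k). a (m, k) * (\<Prod>i\<in>UNIV. (y $ i - x $ i) ^ m i) * (s - t) ^ k) has_sum g y s) UNIV)"

definition locally_series :: "(real^'n::finite \<Rightarrow> real \<Rightarrow> real) \<Rightarrow> bool" where
  "locally_series g \<longleftrightarrow> (\<forall>x. \<forall>t>0. \<exists>r>0. \<exists>a. series_at a r x t g)"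

lemma analytic_imp_locally_series:
  fixes u :: "real^'n::finite \<Rightarrow> real \<Rightarrow> real"
  assumes "analytic_pos_time u" shows "locally_series u"
  unfolding locally_series_def
proof (intro allI impI)
  fix x :: "real^'n" and t :: real assume t: "t > 0"
  obtain r a where r: "r > 0" and a: "\<And>y s. dist (y, s) (x, t) < r \<Longrightarrow>
      ((\<lambda>(m, k). a (m, k) * (\<Prod>i\<in>UNIV. (y $ i - x $ i) ^ m i) * (s - t) ^ k) has_sum u y s) UNIV"
    using assms t unfolding analytic_pos_time_def by meson
  let ?q = "r / (real CARD('n) + 2)"
  have "dist (y, s) (x, t) < r" if "\<And>i. \<bar>y $ i - x $ i\<bar> < ?q" "\<bar>s - t\<bar> < ?q" for y s
  proof -
    have "dist (y, s) (x, t) \<le> norm (y - x) + \<bar>s - t\<bar>"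
      using norm_Pair_le[of "y - x" "s - t"] by (simp add: dist_norm)
    also have "norm (y - x) \<le> (\<Sum>i\<in>UNIV. \<bar>(y - x) $ i\<bar>)" by (rule norm_le_l1_cart)
    also have "\<dots> \<le> (\<Sum>i\<in>(UNIV::'n set). ?q)" using that(1) by (intro sum_mono) (simp add: less_imp_le)
    also have "\<dots> = real CARD('n) * ?q" by simp
    finally have "dist (y, s) (x, t) < real CARD('n) * ?q + 2 * ?q" using that(2) r by (simp add: add_mono)
    also have "\<dots> = (real CARD('n) + 2) * ?q" by (simp only: distrib_right)
    also have "\<dots> = r" by simp
    finally show ?thesis .
  qed
  then have "series_at a ?q x t u" unfolding series_at_def using a by blast
  moreover have "?q > 0" using r by simp
  ultimately show "\<exists>r>0. \<exists>a. series_at a r x t u" by blast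
qed

lemma series_at_pd:
  fixes g :: "real^'n::finite \<Rightarrow> real \<Rightarrow> real"
  assumes g: "series_at a r x t g"
  shows "series_at (\<lambda>(m, k). (real (m i) + 1) * a (m(i := Suc (m i)), k)) r x t (\<lambda>y s. pd i (\<lambda>z. g z s) y)"
    and "(\<And>j. \<bar>y $ j - x $ j\<bar> < r) \<Longrightarrow> \<bar>s - t\<bar> < r \<Longrightarrow> has_pd i (\<lambda>z. g z s) y (pd i (\<lambda>z. g z s) y)"
proof -
  let ?a' = "\<lambda>(m, k). (real (m i) + 1) * a (m(i := Suc (m i)), k)"
  have main: "\<exists>D. has_pd i (\<lambda>z. g z s) y D \<and>
     ((\<lambda>(m, k). ?a' (m, k) * (\<Prod>i\<in>UNIV. (y $ i - x $ i) ^ m i) * (s - t) ^ k) has_sum D) UNIV"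
    if y: "\<And>j. \<bar>y $ j - x $ j\<bar> < r" and s: "\<bar>s - t\<bar> < r" for y s
  proof -
    define T where "T = (\<lambda>(m::'n \<Rightarrow> nat, k). (\<Prod>j\<in>UNIV - {i}. (y $ j - x $ j) ^ m j) * (s - t) ^ k)"
    define e where "e = (\<lambda>(m::'n \<Rightarrow> nat, k::nat). m i)"
    define S where "S = (\<lambda>(m::'n \<Rightarrow> nat, k::nat). (m(i := Suc (m i)), k))"
    define Y where "Y w = y + (w - (y $ i - x $ i)) *\<^sub>R axis i 1" for w
    have Yi: "Y w $ i - x $ i = w" "j \<noteq> i \<Longrightarrow> Y w $ j = y $ j" for w j
      by (auto simp: Y_def axis_def)
    have split: "(\<Prod>j\<in>UNIV. (Y w $ j - x $ j) ^ m j) * (s - t) ^ k = w ^ e (m, k) * T (m, k)" for w m k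
      by (simp add: prod.remove[of UNIV i] Yi e_def T_def mult_ac)
    have "\<exists>D. ((\<lambda>w. g (Y w) s) has_real_derivative D) (at (y $ i - x $ i)) \<and>
     ((\<lambda>\<kappa>. (real (e \<kappa>) + 1) * a (S \<kappa>) * ((y $ i - x $ i) ^ e \<kappa> * T \<kappa>)) has_sum D) UNIV"
    proof (rule power_series_step)
      show "inj S"
      proof (rule injI, clarify)
        fix m k m' k' assume *: "S (m, k) = S (m', k')"
        then have "m(i := Suc (m i)) = m'(i := Suc (m' i))" "k = k'" by (auto simp: S_def)
        then show "m = m' \<and> k = k'" by (metis fun_upd_triv fun_upd_same fun_upd_upd nat.inject)
      qed
      show "range S = {\<kappa>. e \<kappa> > 0}"
      proof (intro set_eqI iffI)
        fix \<kappa> :: "('n \<Rightarrow> nat) \<times> nat" assume "\<kappa> \<in> {\<kappa>. e \<kappa> > 0}"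
        then obtain m k where mk: "\<kappa> = (m, k)" "m i > 0" by (cases \<kappa>) (auto simp: e_def)
        then have "\<kappa> = S (m(i := m i - 1), k)" by (simp add: S_def)
        then show "\<kappa> \<in> range S" by blast
      qed (auto simp: S_def e_def)
      show "e (S \<kappa>) = Suc (e \<kappa>)" "T (S \<kappa>) = T \<kappa>" for \<kappa>
        by (cases \<kappa>; auto simp: S_def e_def T_def intro!: prod.cong)+
      show "((\<lambda>\<kappa>. a \<kappa> * (w ^ e \<kappa> * T \<kappa>)) has_sum g (Y w) s) UNIV" if "\<bar>w\<bar> < r" for w
      proof -
        have "\<bar>Y w $ j - x $ j\<bar> < r" for j using that y[of j] Yi(1)[of w] Yi(2)[of j w] by (cases "j = i") auto
        with g s have "((\<lambda>(m, k). a (m, k) * (\<Prod>j\<in>UNIV. (Y w $ j - x $ j) ^ m j) * (s - t) ^ k) has_sum g (Y w) s) UNIV"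
          unfolding series_at_def by blast
        moreover have "(\<lambda>(m, k). a (m, k) * (\<Prod>j\<in>UNIV. (Y w $ j - x $ j) ^ m j) * (s - t) ^ k) = (\<lambda>\<kappa>. a \<kappa> * (w ^ e \<kappa> * T \<kappa>))"
          by (auto simp: fun_eq_iff mult.assoc split)
        ultimately show ?thesis by simp
      qed
    qed (rule y)
    then obtain D where D: "((\<lambda>w. g (Y w) s) has_real_derivative D) (at (y $ i - x $ i))"
      "((\<lambda>\<kappa>. (real (e \<kappa>) + 1) * a (S \<kappa>) * ((y $ i - x $ i) ^ e \<kappa> * T \<kappa>)) has_sum D) UNIV" by blast
    have "((\<lambda>h. g (Y ((y $ i - x $ i) + h)) s) has_real_derivative D) (at 0)"
      using D(1) DERIV_shift[of "\<lambda>w. g (Y w) s" D 0 "y $ i - x $ i"] by (simp add: add.commute)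
    then have "has_pd i (\<lambda>z. g z s) y D" by (simp add: has_pd_def Y_def)
    moreover have "(\<lambda>\<kappa>. (real (e \<kappa>) + 1) * a (S \<kappa>) * ((y $ i - x $ i) ^ e \<kappa> * T \<kappa>)) =
      (\<lambda>(m, k). ?a' (m, k) * (\<Prod>i\<in>UNIV. (y $ i - x $ i) ^ m i) * (s - t) ^ k)"
    proof -
      have "Y (y $ i - x $ i) = y" by (simp add: Y_def)
      then show ?thesis using split[of "y $ i - x $ i"] by (auto simp: fun_eq_iff mult.assoc S_def e_def)
    qed
    ultimately show ?thesis using D(2) by auto
  qed
  show "series_at ?a' r x t (\<lambda>y s. pd i (\<lambda>z. g z s) y)"
    unfolding series_at_def
  proof (intro allI impI)
    fix y s assume "(\<forall>i. \<bar>y $ i - x $ i\<bar> < r) \<and> \<bar>s - t\<bar> < r"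
    then obtain D where D: "has_pd i (\<lambda>z. g z s) y D"
      "((\<lambda>(m, k). ?a' (m, k) * (\<Prod>i\<in>UNIV. (y $ i - x $ i) ^ m i) * (s - t) ^ k) has_sum D) UNIV"
      using main by blast
    show "((\<lambda>(m, k). ?a' (m, k) * (\<Prod>i\<in>UNIV. (y $ i - x $ i) ^ m i) * (s - t) ^ k) has_sum pd i (\<lambda>z. g z s) y) UNIV"
      using D(2) has_pd_imp_pd[OF D(1)] by simp
  qed
  show "has_pd i (\<lambda>z. g z s) y (pd i (\<lambda>z. g z s) y)" if "\<And>j. \<bar>y $ j - x $ j\<bar> < r" "\<bar>s - t\<bar> < r"
    using main[OF that] has_pd_imp_pd by metis
qed

lemma series_at_dt:
  fixes g :: "real^'n::finite \<Rightarrow> real \<Rightarrow> real"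
  assumes g: "series_at a r x t g" and y: "\<And>j. \<bar>y $ j - x $ j\<bar> < r" and s: "\<bar>s - t\<bar> < r"
  shows "\<exists>D. (g y has_real_derivative D) (at s)"
proof -
  define T where "T = (\<lambda>(m::'n \<Rightarrow> nat, k::nat). (\<Prod>j\<in>UNIV. (y $ j - x $ j) ^ m j))"
  define S where "S = (\<lambda>(m::'n \<Rightarrow> nat, k::nat). (m, Suc k))"
  have "\<exists>D. ((\<lambda>w. g y (t + w)) has_real_derivative D) (at (s - t)) \<and>
     ((\<lambda>\<kappa>. (real (snd \<kappa>) + 1) * a (S \<kappa>) * ((s - t) ^ snd \<kappa> * T \<kappa>)) has_sum D) UNIV"
  proof (rule power_series_step)
    show "inj S" by (auto simp: S_def inj_def)
    show "range S = {\<kappa>. snd \<kappa> > 0}"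
    proof (intro set_eqI iffI)
      fix \<kappa> :: "('n \<Rightarrow> nat) \<times> nat" assume "\<kappa> \<in> {\<kappa>. snd \<kappa> > 0}"
      then have "\<kappa> = S (fst \<kappa>, snd \<kappa> - 1)" by (cases \<kappa>) (simp add: S_def)
      then show "\<kappa> \<in> range S" by blast
    qed (auto simp: S_def)
    show "snd (S \<kappa>) = Suc (snd \<kappa>)" "T (S \<kappa>) = T \<kappa>" for \<kappa>
      by (cases \<kappa>; simp add: S_def T_def)+
    show "((\<lambda>\<kappa>. a \<kappa> * (w ^ snd \<kappa> * T \<kappa>)) has_sum g y (t + w)) UNIV" if "\<bar>w\<bar> < r" for w
    proof -
      have "((\<lambda>(m, k). a (m, k) * (\<Prod>j\<in>UNIV. (y $ j - x $ j) ^ m j) * (t + w - t) ^ k) has_sum g y (t + w)) UNIV"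
        by (rule g[unfolded series_at_def, rule_format]) (use y that in simp)
      moreover have "(\<lambda>(m, k). a (m, k) * (\<Prod>j\<in>UNIV. (y $ j - x $ j) ^ m j) * (t + w - t) ^ k) = (\<lambda>\<kappa>. a \<kappa> * (w ^ snd \<kappa> * T \<kappa>))"
        by (auto simp: fun_eq_iff T_def mult_ac)
      ultimately show ?thesis by simp
    qed
  qed (rule s)
  then obtain D where "((\<lambda>w. g y (t + w)) has_real_derivative D) (at (s - t))" by blast
  then have "(g y has_real_derivative D) (at s)"
    using DERIV_shift[of "g y" D "s - t" t] by (simp add: add.commute)
  then show ?thesis by blast
qed

lemma locally_series_pd:
  assumes "locally_series g"
  shows "locally_series (\<lambda>y s. pd i (\<lambda>z. g z s) y)"
    and "t > 0 \<Longrightarrow> has_pd i (\<lambda>z. g z t) x (pd i (\<lambda>z. g z t) x)"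
proof -
  show "locally_series (\<lambda>y s. pd i (\<lambda>z. g z s) y)"
    unfolding locally_series_def
  proof (intro allI impI)
    fix x t assume "0 < (t::real)"
    then obtain r a where "r > 0" "series_at a r x t g" using assms unfolding locally_series_def by blast
    then show "\<exists>r>0. \<exists>a. series_at a r x t (\<lambda>y s. pd i (\<lambda>z. g z s) y)"
      using series_at_pd(1) by blast
  qed
  assume "t > 0"
  then obtain r a where r: "r > 0" "series_at a r x t g" using assms unfolding locally_series_def by blast
  show "has_pd i (\<lambda>z. g z t) x (pd i (\<lambda>z. g z t) x)"
    by (rule series_at_pd(2)[OF r(2)]) (use r in auto)
qed

lemma locally_series_dt:
  assumes "locally_series g" "t > 0"
  shows "(g x has_real_derivative deriv (g x) t) (at t)"
proof -
  obtain r a where r: "r > 0" "series_at a r x t g" using assms unfolding locally_series_def by blast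
  obtain D where D: "(g x has_real_derivative D) (at t)"
    using series_at_dt[OF r(2), of x t] r(1) by auto
  then show ?thesis using DERIV_imp_deriv by metis
qed

lemma norm_rows_le:
  fixes M :: "real^'n::finite^'m::finite"
  shows "norm M \<le> (\<Sum>i\<in>UNIV. norm (M $ i))"
  unfolding norm_vec_def[of M] by (rule L2_set_le_sum) auto

text \<open>
  The factorial bounds with \<open>|\<gamma>| \<le> 2\<close> and \<open>k \<le> 1\<close>, integrated along segments.  Analyticity enters
  because the derivatives in the bounds are defined by \<open>deriv\<close>, whose values say something about
  increments only if the derivatives exist; power series are differentiable to all orders.
\<close>

lemma analytic_consequences:
  fixes u :: "real^'n::finite \<Rightarrow> real \<Rightarrow> real" and c m R :: real
  assumes an: "analytic_pos_time u" and b: "analytic_bounds F c R m u" and t: "t > 0"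
  shows "norm (grad (\<lambda>z. u z t) x) \<le> c * m"
    and "norm (hess (\<lambda>z. u z t) x) \<le> CARD('n) * (c * m * R) * t powr (- 1 / alpha F)"
    and "\<bar>hess (\<lambda>z. u z t) (x + h *\<^sub>R axis i 1) $ i $ j - hess (\<lambda>z. u z t) x $ i $ j\<bar> \<le> 2 * c * m * R\<^sup>2 * t powr (- 2 / alpha F) * \<bar>h\<bar>"
    and "s > 0 \<Longrightarrow> \<bar>grad (\<lambda>z. u z t) x $ j - grad (\<lambda>z. u z s) x $ j\<bar> \<le> c * m * R / min s t * \<bar>t - s\<bar>"
proof -
  have B: "norm (\<chi> j. t powr (real (length \<gamma>) / alpha F) *
                pd_list \<gamma> (\<lambda>y. (t_dt ^^ k) (\<lambda>z s. pd j (\<lambda>z'. u z' s) z) y t) x)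
        \<le> c * m * R ^ (length \<gamma> + k) * fact (length \<gamma> + k)" if "t > 0" for \<gamma> k x t
    using b that unfolding analytic_bounds_def by blast
  have ser: "locally_series u" by (rule analytic_imp_locally_series[OF an])
  note ser1 = locally_series_pd(1)[OF ser]
  note ser2 = locally_series_pd(1)[OF ser1]
  have inv: "X \<le> Y * t powr (- p / alpha F)" if "t > 0" "t powr (p / alpha F) * X \<le> Y" for t p X Y
  proof -
    have "t powr (- p / alpha F) * (t powr (p / alpha F) * X) \<le> t powr (- p / alpha F) * Y"
      using that by (intro mult_left_mono) auto
    moreover have "t powr (- p / alpha F) * (t powr (p / alpha F) * X) = X"
    proof -
      have "t powr (- p / alpha F) * t powr (p / alpha F) = 1" using that by (simp flip: powr_add)
      then show ?thesis by (simp flip: mult.assoc)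
    qed
    ultimately show ?thesis by (simp only: mult.commute)
  qed
  show "norm (grad (\<lambda>z. u z t) x) \<le> c * m"
    using B[OF t, of "[]" 0 x] t by (simp add: pd_list_def grad_def)
  have row: "norm (hess (\<lambda>z. u z t) x $ i) \<le> c * m * R * t powr (- 1 / alpha F)" for i
  proof (rule inv[OF t])
    have "(\<chi> j. t powr (1 / alpha F) * pd i (\<lambda>y. pd j (\<lambda>z. u z t) y) x) = t powr (1 / alpha F) *\<^sub>R (hess (\<lambda>z. u z t) x $ i)"
      by (simp add: vec_eq_iff hess_def)
    then have "norm (\<chi> j. t powr (1 / alpha F) * pd i (\<lambda>y. pd j (\<lambda>z. u z t) y) x) = t powr (1 / alpha F) * norm (hess (\<lambda>z. u z t) x $ i)"
      by simp
    then show "t powr (1 / alpha F) * norm (hess (\<lambda>z. u z t) x $ i) \<le> c * m * R"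
      using B[OF t, of "[i]" 0 x] by (simp add: pd_list_def)
  qed
  show "norm (hess (\<lambda>z. u z t) x) \<le> CARD('n) * (c * m * R) * t powr (- 1 / alpha F)"
  proof -
    have "norm (hess (\<lambda>z. u z t) x) \<le> (\<Sum>i\<in>UNIV. norm (hess (\<lambda>z. u z t) x $ i))" by (rule norm_rows_le)
    also have "\<dots> \<le> (\<Sum>i\<in>(UNIV::'n set). c * m * R * t powr (- 1 / alpha F))" by (intro sum_mono row)
    finally show ?thesis by (simp add: mult.assoc)
  qed
  \<comment> \<open>The factor two is the factorial of the order of differentiation.\<close>
  have third: "\<bar>pd l (\<lambda>z. pd i (\<lambda>z. pd j (\<lambda>z. u z t) z) z) x\<bar> \<le> 2 * c * m * R\<^sup>2 * t powr (- 2 / alpha F)" for l i j x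
  proof (rule inv[OF t])
    let ?v = "\<chi> j. t powr (2 / alpha F) * pd l (\<lambda>z. pd i (\<lambda>z. pd j (\<lambda>z. u z t) z) z) x"
    have "\<bar>?v $ j\<bar> \<le> norm ?v" by (rule component_le_norm_cart)
    also have "\<dots> \<le> 2 * c * m * R\<^sup>2"
      using B[OF t, of "[l, i]" 0 x] by (simp add: pd_list_def power2_eq_square mult_ac)
    finally show "t powr (2 / alpha F) * \<bar>pd l (\<lambda>z. pd i (\<lambda>z. pd j (\<lambda>z. u z t) z) z) x\<bar> \<le> 2 * c * m * R\<^sup>2"
      by (simp add: abs_mult)
  qed
  show "\<bar>hess (\<lambda>z. u z t) (x + h *\<^sub>R axis i 1) $ i $ j - hess (\<lambda>z. u z t) x $ i $ j\<bar> \<le> 2 * c * m * R\<^sup>2 * t powr (- 2 / alpha F) * \<bar>h\<bar>"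
    unfolding hess_def vec_lambda_beta
    by (rule line_bound[of i _ "\<lambda>x. pd i (\<lambda>z. pd i (\<lambda>z. pd j (\<lambda>z. u z t) z) z) x"])
      (rule locally_series_pd(2)[OF ser2 t] third)+
  show "\<bar>grad (\<lambda>z. u z t) x $ j - grad (\<lambda>z. u z s) x $ j\<bar> \<le> c * m * R / min s t * \<bar>t - s\<bar>" if s: "s > 0"
  proof -
    let ?g = "\<lambda>\<tau>. pd j (\<lambda>z. u z \<tau>) x"
    have d: "(?g has_real_derivative deriv ?g \<tau>) (at \<tau>)" if "\<tau> > 0" for \<tau>
      by (rule locally_series_dt[OF ser1 that])
    have db: "\<tau> * \<bar>deriv ?g \<tau>\<bar> \<le> c * m * R" if "\<tau> > 0" for \<tau>
    proof -
      let ?v = "\<chi> j. \<tau> * deriv (\<lambda>s. pd j (\<lambda>z. u z s) x) \<tau>"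
      have "\<bar>?v $ j\<bar> \<le> norm ?v" by (rule component_le_norm_cart)
      also have "\<dots> \<le> c * m * R"
        using B[OF that, of "[]" 1 x] that by (simp add: pd_list_def t_dt_def)
      finally show ?thesis using that by (simp add: abs_mult)
    qed
    let ?I = "{min s t..max s t}"
    have "norm (?g t - ?g s) \<le> c * m * R / min s t * norm (t - s)"
    proof (rule field_differentiable_bound[of ?I _ "deriv ?g"])
      fix \<tau> assume \<tau>: "\<tau> \<in> ?I"
      then have \<tau>0: "\<tau> > 0" "min s t \<le> \<tau>" using s t by auto
      show "(?g has_field_derivative deriv ?g \<tau>) (at \<tau> within ?I)"
        using d[OF \<tau>0(1)] by (rule has_field_derivative_at_within)
      have "min s t * \<bar>deriv ?g \<tau>\<bar> \<le> \<tau> * \<bar>deriv ?g \<tau>\<bar>" using \<tau>0 by (intro mult_right_mono) auto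
      then show "norm (deriv ?g \<tau>) \<le> c * m * R / min s t"
        using db[OF \<tau>0(1)] s t by (simp add: pos_le_divide_eq mult.commute)
    qed auto
    then show ?thesis by (simp add: grad_def)
  qed
qed

section \<open>Structure of the nonlinearity\<close>

text \<open>
  The part of the nonlinearity paired with the kernel derivative in the directions \<open>l\<close>.
\<close>

definition nonlin_part :: "('n::finite) nonlin \<Rightarrow> 'n list \<Rightarrow> real^'n \<Rightarrow> real^'n^'n \<Rightarrow> real" where
  "nonlin_part N l = (case l of [] \<Rightarrow> nl0 N | [i] \<Rightarrow> nl1 N i | i # j # _ \<Rightarrow> nl2 N i j)"

text \<open>
  The number of second derivatives in each term.  Together with the derivatives on the kernel it
  always adds up to \<open>\<alpha> - 1\<close> (\<open>hess_degree_alpha\<close>), which is the scale invariance of the equation.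
\<close>

definition hess_degree :: "flow \<Rightarrow> 'n::finite list \<Rightarrow> nat" where
  "hess_degree F l = (if F = MCF then 1 else 3 - length l)"

lemma hess_degree_alpha: "l \<in> deriv_lists F \<Longrightarrow> real (hess_degree F l) + real (length l) + 1 = alpha F"
  by (cases F) (auto simp: deriv_lists_def hess_degree_def)


text \<open>
  What the Duhamel term needs to know about a term of the nonlinearity: continuity for limits,
  homogeneity in the Hessian for scaling, and growth for domination.
\<close>

definition homogeneous :: "nat \<Rightarrow> (real^'n::finite \<Rightarrow> real^'n^'n \<Rightarrow> real) \<Rightarrow> bool" where
  "homogeneous d f \<longleftrightarrow> continuous_on UNIV (\<lambda>z. f (fst z) (snd z)) \<and>
     (\<forall>c p M. f p (c *\<^sub>R M) = c ^ d * f p M) \<and> (\<exists>C\<ge>0. \<forall>p M. \<bar>f p M\<bar> \<le> C * norm M ^ d)"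

lemma homogeneous_zero: "homogeneous d (\<lambda>_ _. 0)"
  by (auto simp: homogeneous_def)

lemma homogeneous_add:
  assumes "homogeneous d f" "homogeneous d g" shows "homogeneous d (\<lambda>p M. f p M + g p M)"
proof -
  obtain C D where CD: "C \<ge> 0" "\<And>p M. \<bar>f p M\<bar> \<le> C * norm M ^ d" "D \<ge> 0" "\<And>p M. \<bar>g p M\<bar> \<le> D * norm M ^ d"
    using assms unfolding homogeneous_def by blast
  have "\<bar>f p M + g p M\<bar> \<le> (C + D) * norm M ^ d" for p M
    using CD(2)[of p M] CD(4)[of p M] by (simp add: distrib_right)
  then show ?thesis using assms CD unfolding homogeneous_def
    by (intro conjI continuous_on_add exI[of _ "C + D"]) (auto simp: distrib_left)
qed

lemma homogeneous_cmult:
  assumes "homogeneous d f" shows "homogeneous d (\<lambda>p M. c * f p M)"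
proof -
  obtain C where C: "C \<ge> 0" "\<And>p M. \<bar>f p M\<bar> \<le> C * norm M ^ d"
    using assms unfolding homogeneous_def by blast
  have "\<bar>c * f p M\<bar> \<le> \<bar>c\<bar> * C * norm M ^ d" for p M
    using mult_left_mono[OF C(2)[of p M], of "\<bar>c\<bar>"] by (simp add: abs_mult mult.assoc)
  then show ?thesis using assms C unfolding homogeneous_def
    by (intro conjI continuous_on_mult_left exI[of _ "\<bar>c\<bar> * C"]) auto
qed

lemma homogeneous_sum: "finite T \<Longrightarrow> (\<And>i. i \<in> T \<Longrightarrow> homogeneous d (f i)) \<Longrightarrow> homogeneous d (\<lambda>p M. \<Sum>i\<in>T. f i p M)"
  by (induction rule: finite_induct) (simp_all add: homogeneous_zero homogeneous_add)

lemma homogeneous_lin_combs: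
  assumes "f \<in> lin_combs S" "\<And>g. g \<in> S \<Longrightarrow> homogeneous d g" shows "homogeneous d f"
proof -
  obtain T c where T: "finite T" "T \<subseteq> S" "f = (\<lambda>p M. \<Sum>g\<in>T. c g * g p M)"
    using assms(1) unfolding lin_combs_def by blast
  show ?thesis unfolding T(3)
    by (rule homogeneous_sum[OF T(1)], rule homogeneous_cmult, rule assms(2)) (use T(2) in blast)
qed

text \<open>
  The weights \<open>w\<^sup>-\<^sup>2\<^sup>k P\<^sub>j (\<nabla>u)\<close> with \<open>j \<le> 2 k\<close> are such factors (\<open>grad_mono_le_1\<close>).
\<close>

lemma homogeneous_mult_gradient_factor:
  assumes f: "homogeneous d f" and q: "continuous_on UNIV q" "\<And>p. \<bar>q p\<bar> \<le> 1"
  shows "homogeneous d (\<lambda>p M. f p M * q p)"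
proof -
  obtain C where C: "C \<ge> 0" "\<And>p M. \<bar>f p M\<bar> \<le> C * norm M ^ d"
    using f unfolding homogeneous_def by blast
  have "\<bar>f p M * q p\<bar> \<le> C * norm M ^ d" for p M
    using mult_mono[OF C(2)[of p M] q(2)[of p]] C(1) by (simp add: abs_mult)
  moreover have "continuous_on UNIV (\<lambda>z. f (fst z) (snd z) * q (fst z))"
    using f unfolding homogeneous_def
    by (intro continuous_on_mult continuous_on_compose2[OF q(1)] continuous_on_fst continuous_on_id) auto
  ultimately show ?thesis using f C unfolding homogeneous_def by auto
qed

lemma homogeneous_mult_entry:
  assumes f: "homogeneous d f" shows "homogeneous (Suc d) (\<lambda>p M. f p M * M $ a $ b)"
proof -
  obtain C where C: "C \<ge> 0" "\<And>p M. \<bar>f p M\<bar> \<le> C * norm M ^ d"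
    using f unfolding homogeneous_def by blast
  have e: "\<bar>M $ a $ b\<bar> \<le> norm M" for M :: "real^'a^'a"
    using component_le_norm_cart[of "M $ a" b] Finite_Cartesian_Product.norm_nth_le[of M a] by linarith
  have "\<bar>f p M * M $ a $ b\<bar> \<le> C * norm M ^ Suc d" for p M
    using mult_mono[OF C(2)[of p M] e[of M]] C(1) by (simp add: abs_mult mult_ac)
  moreover have "continuous_on UNIV (\<lambda>z. f (fst z) (snd z) * snd z $ a $ b)"
    using f unfolding homogeneous_def by (intro continuous_intros) auto
  ultimately show ?thesis using f C unfolding homogeneous_def by (auto simp: mult_ac)
qed

lemma homogeneous_entry: "homogeneous 1 (\<lambda>p M. M $ a $ b)"
proof -
  have "homogeneous 0 (\<lambda>p M. 1)" unfolding homogeneous_def by (auto intro: exI[of _ 1])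
  from homogeneous_mult_entry[OF this] show ?thesis by simp
qed

lemma grad_mono_continuous: "continuous_on UNIV (grad_mono k is)"
proof -
  have "continuous_on UNIV (\<lambda>p::real^'a. prod_list (map (\<lambda>i. p $ i) is))"
    by (induction "is") (auto intro!: continuous_intros)
  moreover have "(1 + (norm p)\<^sup>2) ^ k \<noteq> 0" for p :: "real^'a"
    by (metis add_nonneg_eq_0_iff power_not_zero zero_le_one zero_le_power2 zero_neq_one)
  ultimately show ?thesis unfolding grad_mono_def by (intro continuous_intros) auto
qed

lemma grad_mono_le_1:
  assumes "length is \<le> 2 * k" shows "\<bar>grad_mono k is p\<bar> \<le> 1"
proof -
  have a: "\<bar>prod_list (map (\<lambda>i. p $ i) is)\<bar> \<le> norm p ^ length is"
  proof (induction "is")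
    case (Cons i l)
    then show ?case using mult_mono[OF component_le_norm_cart[of p i] Cons] by (simp add: abs_mult)
  qed simp
  have b: "norm p ^ length is \<le> (1 + (norm p)\<^sup>2) ^ k"
  proof (cases "norm p \<le> 1")
    case True
    then have "norm p ^ length is \<le> 1" by (simp add: power_le_one)
    also have "1 \<le> (1 + (norm p)\<^sup>2) ^ k" by (rule one_le_power) simp
    finally show ?thesis .
  next
    case False
    then have "norm p ^ length is \<le> norm p ^ (2 * k)" using assms by (intro power_increasing) auto
    also have "\<dots> = ((norm p)\<^sup>2) ^ k" by (simp add: power_mult)
    also have "\<dots> \<le> (1 + (norm p)\<^sup>2) ^ k" by (intro power_mono) auto
    finally show ?thesis .
  qed
  have "(1 + (norm p)\<^sup>2) ^ k > 0" by (intro zero_less_power) (simp add: add_pos_nonneg)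
  then show ?thesis using order_trans[OF a b] by (simp add: grad_mono_def abs_divide)
qed

lemma homogeneous_terms:
  "g \<in> terms0 \<Longrightarrow> homogeneous 3 g" "g \<in> terms1 \<Longrightarrow> homogeneous 2 g" "g \<in> terms2 \<Longrightarrow> homogeneous 1 g"
proof -
  note m = homogeneous_mult_gradient_factor[OF _ grad_mono_continuous grad_mono_le_1]
  have e2: "homogeneous 2 (\<lambda>p M. M $ a $ b * M $ c $ d)" for a b c d
    using homogeneous_mult_entry[OF homogeneous_entry] by (simp add: numeral_2_eq_2)
  have e3: "homogeneous 3 (\<lambda>p M. M $ a $ b * M $ c $ d * M $ e $ f)" for a b c d e f
    using homogeneous_mult_entry[OF e2] by (simp add: numeral_3_eq_3 numeral_2_eq_2)
  show "homogeneous 3 g" if g: "g \<in> terms0"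
  proof -
    from g obtain a b c d e f k "is" where g: "g = (\<lambda>p M. M $ a $ b * M $ c $ d * M $ e $ f * grad_mono k is p)"
      and k: "1 \<le> k" "length is = 2 * k - 2" unfolding terms0_def by blast
    show ?thesis unfolding g by (rule m[OF e3]) (use k in simp)
  qed
  show "homogeneous 2 g" if g: "g \<in> terms1"
  proof -
    from g obtain a b c d k "is" where g: "g = (\<lambda>p M. M $ a $ b * M $ c $ d * grad_mono k is p)"
      and k: "1 \<le> k" "length is = 2 * k - 1" unfolding terms1_def by blast
    show ?thesis unfolding g by (rule m[OF e2]) (use k in simp)
  qed
  show "homogeneous 1 g" if g: "g \<in> terms2"
  proof -
    from g obtain a b k "is" where g: "g = (\<lambda>p M. M $ a $ b * grad_mono k is p)"
      and k: "1 \<le> k" "length is = 2 * k" unfolding terms2_def by blast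
    show ?thesis unfolding g by (rule m[OF homogeneous_entry]) (use k in simp)
  qed
qed

lemma homogeneous_mcf: "homogeneous 1 (nl0 mcf_nonlin)"
proof -
  have eq: "nl0 mcf_nonlin = (\<lambda>p M. \<Sum>i\<in>UNIV. \<Sum>j\<in>UNIV. (- 1) * (M $ i $ j * grad_mono 1 [i, j] p))"
    unfolding mcf_nonlin_def nonlin.simps
    by (intro ext) (simp add: grad_mono_def sum_divide_distrib sum_negf mult_ac)
  show ?thesis unfolding eq
    by (intro homogeneous_sum homogeneous_cmult homogeneous_mult_gradient_factor[OF homogeneous_entry grad_mono_continuous grad_mono_le_1]) auto
qed

lemma homogeneous_nonlin_part:
  assumes "nonlin_form F N" "l \<in> deriv_lists F"
  shows "homogeneous (hess_degree F l) (nonlin_part N l)"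
proof (cases "F = MCF")
  case True
  then show ?thesis using assms homogeneous_mcf by (auto simp: deriv_lists_def hess_degree_def nonlin_part_def)
next
  case False
  have n0: "homogeneous 3 (nl0 N)"
  proof (cases F)
    case SD
    then have "nl0 N = (\<lambda>_ _. 0)" using assms by simp
    then show ?thesis using homogeneous_zero by metis
  next
    case WF
    then show ?thesis using assms homogeneous_lin_combs[OF _ homogeneous_terms(1)] by auto
  qed (use False in simp)
  have n1: "homogeneous 2 (nl1 N i)" for i
    by (rule homogeneous_lin_combs[OF _ homogeneous_terms(2)]) (use assms False in \<open>cases F; auto\<close>)
  have n2: "homogeneous 1 (nl2 N i j)" for i j
    by (rule homogeneous_lin_combs[OF _ homogeneous_terms(3)]) (use assms False in \<open>cases F; auto\<close>)
  have "length l \<le> 2" using assms(2) False by (simp add: deriv_lists_def)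
  then consider "l = []" | i where "l = [i]" | i j where "l = [i, j]"
    by (metis One_nat_def Suc_1 le_SucE le_zero_eq length_0_conv length_Suc_conv)
  then show ?thesis using n0 n1 n2 False by cases (auto simp: nonlin_part_def hess_degree_def)
qed

lemma sum_lists_le_2:
  "(\<Sum>l | length (l::'n::finite list) \<le> 2. f l) = f [] + (\<Sum>i\<in>UNIV. f [i]) + (\<Sum>i\<in>UNIV. \<Sum>j\<in>UNIV. (f [i, j] :: real))"
proof -
  have eq: "{l::'n list. length l \<le> 2} = {[]} \<union> range (\<lambda>i. [i]) \<union> range (\<lambda>(i, j). [i, j])"
  proof (intro set_eqI iffI)
    fix l :: "'n list" assume "l \<in> {l. length l \<le> 2}"
    then consider "l = []" | i where "l = [i]" | i j where "l = [i, j]"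
      by (metis One_nat_def Suc_1 le_SucE le_zero_eq length_0_conv length_Suc_conv mem_Collect_eq)
    then show "l \<in> {[]} \<union> range (\<lambda>i. [i]) \<union> range (\<lambda>(i, j). [i, j])" by cases auto
  qed auto
  have "(\<Sum>l | length (l::'n list) \<le> 2. f l) = sum f {[]} + sum f (range (\<lambda>i. [i])) + sum f (range (\<lambda>(i, j). [i, j]))"
  proof -
    have "sum f ({[]} \<union> range (\<lambda>i. [i]) \<union> range (\<lambda>(i, j). [i, j])) =
        sum f ({[]} \<union> range (\<lambda>i. [i])) + sum f (range (\<lambda>(i, j). [i, j]))"
      by (rule sum.union_disjoint) auto
    also have "sum f ({[]} \<union> range (\<lambda>i. [i])) = sum f {[]} + sum f (range (\<lambda>i. [i]))"
      by (rule sum.union_disjoint) auto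
    finally show ?thesis unfolding eq .
  qed
  also have "sum f (range (\<lambda>i. [i])) = (\<Sum>i\<in>UNIV. f [i])"
    by (subst sum.reindex) (auto simp: inj_def)
  also have "sum f (range (\<lambda>(i, j). [i, j])) = (\<Sum>i\<in>UNIV. \<Sum>j\<in>UNIV. f [i, j])"
    by (subst sum.reindex) (auto simp: inj_def sum.cartesian_product UNIV_Times_UNIV case_prod_unfold)
  finally show ?thesis by simp
qed

lemma duhamel_integrand_expand:
  assumes "nonlin_form F N"
  shows "duhamel_integrand F N u x t s y =
    (\<Sum>l\<in>deriv_lists F. pd_list l (\<lambda>z. kernel F z (t - s)) (x - y) * nonlin_part N l (grad (\<lambda>z. u z s) y) (hess (\<lambda>z. u z s) y))"
proof (cases "F = MCF")
  case True
  then show ?thesis using assms by (simp add: duhamel_integrand_def deriv_lists_def nonlin_part_def pd_list_def mcf_nonlin_def Let_def)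
next
  case False
  then show ?thesis by (simp add: duhamel_integrand_def deriv_lists_def sum_lists_le_2 nonlin_part_def pd_list_def Let_def)
qed

section \<open>The linear evolution and the Duhamel term\<close>

lemma Beta_integrable_scaled:
  fixes a b t :: real
  assumes "0 \<le> a" "a < 1" "0 \<le> b" "b < 1" "t > 0"
  shows "integrable lborel (\<lambda>s. indicator {0<..<t} s * ((t - s) powr (- a) * s powr (- b)))"
proof -
  let ?f = "\<lambda>s. indicator {0<..<t} s * ((t - s) powr (- a) * s powr (- b))"
  have B: "integrable lborel (\<lambda>\<sigma>. indicator {0..1} \<sigma> *\<^sub>R (\<sigma> powr ((1 - b) - 1) * (1 - \<sigma>) powr ((1 - a) - 1)))"
    using integrable_Beta[of "1 - b" "1 - a"] assms unfolding set_integrable_def by simp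
  have "?f (0 + t * \<sigma>) = t powr (- a) * t powr (- b) * (indicator {0..1} \<sigma> *\<^sub>R (\<sigma> powr ((1 - b) - 1) * (1 - \<sigma>) powr ((1 - a) - 1)))" for \<sigma>
  proof (cases "0 < \<sigma> \<and> \<sigma> < 1")
    case True
    have "t - t * \<sigma> = t * (1 - \<sigma>)" by (simp add: algebra_simps)
    then show ?thesis using True assms(5) by (simp add: powr_mult)
  next
    case False
    then have "\<not> (0 < t * \<sigma> \<and> t * \<sigma> < t)" using assms(5) by (simp add: zero_less_mult_iff)
    moreover have "\<sigma> = 0 \<or> \<sigma> = 1 \<or> \<sigma> \<notin> {0..1}" using False by auto
    ultimately show ?thesis by auto
  qed
  then have "integrable lborel (\<lambda>\<sigma>. ?f (0 + t * \<sigma>))" using B by simp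
  then show ?thesis using lborel_integrable_real_affine_iff[of t ?f 0] assms(5) by blast
qed

text \<open>
  Projections as Borel maps on the product space, whose Borel algebra is not literally the product
  algebra that the measurability prover works with.
\<close>

lemma borel_measurable_fst_snd [measurable]:
  "(fst :: 'a::euclidean_space \<times> 'b::euclidean_space \<Rightarrow> 'a) \<in> borel_measurable borel"
  "(snd :: 'a::euclidean_space \<times> 'b::euclidean_space \<Rightarrow> 'b) \<in> borel_measurable borel"
  by (auto intro!: borel_measurable_continuous_onI continuous_intros)

text \<open>
  All three flows are treated at once through the lists of kernel derivatives.
\<close>

locale flow_form =
  fixes F :: flow and N :: "('n::finite) nonlin"
  assumes form: "nonlin_form F N"
begin

abbreviation \<alpha> :: real where "\<alpha> \<equiv> alpha F"

definition kern1 :: "'n list \<Rightarrow> real^'n \<Rightarrow> real" where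
  "kern1 l z = pd_list l (\<lambda>z. kernel F z 1) z"

definition kern :: "'n list \<Rightarrow> real^'n \<Rightarrow> real \<Rightarrow> real" where
  "kern l z t = pd_list l (\<lambda>z. kernel F z t) z"

lemma alpha_ge_2: "\<alpha> \<ge> 2" by (cases F) auto

lemma alpha_pos: "\<alpha> > 0" using alpha_ge_2 by simp

lemma Nil_deriv_lists: "[] \<in> (deriv_lists F :: 'n list set)" by (simp add: deriv_lists_def)

lemma kern1_measurable: "l \<in> deriv_lists F \<Longrightarrow> kern1 l \<in> borel_measurable borel"
  using kernel_measurable[of l F] by (simp add: kern1_def[abs_def])

lemma kern1_decay: "l \<in> deriv_lists F \<Longrightarrow> \<exists>C\<ge>0. \<forall>z. \<bar>kern1 l z\<bar> \<le> C / (1 + norm z) ^ m"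
  unfolding kern1_def by (rule kernel_decay)

lemma kern1_weighted_integrable:
  assumes l: "l \<in> deriv_lists F"
  shows "integrable lborel (\<lambda>z. (1 + norm z) * \<bar>kern1 l z\<bar>)"
proof -
  let ?m = "CARD('n) + 2"
  obtain C where C: "C \<ge> 0" "\<And>z. \<bar>kern1 l z\<bar> \<le> C / (1 + norm z) ^ Suc ?m" using kern1_decay[OF l] by blast
  show ?thesis
  proof (rule Bochner_Integration.integrable_bound[of lborel "\<lambda>z. C * (1 / (1 + norm z) ^ ?m)"])
    show "integrable lborel (\<lambda>z::real^'n. C * (1 / (1 + norm z) ^ ?m))"
      by (intro integrable_mult_right integrable_decay) simp
    show "(\<lambda>z. (1 + norm z) * \<bar>kern1 l z\<bar>) \<in> borel_measurable lborel"
      using kern1_measurable[OF l] by simp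
    show "AE z in lborel. norm ((1 + norm z) * \<bar>kern1 l z\<bar>) \<le> norm (C * (1 / (1 + norm z) ^ ?m))"
    proof (intro AE_I2)
      fix z :: "real^'n"
      have p: "1 + norm z > 0" by (simp add: add_pos_nonneg)
      have "(1 + norm z) * \<bar>kern1 l z\<bar> \<le> (1 + norm z) * (C / (1 + norm z) ^ Suc ?m)"
        using p by (intro mult_left_mono C) auto
      also have "\<dots> = C * (1 / (1 + norm z) ^ ?m)" unfolding power_Suc[of _ ?m] using p by simp
      finally show "norm ((1 + norm z) * \<bar>kern1 l z\<bar>) \<le> norm (C * (1 / (1 + norm z) ^ ?m))"
        using C(1) by (simp add: abs_of_nonneg)
    qed
  qed
qed

lemma kern1_integrable:
  assumes l: "l \<in> deriv_lists F" shows "integrable lborel (kern1 l)"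
proof (rule Bochner_Integration.integrable_bound[OF kern1_weighted_integrable[OF l]])
  show "AE z in lborel. norm (kern1 l z) \<le> norm ((1 + norm z) * \<bar>kern1 l z\<bar>)"
  proof (intro AE_I2)
    show "norm (kern1 l z) \<le> norm ((1 + norm z) * \<bar>kern1 l z\<bar>)" for z
      using mult_right_mono[of 1 "1 + norm z" "\<bar>kern1 l z\<bar>"] by (simp add: abs_mult)
  qed
qed (use kern1_measurable[OF l] in simp)

lemma kern_scale:
  assumes "l \<in> deriv_lists F" "t > 0"
  shows "kern l z t = t powr (- (real CARD('n) + length l) / \<alpha>) * kern1 l (t powr (- 1 / \<alpha>) *\<^sub>R z)"
  unfolding kern_def kern1_def by (rule kernel_scale[OF assms])

lemma kern_rescale:
  assumes l: "l \<in> deriv_lists F" and c: "c > 0" and t: "t > 0"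
  shows "kern l (c *\<^sub>R z) (c powr \<alpha> * t) = c powr (- (real CARD('n) + length l)) * kern l z t"
proof -
  have t': "c powr \<alpha> * t > 0" using c t by simp
  have 1: "(c powr \<alpha> * t) powr (p / \<alpha>) = c powr p * t powr (p / \<alpha>)" for p
    using c t alpha_pos by (simp add: powr_mult powr_powr)
  have 2: "(c powr \<alpha> * t) powr (- 1 / \<alpha>) * c = t powr (- 1 / \<alpha>)"
  proof -
    have "c powr (- 1) * c = 1" using c by (simp add: powr_neg_one)
    then have "(c powr (- 1) * t powr (- 1 / \<alpha>)) * c = t powr (- 1 / \<alpha>)" by (simp add: mult_ac)
    then show ?thesis unfolding 1[of "- 1"] .
  qed
  show ?thesis
    unfolding kern_scale[OF l t'] kern_scale[OF l t] 1[of "- (real CARD('n) + length l)"]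
    by (simp only: scaleR_scaleR 2 mult.assoc)
qed

text \<open>
  The total integral of the kernel, by which constants are multiplied under the linear evolution.
  It is one for both kernels, but keeping it abstract avoids computing it.
\<close>

definition mass :: real where "mass = (\<integral>z. kern1 [] z \<partial>lborel)"

text \<open>
  The substitution \<open>y = x - t powr (1 / \<alpha>) z\<close>, which reduces everything to the kernel at time one.
\<close>

lemma kern_substitution:
  assumes l: "l \<in> deriv_lists F" and t: "t > 0" and q: "q \<in> borel_measurable borel"
  shows "(\<integral>y. kern l (x - y) t * q y \<partial>lborel) = t powr (- (length l) / \<alpha>) * (\<integral>z. kern1 l z * q (x - t powr (1 / \<alpha>) *\<^sub>R z) \<partial>lborel)"
    and "integrable lborel (\<lambda>y. kern l (x - y) t * q y) \<longleftrightarrow> integrable lborel (\<lambda>z. kern1 l z * q (x - t powr (1 / \<alpha>) *\<^sub>R z))"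
proof -
  define r where "r = t powr (1 / \<alpha>)"
  have r: "r > 0" using t by (simp add: r_def)
  have kr: "t powr (- 1 / \<alpha>) * r = 1" using t by (simp add: r_def flip: powr_add)
  have rn: "r ^ CARD('n) = t powr (real CARD('n) / \<alpha>)" using t by (simp add: r_def powr_power)
  have e: "kern l (x - (x + (- r) *\<^sub>R z)) t * q (x + (- r) *\<^sub>R z) =
      t powr (- (real CARD('n) + length l) / \<alpha>) * (kern1 l z * q (x - r *\<^sub>R z))" for z
    using kr by (simp add: kern_scale[OF l t])
  note kern1_measurable[OF l, measurable] q[measurable]
  have m: "(\<lambda>y. kern l (x - y) t * q y) \<in> borel_measurable borel"
    unfolding kern_scale[OF l t] by measurable
  have c: "- r \<noteq> 0" using r by simp
  have "(\<integral>y. kern l (x - y) t * q y \<partial>lborel) = r ^ CARD('n) * (t powr (- (real CARD('n) + length l) / \<alpha>) * (\<integral>z. kern1 l z * q (x - r *\<^sub>R z) \<partial>lborel))"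
    unfolding lborel_affine_integral(1)[OF m c, of x] e using r by simp
  also have "\<dots> = t powr (- (length l) / \<alpha>) * (\<integral>z. kern1 l z * q (x - r *\<^sub>R z) \<partial>lborel)"
  proof -
    have "real CARD('n) / \<alpha> + - (real CARD('n) + length l) / \<alpha> = - (length l) / \<alpha>"
      by (simp add: add_divide_distrib diff_divide_distrib)
    then have "t powr (real CARD('n) / \<alpha>) * t powr (- (real CARD('n) + length l) / \<alpha>) = t powr (- (length l) / \<alpha>)"
      using t by (simp only: powr_add[symmetric])
    then show ?thesis unfolding rn by (simp only: mult.assoc[symmetric])
  qed
  finally show "(\<integral>y. kern l (x - y) t * q y \<partial>lborel) = t powr (- (length l) / \<alpha>) * (\<integral>z. kern1 l z * q (x - t powr (1 / \<alpha>) *\<^sub>R z) \<partial>lborel)"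
    by (simp only: r_def)
  show "integrable lborel (\<lambda>y. kern l (x - y) t * q y) \<longleftrightarrow> integrable lborel (\<lambda>z. kern1 l z * q (x - t powr (1 / \<alpha>) *\<^sub>R z))"
    unfolding lborel_affine_integral(2)[OF m c, of x, symmetric] e using t by (simp add: r_def)
qed

lemma kern_measurable:
  assumes l: "l \<in> deriv_lists F" and t: "t > 0" shows "(\<lambda>y. kern l (x - y) t) \<in> borel_measurable borel"
proof -
  note kern1_measurable[OF l, measurable]
  show ?thesis unfolding kern_scale[OF l t] by measurable
qed

lemma kern_abs_integral:
  assumes l: "l \<in> deriv_lists F" and t: "t > 0"
  shows "integrable lborel (\<lambda>y. kern l (x - y) t)"
    "(\<integral>y. \<bar>kern l (x - y) t\<bar> \<partial>lborel) = t powr (- (length l) / \<alpha>) * (\<integral>z. \<bar>kern1 l z\<bar> \<partial>lborel)"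
proof -
  show "integrable lborel (\<lambda>y. kern l (x - y) t)"
    using kern_substitution(2)[OF l t, of "\<lambda>_. 1" x] kern1_integrable[OF l] by simp
  define q where "q y = sgn (kern l (x - y) t)" for y
  have qm: "q \<in> borel_measurable borel" unfolding q_def using kern_measurable[OF l t] by simp
  have "q (x - t powr (1 / \<alpha>) *\<^sub>R z) = sgn (kern1 l z)" for z
  proof -
    have "t powr (- 1 / \<alpha>) * t powr (1 / \<alpha>) = 1" using t by (simp flip: powr_add)
    then show ?thesis unfolding q_def kern_scale[OF l t] using t by (simp add: sgn_mult)
  qed
  then show "(\<integral>y. \<bar>kern l (x - y) t\<bar> \<partial>lborel) = t powr (- (length l) / \<alpha>) * (\<integral>z. \<bar>kern1 l z\<bar> \<partial>lborel)"
    using kern_substitution(1)[OF l t qm, of x] by (simp add: q_def abs_sgn[symmetric])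
qed

text \<open>
  Lipschitz data grow at most linearly, and the kernel integrates \<open>1 + norm y\<close>; so the linear
  evolution is an absolutely convergent integral, stable under dominated pointwise limits.
\<close>

definition linear_part :: "(real^'n \<Rightarrow> real) \<Rightarrow> real^'n \<Rightarrow> real \<Rightarrow> real" where
  "linear_part f x t = (\<integral>y. kern [] (x - y) t * f y \<partial>lborel)"

lemma linear_part_dominant:
  assumes t: "t > 0"
  shows "integrable lborel (\<lambda>y. kern [] (x - y) t * (A + B * norm y))"
proof -
  define r where "r = t powr (1 / \<alpha>)"
  have r: "r > 0" using t by (simp add: r_def)
  note kern1_measurable[OF Nil_deriv_lists, measurable]
  have "integrable lborel (\<lambda>z. kern1 [] z * (A + B * norm (x - r *\<^sub>R z)))"
  proof (rule Bochner_Integration.integrable_bound[OF integrable_mult_right[OF kern1_weighted_integrable[OF Nil_deriv_lists], of "\<bar>A\<bar> + \<bar>B\<bar> * (norm x + r)"]])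
    show "AE z in lborel. norm (kern1 [] z * (A + B * norm (x - r *\<^sub>R z))) \<le> norm ((\<bar>A\<bar> + \<bar>B\<bar> * (norm x + r)) * ((1 + norm z) * \<bar>kern1 [] z\<bar>))"
    proof (intro AE_I2)
      fix z :: "real^'n"
      have "norm (x - r *\<^sub>R z) \<le> norm x + r * norm z" using norm_triangle_ineq4[of x "r *\<^sub>R z"] r by simp
      also have "\<dots> \<le> (norm x + r) * (1 + norm z)" using r by (simp add: algebra_simps)
      finally have n: "norm (x - r *\<^sub>R z) \<le> (norm x + r) * (1 + norm z)" .
      have "\<bar>A + B * norm (x - r *\<^sub>R z)\<bar> \<le> \<bar>A\<bar> + \<bar>B\<bar> * norm (x - r *\<^sub>R z)"
        using abs_triangle_ineq[of A "B * norm (x - r *\<^sub>R z)"] by (simp add: abs_mult)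
      also have "\<dots> \<le> \<bar>A\<bar> * (1 + norm z) + \<bar>B\<bar> * ((norm x + r) * (1 + norm z))"
        using mult_left_mono[of 1 "1 + norm z" "\<bar>A\<bar>"] by (intro add_mono mult_left_mono n) auto
      also have "\<dots> = (\<bar>A\<bar> + \<bar>B\<bar> * (norm x + r)) * (1 + norm z)" by (simp add: algebra_simps)
      finally have "\<bar>kern1 [] z\<bar> * \<bar>A + B * norm (x - r *\<^sub>R z)\<bar> \<le> \<bar>kern1 [] z\<bar> * ((\<bar>A\<bar> + \<bar>B\<bar> * (norm x + r)) * (1 + norm z))"
        by (intro mult_left_mono) auto
      then show "norm (kern1 [] z * (A + B * norm (x - r *\<^sub>R z))) \<le> norm ((\<bar>A\<bar> + \<bar>B\<bar> * (norm x + r)) * ((1 + norm z) * \<bar>kern1 [] z\<bar>))"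
        using r by (simp add: abs_mult mult_ac)
    qed
  qed measurable
  then show ?thesis using kern_substitution(2)[OF Nil_deriv_lists t, of "\<lambda>y. A + B * norm y" x] by (simp add: r_def)
qed

lemma linear_part_integrable:
  assumes t: "t > 0" and f: "f \<in> borel_measurable borel" "\<And>y. \<bar>f y\<bar> \<le> A + B * norm y"
  shows "integrable lborel (\<lambda>y. kern [] (x - y) t * f y)"
proof (rule Bochner_Integration.integrable_bound[OF linear_part_dominant[OF t]])
  show "AE y in lborel. norm (kern [] (x - y) t * f y) \<le> norm (kern [] (x - y) t * (A + B * norm y))"
  proof (intro AE_I2)
    fix y
    have "\<bar>f y\<bar> \<le> \<bar>A + B * norm y\<bar>" using f(2)[of y] by linarith
    then show "norm (kern [] (x - y) t * f y) \<le> norm (kern [] (x - y) t * (A + B * norm y))"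
      by (simp add: abs_mult mult_left_mono)
  qed
qed (use kern_measurable[OF Nil_deriv_lists t] f in simp)

lemma linear_part_converges:
  assumes t: "t > 0" and f: "\<And>j. f j \<in> borel_measurable borel" "\<And>j y. \<bar>f j y\<bar> \<le> A + B * norm y"
    and g: "\<And>y. (\<lambda>j. f j y) \<longlonglongrightarrow> g y"
  shows "(\<lambda>j. linear_part (f j) x t) \<longlonglongrightarrow> linear_part g x t"
proof -
  have gm: "g \<in> borel_measurable borel" by (rule borel_measurable_LIMSEQ_real[OF g f(1)])
  note kern_measurable[OF Nil_deriv_lists t, measurable] gm[measurable] f(1)[measurable]
  show ?thesis
    unfolding linear_part_def
  proof (rule integral_dominated_convergence[OF _ _ integrable_abs[OF linear_part_dominant[OF t, of x A B]]])
    show "AE y in lborel. (\<lambda>j. kern [] (x - y) t * f j y) \<longlonglongrightarrow> kern [] (x - y) t * g y"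
      by (intro AE_I2 tendsto_mult_left g)
    show "AE y in lborel. norm (kern [] (x - y) t * f j y) \<le> \<bar>kern [] (x - y) t * (A + B * norm y)\<bar>" for j
    proof (intro AE_I2)
      fix y
      have "\<bar>f j y\<bar> \<le> \<bar>A + B * norm y\<bar>" using f(2)[of j y] by linarith
      then show "norm (kern [] (x - y) t * f j y) \<le> \<bar>kern [] (x - y) t * (A + B * norm y)\<bar>"
        by (simp add: abs_mult mult_left_mono)
    qed
  qed measurable
qed

lemma linear_part_rescale:
  assumes t: "t > 0" and c: "c > 0" and f: "f \<in> borel_measurable borel" "\<And>y. \<bar>f y\<bar> \<le> A + B * norm y"
  shows "linear_part (\<lambda>y. f (x + c *\<^sub>R y) / c - \<kappa>) z t = linear_part f (x + c *\<^sub>R z) (c powr \<alpha> * t) / c - mass * \<kappa>"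
proof -
  note f(1)[measurable]
  have t': "c powr \<alpha> * t > 0" using c t by simp
  define r where "r = t powr (1 / \<alpha>)"
  have r': "(c powr \<alpha> * t) powr (1 / \<alpha>) = c * r"
    using c t alpha_pos by (simp add: powr_mult powr_powr r_def)
  let ?X = "x + c *\<^sub>R z"
  have e: "x + c *\<^sub>R (z - r *\<^sub>R \<zeta>) = ?X - (c * r) *\<^sub>R \<zeta>" for \<zeta> by (simp add: algebra_simps)
  have i: "integrable lborel (\<lambda>\<zeta>. kern1 [] \<zeta> * f (?X - (c * r) *\<^sub>R \<zeta>))"
    using linear_part_integrable[OF t' f, of ?X] kern_substitution(2)[OF Nil_deriv_lists t' f(1), of ?X] by (simp add: r')
  have m: "(\<lambda>y. f (x + c *\<^sub>R y) / c - \<kappa>) \<in> borel_measurable borel" by measurable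
  have "linear_part (\<lambda>y. f (x + c *\<^sub>R y) / c - \<kappa>) z t = (\<integral>\<zeta>. kern1 [] \<zeta> * (f (?X - (c * r) *\<^sub>R \<zeta>) / c - \<kappa>) \<partial>lborel)"
    using kern_substitution(1)[OF Nil_deriv_lists t m, of z] t by (simp add: linear_part_def r_def[symmetric] e)
  also have "\<dots> = (\<integral>\<zeta>. kern1 [] \<zeta> * f (?X - (c * r) *\<^sub>R \<zeta>) / c - kern1 [] \<zeta> * \<kappa> \<partial>lborel)"
    by (simp add: right_diff_distrib)
  also have "\<dots> = (\<integral>\<zeta>. kern1 [] \<zeta> * f (?X - (c * r) *\<^sub>R \<zeta>) \<partial>lborel) / c - mass * \<kappa>"
    using i kern1_integrable[OF Nil_deriv_lists] by (simp add: mass_def)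
  also have "(\<integral>\<zeta>. kern1 [] \<zeta> * f (?X - (c * r) *\<^sub>R \<zeta>) \<partial>lborel) = linear_part f ?X (c powr \<alpha> * t)"
    using kern_substitution(1)[OF Nil_deriv_lists t' f(1), of ?X] c t by (simp add: linear_part_def r')
  finally show ?thesis .
qed

text \<open>
  The integrand depends on \<open>u\<close> through its gradient and Hessian only.  Taking these as independent
  fields \<open>P\<close> and \<open>M\<close> lets limits be formed before it is known that the limit fields are derivatives.
\<close>

definition integrand :: "(real^'n \<Rightarrow> real \<Rightarrow> real^'n) \<Rightarrow> (real^'n \<Rightarrow> real \<Rightarrow> real^'n^'n) \<Rightarrow> real^'n \<Rightarrow> real \<Rightarrow> real \<Rightarrow> real^'n \<Rightarrow> real" where
  "integrand P M x t s y = (\<Sum>l\<in>deriv_lists F. kern l (x - y) (t - s) * nonlin_part N l (P y s) (M y s))"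

definition duhamel :: "(real^'n \<Rightarrow> real \<Rightarrow> real^'n) \<Rightarrow> (real^'n \<Rightarrow> real \<Rightarrow> real^'n^'n) \<Rightarrow> real^'n \<Rightarrow> real \<Rightarrow> real" where
  "duhamel P M x t = (\<integral>s. indicator {0<..<t} s * (\<integral>y. integrand P M x t s y \<partial>lborel) \<partial>lborel)"

text \<open>
  Fields are restricted to positive times, where solutions are regular; at other times they are
  arbitrary, hence the indicators.
\<close>

definition admissible_fields :: "real \<Rightarrow> (real^'n \<Rightarrow> real \<Rightarrow> real^'n) \<Rightarrow> (real^'n \<Rightarrow> real \<Rightarrow> real^'n^'n) \<Rightarrow> bool" where
  "admissible_fields \<delta> P M \<longleftrightarrow>
     (\<lambda>z. indicator {0<..} (fst z) *\<^sub>R P (snd z) (fst z)) \<in> borel_measurable borel \<and>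
     (\<lambda>z. indicator {0<..} (fst z) *\<^sub>R M (snd z) (fst z)) \<in> borel_measurable borel \<and>
     (\<forall>s>0. \<forall>y. norm (M y s) \<le> \<delta> * s powr (- 1 / \<alpha>))"

lemma nonlin_part_bound_ex: "\<exists>C. \<forall>l\<in>deriv_lists F. C l \<ge> 0 \<and> (\<forall>p M. \<bar>nonlin_part N l p M\<bar> \<le> C l * norm M ^ hess_degree F l)"
  using homogeneous_nonlin_part[OF form] unfolding homogeneous_def by (intro bchoice) blast

definition nonlin_const :: "'n list \<Rightarrow> real" where
  "nonlin_const = (SOME C. \<forall>l\<in>deriv_lists F. C l \<ge> 0 \<and> (\<forall>p M. \<bar>nonlin_part N l p M\<bar> \<le> C l * norm M ^ hess_degree F l))"

lemma nonlin_const: "l \<in> deriv_lists F \<Longrightarrow> nonlin_const l \<ge> 0" "l \<in> deriv_lists F \<Longrightarrow> \<bar>nonlin_part N l p M\<bar> \<le> nonlin_const l * norm M ^ hess_degree F l"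
  using someI_ex[OF nonlin_part_bound_ex] unfolding nonlin_const_def by blast+

text \<open>
  A majorant of one summand of the integrand that depends on the fields only through \<open>\<delta>\<close>.
\<close>

definition dom_term :: "'n list \<Rightarrow> real \<Rightarrow> real^'n \<Rightarrow> real \<Rightarrow> real \<Rightarrow> real^'n \<Rightarrow> real" where
  "dom_term l \<delta> x t s y = \<bar>kern l (x - y) (t - s)\<bar> * (nonlin_const l * (\<delta> * s powr (- 1 / \<alpha>)) ^ hess_degree F l)"

lemma term_bound:
  assumes l: "l \<in> deriv_lists F" and M: "norm (M y s) \<le> \<delta> * s powr (- 1 / \<alpha>)"
  shows "\<bar>kern l (x - y) (t - s) * nonlin_part N l (P y s) (M y s)\<bar> \<le> dom_term l \<delta> x t s y"
proof -
  have "\<bar>nonlin_part N l (P y s) (M y s)\<bar> \<le> nonlin_const l * norm (M y s) ^ hess_degree F l" by (rule nonlin_const(2)[OF l])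
  also have "\<dots> \<le> nonlin_const l * (\<delta> * s powr (- 1 / \<alpha>)) ^ hess_degree F l"
    by (intro mult_left_mono power_mono M nonlin_const(1)[OF l]) auto
  finally show ?thesis unfolding dom_term_def abs_mult by (intro mult_left_mono) auto
qed

lemma kern_joint_measurable:
  assumes l: "l \<in> deriv_lists F"
  shows "(\<lambda>z. indicator {0<..<t} (fst z) * kern l (x - snd z) (t - fst z)) \<in> borel_measurable (borel :: (real \<times> (real^'n)) measure)"
proof -
  note kern1_measurable[OF l, measurable]
  have "(\<lambda>z. indicator {0<..<t} (fst z) * kern l (x - snd z) (t - fst z)) =
    (\<lambda>z. indicator {0<..<t} (fst z) * ((t - fst z) powr (- (real CARD('n) + length l) / \<alpha>) * kern1 l ((t - fst z) powr (- 1 / \<alpha>) *\<^sub>R (x - snd z))))"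
    using kern_scale[OF l] by (auto simp: fun_eq_iff indicator_def)
  moreover have "(\<lambda>z. indicator {0<..<t} (fst z) * ((t - fst z) powr (- (real CARD('n) + length l) / \<alpha>) * kern1 l ((t - fst z) powr (- 1 / \<alpha>) *\<^sub>R (x - snd z))))
    \<in> borel_measurable (borel :: (real \<times> (real^'n)) measure)" by measurable
  ultimately show ?thesis by simp
qed

text \<open>
  Integrating in space first gives a multiple of \<open>(t - s) powr (- a) * s powr (- b)\<close> with
  \<open>a + b = (\<alpha> - 1) / \<alpha> < 1\<close>, a convergent Beta integral.
\<close>

lemma dom_term_integrable:
  assumes l: "l \<in> deriv_lists F" and t: "t > 0"
  shows "integrable (lborel \<Otimes>\<^sub>M lborel) (\<lambda>z. indicator {0<..<t} (fst z) * dom_term l \<delta> x t (fst z) (snd z))"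
proof (rule lborel_pair.Fubini_integrable)
  define D where "D = nonlin_const l * \<delta> ^ hess_degree F l"
  define a where "a = real (length l) / \<alpha>"
  define b where "b = real (hess_degree F l) / \<alpha>"
  have ab: "0 \<le> a" "a < 1" "0 \<le> b" "b < 1"
    using hess_degree_alpha[OF l] alpha_pos by (auto simp: a_def b_def)
  have dt: "dom_term l \<delta> x t s y = \<bar>kern l (x - y) (t - s)\<bar> * (D * s powr (- b))" if "s > 0" for s y
    using that by (simp add: dom_term_def D_def b_def power_mult_distrib powr_power mult.assoc)
  have eq: "indicator {0<..<t} s * dom_term l \<delta> x t s y = (indicator {0<..<t} s * D * s powr (- b)) * \<bar>indicator {0<..<t} s * kern l (x - y) (t - s)\<bar>" for s y
    using dt[of s y] by (simp add: indicator_def)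
  show "(\<lambda>z. indicator {0<..<t} (fst z) * dom_term l \<delta> x t (fst z) (snd z)) \<in> borel_measurable (lborel \<Otimes>\<^sub>M lborel)"
  proof -
    note kern_joint_measurable[OF l, measurable]
    show ?thesis unfolding eq lborel_prod measurable_lborel2 measurable_lborel1 by measurable
  qed
  have i1: "integrable lborel (\<lambda>y. indicator {0<..<t} s * dom_term l \<delta> x t s y)" for s
    unfolding eq using kern_abs_integral(1)[OF l, of "t - s" x]
    by (cases "s \<in> {0<..<t}") (auto intro!: integrable_mult_right integrable_abs simp: abs_mult)
  then show "AE s in lborel. integrable lborel (\<lambda>y. indicator {0<..<t} (fst (s, y)) * dom_term l \<delta> x t (fst (s, y)) (snd (s, y)))"
    by simp
  have "(\<integral>y. norm (indicator {0<..<t} s * dom_term l \<delta> x t s y) \<partial>lborel) =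
     \<bar>D\<bar> * (\<integral>z. \<bar>kern1 l z\<bar> \<partial>lborel) * (indicator {0<..<t} s * ((t - s) powr (- a) * s powr (- b)))" for s
  proof (cases "s \<in> {0<..<t}")
    case True
    then have s: "0 < s" "t - s > 0" by auto
    have "(\<integral>y. norm (indicator {0<..<t} s * dom_term l \<delta> x t s y) \<partial>lborel) = (\<integral>y. \<bar>kern l (x - y) (t - s)\<bar> * (\<bar>D\<bar> * s powr (- b)) \<partial>lborel)"
      using True s by (simp add: dt abs_mult)
    also have "\<dots> = (\<integral>y. \<bar>kern l (x - y) (t - s)\<bar> \<partial>lborel) * (\<bar>D\<bar> * s powr (- b))" by simp
    finally show ?thesis using True kern_abs_integral(2)[OF l s(2), of x] by (simp add: a_def mult_ac)
  qed simp
  then show "integrable lborel (\<lambda>s. \<integral>y. norm (indicator {0<..<t} (fst (s, y)) * dom_term l \<delta> x t (fst (s, y)) (snd (s, y))) \<partial>lborel)"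
    using Beta_integrable_scaled[OF ab t] by simp
qed

lemma nonlin_part_joint_measurable:
  assumes l: "l \<in> deriv_lists F" and A: "admissible_fields \<delta> P M"
  shows "(\<lambda>z. indicator {0<..<t} (fst z) * nonlin_part N l (P (snd z) (fst z)) (M (snd z) (fst z))) \<in> borel_measurable (borel :: (real \<times> (real^'n)) measure)"
proof -
  let ?P = "\<lambda>z. indicator {0<..} (fst z) *\<^sub>R P (snd z) (fst z)" and ?M = "\<lambda>z. indicator {0<..} (fst z) *\<^sub>R M (snd z) (fst z)"
  have PM: "?P \<in> borel_measurable borel" "?M \<in> borel_measurable borel" using A by (auto simp: admissible_fields_def)
  have "(\<lambda>z. nonlin_part N l (?P z) (?M z)) \<in> borel_measurable borel"
    using homogeneous_nonlin_part[OF form l] unfolding homogeneous_def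
    by (intro borel_measurable_continuous_Pair[OF PM]) auto
  then have "(\<lambda>z. indicator {0<..<t} (fst z) * nonlin_part N l (?P z) (?M z)) \<in> borel_measurable (borel :: (real \<times> (real^'n)) measure)"
    by (intro borel_measurable_times) measurable
  also have "(\<lambda>z. indicator {0<..<t} (fst z) * nonlin_part N l (?P z) (?M z)) = (\<lambda>z. indicator {0<..<t} (fst z) * nonlin_part N l (P (snd z) (fst z)) (M (snd z) (fst z)))"
    by (auto simp: fun_eq_iff indicator_def)
  finally show ?thesis .
qed

definition spacetime_integrand :: "(real^'n \<Rightarrow> real \<Rightarrow> real^'n) \<Rightarrow> (real^'n \<Rightarrow> real \<Rightarrow> real^'n^'n) \<Rightarrow> real^'n \<Rightarrow> real \<Rightarrow> real \<times> (real^'n) \<Rightarrow> real" where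
  "spacetime_integrand P M x t z = indicator {0<..<t} (fst z) * integrand P M x t (fst z) (snd z)"

lemma spacetime_integrand_measurable:
  assumes A: "admissible_fields \<delta> P M" shows "spacetime_integrand P M x t \<in> borel_measurable borel"
proof -
  have "spacetime_integrand P M x t = (\<lambda>z. \<Sum>l\<in>deriv_lists F. (indicator {0<..<t} (fst z) * kern l (x - snd z) (t - fst z)) *
      (indicator {0<..<t} (fst z) * nonlin_part N l (P (snd z) (fst z)) (M (snd z) (fst z))))"
    by (auto simp: spacetime_integrand_def integrand_def fun_eq_iff sum_distrib_left indicator_def)
  then show ?thesis
    by (simp only:) (intro borel_measurable_sum borel_measurable_times kern_joint_measurable nonlin_part_joint_measurable[OF _ A])
qed

definition dominating :: "real \<Rightarrow> real^'n \<Rightarrow> real \<Rightarrow> real \<times> (real^'n) \<Rightarrow> real" where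
  "dominating \<delta> x t z = (\<Sum>l\<in>deriv_lists F. indicator {0<..<t} (fst z) * dom_term l \<delta> x t (fst z) (snd z))"

lemma dominating_integrable: "t > 0 \<Longrightarrow> integrable (lborel \<Otimes>\<^sub>M lborel) (dominating \<delta> x t)"
  unfolding dominating_def[abs_def] by (intro Bochner_Integration.integrable_sum dom_term_integrable)

lemma spacetime_integrand_bound:
  assumes A: "admissible_fields \<delta> P M" shows "\<bar>spacetime_integrand P M x t z\<bar> \<le> dominating \<delta> x t z"
proof (cases "fst z \<in> {0<..<t}")
  case True
  then have s: "fst z > 0" by simp
  have "\<bar>integrand P M x t (fst z) (snd z)\<bar> \<le> (\<Sum>l\<in>deriv_lists F. \<bar>kern l (x - snd z) (t - fst z) * nonlin_part N l (P (snd z) (fst z)) (M (snd z) (fst z))\<bar>)"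
    unfolding integrand_def by (rule sum_abs)
  also have "\<dots> \<le> (\<Sum>l\<in>deriv_lists F. dom_term l \<delta> x t (fst z) (snd z))"
    using A s by (intro sum_mono term_bound) (auto simp: admissible_fields_def)
  finally show ?thesis using True by (simp add: spacetime_integrand_def dominating_def)
qed (simp add: spacetime_integrand_def dominating_def)

lemma spacetime_integrand_integrable:
  assumes A: "admissible_fields \<delta> P M" and t: "t > 0"
  shows "integrable (lborel \<Otimes>\<^sub>M lborel) (spacetime_integrand P M x t)"
proof (rule Bochner_Integration.integrable_bound[OF dominating_integrable[OF t]])
  show "spacetime_integrand P M x t \<in> borel_measurable (lborel \<Otimes>\<^sub>M lborel)" unfolding lborel_prod using spacetime_integrand_measurable[OF A] by simp
  show "AE z in lborel \<Otimes>\<^sub>M lborel. norm (spacetime_integrand P M x t z) \<le> norm (dominating \<delta> x t z)"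
    using spacetime_integrand_bound[OF A, of x t] by (intro AE_I2) (metis abs_ge_self order_trans real_norm_def)
qed

lemma duhamel_eq_integral:
  assumes A: "admissible_fields \<delta> P M" and t: "t > 0"
  shows "duhamel P M x t = (\<integral>z. spacetime_integrand P M x t z \<partial>(lborel \<Otimes>\<^sub>M lborel))"
proof -
  have "duhamel P M x t = (\<integral>s. \<integral>y. spacetime_integrand P M x t (s, y) \<partial>lborel \<partial>lborel)"
    by (simp add: duhamel_def spacetime_integrand_def)
  also have "\<dots> = (\<integral>z. spacetime_integrand P M x t z \<partial>(lborel \<Otimes>\<^sub>M lborel))"
    by (rule lborel_pair.integral_fst'[OF spacetime_integrand_integrable[OF A t]])
  finally show ?thesis .
qed

lemma duhamel_converges:
  assumes A: "\<And>j. admissible_fields \<delta> (P j) (M j)" and A': "admissible_fields \<delta> P' M'" and t: "t > 0"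
    and P: "\<And>y s. s > 0 \<Longrightarrow> (\<lambda>j. P j y s) \<longlonglongrightarrow> P' y s"
    and M: "\<And>y s. s > 0 \<Longrightarrow> (\<lambda>j. M j y s) \<longlonglongrightarrow> M' y s"
  shows "(\<lambda>j. duhamel (P j) (M j) x t) \<longlonglongrightarrow> duhamel P' M' x t"
  unfolding duhamel_eq_integral[OF A t] duhamel_eq_integral[OF A' t]
proof (rule integral_dominated_convergence[OF _ _ dominating_integrable[OF t]])
  show "spacetime_integrand P' M' x t \<in> borel_measurable (lborel \<Otimes>\<^sub>M lborel)" "spacetime_integrand (P j) (M j) x t \<in> borel_measurable (lborel \<Otimes>\<^sub>M lborel)" for j
    unfolding lborel_prod using spacetime_integrand_measurable[OF A] spacetime_integrand_measurable[OF A'] by simp_all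
  show "AE z in lborel \<Otimes>\<^sub>M lborel. norm (spacetime_integrand (P j) (M j) x t z) \<le> dominating \<delta> x t z" for j
    using spacetime_integrand_bound[OF A] by simp
  show "AE z in lborel \<Otimes>\<^sub>M lborel. (\<lambda>j. spacetime_integrand (P j) (M j) x t z) \<longlonglongrightarrow> spacetime_integrand P' M' x t z"
  proof (intro AE_I2)
    fix z :: "real \<times> (real^'n)"
    show "(\<lambda>j. spacetime_integrand (P j) (M j) x t z) \<longlonglongrightarrow> spacetime_integrand P' M' x t z"
    proof (cases "fst z > 0")
      case True
      have "(\<lambda>j. nonlin_part N l (P j (snd z) (fst z)) (M j (snd z) (fst z))) \<longlonglongrightarrow> nonlin_part N l (P' (snd z) (fst z)) (M' (snd z) (fst z))" if l: "l \<in> deriv_lists F" for l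
      proof -
        have c: "continuous_on UNIV (\<lambda>z. nonlin_part N l (fst z) (snd z))" using homogeneous_nonlin_part[OF form l] by (simp add: homogeneous_def)
        have "(\<lambda>j. (P j (snd z) (fst z), M j (snd z) (fst z))) \<longlonglongrightarrow> (P' (snd z) (fst z), M' (snd z) (fst z))"
          by (intro tendsto_Pair P M True)
        from continuous_on_tendsto_compose[OF c this] show ?thesis by simp
      qed
      then show ?thesis unfolding spacetime_integrand_def integrand_def by (intro tendsto_intros)
    qed (simp add: spacetime_integrand_def)
  qed
qed

text \<open>
  Exponents: the kernel derivative contributes \<open>- n - |l|\<close>, the Hessian \<open>- d\<close>, space-time volume
  \<open>n + \<alpha>\<close>; since \<open>d + |l| = \<alpha> - 1\<close> one power of \<open>c\<close> remains for every \<open>l\<close>.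
\<close>

lemma duhamel_rescale:
  assumes A: "admissible_fields \<delta> P M" and c: "c > 0" and t: "t > 0"
  shows "duhamel (\<lambda>y s. P (x + c *\<^sub>R y) (c powr \<alpha> * s)) (\<lambda>y s. c *\<^sub>R M (x + c *\<^sub>R y) (c powr \<alpha> * s)) z t
    = duhamel P M (x + c *\<^sub>R z) (c powr \<alpha> * t) / c"
proof -
  let ?a = "c powr \<alpha>" and ?X = "x + c *\<^sub>R z"
  let ?P = "\<lambda>y s. P (x + c *\<^sub>R y) (c powr \<alpha> * s)" and ?M = "\<lambda>y s. c *\<^sub>R M (x + c *\<^sub>R y) (c powr \<alpha> * s)"
  have a: "?a > 0" using c by simp
  have pw: "integrand P M ?X (?a * t) (?a * \<sigma>) (x + c *\<^sub>R \<eta>) = c powr (- (real CARD('n) + \<alpha> - 1)) * integrand ?P ?M z t \<sigma> \<eta>"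
    if \<sigma>: "0 < \<sigma>" "\<sigma> < t" for \<sigma> \<eta>
    unfolding integrand_def sum_distrib_left
  proof (rule sum.cong[OF refl])
    fix l :: "'n list" assume l: "l \<in> deriv_lists F"
    have 1: "?X - (x + c *\<^sub>R \<eta>) = c *\<^sub>R (z - \<eta>)" "?a * t - ?a * \<sigma> = ?a * (t - \<sigma>)"
      by (simp_all add: algebra_simps)
    have 2: "nonlin_part N l p (c *\<^sub>R q) = c powr (real (hess_degree F l)) * nonlin_part N l p q" for p q
      using homogeneous_nonlin_part[OF form l] c unfolding homogeneous_def by (simp add: powr_realpow)
    have e: "- (real CARD('n) + length l) = - (real CARD('n) + \<alpha> - 1) + real (hess_degree F l)"
      using hess_degree_alpha[OF l] by simp
    have 3: "kern l (c *\<^sub>R (z - \<eta>)) (?a * (t - \<sigma>)) = c powr (- (real CARD('n) + \<alpha> - 1)) * (c powr real (hess_degree F l) * kern l (z - \<eta>) (t - \<sigma>))"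
      using kern_rescale[OF l c, of "t - \<sigma>" "z - \<eta>"] \<sigma> unfolding e powr_add by (simp add: mult.assoc)
    show "kern l (?X - (x + c *\<^sub>R \<eta>)) (?a * t - ?a * \<sigma>) * nonlin_part N l (P (x + c *\<^sub>R \<eta>) (?a * \<sigma>)) (M (x + c *\<^sub>R \<eta>) (?a * \<sigma>)) =
      c powr (- (real CARD('n) + \<alpha> - 1)) * (kern l (z - \<eta>) (t - \<sigma>) * nonlin_part N l (?P \<eta> \<sigma>) (?M \<eta> \<sigma>))"
      unfolding 1 2 3 by (simp add: mult_ac)
  qed
  have sec: "integrand P M ?X (?a * t) s \<in> borel_measurable borel" if s: "0 < s" "s < ?a * t" for s
  proof -
    have "(\<lambda>y. spacetime_integrand P M ?X (?a * t) (s, y)) \<in> borel_measurable borel"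
      by (rule measurable_compose[OF _ spacetime_integrand_measurable[OF A]]) simp
    moreover have "(\<lambda>y. spacetime_integrand P M ?X (?a * t) (s, y)) = integrand P M ?X (?a * t) s" using s by (simp add: spacetime_integrand_def fun_eq_iff)
    ultimately show ?thesis by simp
  qed
  have inner: "(\<integral>y. integrand P M ?X (?a * t) (?a * \<sigma>) y \<partial>lborel) = c powr (1 - \<alpha>) * (\<integral>\<eta>. integrand ?P ?M z t \<sigma> \<eta> \<partial>lborel)"
    if \<sigma>: "0 < \<sigma>" "\<sigma> < t" for \<sigma>
  proof -
    have "0 < ?a * \<sigma>" "?a * \<sigma> < ?a * t" using \<sigma> a by auto
    from lborel_affine_integral(1)[OF sec[OF this], of c x] c
    have "(\<integral>y. integrand P M ?X (?a * t) (?a * \<sigma>) y \<partial>lborel) = c ^ CARD('n) * (c powr (- (real CARD('n) + \<alpha> - 1)) * (\<integral>\<eta>. integrand ?P ?M z t \<sigma> \<eta> \<partial>lborel))"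
      by (simp add: pw[OF \<sigma>])
    moreover have "c ^ CARD('n) * c powr (- (real CARD('n) + \<alpha> - 1)) = c powr (1 - \<alpha>)"
      using c by (simp add: powr_realpow[symmetric] powr_add[symmetric])
    ultimately show ?thesis by (simp add: mult.assoc[symmetric])
  qed
  have "duhamel P M ?X (?a * t) = \<bar>?a\<bar> *\<^sub>R (\<integral>\<sigma>. indicator {0<..<?a * t} (0 + ?a * \<sigma>) * (\<integral>y. integrand P M ?X (?a * t) (0 + ?a * \<sigma>) y \<partial>lborel) \<partial>lborel)"
    unfolding duhamel_def by (rule lborel_integral_real_affine) (use a in simp)
  also have "\<dots> = ?a * (\<integral>\<sigma>. c powr (1 - \<alpha>) * (indicator {0<..<t} \<sigma> * (\<integral>\<eta>. integrand ?P ?M z t \<sigma> \<eta> \<partial>lborel)) \<partial>lborel)"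
  proof -
    have "indicator {0<..<?a * t} (0 + ?a * \<sigma>) * (\<integral>y. integrand P M ?X (?a * t) (0 + ?a * \<sigma>) y \<partial>lborel) =
       c powr (1 - \<alpha>) * (indicator {0<..<t} \<sigma> * (\<integral>\<eta>. integrand ?P ?M z t \<sigma> \<eta> \<partial>lborel))" for \<sigma>
    proof (cases "0 < \<sigma> \<and> \<sigma> < t")
      case True
      then show ?thesis using inner[of \<sigma>] a by simp
    next
      case False
      then have "\<not> (0 < ?a * \<sigma> \<and> ?a * \<sigma> < ?a * t)" using a by (simp add: zero_less_mult_iff)
      then show ?thesis using False by (auto simp: indicator_def)
    qed
    then show ?thesis using a by simp
  qed
  also have "\<dots> = c * duhamel ?P ?M z t"
  proof -
    have "?a * c powr (1 - \<alpha>) = c" using c by (simp flip: powr_add)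
    then show ?thesis unfolding integral_mult_right_zero duhamel_def by (simp only: mult.assoc[symmetric])
  qed
  finally show ?thesis using c by simp
qed

end

section \<open>Compactness of solutions\<close>

text \<open>
  The diagonal sequence for a countable dense subset; equicontinuity extends convergence to all
  points.
\<close>

lemma pointwise_compactness:
  fixes f :: "nat \<Rightarrow> 'a::euclidean_space \<Rightarrow> 'b::euclidean_space"
  assumes bd: "\<And>x. x \<in> S \<Longrightarrow> \<exists>K. \<forall>j. norm (f j x) \<le> K"
    and eq: "\<And>x e. x \<in> S \<Longrightarrow> e > 0 \<Longrightarrow> \<exists>d>0. \<forall>y\<in>S. dist y x < d \<longrightarrow> (\<forall>j. norm (f j y - f j x) \<le> e)"
  shows "\<exists>r. strict_mono r \<and> (\<forall>x\<in>S. convergent (\<lambda>j. f (r j) x))"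
proof (cases "S = {}")
  case True
  then show ?thesis using strict_mono_id by blast
next
  case False
  obtain D where D: "countable D" "D \<subseteq> S" "S \<subseteq> closure D" using separable[of S] by blast
  have "D \<noteq> {}" using D(3) False by auto
  then obtain d :: "nat \<Rightarrow> 'a" where d: "D = range d" using uncountable_def D(1) by blast
  interpret subseqs "\<lambda>n s. convergent (\<lambda>j. f (s j) (d n))"
  proof
    fix n and s :: "nat \<Rightarrow> nat" assume "strict_mono s"
    have "d n \<in> S" using D(2) d by blast
    then obtain K where K: "\<And>j. norm (f j (d n)) \<le> K" using bd by blast
    have "\<forall>j. f (s j) (d n) \<in> cball 0 K" using K by simp
    then obtain l r where "strict_mono r" "((\<lambda>j. f (s j) (d n)) \<circ> r) \<longlonglongrightarrow> l"
      using compact_cball[of "0::'b" K] unfolding compact_def by meson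
    then show "\<exists>r'. strict_mono r' \<and> convergent (\<lambda>j. f ((s \<circ> r') j) (d n))"
      by (auto simp: convergent_def comp_def)
  qed
  let ?r = "diagseq"
  have conv: "convergent (\<lambda>j. f (?r j) (d n))" for n
  proof -
    have "convergent (\<lambda>j. f ((diagseq \<circ> ((+) (Suc n))) j) (d n))"
    proof (rule diagseq_holds)
      fix r s :: "nat \<Rightarrow> nat" and n assume "strict_mono r" "convergent (\<lambda>j. f (s j) (d n))"
      then obtain l where "(\<lambda>j. f (s j) (d n)) \<longlonglongrightarrow> l" by (auto simp: convergent_def)
      from LIMSEQ_subseq_LIMSEQ[OF this \<open>strict_mono r\<close>]
      show "convergent (\<lambda>j. f ((s \<circ> r) j) (d n))" by (auto simp: convergent_def comp_def)
    qed
    then obtain l where "(\<lambda>j. f (diagseq (Suc n + j)) (d n)) \<longlonglongrightarrow> l" by (auto simp: convergent_def comp_def)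
    then have "(\<lambda>j. f (diagseq (j + Suc n)) (d n)) \<longlonglongrightarrow> l" by (simp add: add.commute)
    then have "(\<lambda>j. f (diagseq j) (d n)) \<longlonglongrightarrow> l" by (rule LIMSEQ_offset)
    then show ?thesis by (auto simp: convergent_def)
  qed
  have "convergent (\<lambda>j. f (?r j) x)" if x: "x \<in> S" for x
  proof -
    have "Cauchy (\<lambda>j. f (?r j) x)"
    proof (rule metric_CauchyI)
      fix e :: real assume e: "e > 0"
      then obtain \<delta> where \<delta>: "\<delta> > 0" "\<And>y j. y \<in> S \<Longrightarrow> dist y x < \<delta> \<Longrightarrow> norm (f j y - f j x) \<le> e / 4"
        using eq[OF x, of "e / 4"] by auto
      have "x \<in> closure D" using x D(3) by blast
      then obtain n where n: "dist (d n) x < \<delta>" using \<delta>(1) d unfolding closure_approachable by blast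
      have dn: "d n \<in> S" using D(2) d by blast
      have "Cauchy (\<lambda>j. f (?r j) (d n))" using conv[of n] by (simp add: Cauchy_convergent_iff)
      then obtain M where M: "\<And>i j. i \<ge> M \<Longrightarrow> j \<ge> M \<Longrightarrow> dist (f (?r i) (d n)) (f (?r j) (d n)) < e / 4"
        using e unfolding Cauchy_def by (meson divide_pos_pos zero_less_numeral)
      have "dist (f (?r i) x) (f (?r j) x) < e" if "i \<ge> M" "j \<ge> M" for i j
      proof -
        have 1: "dist (f (?r i) (d n)) (f (?r i) x) \<le> e / 4" "dist (f (?r j) (d n)) (f (?r j) x) \<le> e / 4"
          using \<delta>(2)[OF dn n] by (auto simp: dist_norm)
        have 2: "dist (f (?r i) x) (f (?r j) x) \<le> dist (f (?r i) (d n)) (f (?r i) x) + dist (f (?r i) (d n)) (f (?r j) (d n)) + dist (f (?r j) (d n)) (f (?r j) x)"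
          using dist_triangle[of "f (?r i) x" "f (?r j) x" "f (?r i) (d n)"] dist_triangle[of "f (?r i) (d n)" "f (?r j) x" "f (?r j) (d n)"]
          by (simp add: dist_commute)
        show ?thesis using 1 2 M[OF that] e by linarith
      qed
      then show "\<exists>M. \<forall>i\<ge>M. \<forall>j\<ge>M. dist (f (?r i) x) (f (?r j) x) < e" by blast
    qed
    then show ?thesis by (simp add: Cauchy_convergent_iff)
  qed
  then show ?thesis using subseq_diagseq by blast
qed

lemma pd_quadratic_remainder:
  fixes g :: "real^'n::finite \<Rightarrow> real"
  assumes d: "\<And>x. has_pd i g x (D x)" and L: "\<And>x h. \<bar>D (x + h *\<^sub>R axis i 1) - D x\<bar> \<le> C * \<bar>h\<bar>"
  shows "\<bar>g (x + h *\<^sub>R axis i 1) - g x - h * D x\<bar> \<le> C * h\<^sup>2"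
proof -
  let ?e = "axis i 1"
  have C: "C \<ge> 0" using order_trans[OF abs_ge_zero L[of 0 1]] by simp
  define q where "q s = g (x + s *\<^sub>R ?e) - s * D x" for s
  have "norm (q h - q 0) \<le> C * \<bar>h\<bar> * norm (h - 0)"
  proof (rule field_differentiable_bound[of "{- \<bar>h\<bar>..\<bar>h\<bar>}" _ "\<lambda>s. D (x + s *\<^sub>R ?e) - D x"])
    fix s :: real assume s: "s \<in> {- \<bar>h\<bar>..\<bar>h\<bar>}"
    show "(q has_field_derivative D (x + s *\<^sub>R ?e) - D x) (at s within {- \<bar>h\<bar>..\<bar>h\<bar>})"
      unfolding q_def by (rule has_field_derivative_at_within) (auto intro!: derivative_eq_intros has_pd_line[OF d])
    have "\<bar>D (x + s *\<^sub>R ?e) - D x\<bar> \<le> C * \<bar>s\<bar>" by (rule L)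
    also have "\<dots> \<le> C * \<bar>h\<bar>" using s C by (intro mult_left_mono) auto
    finally show "norm (D (x + s *\<^sub>R ?e) - D x) \<le> C * \<bar>h\<bar>" by simp
  qed auto
  then show ?thesis by (simp add: q_def power2_eq_square mult.assoc abs_if split: if_splits)
qed

text \<open>
  Difference quotients of \<open>g j\<close> are within \<open>C \<bar>h\<bar>\<close> of the derivative, uniformly in \<open>j\<close>, and for fixed
  \<open>h\<close> they converge with \<open>j\<close>; so the derivatives form a Cauchy sequence, and the remainder estimate
  survives in the limit.
\<close>

lemma pd_limit:
  fixes g :: "nat \<Rightarrow> real^'n::finite \<Rightarrow> real"
  assumes d: "\<And>j x. has_pd i (g j) x (D j x)" and L: "\<And>j x h. \<bar>D j (x + h *\<^sub>R axis i 1) - D j x\<bar> \<le> C * \<bar>h\<bar>"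
    and lim: "\<And>x. (\<lambda>j. g j x) \<longlonglongrightarrow> g' x"
  shows "\<exists>D'. (\<lambda>j. D j x) \<longlonglongrightarrow> D' \<and> has_pd i g' x D' \<and> (\<forall>h. \<bar>g' (x + h *\<^sub>R axis i 1) - g' x - h * D'\<bar> \<le> C * h\<^sup>2)"
proof -
  let ?e = "axis i 1"
  have C: "C \<ge> 0" using order_trans[OF abs_ge_zero L[of 0 0 1]] by simp
  note rem = pd_quadratic_remainder[OF d L]
  have "Cauchy (\<lambda>j. D j x)"
  proof (rule metric_CauchyI)
    fix e :: real assume e: "e > 0"
    define h where "h = e / (4 * (C + 1))"
    have h: "h > 0" "C * h \<le> e / 4"
    proof -
      show "h > 0" using e C by (simp add: h_def)
      have "C * h \<le> (C + 1) * h" using \<open>h > 0\<close> by (intro mult_right_mono) auto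
      also have "(C + 1) * h = e / 4"
      proof -
        have "a * (e / (4 * a)) = e / 4" if "a > 0" for a :: real using that by simp
        from this[of "C + 1"] C show ?thesis by (simp add: h_def)
      qed
      finally show "C * h \<le> e / 4" .
    qed
    define q where "q j = (g j (x + h *\<^sub>R ?e) - g j x) / h" for j
    have qd: "\<bar>q j - D j x\<bar> \<le> e / 4" for j
    proof -
      have "(q j - D j x) * h = g j (x + h *\<^sub>R ?e) - g j x - h * D j x"
      proof -
        have "(a / h - d) * h = a - h * d" for a d using h by (simp add: left_diff_distrib)
        then show ?thesis unfolding q_def .
      qed
      then have "\<bar>(q j - D j x) * h\<bar> \<le> C * h\<^sup>2" using rem[of j x h] by simp
      then have "\<bar>q j - D j x\<bar> * h \<le> (C * h) * h" using h by (simp add: abs_mult power2_eq_square)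
      then have "\<bar>q j - D j x\<bar> \<le> C * h" using h(1) by (rule mult_right_le_imp_le)
      then show ?thesis using h(2) by linarith
    qed
    have "q \<longlonglongrightarrow> (g' (x + h *\<^sub>R ?e) - g' x) / h" unfolding q_def using h by (intro tendsto_intros lim) auto
    from LIMSEQ_imp_Cauchy[OF this] obtain M where M: "\<And>a b. a \<ge> M \<Longrightarrow> b \<ge> M \<Longrightarrow> dist (q a) (q b) < e / 4"
      using e unfolding Cauchy_def by (meson divide_pos_pos zero_less_numeral)
    have "dist (D a x) (D b x) < e" if "a \<ge> M" "b \<ge> M" for a b
      using qd[of a] qd[of b] M[OF that] e unfolding dist_real_def by linarith
    then show "\<exists>M. \<forall>a\<ge>M. \<forall>b\<ge>M. dist (D a x) (D b x) < e" by blast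
  qed
  then obtain D' where D': "(\<lambda>j. D j x) \<longlonglongrightarrow> D'" by (auto simp: Cauchy_convergent_iff convergent_def)
  have r: "\<bar>g' (x + h *\<^sub>R ?e) - g' x - h * D'\<bar> \<le> C * h\<^sup>2" for h
    by (rule LIMSEQ_le_const2[OF tendsto_rabs[OF tendsto_diff[OF tendsto_diff[OF lim lim] tendsto_mult_left[OF D']]]])
      (use rem in blast)
  have "has_pd i g' x D'"
    unfolding has_pd_def by (rule DERIV_quadratic_remainder[of 1 _ _ _ C]) (use r in auto)
  then show ?thesis using D' r by blast
qed

context flow_form
begin

abbreviation Gr :: "(real^'n \<Rightarrow> real \<Rightarrow> real) \<Rightarrow> real^'n \<Rightarrow> real \<Rightarrow> real^'n" where
  "Gr u y s \<equiv> grad (\<lambda>z. u z s) y"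

abbreviation He :: "(real^'n \<Rightarrow> real \<Rightarrow> real) \<Rightarrow> real^'n \<Rightarrow> real \<Rightarrow> real^'n^'n" where
  "He u y s \<equiv> hess (\<lambda>z. u z s) y"

text \<open>
  The scale invariant bounds shared by all solutions under consideration.  The increments of
  \<open>M $ i $ j\<close> in direction \<open>i\<close> are those that make Hessians converge along with gradients; the time
  increments of \<open>P\<close> give equicontinuity of the gradients in time.
\<close>

definition fields_bounded :: "real \<Rightarrow> real \<Rightarrow> (real^'n \<Rightarrow> real \<Rightarrow> real^'n) \<Rightarrow> (real^'n \<Rightarrow> real \<Rightarrow> real^'n^'n) \<Rightarrow> bool" where
  "fields_bounded \<delta> B P M \<longleftrightarrow> 0 \<le> \<delta> \<and> 0 \<le> B \<and>
     (\<forall>t>0. \<forall>x. norm (P x t) \<le> \<delta>) \<and>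
     (\<forall>t>0. \<forall>x. norm (M x t) \<le> \<delta> * t powr (- 1 / \<alpha>)) \<and>
     (\<forall>t>0. \<forall>x h i j. \<bar>M (x + h *\<^sub>R axis i 1) t $ i $ j - M x t $ i $ j\<bar> \<le> B * t powr (- 2 / \<alpha>) * \<bar>h\<bar>) \<and>
     (\<forall>t>0. \<forall>s>0. \<forall>x j. \<bar>P x t $ j - P x s $ j\<bar> \<le> B / min s t * \<bar>t - s\<bar>)"

lemma fields_boundedD:
  assumes "fields_bounded \<delta> B P M"
  shows "0 \<le> \<delta>" "0 \<le> B" "t > 0 \<Longrightarrow> norm (P x t) \<le> \<delta>" "t > 0 \<Longrightarrow> norm (M x t) \<le> \<delta> * t powr (- 1 / \<alpha>)"
    "t > 0 \<Longrightarrow> \<bar>M (x + h *\<^sub>R axis i 1) t $ i $ j - M x t $ i $ j\<bar> \<le> B * t powr (- 2 / \<alpha>) * \<bar>h\<bar>"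
    "t > 0 \<Longrightarrow> s > 0 \<Longrightarrow> \<bar>P x t $ j - P x s $ j\<bar> \<le> B / min s t * \<bar>t - s\<bar>"
  using assms unfolding fields_bounded_def by blast+

definition lipschitz_by :: "real \<Rightarrow> (real^'n \<Rightarrow> real) \<Rightarrow> bool" where
  "lipschitz_by L f \<longleftrightarrow> 0 \<le> L \<and> (\<forall>x y. \<bar>f x - f y\<bar> \<le> L * norm (x - y))"

lemma lipschitz_by_continuous: "lipschitz_by L f \<Longrightarrow> continuous_on UNIV f"
  by (rule lipschitz_on_continuous_on[of L]) (auto simp: lipschitz_by_def dist_norm intro!: lipschitz_onI)

lemma lipschitz_by_measurable: "lipschitz_by L f \<Longrightarrow> f \<in> borel_measurable borel"
  by (rule borel_measurable_continuous_onI[OF lipschitz_by_continuous])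

lemma lipschitz_by_growth: "lipschitz_by L f \<Longrightarrow> \<bar>f y\<bar> \<le> \<bar>f 0\<bar> + L * norm y"
  unfolding lipschitz_by_def by (smt (verit) diff_zero)

definition duhamel_formula :: "(real^'n \<Rightarrow> real) \<Rightarrow> (real^'n \<Rightarrow> real \<Rightarrow> real) \<Rightarrow> bool" where
  "duhamel_formula f u \<longleftrightarrow> (\<forall>x. \<forall>t>0. u x t = linear_part f x t + duhamel (Gr u) (He u) x t)"

text \<open>
  A solution with Lipschitz datum \<open>f\<close> and the scale invariant bounds.  This class is closed under the
  symmetries of the equation and, up to additive constants, compact.
\<close>

definition solves :: "real \<Rightarrow> real \<Rightarrow> real \<Rightarrow> (real^'n \<Rightarrow> real) \<Rightarrow> (real^'n \<Rightarrow> real \<Rightarrow> real) \<Rightarrow> bool" where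
  "solves L \<delta> B f u \<longleftrightarrow> lipschitz_by L f \<and> spatially_C2 u \<and> fields_bounded \<delta> B (Gr u) (He u) \<and> duhamel_formula f u"

lemma C2_pd:
  assumes C: "spatially_C2 u" and t: "t > 0"
  shows "has_pd i (\<lambda>z. u z t) x (Gr u x t $ i)" "has_pd i (\<lambda>z. Gr u z t $ j) x (He u x t $ i $ j)"
proof -
  have Ck: "Ck 2 (\<lambda>x. u x t)" using assms by (simp add: spatially_C2_def)
  have *: "(\<lambda>h. pd_list l (\<lambda>x. u x t) (x + h *\<^sub>R axis i 1)) differentiable (at 0)" if "length l < 2" for l :: "'n list"
    using Ck that unfolding Ck_def by blast
  show "has_pd i (\<lambda>z. u z t) x (Gr u x t $ i)"
    using *[of "[]"] unfolding has_pd_def grad_def pd_def vec_lambda_beta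
    by (simp add: pd_list_def DERIV_deriv_iff_real_differentiable)
  have "has_pd i (pd j (\<lambda>z. u z t)) x (pd i (pd j (\<lambda>z. u z t)) x)"
    using *[of "[j]"] unfolding has_pd_def pd_def[of i]
    by (simp add: pd_list_def DERIV_deriv_iff_real_differentiable)
  then show "has_pd i (\<lambda>z. Gr u z t $ j) x (He u x t $ i $ j)"
    by (simp add: grad_def hess_def)
qed

lemma C2_intro:
  assumes uP: "\<And>i x t. t > 0 \<Longrightarrow> has_pd i (\<lambda>z. u z t) x (P x t $ i)"
    and PM: "\<And>i j x t. t > 0 \<Longrightarrow> has_pd i (\<lambda>z. P z t $ j) x (M x t $ i $ j)"
    and cu: "continuous_on (UNIV \<times> {0<..}) (\<lambda>(x, t). u x t)"
    and cP: "continuous_on (UNIV \<times> {0<..}) (\<lambda>(x, t). P x t)"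
    and cM: "continuous_on (UNIV \<times> {0<..}) (\<lambda>(x, t). M x t)"
  shows "spatially_C2 u" "t > 0 \<Longrightarrow> Gr u x t = P x t" "t > 0 \<Longrightarrow> He u x t = M x t"
proof -
  have pd1: "pd i (\<lambda>z. u z t) = (\<lambda>x. P x t $ i)" if "t > 0" for i t
    using has_pd_imp_pd[OF uP[OF that]] by blast
  have pd2: "pd i (\<lambda>z. P z t $ j) = (\<lambda>x. M x t $ i $ j)" if "t > 0" for i j t
    using has_pd_imp_pd[OF PM[OF that]] by blast
  show G: "Gr u x t = P x t" if "t > 0" for x t
    by (simp add: grad_def pd1[OF that] vec_eq_iff)
  show H: "He u x t = M x t" if "t > 0" for x t
    by (simp add: hess_def pd1[OF that] pd2[OF that] vec_eq_iff)
  have sl: "continuous_on UNIV (\<lambda>x. q x t)" if "continuous_on (UNIV \<times> {0<..}) (\<lambda>(x, t). q x t)" "t > 0"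
    for q :: "real^'n \<Rightarrow> real \<Rightarrow> 'z::topological_space" and t
  proof -
    have "continuous_on UNIV (\<lambda>x. case (x, t) of (x, t) \<Rightarrow> q x t)"
      by (rule continuous_on_compose2[OF that(1)]) (use that(2) in \<open>auto intro!: continuous_intros\<close>)
    then show ?thesis by simp
  qed
  show "spatially_C2 u"
    unfolding spatially_C2_def
  proof (intro conjI allI impI cu)
    show "continuous_on (UNIV \<times> {0<..}) (\<lambda>(x, t). Gr u x t)"
      using cP by (rule continuous_on_eq) (auto simp: G)
    show "continuous_on (UNIV \<times> {0<..}) (\<lambda>(x, t). He u x t)"
      using cM by (rule continuous_on_eq) (auto simp: H)
    fix t :: real assume t: "t > 0"
    have l0: "pd_list [] (\<lambda>x. u x t) = (\<lambda>x. u x t)" by (simp add: pd_list_def)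
    have l1: "pd_list [j] (\<lambda>x. u x t) = (\<lambda>x. P x t $ j)" for j by (simp add: pd_list_def pd1[OF t])
    have l2: "pd_list [i, j] (\<lambda>x. u x t) = (\<lambda>x. M x t $ i $ j)" for i j by (simp add: pd_list_def pd1[OF t] pd2[OF t])
    have cases: "l = [] \<or> (\<exists>j. l = [j]) \<or> (\<exists>i j. l = [i, j])" if "length l \<le> 2" for l :: "'n list"
      using that by (cases l; cases "tl l") auto
    show "Ck 2 (\<lambda>x. u x t)"
      unfolding Ck_def
    proof (intro conjI allI impI)
      fix l :: "'n list" assume "length l \<le> 2"
      from cases[OF this] show "continuous_on UNIV (pd_list l (\<lambda>x. u x t))"
        using l0 l1 l2 sl[OF cu t] continuous_on_component[OF sl[OF cP t]] continuous_on_component[OF continuous_on_component[OF sl[OF cM t]]]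
        by auto
    next
      fix l :: "'n list" and i x assume l: "length l < 2"
      then have "l = [] \<or> (\<exists>j. l = [j])" using cases[of l] by auto
      then show "(\<lambda>h. pd_list l (\<lambda>x. u x t) (x + h *\<^sub>R axis i 1)) differentiable at 0"
      proof (elim disjE exE)
        assume "l = []"
        then show ?thesis using uP[OF t, of i x] l0 unfolding has_pd_def real_differentiable_def by auto
      next
        fix j assume "l = [j]"
        then show ?thesis using PM[OF t, of i j x] l1[of j] unfolding has_pd_def real_differentiable_def by auto
      qed
    qed
  qed
qed

lemma field_measurable:
  fixes q :: "real^'n \<Rightarrow> real \<Rightarrow> 'z::euclidean_space"
  assumes "continuous_on (UNIV \<times> {0<..}) (\<lambda>(x, t). q x t)"
  shows "(\<lambda>z. indicator {0<..} (fst z) *\<^sub>R q (snd z) (fst z)) \<in> borel_measurable borel"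
proof -
  let ?A = "{0<..} \<times> UNIV :: (real \<times> (real^'n)) set"
  have "continuous_on ?A (\<lambda>z. case (snd z, fst z) of (x, t) \<Rightarrow> q x t)"
    by (rule continuous_on_compose2[OF assms]) (auto intro!: continuous_intros)
  moreover have "?A \<in> sets borel" by (intro borel_open open_Times) auto
  ultimately have "(\<lambda>z. indicator ?A z *\<^sub>R (case (snd z, fst z) of (x, t) \<Rightarrow> q x t)) \<in> borel_measurable borel"
    by (intro borel_measurable_continuous_on_indicator)
  also have "(\<lambda>z. indicator ?A z *\<^sub>R (case (snd z, fst z) of (x, t) \<Rightarrow> q x t)) = (\<lambda>z. indicator {0<..} (fst z) *\<^sub>R q (snd z) (fst z))"
    by (auto simp: fun_eq_iff indicator_def)
  finally show ?thesis .
qed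

lemma C2_admissible_fields:
  assumes "spatially_C2 u" "fields_bounded \<delta> B (Gr u) (He u)"
  shows "admissible_fields \<delta> (Gr u) (He u)"
  using assms field_measurable[of "Gr u"] field_measurable[of "He u"] fields_boundedD(4)[OF assms(2)]
  unfolding admissible_fields_def spatially_C2_def by blast

text \<open>
  Space-time Lipschitz continuity of the gradient, with constants that are locally uniform for
  positive times and depend on \<open>\<delta>\<close> and \<open>B\<close> only: the source of equicontinuity.
\<close>

definition field_lip :: "real \<Rightarrow> real \<Rightarrow> (real^'n \<Rightarrow> real \<Rightarrow> real^'n) \<Rightarrow> bool" where
  "field_lip \<delta> B P \<longleftrightarrow> (\<forall>x y j. \<forall>t>0. \<forall>s>0. \<bar>P x t $ j - P y s $ j\<bar> \<le>
      CARD('n) * (\<delta> * t powr (- 1 / \<alpha>)) * norm (x - y) + B / min s t * \<bar>t - s\<bar>)"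

lemma C2_field_lip:
  assumes C: "spatially_C2 u" and b: "fields_bounded \<delta> B (Gr u) (He u)"
  shows "field_lip \<delta> B (Gr u)"
  unfolding field_lip_def
proof (intro allI impI)
  fix x y :: "real^'n" and j and t s :: real assume t: "t > 0" and s: "s > 0"
  have "\<bar>Gr u x t $ j - Gr u y t $ j\<bar> \<le> CARD('n) * (\<delta> * t powr (- 1 / \<alpha>)) * norm (x - y)"
  proof (rule partials_bounded_imp_lipschitz)
    show "has_pd i (\<lambda>z. Gr u z t $ j) x (He u x t $ i $ j)" for i x by (rule C2_pd[OF C t])
    show "\<bar>He u x t $ i $ j\<bar> \<le> \<delta> * t powr (- 1 / \<alpha>)" for i x
      using component_le_norm_cart[of "He u x t $ i" j] Finite_Cartesian_Product.norm_nth_le[of "He u x t" i]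
        fields_boundedD(4)[OF b t, of x] by linarith
  qed
  moreover have "\<bar>Gr u y t $ j - Gr u y s $ j\<bar> \<le> B / min s t * \<bar>t - s\<bar>" by (rule fields_boundedD(6)[OF b t s])
  ultimately show "\<bar>Gr u x t $ j - Gr u y s $ j\<bar> \<le> CARD('n) * (\<delta> * t powr (- 1 / \<alpha>)) * norm (x - y) + B / min s t * \<bar>t - s\<bar>"
    by linarith
qed

lemma field_lip_equicontinuous:
  assumes \<delta>: "0 \<le> \<delta>" and B: "0 \<le> B" and t: "t > 0" and e: "e > 0"
  shows "\<exists>d>0. \<forall>P. field_lip \<delta> B P \<longrightarrow> (\<forall>y s. s > 0 \<and> dist (y, s) (x, t) < d \<longrightarrow> norm (P y s - P x t) \<le> e)"
proof -
  let ?n = "real CARD('n)"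
  define K where "K = ?n * (?n * (\<delta> * t powr (- 1 / \<alpha>)) + B / (t / 2)) + 1"
  have K: "K > 0" using \<delta> B t by (auto simp: K_def intro!: add_nonneg_pos mult_nonneg_nonneg add_nonneg_nonneg)
  define d where "d = min (t / 2) (e / K)"
  have d: "d > 0" using t e K by (simp add: d_def)
  have "norm (P y s - P x t) \<le> e" if P: "field_lip \<delta> B P" and s: "s > 0" "dist (y, s) (x, t) < d" for P y s
  proof -
    have n1: "norm (x - y) \<le> d" "\<bar>t - s\<bar> \<le> d"
      using s(2) dist_fst_le[of "(y, s)" "(x, t)"] dist_snd_le[of "(y, s)" "(x, t)"]
      by (auto simp: dist_norm norm_minus_commute dist_real_def abs_minus_commute)
    have "\<bar>t - s\<bar> < t / 2"
      using s(2) dist_snd_le[of "(y, s)" "(x, t)"] by (auto simp: d_def dist_real_def abs_minus_commute)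
    then have "t / 2 \<le> s" by linarith
    then have m: "t / 2 \<le> min s t" using t by simp
    have c: "\<bar>(P y s - P x t) $ j\<bar> \<le> (?n * (\<delta> * t powr (- 1 / \<alpha>)) + B / (t / 2)) * d" for j
    proof -
      have "\<bar>P x t $ j - P y s $ j\<bar> \<le> ?n * (\<delta> * t powr (- 1 / \<alpha>)) * norm (x - y) + B / min s t * \<bar>t - s\<bar>"
        using P t s unfolding field_lip_def by blast
      also have "\<dots> \<le> ?n * (\<delta> * t powr (- 1 / \<alpha>)) * d + B / (t / 2) * d"
        using n1 m t B \<delta> d s(1) by (intro add_mono mult_mono divide_left_mono) auto
      finally show ?thesis by (simp add: distrib_right abs_minus_commute)
    qed
    have "norm (P y s - P x t) \<le> (\<Sum>j\<in>UNIV. \<bar>(P y s - P x t) $ j\<bar>)" by (rule norm_le_l1_cart)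
    also have "\<dots> \<le> (\<Sum>j\<in>(UNIV::'n set). (?n * (\<delta> * t powr (- 1 / \<alpha>)) + B / (t / 2)) * d)" by (intro sum_mono c)
    also have "\<dots> = ?n * (?n * (\<delta> * t powr (- 1 / \<alpha>)) + B / (t / 2)) * d" by simp
    also have "\<dots> \<le> K * d" unfolding K_def using d by (intro mult_right_mono) auto
    also have "\<dots> \<le> K * (e / K)" using K by (intro mult_left_mono) (auto simp: d_def)
    also have "\<dots> = e" using K by simp
    finally show ?thesis .
  qed
  then show ?thesis using d by blast
qed

lemma field_lip_continuous:
  assumes \<delta>: "0 \<le> \<delta>" "0 \<le> B" and P: "field_lip \<delta> B P"
  shows "continuous_on (UNIV \<times> {0<..}) (\<lambda>(x, t). P x t)"
proof (rule continuous_onI, clarify)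
  fix x t e assume "(0::real) < t" "(0::real) < e"
  then obtain d where "d > 0" "\<And>y s. s > 0 \<Longrightarrow> dist (y, s) (x, t) < d \<Longrightarrow> norm (P y s - P x t) \<le> e"
    using field_lip_equicontinuous[OF \<delta>, of t e x] P by blast
  then show "\<exists>d>0. \<forall>z\<in>UNIV \<times> {0<..}. dist z (x, t) < d \<longrightarrow> dist (case z of (x, t) \<Rightarrow> P x t) (P x t) \<le> e"
    by (intro exI[of _ d]) (auto simp: dist_norm)
qed

text \<open>
  On times bounded away from zero the Hessian is the uniform limit of difference quotients of the
  gradient.
\<close>

lemma hessian_continuous:
  fixes P :: "real^'n \<Rightarrow> real \<Rightarrow> real^'n" and M :: "real^'n \<Rightarrow> real \<Rightarrow> real^'n^'n"
  assumes cP: "continuous_on (UNIV \<times> {0<..}) (\<lambda>(x, t). P x t)" and B: "0 \<le> B"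
    and r: "\<And>x t i j h. t > 0 \<Longrightarrow> \<bar>P (x + h *\<^sub>R axis i 1) t $ j - P x t $ j - h * M x t $ i $ j\<bar> \<le> B * t powr (- 2 / \<alpha>) * h\<^sup>2"
  shows "continuous_on (UNIV \<times> {0<..}) (\<lambda>(x, t). M x t)"
proof -
  have ij: "continuous_on (UNIV \<times> {t0<..}) (\<lambda>z. M (fst z) (snd z) $ i $ j)" if t0: "t0 > 0" for t0 i j
  proof -
    define h where "h k = 1 / real (Suc k)" for k
    have h: "h k > 0" for k by (simp add: h_def)
    have h0: "h \<longlonglongrightarrow> 0" unfolding h_def[abs_def] by (rule LIMSEQ_Suc[OF lim_1_over_n])
    define q where "q k z = (P (fst z + h k *\<^sub>R axis i 1) (snd z) $ j - P (fst z) (snd z) $ j) / h k" for k z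
    define K where "K = B * t0 powr (- 2 / \<alpha>)"
    show ?thesis
    proof (rule uniform_limit_theorem[where F=sequentially and f=q])
      show "\<forall>\<^sub>F k in sequentially. continuous_on (UNIV \<times> {t0<..}) (q k)"
      proof (intro always_eventually allI)
        fix k
        have "continuous_on (UNIV \<times> {t0<..}) (\<lambda>z. case (fst z + v, snd z) of (x, t) \<Rightarrow> P x t)" for v
        proof (rule continuous_on_compose2[OF cP])
          show "continuous_on (UNIV \<times> {t0<..}) (\<lambda>z. (fst z + v, snd z))"
            by (intro continuous_on_Pair continuous_on_add continuous_on_fst continuous_on_snd continuous_on_const continuous_on_id)
        qed (use t0 in auto)
        from continuous_on_component[OF this[of "h k *\<^sub>R axis i 1"]] continuous_on_component[OF this[of 0]]
        have "continuous_on (UNIV \<times> {t0<..}) (\<lambda>z. P (fst z + h k *\<^sub>R axis i 1) (snd z) $ j)"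
          "continuous_on (UNIV \<times> {t0<..}) (\<lambda>z. P (fst z) (snd z) $ j)" by (simp_all add: case_prod_unfold)
        then show "continuous_on (UNIV \<times> {t0<..}) (q k)"
          unfolding q_def using h[of k]
          by (intro continuous_on_divide continuous_on_diff continuous_on_const ballI) simp_all
      qed
      show "uniform_limit (UNIV \<times> {t0<..}) q (\<lambda>z. M (fst z) (snd z) $ i $ j) sequentially"
      proof (rule uniform_limitI)
        fix e :: real assume e: "e > 0"
        have "(\<lambda>k. K * h k) \<longlonglongrightarrow> K * 0" by (intro tendsto_intros h0)
        then have "\<forall>\<^sub>F k in sequentially. K * h k < e" using e by (simp add: order_tendstoD(2))
        then show "\<forall>\<^sub>F k in sequentially. \<forall>z\<in>UNIV \<times> {t0<..}. dist (q k z) (M (fst z) (snd z) $ i $ j) < e"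
        proof eventually_elim
          case (elim k)
          show ?case
          proof (intro ballI)
            fix z :: "(real^'n) \<times> real" assume z: "z \<in> UNIV \<times> {t0<..}"
            define x t where "x = fst z" and "t = snd z"
            have zx: "z = (x, t)" by (simp add: x_def t_def)
            have t: "t \<in> {t0<..}" using z by (auto simp: t_def)
            have tp: "t powr (- 2 / \<alpha>) \<le> t0 powr (- 2 / \<alpha>)"
              using t t0 alpha_pos by (intro powr_mono2') (auto simp: divide_nonpos_pos)
            have "(q k (x, t) - M x t $ i $ j) * h k = P (x + h k *\<^sub>R axis i 1) t $ j - P x t $ j - h k * M x t $ i $ j"
            proof -
              have "(a / h k - d) * h k = a - h k * d" for a d using h[of k] by (simp add: left_diff_distrib)
              then show ?thesis unfolding q_def fst_conv snd_conv .
            qed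
            then have "\<bar>(q k (x, t) - M x t $ i $ j) * h k\<bar> \<le> B * t powr (- 2 / \<alpha>) * (h k)\<^sup>2"
              using r[of t x "h k" i j] t t0 by simp
            also have "\<dots> \<le> K * (h k)\<^sup>2" unfolding K_def using tp B by (intro mult_right_mono mult_left_mono) auto
            finally have "\<bar>q k (x, t) - M x t $ i $ j\<bar> * h k \<le> (K * h k) * h k"
              using h[of k] by (simp add: abs_mult power2_eq_square)
            then have "\<bar>q k (x, t) - M x t $ i $ j\<bar> \<le> K * h k" using h[of k] by (rule mult_right_le_imp_le)
            then show "dist (q k z) (M (fst z) (snd z) $ i $ j) < e"
              using elim by (simp add: dist_real_def zx)
          qed
        qed
      qed
    qed simp
  qed
  have "continuous_on (UNIV \<times> {0<..}) (\<lambda>z. M (fst z) (snd z) $ i $ j)" for i j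
  proof -
    have "continuous_on (\<Union>t0\<in>{0<..}. UNIV \<times> {t0<..}) (\<lambda>z. M (fst z) (snd z) $ i $ j)"
      by (rule continuous_on_open_UN) (use ij in \<open>auto intro: open_Times\<close>)
    moreover have "(\<Union>t0\<in>{0<..}. UNIV \<times> {t0<..}) = (UNIV \<times> {0<..} :: ((real^'n) \<times> real) set)"
    proof (intro set_eqI iffI)
      fix z :: "(real^'n) \<times> real" assume "z \<in> UNIV \<times> {0<..}"
      then show "z \<in> (\<Union>t0\<in>{0<..}. UNIV \<times> {t0<..})" by (intro UN_I[of "snd z / 2"]) (auto simp: mem_Times_iff)
    qed auto
    ultimately show ?thesis by simp
  qed
  then have "continuous_on (UNIV \<times> {0<..}) (\<lambda>z. \<chi> i j. M (fst z) (snd z) $ i $ j)"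
    by (intro continuous_on_vec_lambda)
  then show ?thesis by (simp add: case_prod_unfold)
qed

end

context flow_form
begin

definition evolution :: "(real^'n \<Rightarrow> real) \<Rightarrow> (real^'n \<Rightarrow> real \<Rightarrow> real^'n) \<Rightarrow> (real^'n \<Rightarrow> real \<Rightarrow> real^'n^'n) \<Rightarrow> real^'n \<Rightarrow> real \<Rightarrow> real" where
  "evolution f P M x t = linear_part f x t + duhamel P M x t"

text \<open>
  The Hessian bound is invariant under the scaling.
\<close>

lemma scaled_bound:
  assumes "c > 0" "s > 0" shows "c * (\<delta> * (c powr \<alpha> * s) powr (- 1 / \<alpha>)) = \<delta> * s powr (- 1 / \<alpha>)"
proof -
  have "(c powr \<alpha> * s) powr (- 1 / \<alpha>) = c powr (- 1) * s powr (- 1 / \<alpha>)"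
    using assms alpha_pos by (simp add: powr_mult powr_powr)
  moreover have "c * c powr (- 1) = 1" using assms by (simp add: powr_neg_one)
  ultimately show ?thesis by (simp add: mult_ac)
qed

lemma admissible_fields_rescale:
  assumes A: "admissible_fields \<delta> P M" and c: "c > 0"
  shows "admissible_fields \<delta> (\<lambda>y s. P (x + c *\<^sub>R y) (c powr \<alpha> * s)) (\<lambda>y s. c *\<^sub>R M (x + c *\<^sub>R y) (c powr \<alpha> * s))"
  unfolding admissible_fields_def
proof (intro conjI allI impI)
  let ?\<Phi> = "\<lambda>z::real \<times> (real^'n). (c powr \<alpha> * fst z, x + c *\<^sub>R snd z)"
  have \<Phi>: "?\<Phi> \<in> borel_measurable borel"
    by (intro borel_measurable_continuous_onI continuous_intros)
  have cs: "0 < c powr \<alpha> * s \<longleftrightarrow> 0 < s" for s using c by (simp add: zero_less_mult_iff)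
  have "(\<lambda>z. indicator {0<..} (fst (?\<Phi> z)) *\<^sub>R P (snd (?\<Phi> z)) (fst (?\<Phi> z))) \<in> borel_measurable borel"
    by (rule measurable_compose[OF \<Phi>]) (use A in \<open>simp add: admissible_fields_def\<close>)
  then show "(\<lambda>z. indicator {0<..} (fst z) *\<^sub>R P (x + c *\<^sub>R snd z) (c powr \<alpha> * fst z)) \<in> borel_measurable borel"
    by (simp add: indicator_def cs)
  have "(\<lambda>z. indicator {0<..} (fst (?\<Phi> z)) *\<^sub>R M (snd (?\<Phi> z)) (fst (?\<Phi> z))) \<in> borel_measurable borel"
    by (rule measurable_compose[OF \<Phi>]) (use A in \<open>simp add: admissible_fields_def\<close>)
  note m = borel_measurable_scaleR[OF borel_measurable_const[of c] this]
  have e: "indicator {0<..} (fst z) *\<^sub>R c *\<^sub>R M (x + c *\<^sub>R snd z) (c powr \<alpha> * fst z) =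
      c *\<^sub>R (indicator {0<..} (fst (?\<Phi> z)) *\<^sub>R M (snd (?\<Phi> z)) (fst (?\<Phi> z)))" for z
    by (cases "0 < fst z") (simp_all add: indicator_def cs)
  show "(\<lambda>z. indicator {0<..} (fst z) *\<^sub>R c *\<^sub>R M (x + c *\<^sub>R snd z) (c powr \<alpha> * fst z)) \<in> borel_measurable borel"
    unfolding e by (rule m)
  fix s :: real and y assume s: "s > 0"
  then have "norm (M (x + c *\<^sub>R y) (c powr \<alpha> * s)) \<le> \<delta> * (c powr \<alpha> * s) powr (- 1 / \<alpha>)"
    using A cs unfolding admissible_fields_def by blast
  then have "c * norm (M (x + c *\<^sub>R y) (c powr \<alpha> * s)) \<le> c * (\<delta> * (c powr \<alpha> * s) powr (- 1 / \<alpha>))"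
    using c by (intro mult_left_mono) auto
  then show "norm (c *\<^sub>R M (x + c *\<^sub>R y) (c powr \<alpha> * s)) \<le> \<delta> * s powr (- 1 / \<alpha>)"
    unfolding scaled_bound[OF c s] using c by simp
qed

lemma evolution_rescale:
  assumes f: "lipschitz_by L f" and A: "admissible_fields \<delta> P M" and c: "c > 0" and t: "t > 0"
  shows "evolution (\<lambda>y. f (x + c *\<^sub>R y) / c - \<kappa>) (\<lambda>y s. P (x + c *\<^sub>R y) (c powr \<alpha> * s)) (\<lambda>y s. c *\<^sub>R M (x + c *\<^sub>R y) (c powr \<alpha> * s)) z t
    = evolution f P M (x + c *\<^sub>R z) (c powr \<alpha> * t) / c - mass * \<kappa>"
  unfolding evolution_def linear_part_rescale[OF t c lipschitz_by_measurable[OF f] lipschitz_by_growth[OF f]] duhamel_rescale[OF A c t]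
  by (simp add: add_divide_distrib)

text \<open>
  Moving the point \<open>(x, t)\<close> is the same as rescaling and translating data and fields and evaluating
  at \<open>(0, 1)\<close>.  So continuity is an instance of convergence of the linear part and the Duhamel term.
\<close>

lemma evolution_continuous:
  assumes f: "lipschitz_by L f" and A: "admissible_fields \<delta> P M"
    and P: "continuous_on (UNIV \<times> {0<..}) (\<lambda>(x, t). P x t)" and M: "continuous_on (UNIV \<times> {0<..}) (\<lambda>(x, t). M x t)"
  shows "continuous_on (UNIV \<times> {0<..}) (\<lambda>(x, t). evolution f P M x t)"
  unfolding continuous_on_sequentially
proof (intro allI ballI impI, elim conjE)
  fix a :: "(real^'n) \<times> real" and X assume a: "a \<in> UNIV \<times> {0<..}" and X: "\<forall>k. X k \<in> UNIV \<times> {0<..}" "X \<longlonglongrightarrow> a"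
  define x t where "x k = fst (X k)" and "t k = snd (X k)" for k
  define x0 t0 where "x0 = fst a" and "t0 = snd a"
  have t: "t k > 0" "t0 > 0" for k using X(1) a by (auto simp: t_def t0_def mem_Times_iff)
  have xl: "x \<longlonglongrightarrow> x0" unfolding x_def x0_def by (rule tendsto_fst[OF X(2)])
  have tl: "t \<longlonglongrightarrow> t0" unfolding t_def t0_def by (rule tendsto_snd[OF X(2)])
  define c where "c k = t k powr (1 / \<alpha>)" for k
  define c0 where "c0 = t0 powr (1 / \<alpha>)"
  have "t k \<noteq> 0" "t0 \<noteq> 0" for k using t(1)[of k] t(2) by simp_all
  then have c: "c k > 0" "c0 > 0" for k by (simp_all add: c_def c0_def)
  have cl: "c \<longlonglongrightarrow> c0" unfolding c_def c0_def using t by (intro tendsto_powr tl tendsto_const) auto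
  have ct: "c k powr \<alpha> = t k" "c0 powr \<alpha> = t0" for k
    using t(1)[of k] t(2) alpha_pos by (simp_all add: c_def c0_def powr_powr)
  let ?f = "\<lambda>x c y. f (x + c *\<^sub>R y) / c - 0"
  let ?P = "\<lambda>x c y s. P (x + c *\<^sub>R y) (c powr \<alpha> * s)" and ?M = "\<lambda>x c y s. c *\<^sub>R M (x + c *\<^sub>R y) (c powr \<alpha> * s)"
  have ev: "evolution f P M x (c powr \<alpha>) = c * evolution (?f x c) (?P x c) (?M x c) 0 1" if "c > 0" for x c
    using evolution_rescale[OF f A that zero_less_one, of x 0 0] that by simp
  have Y: "(\<lambda>k. x k + c k *\<^sub>R y) \<longlonglongrightarrow> x0 + c0 *\<^sub>R y" for y by (intro tendsto_intros xl cl)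
  have S: "(\<lambda>k. c k powr \<alpha> * s) \<longlonglongrightarrow> c0 powr \<alpha> * s" for s
    using tl by (simp add: ct tendsto_mult_right)
  have field: "(\<lambda>k. q (x k + c k *\<^sub>R y) (c k powr \<alpha> * s)) \<longlonglongrightarrow> q (x0 + c0 *\<^sub>R y) (c0 powr \<alpha> * s)"
    if q: "continuous_on (UNIV \<times> {0<..}) (\<lambda>(x, t). q x t)" and s: "s > 0" for q :: "real^'n \<Rightarrow> real \<Rightarrow> 'z::euclidean_space" and y s
  proof -
    have "(\<lambda>k. case (x k + c k *\<^sub>R y, c k powr \<alpha> * s) of (x, t) \<Rightarrow> q x t) \<longlonglongrightarrow> (case (x0 + c0 *\<^sub>R y, c0 powr \<alpha> * s) of (x, t) \<Rightarrow> q x t)"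
      by (rule continuous_on_tendsto_compose[OF q tendsto_Pair[OF Y S]]) (use s t in \<open>auto simp: ct\<close>)
    then show ?thesis by simp
  qed
  have "(\<lambda>k. duhamel (?P (x k) (c k)) (?M (x k) (c k)) 0 1) \<longlonglongrightarrow> duhamel (?P x0 c0) (?M x0 c0) 0 1"
    by (rule duhamel_converges[OF admissible_fields_rescale[OF A c(1)] admissible_fields_rescale[OF A c(2)] zero_less_one])
      (intro field[OF P] tendsto_scaleR cl field[OF M]; assumption)+
  moreover have "(\<lambda>k. linear_part (?f (x k) (c k)) 0 1) \<longlonglongrightarrow> linear_part (?f x0 c0) 0 1"
  proof -
    have "(\<lambda>k. (\<bar>f 0\<bar> + L * norm (x k)) / c k) \<longlonglongrightarrow> (\<bar>f 0\<bar> + L * norm x0) / c0"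
      using c by (intro tendsto_intros xl cl) auto
    from convergent_imp_Bseq[OF convergentI[OF this]] obtain K where K: "\<And>k. \<bar>(\<bar>f 0\<bar> + L * norm (x k)) / c k\<bar> \<le> K"
      by (auto simp: Bseq_def)
    note lipschitz_by_measurable[OF f, measurable]
    have L: "L \<ge> 0" using f by (simp add: lipschitz_by_def)
    have g: "\<bar>?f (x k) (c k) y\<bar> \<le> K + L * norm y" for k y
    proof -
      have "\<bar>f (x k + c k *\<^sub>R y)\<bar> \<le> \<bar>f 0\<bar> + L * norm (x k + c k *\<^sub>R y)" by (rule lipschitz_by_growth[OF f])
      also have "\<dots> \<le> \<bar>f 0\<bar> + L * (norm (x k) + c k * norm y)"
        using norm_triangle_ineq[of "x k" "c k *\<^sub>R y"] c(1)[of k] L by (intro add_left_mono mult_left_mono) auto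
      finally have "\<bar>f (x k + c k *\<^sub>R y)\<bar> / c k \<le> (\<bar>f 0\<bar> + L * (norm (x k) + c k * norm y)) / c k"
        using c(1)[of k] by (intro divide_right_mono) auto
      also have "\<dots> = (\<bar>f 0\<bar> + L * norm (x k)) / c k + L * norm y"
        using c(1)[of k] by (simp add: field_simps)
      finally show ?thesis using abs_le_D1[OF K[of k]] c(1)[of k] by (simp add: abs_divide)
    qed
    show ?thesis
    proof (rule linear_part_converges[OF zero_less_one _ g])
      show "?f (x k) (c k) \<in> borel_measurable borel" for k by measurable
      have "isCont f z" for z using lipschitz_by_continuous[OF f] by (simp add: continuous_on_eq_continuous_at)
      then show "(\<lambda>k. ?f (x k) (c k) y) \<longlonglongrightarrow> ?f x0 c0 y" for y
        using c by (intro tendsto_intros cl isCont_tendsto_compose[OF _ Y]) auto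
    qed
  qed
  ultimately have "(\<lambda>k. c k * evolution (?f (x k) (c k)) (?P (x k) (c k)) (?M (x k) (c k)) 0 1) \<longlonglongrightarrow>
      c0 * evolution (?f x0 c0) (?P x0 c0) (?M x0 c0) 0 1"
    unfolding evolution_def by (intro tendsto_intros cl)
  then have "(\<lambda>k. evolution f P M (x k) (c k powr \<alpha>)) \<longlonglongrightarrow> evolution f P M x0 (c0 powr \<alpha>)"
    unfolding ev[OF c(1)] ev[OF c(2)] .
  then show "((\<lambda>(x, t). evolution f P M x t) \<circ> X) \<longlonglongrightarrow> (\<lambda>(x, t). evolution f P M x t) a"
    by (simp add: ct comp_def case_prod_unfold x_def t_def x0_def t0_def)
qed

lemma duhamel_formula_evol: "duhamel_formula f u \<longleftrightarrow> (\<forall>x. \<forall>t>0. u x t = evolution f (Gr u) (He u) x t)"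
  by (simp add: duhamel_formula_def evolution_def)

lemma solves_admissible_fields: "solves L \<delta> B f u \<Longrightarrow> admissible_fields \<delta> (Gr u) (He u)"
  using C2_admissible_fields unfolding solves_def by blast

lemma duhamel_cong:
  assumes "\<And>y s. s > 0 \<Longrightarrow> P y s = P' y s" "\<And>y s. s > 0 \<Longrightarrow> M y s = M' y s"
  shows "duhamel P M x t = duhamel P' M' x t"
proof -
  have "indicator {0<..<t} s * (\<integral>y. integrand P M x t s y \<partial>lborel) = indicator {0<..<t} s * (\<integral>y. integrand P' M' x t s y \<partial>lborel)" for s
    using assms by (cases "0 < s") (simp_all add: integrand_def)
  then show ?thesis unfolding duhamel_def by (intro Bochner_Integration.integral_cong refl)
qed

text \<open>
  Ascoli's theorem gives limits of data and gradients; Hessians follow by \<open>pd_limit\<close>, and \<open>u\<close> itself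
  through the Duhamel formula.  Only then the limit fields are recognised as derivatives of the limit.
  The bound at the origin fixes the additive constant, about which derivatives say nothing.
\<close>

lemma solutions_compact:
  fixes f :: "nat \<Rightarrow> real^'n \<Rightarrow> real" and u :: "nat \<Rightarrow> real^'n \<Rightarrow> real \<Rightarrow> real"
  assumes S: "\<And>k. solves L \<delta> B (f k) (u k)" and A: "\<And>k. \<bar>f k 0\<bar> \<le> A"
  shows "\<exists>r f' u'. strict_mono r \<and> solves L \<delta> B f' u' \<and> (\<forall>y. (\<lambda>k. f (r k) y) \<longlonglongrightarrow> f' y) \<and>
    (\<forall>x. \<forall>t>0. (\<lambda>k. u (r k) x t) \<longlonglongrightarrow> u' x t) \<and> (\<forall>x. \<forall>t>0. (\<lambda>k. Gr (u (r k)) x t) \<longlonglongrightarrow> Gr u' x t)"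
proof -
  have lf: "lipschitz_by L (f k)" and C2: "spatially_C2 (u k)" and fb: "fields_bounded \<delta> B (Gr (u k)) (He (u k))" and re: "duhamel_formula (f k) (u k)" for k
    using S[of k] by (auto simp: solves_def)
  have L: "L \<ge> 0" using lf[of 0] by (simp add: lipschitz_by_def)
  note \<delta>B = fields_boundedD(1,2)[OF fb[of 0]]
  have growth: "\<bar>f k y\<bar> \<le> A + L * norm y" for k y
    using lipschitz_by_growth[OF lf[of k], of y] A[of k] by linarith
  have "\<exists>r. strict_mono r \<and> (\<forall>x\<in>UNIV. convergent (\<lambda>k. f (r k) x))"
  proof (rule pointwise_compactness)
    show "\<exists>K. \<forall>k. norm (f k x) \<le> K" for x using growth[of _ x] by auto
    show "\<exists>d>0. \<forall>y\<in>UNIV. dist y x < d \<longrightarrow> (\<forall>k. norm (f k y - f k x) \<le> e)" if e: "e > 0" for x e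
    proof (intro exI[of _ "e / (L + 1)"] conjI ballI impI allI)
      show "e / (L + 1) > 0" using e L by simp
      fix y k assume y: "dist y x < e / (L + 1)"
      have "\<bar>f k y - f k x\<bar> \<le> L * norm (y - x)" using lf[of k] by (simp add: lipschitz_by_def)
      also have "\<dots> \<le> (L + 1) * (e / (L + 1))" using y L by (intro mult_mono) (auto simp: dist_norm)
      also have "\<dots> = e" using L by simp
      finally show "norm (f k y - f k x) \<le> e" by simp
    qed
  qed
  then obtain r1 where r1: "strict_mono r1" "\<And>x. convergent (\<lambda>k. f (r1 k) x)" by auto
  have "\<exists>r. strict_mono r \<and> (\<forall>z\<in>UNIV \<times> {0<..}. convergent (\<lambda>k. Gr (u (r1 (r k))) (fst z) (snd z)))"
  proof (rule pointwise_compactness[of "UNIV \<times> {0<..}" "\<lambda>k z. Gr (u (r1 k)) (fst z) (snd z)"])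
    fix z :: "(real^'n) \<times> real" assume z: "z \<in> UNIV \<times> {0<..}"
    show "\<exists>K. \<forall>k. norm (Gr (u (r1 k)) (fst z) (snd z)) \<le> K"
      using fields_boundedD(3)[OF fb] z by (intro exI[of _ \<delta>]) auto
    fix e :: real assume e: "e > 0"
    have z0: "snd z > 0" using z by auto
    from field_lip_equicontinuous[OF \<delta>B z0 e, of "fst z"] obtain d where d: "d > 0"
      "\<And>P y s. field_lip \<delta> B P \<Longrightarrow> s > 0 \<Longrightarrow> dist (y, s) (fst z, snd z) < d \<Longrightarrow> norm (P y s - P (fst z) (snd z)) \<le> e" by blast
    show "\<exists>d>0. \<forall>y\<in>UNIV \<times> {0<..}. dist y z < d \<longrightarrow> (\<forall>k. norm (Gr (u (r1 k)) (fst y) (snd y) - Gr (u (r1 k)) (fst z) (snd z)) \<le> e)"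
    proof (intro exI[of _ d] conjI ballI impI allI d(1))
      fix y :: "(real^'n) \<times> real" and k assume "y \<in> UNIV \<times> {0<..}" "dist y z < d"
      then show "norm (Gr (u (r1 k)) (fst y) (snd y) - Gr (u (r1 k)) (fst z) (snd z)) \<le> e"
        by (intro d(2)[OF C2_field_lip[OF C2 fb]]) auto
    qed
  qed
  then obtain r2 where r2: "strict_mono r2" "\<And>x t. t > 0 \<Longrightarrow> convergent (\<lambda>k. Gr (u (r1 (r2 k))) x t)"
    by (metis UNIV_I fst_conv greaterThan_iff mem_Sigma_iff snd_conv)
  define r where "r = r1 \<circ> r2"
  have r: "strict_mono r" unfolding r_def using r1(1) r2(1) by (rule strict_mono_o)
  define f' where "f' y = lim (\<lambda>k. f (r k) y)" for y
  define P where "P x t = lim (\<lambda>k. Gr (u (r k)) x t)" for x t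
  have fl: "(\<lambda>k. f (r k) y) \<longlonglongrightarrow> f' y" for y
  proof -
    obtain l where "(\<lambda>k. f (r1 k) y) \<longlonglongrightarrow> l" using r1(2)[of y] by (auto simp: convergent_def)
    from LIMSEQ_subseq_LIMSEQ[OF this r2(1)] have "convergent (\<lambda>k. f (r k) y)" by (auto simp: convergent_def r_def comp_def)
    then show ?thesis by (simp add: f'_def convergent_LIMSEQ_iff)
  qed
  have Pl: "(\<lambda>k. Gr (u (r k)) x t) \<longlonglongrightarrow> P x t" if "t > 0" for x t
    using r2(2)[OF that, of x] by (simp add: P_def r_def convergent_LIMSEQ_iff)
  have Pc: "(\<lambda>k. Gr (u (r k)) x t $ j) \<longlonglongrightarrow> P x t $ j" if "t > 0" for x t j
    by (intro tendsto_vec_nth Pl that)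
  have lf': "lipschitz_by L f'"
    unfolding lipschitz_by_def
  proof (intro conjI allI L)
    show "\<bar>f' x - f' y\<bar> \<le> L * norm (x - y)" for x y
      by (rule LIMSEQ_le_const2[OF tendsto_rabs[OF tendsto_diff[OF fl fl]]]) (use lf in \<open>auto simp: lipschitz_by_def\<close>)
  qed
  have hl: "\<exists>D. (\<lambda>k. He (u (r k)) x t $ i $ j) \<longlonglongrightarrow> D \<and> has_pd i (\<lambda>z. P z t $ j) x D \<and>
      (\<forall>h. \<bar>P (x + h *\<^sub>R axis i 1) t $ j - P x t $ j - h * D\<bar> \<le> B * t powr (- 2 / \<alpha>) * h\<^sup>2)" if t: "t > 0" for x t i j
    by (rule pd_limit[where g="\<lambda>k z. Gr (u (r k)) z t $ j" and D="\<lambda>k z. He (u (r k)) z t $ i $ j"])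
      (rule C2_pd(2)[OF C2 t], rule fields_boundedD(5)[OF fb t], rule Pc[OF t])
  define M where "M x t = (\<chi> i j. lim (\<lambda>k. He (u (r k)) x t $ i $ j))" for x t
  have Mc: "(\<lambda>k. He (u (r k)) x t $ i $ j) \<longlonglongrightarrow> M x t $ i $ j" if t: "t > 0" for x t i j
    using hl[OF t, of x i j] limI unfolding M_def vec_lambda_beta by fast
  have Ml: "(\<lambda>k. He (u (r k)) x t) \<longlonglongrightarrow> M x t" if t: "t > 0" for x t
    by (intro vec_tendstoI Mc[OF t])
  have PM: "has_pd i (\<lambda>z. P z t $ j) x (M x t $ i $ j)"
    and Pr: "\<bar>P (x + h *\<^sub>R axis i 1) t $ j - P x t $ j - h * M x t $ i $ j\<bar> \<le> B * t powr (- 2 / \<alpha>) * h\<^sup>2" if t: "t > 0" for x t i j h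
    using hl[OF t, of x i j] LIMSEQ_unique[OF Mc[OF t]] by auto
  have fb': "fields_bounded \<delta> B P M"
    unfolding fields_bounded_def
  proof (intro conjI allI impI \<delta>B)
    fix t :: real and x assume t: "t > 0"
    show "norm (P x t) \<le> \<delta>"
      by (rule LIMSEQ_le_const2[OF tendsto_norm[OF Pl[OF t]]]) (use fields_boundedD(3)[OF fb t] in blast)
    show "norm (M x t) \<le> \<delta> * t powr (- 1 / \<alpha>)"
      by (rule LIMSEQ_le_const2[OF tendsto_norm[OF Ml[OF t]]]) (use fields_boundedD(4)[OF fb t] in blast)
    show "\<bar>M (x + h *\<^sub>R axis i 1) t $ i $ j - M x t $ i $ j\<bar> \<le> B * t powr (- 2 / \<alpha>) * \<bar>h\<bar>" for h i j
      by (rule LIMSEQ_le_const2[OF tendsto_rabs[OF tendsto_diff[OF Mc[OF t] Mc[OF t]]]]) (use fields_boundedD(5)[OF fb t] in blast)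
    fix s :: real and j assume s: "s > 0"
    show "\<bar>P x t $ j - P x s $ j\<bar> \<le> B / min s t * \<bar>t - s\<bar>"
      by (rule LIMSEQ_le_const2[OF tendsto_rabs[OF tendsto_diff[OF Pc[OF t] Pc[OF s]]]]) (use fields_boundedD(6)[OF fb t s] in blast)
  qed
  have "field_lip \<delta> B P"
    unfolding field_lip_def
  proof (intro allI impI)
    fix x y j and t s :: real assume t: "t > 0" and s: "s > 0"
    show "\<bar>P x t $ j - P y s $ j\<bar> \<le> CARD('n) * (\<delta> * t powr (- 1 / \<alpha>)) * norm (x - y) + B / min s t * \<bar>t - s\<bar>"
      by (rule LIMSEQ_le_const2[OF tendsto_rabs[OF tendsto_diff[OF Pc[OF t] Pc[OF s]]]])
        (use C2_field_lip[OF C2 fb] t s in \<open>unfold field_lip_def, blast\<close>)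
  qed
  then have cP: "continuous_on (UNIV \<times> {0<..}) (\<lambda>(x, t). P x t)" by (rule field_lip_continuous[OF \<delta>B])
  have cM: "continuous_on (UNIV \<times> {0<..}) (\<lambda>(x, t). M x t)" by (rule hessian_continuous[OF cP \<delta>B(2) Pr])
  have ad: "admissible_fields \<delta> P M"
    using field_measurable[OF cP] field_measurable[OF cM] fields_boundedD(4)[OF fb'] unfolding admissible_fields_def by blast
  define u' where "u' = evolution f' P M"
  have ul: "(\<lambda>k. u (r k) x t) \<longlonglongrightarrow> u' x t" if t: "t > 0" for x t
  proof -
    have "u (r k) x t = linear_part (f (r k)) x t + duhamel (Gr (u (r k))) (He (u (r k))) x t" for k
      using re t unfolding duhamel_formula_def by blast
    moreover have "(\<lambda>k. linear_part (f (r k)) x t) \<longlonglongrightarrow> linear_part f' x t"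
      by (rule linear_part_converges[OF t lipschitz_by_measurable[OF lf] growth fl])
    moreover have "(\<lambda>k. duhamel (Gr (u (r k))) (He (u (r k))) x t) \<longlonglongrightarrow> duhamel P M x t"
      by (rule duhamel_converges[OF C2_admissible_fields[OF C2 fb] ad t Pl Ml])
    ultimately show ?thesis unfolding u'_def evolution_def by (simp add: tendsto_add)
  qed
  have uP: "has_pd i (\<lambda>z. u' z t) x (P x t $ i)" if t: "t > 0" for i x t
  proof -
    have Hl: "\<bar>Gr (u (r k)) (x + h *\<^sub>R axis i 1) t $ i - Gr (u (r k)) x t $ i\<bar> \<le> (\<delta> * t powr (- 1 / \<alpha>)) * \<bar>h\<bar>" for k x h
    proof (rule line_bound)
      show "has_pd i (\<lambda>z. Gr (u (r k)) z t $ i) z (He (u (r k)) z t $ i $ i)" for z by (rule C2_pd(2)[OF C2 t])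
      show "\<bar>He (u (r k)) z t $ i $ i\<bar> \<le> \<delta> * t powr (- 1 / \<alpha>)" for z
        using component_le_norm_cart[of "He (u (r k)) z t $ i" i] Finite_Cartesian_Product.norm_nth_le[of "He (u (r k)) z t" i]
          fields_boundedD(4)[OF fb t, of "r k" z] by linarith
    qed
    have "\<exists>D. (\<lambda>k. Gr (u (r k)) x t $ i) \<longlonglongrightarrow> D \<and> has_pd i (\<lambda>z. u' z t) x D \<and>
      (\<forall>h. \<bar>u' (x + h *\<^sub>R axis i 1) t - u' x t - h * D\<bar> \<le> (\<delta> * t powr (- 1 / \<alpha>)) * h\<^sup>2)"
      by (rule pd_limit[where g="\<lambda>k z. u (r k) z t" and D="\<lambda>k z. Gr (u (r k)) z t $ i"])
        (rule C2_pd(1)[OF C2 t], rule Hl, rule ul[OF t])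
    then show ?thesis using LIMSEQ_unique[OF Pc[OF t]] by blast
  qed
  have cu: "continuous_on (UNIV \<times> {0<..}) (\<lambda>(x, t). u' x t)"
    unfolding u'_def by (rule evolution_continuous[OF lf' ad cP cM])
  have C2'1: "spatially_C2 u'"
    by (rule C2_intro(1)[of u' P M], fact uP, fact PM, fact cu, fact cP, fact cM)
  have C2'2: "Gr u' y s = P y s" if "s > 0" for y s
    by (rule C2_intro(2)[of u' P M], fact uP, fact PM, fact cu, fact cP, fact cM, fact that)
  have C2'3: "He u' y s = M y s" if "s > 0" for y s
    by (rule C2_intro(3)[of u' P M], fact uP, fact PM, fact cu, fact cP, fact cM, fact that)
  note C2' = C2'1 C2'2 C2'3
  have "fields_bounded \<delta> B (Gr u') (He u')"
    using fb' C2'(2,3) unfolding fields_bounded_def by simp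
  moreover have "duhamel_formula f' u'"
    unfolding duhamel_formula_def
  proof (intro allI impI)
    fix x and t :: real
    have "duhamel (Gr u') (He u') x t = duhamel P M x t" by (rule duhamel_cong) (rule C2'(2,3), assumption)+
    then show "u' x t = linear_part f' x t + duhamel (Gr u') (He u') x t" by (simp add: u'_def evolution_def)
  qed
  ultimately have "solves L \<delta> B f' u'" using lf' C2'(1) by (simp add: solves_def)
  moreover have "(\<lambda>k. Gr (u (r k)) x t) \<longlonglongrightarrow> Gr u' x t" if "t > 0" for x t
    using Pl[OF that] C2'(2)[OF that] by simp
  ultimately show ?thesis using r fl ul by blast
qed

text \<open>
  The additive constant \<open>\<kappa>\<close> in the datum moves the solution by \<open>mass * \<kappa>\<close>, because the Duhamel term
  sees derivatives only.
\<close>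

lemma solves_rescale:
  fixes x :: "real^'n" and \<kappa> :: real
  assumes S: "solves L \<delta> B f u" and c: "c > 0"
  defines "u' \<equiv> \<lambda>y s. u (x + c *\<^sub>R y) (c powr \<alpha> * s) / c - mass * \<kappa>"
  shows "solves L \<delta> B (\<lambda>y. f (x + c *\<^sub>R y) / c - \<kappa>) u'"
    and "s > 0 \<Longrightarrow> Gr u' y s = Gr u (x + c *\<^sub>R y) (c powr \<alpha> * s)"
proof -
  have lf: "lipschitz_by L f" and C2: "spatially_C2 u" and fb: "fields_bounded \<delta> B (Gr u) (He u)" and re: "duhamel_formula f u"
    using S by (auto simp: solves_def)
  let ?a = "c powr \<alpha>"
  have a: "?a > 0" using c by simp
  have as: "?a * s > 0" if "s > 0" for s using a that by simp
  define P where "P y s = Gr u (x + c *\<^sub>R y) (?a * s)" for y s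
  define M where "M y s = c *\<^sub>R He u (x + c *\<^sub>R y) (?a * s)" for y s
  have pd: "has_pd i (\<lambda>y. g (x + c *\<^sub>R y)) y (c * D)" if "has_pd i g (x + c *\<^sub>R y) D" for i g y D
    using has_pd_scale[of i "\<lambda>z. g (x + z)" c y D 1] that by (simp add: has_pd_def add.assoc)
  have uP: "has_pd i (\<lambda>z. u' z s) y (P y s $ i)" if s: "s > 0" for i y s
  proof -
    have "has_pd i (\<lambda>y. u (x + c *\<^sub>R y) (?a * s)) y (c * (P y s $ i))"
      unfolding P_def by (rule pd) (rule C2_pd(1)[OF C2 as[OF s]])
    from DERIV_diff[OF DERIV_cdivide[OF this[unfolded has_pd_def], of c] DERIV_const[of "mass * \<kappa>"]]
    show ?thesis using c by (simp add: has_pd_def u'_def)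
  qed
  have PM: "has_pd i (\<lambda>z. P z s $ j) y (M y s $ i $ j)" if s: "s > 0" for i j y s
    using pd[OF C2_pd(2)[OF C2 as[OF s]], of i j y] by (simp add: P_def M_def)
  have cc: "continuous_on (UNIV \<times> {0<..}) (\<lambda>z. q (x + c *\<^sub>R fst z) (?a * snd z))"
    if "continuous_on (UNIV \<times> {0<..}) (\<lambda>(x, t). q x t)" for q :: "real^'n \<Rightarrow> real \<Rightarrow> 'z::euclidean_space"
  proof -
    have "continuous_on (UNIV \<times> {0<..}) (\<lambda>z. case (x + c *\<^sub>R fst z, ?a * snd z) of (x, t) \<Rightarrow> q x t)"
    proof (rule continuous_on_compose2[OF that])
      show "continuous_on (UNIV \<times> {0<..}) (\<lambda>z::(real^'n) \<times> real. (x + c *\<^sub>R fst z, ?a * snd z))"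
        by (intro continuous_intros)
      show "(\<lambda>z::(real^'n) \<times> real. (x + c *\<^sub>R fst z, ?a * snd z)) ` (UNIV \<times> {0<..}) \<subseteq> UNIV \<times> {0<..}"
      proof (intro image_subsetI)
        fix z :: "(real^'n) \<times> real" assume "z \<in> UNIV \<times> {0<..}"
        then have "snd z > 0" by (simp add: mem_Times_iff)
        from as[OF this] show "(x + c *\<^sub>R fst z, ?a * snd z) \<in> UNIV \<times> {0<..}" by simp
      qed
    qed
    then show ?thesis by simp
  qed
  have cu: "continuous_on (UNIV \<times> {0<..}) (\<lambda>(x, t). u' x t)"
  proof -
    have "continuous_on (UNIV \<times> {0<..}) (\<lambda>z. u (x + c *\<^sub>R fst z) (?a * snd z))"
      by (rule cc) (use C2 in \<open>simp add: spatially_C2_def\<close>)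
    then show ?thesis
      unfolding u'_def case_prod_unfold
      by (intro continuous_on_diff continuous_on_divide continuous_on_const ballI) (use c in simp_all)
  qed
  have cP: "continuous_on (UNIV \<times> {0<..}) (\<lambda>(x, t). P x t)"
  proof -
    have "continuous_on (UNIV \<times> {0<..}) (\<lambda>z. Gr u (x + c *\<^sub>R fst z) (?a * snd z))"
      by (rule cc) (use C2 in \<open>simp add: spatially_C2_def\<close>)
    then show ?thesis unfolding P_def case_prod_unfold .
  qed
  have cM: "continuous_on (UNIV \<times> {0<..}) (\<lambda>(x, t). M x t)"
  proof -
    have "continuous_on (UNIV \<times> {0<..}) (\<lambda>z. He u (x + c *\<^sub>R fst z) (?a * snd z))"
      by (rule cc) (use C2 in \<open>simp add: spatially_C2_def\<close>)
    then show ?thesis unfolding M_def case_prod_unfold by (intro continuous_on_scaleR continuous_on_const)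
  qed
  have C2'1: "spatially_C2 u'"
    by (rule C2_intro(1)[of u' P M], fact uP, fact PM, fact cu, fact cP, fact cM)
  have C2'2: "Gr u' y s = P y s" if "s > 0" for y s
    by (rule C2_intro(2)[of u' P M], fact uP, fact PM, fact cu, fact cP, fact cM, fact that)
  have C2'3: "He u' y s = M y s" if "s > 0" for y s
    by (rule C2_intro(3)[of u' P M], fact uP, fact PM, fact cu, fact cP, fact cM, fact that)
  note C2' = C2'1 C2'2 C2'3
  show "Gr u' y s = Gr u (x + c *\<^sub>R y) (?a * s)" if "s > 0" for y s
    using C2'(2)[OF that] by (simp add: P_def)
  have "fields_bounded \<delta> B P M"
    unfolding fields_bounded_def
  proof (intro conjI allI impI fields_boundedD(1,2)[OF fb])
    fix t :: real and y assume t: "t > 0"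
    show "norm (P y t) \<le> \<delta>" unfolding P_def by (rule fields_boundedD(3)[OF fb as[OF t]])
    have "c * norm (He u (x + c *\<^sub>R y) (?a * t)) \<le> c * (\<delta> * (?a * t) powr (- 1 / \<alpha>))"
      using c by (intro mult_left_mono fields_boundedD(4)[OF fb as[OF t]]) auto
    then show "norm (M y t) \<le> \<delta> * t powr (- 1 / \<alpha>)"
      unfolding scaled_bound[OF c t] M_def using c by simp
    show "\<bar>M (y + h *\<^sub>R axis i 1) t $ i $ j - M y t $ i $ j\<bar> \<le> B * t powr (- 2 / \<alpha>) * \<bar>h\<bar>" for h i j
    proof -
      have "\<bar>He u ((x + c *\<^sub>R y) + (c * h) *\<^sub>R axis i 1) (?a * t) $ i $ j - He u (x + c *\<^sub>R y) (?a * t) $ i $ j\<bar> \<le> B * (?a * t) powr (- 2 / \<alpha>) * \<bar>c * h\<bar>"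
        by (rule fields_boundedD(5)[OF fb as[OF t]])
      then have "c * \<bar>He u ((x + c *\<^sub>R y) + (c * h) *\<^sub>R axis i 1) (?a * t) $ i $ j - He u (x + c *\<^sub>R y) (?a * t) $ i $ j\<bar> \<le> c * (B * (?a * t) powr (- 2 / \<alpha>) * \<bar>c * h\<bar>)"
        using c by (intro mult_left_mono) auto
      also have "c * (B * (?a * t) powr (- 2 / \<alpha>) * \<bar>c * h\<bar>) = B * t powr (- 2 / \<alpha>) * \<bar>h\<bar>"
      proof -
        have "(?a * t) powr (- 2 / \<alpha>) = c powr (- 2) * t powr (- 2 / \<alpha>)"
          using c t alpha_pos by (simp add: powr_mult powr_powr)
        moreover have "c * c * c powr (- 2) = 1"
          using powr_add[of c 2 "- 2"] c by (simp add: power2_eq_square mult.assoc)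
        ultimately show ?thesis using c by (simp add: abs_mult mult_ac)
      qed
      also have "(x + c *\<^sub>R y) + (c * h) *\<^sub>R axis i 1 = x + c *\<^sub>R (y + h *\<^sub>R axis i 1)" by (simp add: scaleR_add_right add.assoc)
      finally show ?thesis using c by (simp add: M_def abs_mult flip: right_diff_distrib)
    qed
    fix s :: real and j assume s: "s > 0"
    have "\<bar>P y t $ j - P y s $ j\<bar> \<le> B / min (?a * s) (?a * t) * \<bar>?a * t - ?a * s\<bar>"
      unfolding P_def by (rule fields_boundedD(6)[OF fb as[OF t] as[OF s]])
    also have "\<dots> = B / min s t * \<bar>t - s\<bar>"
    proof -
      have "min (?a * s) (?a * t) = ?a * min s t" using a by (simp add: min_mult_distrib_left)
      moreover have "\<bar>?a * t - ?a * s\<bar> = ?a * \<bar>t - s\<bar>" using a by (simp add: abs_mult flip: right_diff_distrib)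
      ultimately show ?thesis using a by simp
    qed
    finally show "\<bar>P y t $ j - P y s $ j\<bar> \<le> B / min s t * \<bar>t - s\<bar>" .
  qed
  then have fb': "fields_bounded \<delta> B (Gr u') (He u')" using C2'(2,3) unfolding fields_bounded_def by simp
  have "lipschitz_by L (\<lambda>y. f (x + c *\<^sub>R y) / c - \<kappa>)"
    unfolding lipschitz_by_def
  proof (intro conjI allI)
    show "0 \<le> L" using lf by (simp add: lipschitz_by_def)
    fix y z
    have "\<bar>f (x + c *\<^sub>R y) - f (x + c *\<^sub>R z)\<bar> \<le> L * norm ((x + c *\<^sub>R y) - (x + c *\<^sub>R z))"
      using lf unfolding lipschitz_by_def by blast
    also have "(x + c *\<^sub>R y) - (x + c *\<^sub>R z) = c *\<^sub>R (y - z)" by (simp add: scaleR_diff_right)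
    finally have "\<bar>f (x + c *\<^sub>R y) - f (x + c *\<^sub>R z)\<bar> \<le> L * norm (y - z) * c" using c by (simp add: mult_ac)
    then have "\<bar>f (x + c *\<^sub>R y) - f (x + c *\<^sub>R z)\<bar> / c \<le> L * norm (y - z)" using c by (simp add: pos_divide_le_eq)
    then show "\<bar>f (x + c *\<^sub>R y) / c - \<kappa> - (f (x + c *\<^sub>R z) / c - \<kappa>)\<bar> \<le> L * norm (y - z)"
      using c by (simp add: abs_divide flip: diff_divide_distrib)
  qed
  moreover have "duhamel_formula (\<lambda>y. f (x + c *\<^sub>R y) / c - \<kappa>) u'"
    unfolding duhamel_formula_evol
  proof (intro allI impI)
    fix y and s :: real assume s: "s > 0"
    have "u' y s = evolution f (Gr u) (He u) (x + c *\<^sub>R y) (?a * s) / c - mass * \<kappa>"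
      using re as[OF s] by (simp add: u'_def duhamel_formula_evol)
    also have "\<dots> = evolution (\<lambda>y. f (x + c *\<^sub>R y) / c - \<kappa>) P M y s"
      unfolding P_def[abs_def] M_def[abs_def] by (rule evolution_rescale[OF lf solves_admissible_fields[OF S] c s, symmetric])
    also have "\<dots> = evolution (\<lambda>y. f (x + c *\<^sub>R y) / c - \<kappa>) (Gr u') (He u') y s"
      unfolding evolution_def using duhamel_cong[of P "Gr u'" M "He u'" y s] C2'(2,3) by simp
    finally show "u' y s = evolution (\<lambda>y. f (x + c *\<^sub>R y) / c - \<kappa>) (Gr u') (He u') y s" .
  qed
  ultimately show "solves L \<delta> B (\<lambda>y. f (x + c *\<^sub>R y) / c - \<kappa>) u'"
    using C2'(1) fb' by (simp add: solves_def)
qed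

end

section \<open>Smallness of the data\<close>

lemma weak_gradient_add:
  assumes f: "weak_gradient f G" and g: "weak_gradient g H"
    and fm: "f \<in> borel_measurable lebesgue" and gm: "g \<in> borel_measurable lebesgue"
  shows "weak_gradient (\<lambda>x. f x + g x) (\<lambda>x. G x + H x)"
  unfolding weak_gradient_def
proof (intro conjI allI impI)
  fix K :: "(real^'a) set" assume K: "compact K"
  show "set_integrable lebesgue K (\<lambda>x. f x + g x)" "set_integrable lebesgue K (\<lambda>x. G x + H x)"
    using f g K unfolding weak_gradient_def by (auto intro: set_integral_add)
next
  fix \<phi> :: "real^'a \<Rightarrow> real" and i assume \<phi>: "smooth \<phi> \<and> compact (closure {x. \<phi> x \<noteq> 0})"
  obtain R B where RB: "\<And>x. norm x > R \<Longrightarrow> \<phi> x = 0" "\<And>x. \<bar>\<phi> x\<bar> \<le> B"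
    "\<And>i x. norm x > R \<Longrightarrow> pd i \<phi> x = 0" "\<And>i x. \<bar>pd i \<phi> x\<bar> \<le> B"
    using test_function_bounds[of \<phi>] \<phi> by (metis (no_types, lifting))
  have pm: "\<phi> \<in> borel_measurable lebesgue" "pd i \<phi> \<in> borel_measurable lebesgue"
    by (rule measurable_completion, simp add: smooth_measurable \<phi>)+
  have i: "integrable lebesgue (\<lambda>x. q x * p x)"
    if q: "set_integrable lebesgue (cball 0 R) q" "q \<in> borel_measurable lebesgue" and p: "p \<in> borel_measurable lebesgue" "\<And>x. norm x > R \<Longrightarrow> p x = 0" "\<And>x. \<bar>p x\<bar> \<le> B"
    for q p :: "real^'a \<Rightarrow> real"
  proof (rule Bochner_Integration.integrable_bound)
    show "integrable lebesgue (\<lambda>x. B * (indicator (cball 0 R) x *\<^sub>R q x))"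
      using q(1) unfolding set_integrable_def by (intro integrable_mult_right)
    show "AE x in lebesgue. norm (q x * p x) \<le> norm (B * (indicator (cball 0 R) x *\<^sub>R q x))"
    proof (intro AE_I2)
      fix x
      have B: "B \<ge> 0" using order_trans[OF abs_ge_zero p(3)[of 0]] .
      show "norm (q x * p x) \<le> norm (B * (indicator (cball 0 R) x *\<^sub>R q x))"
      proof (cases "norm x > R")
        case False
        have "\<bar>q x\<bar> * \<bar>p x\<bar> \<le> \<bar>q x\<bar> * B" by (intro mult_left_mono p(3)) auto
        then show ?thesis using False B by (simp add: abs_mult mult.commute)
      qed (simp add: p(2))
    qed
  qed (use q p in simp)
  have comp: "set_integrable lebesgue (cball 0 R) (\<lambda>x. Q x $ i) \<and> (\<lambda>x. Q x $ i) \<in> borel_measurable lebesgue"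
    if Q: "weak_gradient q Q" for q Q
  proof
    have si: "set_integrable lebesgue (cball 0 r) (\<lambda>x. Q x $ i)" for r
    proof -
      have "integrable lebesgue (\<lambda>x. indicator (cball 0 r) x *\<^sub>R Q x)"
        using Q unfolding weak_gradient_def set_integrable_def by simp
      from integrable_inner_left[OF this, of "axis i 1"] show ?thesis
        by (simp add: set_integrable_def inner_axis)
    qed
    then show "set_integrable lebesgue (cball 0 R) (\<lambda>x. Q x $ i)" .
    show "(\<lambda>x. Q x $ i) \<in> borel_measurable lebesgue"
    proof (rule borel_measurable_LIMSEQ_real)
      show "(\<lambda>k. indicator (cball 0 (real k)) x *\<^sub>R (Q x $ i)) \<longlonglongrightarrow> Q x $ i" for x
      proof (rule tendsto_eventually)
        obtain k0 :: nat where "norm x \<le> real k0" using real_arch_simple by blast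
        then show "\<forall>\<^sub>F k in sequentially. indicator (cball 0 (real k)) x *\<^sub>R (Q x $ i) = Q x $ i"
          by (intro eventually_sequentiallyI[of k0]) auto
      qed
      show "(\<lambda>x. indicator (cball 0 (real k)) x *\<^sub>R (Q x $ i)) \<in> borel_measurable lebesgue" for k
        using si[of "real k"] unfolding set_integrable_def by (rule borel_measurable_integrable)
    qed
  qed
  have sf: "set_integrable lebesgue (cball 0 R) f" "set_integrable lebesgue (cball 0 R) g"
    using f g by (simp_all add: weak_gradient_def)
  note c1 = comp[OF f] and c2 = comp[OF g]
  have "(LINT x|lebesgue. (f x + g x) * pd i \<phi> x) = (LINT x|lebesgue. f x * pd i \<phi> x) + (LINT x|lebesgue. g x * pd i \<phi> x)"
    unfolding distrib_right
    by (intro Bochner_Integration.integral_add i[OF sf(1) fm pm(2) RB(3,4)] i[OF sf(2) gm pm(2) RB(3,4)])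
  also have "\<dots> = - ((LINT x|lebesgue. G x $ i * \<phi> x) + (LINT x|lebesgue. H x $ i * \<phi> x))"
    using f g \<phi> unfolding weak_gradient_def by simp
  also have "(LINT x|lebesgue. G x $ i * \<phi> x) + (LINT x|lebesgue. H x $ i * \<phi> x) = (LINT x|lebesgue. (G x + H x) $ i * \<phi> x)"
    unfolding vector_add_component distrib_right
    by (intro Bochner_Integration.integral_add[symmetric] i[OF conjunct1[OF c1] conjunct2[OF c1] pm(1) RB(1,2)] i[OF conjunct1[OF c2] conjunct2[OF c2] pm(1) RB(1,2)])
  finally show "(LINT x|lebesgue. (f x + g x) * pd i \<phi> x) = - (LINT x|lebesgue. (G x + H x) $ i * \<phi> x)" .
qed

lemma Linf_less_imp_AE:
  fixes f :: "real^'n::finite \<Rightarrow> 'b::real_normed_vector"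
  assumes "Linf f < ennreal a" shows "AE x in lebesgue. norm (f x) \<le> a"
proof -
  have "AE x in lebesgue. ennreal (norm (f x)) \<le> Linf f" unfolding Linf_def by (rule esssup_AE)
  then show ?thesis
  proof eventually_elim
    case (elim x)
    then have "ennreal (norm (f x)) < ennreal a" using assms by (rule order.strict_trans1)
    then show ?case by (simp add: ennreal_less_iff)
  qed
qed

lemma Linf_le:
  fixes f :: "real^'n::finite \<Rightarrow> 'b::euclidean_space"
  assumes "f \<in> borel_measurable lebesgue" "AE x in lebesgue. norm (f x) \<le> a"
  shows "Linf f \<le> ennreal a"
  unfolding Linf_def
  by (rule esssup_I) (use assms in \<open>auto elim!: eventually_mono intro!: ennreal_leI\<close>)

lemma weighted_grad_norm_less:
  assumes "weighted_grad_norm \<omega> f < ennreal a" "\<And>x. \<omega> x \<ge> 1"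
  shows "\<exists>G. weak_gradient f G \<and> (AE x in lebesgue. norm (G x) \<le> a)"
proof -
  obtain G where G: "weak_gradient f G" "Linf (\<lambda>x. \<omega> x *\<^sub>R G x) < ennreal a"
    using assms(1) unfolding weighted_grad_norm_def by (auto simp: INF_less_iff)
  have "AE x in lebesgue. norm (\<omega> x *\<^sub>R G x) \<le> a" by (rule Linf_less_imp_AE[OF G(2)])
  then have "AE x in lebesgue. norm (G x) \<le> a"
  proof eventually_elim
    case (elim x)
    have "1 * norm (G x) \<le> \<omega> x * norm (G x)" using assms(2) by (intro mult_right_mono) auto
    then show ?case using elim assms(2)[of x] by simp
  qed
  then show ?thesis using G(1) by blast
qed

lemma grad_norm_le:
  fixes f :: "real^'n::finite \<Rightarrow> real"
  assumes G: "weak_gradient f G" "G \<in> borel_measurable lebesgue" "AE x in lebesgue. norm (G x) \<le> a"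
  shows "grad_norm f \<le> ennreal a"
  unfolding weighted_grad_norm_def
  by (rule INF_lower2[of G]) (use G Linf_le[OF G(2,3)] in simp_all)

lemma weak_gradient_measurable:
  fixes G :: "real^'n::finite \<Rightarrow> real^'n"
  assumes "weak_gradient f G" shows "G \<in> borel_measurable lebesgue"
proof (rule borel_measurable_LIMSEQ_metric)
  show "(\<lambda>k. indicator (cball 0 (real k)) x *\<^sub>R G x) \<longlonglongrightarrow> G x" for x
  proof (rule tendsto_eventually)
    obtain k0 :: nat where "norm x \<le> real k0" using real_arch_simple by blast
    then show "\<forall>\<^sub>F k in sequentially. indicator (cball 0 (real k)) x *\<^sub>R G x = G x"
      by (intro eventually_sequentiallyI[of k0]) auto
  qed
  have "set_integrable lebesgue (cball 0 (real k)) G" for k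
    using assms by (simp add: weak_gradient_def)
  then show "(\<lambda>x. indicator (cball 0 (real k)) x *\<^sub>R G x) \<in> borel_measurable lebesgue" for k
    unfolding set_integrable_def by (rule borel_measurable_integrable)
qed

text \<open>
  The weight is at least one, so the weighted norm dominates the gradient of \<open>p\<close>.  The sum of the two
  gradient bounds is strictly below \<open>\<epsilon>\<close>, which leaves room to pick gradients that nearly attain the
  infima.
\<close>

lemma perturbed_data_gradient:
  fixes v0 p :: "real^'n::finite \<Rightarrow> real"
  assumes less: "grad_norm v0 + weighted_grad_norm (\<lambda>x. 1 + norm x powr \<beta>) p < ennreal \<epsilon>"
  shows "\<exists>G. weak_gradient v0 G \<and> (AE x in lebesgue. norm (G x) \<le> \<epsilon>)"
    and "\<exists>G. weak_gradient (\<lambda>x. v0 x + p x) G \<and> (AE x in lebesgue. norm (G x) \<le> \<epsilon>)"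
    and "grad_norm v0 < ennreal \<epsilon>" "grad_norm (\<lambda>x. v0 x + p x) < ennreal \<epsilon>"
proof -
  let ?w = "\<lambda>x::real^'n. 1 + norm x powr \<beta>"
  have fin: "grad_norm v0 < \<infinity>" "weighted_grad_norm ?w p < \<infinity>"
    using less by (auto simp: less_top[symmetric] top_unique)
  obtain a where a: "a \<ge> 0" "grad_norm v0 = ennreal a" using fin(1) by (cases "grad_norm v0") auto
  obtain b where b: "b \<ge> 0" "weighted_grad_norm ?w p = ennreal b" using fin(2) by (cases "weighted_grad_norm ?w p") auto
  have ab: "a + b < \<epsilon>" using less a b by (simp add: ennreal_plus[symmetric] ennreal_less_iff del: ennreal_plus)
  \<comment> \<open>A quarter of the slack for each of the two infima leaves half of it unused.\<close>
  define d where "d = (\<epsilon> - a - b) / 4"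
  have d: "d > 0" "(a + d) + (b + d) < \<epsilon>" using ab by (simp_all add: d_def field_simps)
  have "grad_norm v0 < ennreal (a + d)" using a d by (simp add: ennreal_less_iff)
  then obtain G where G: "weak_gradient v0 G" "AE x in lebesgue. norm (G x) \<le> a + d"
    using weighted_grad_norm_less by fastforce
  have "weighted_grad_norm ?w p < ennreal (b + d)" using b d by (simp add: ennreal_less_iff)
  from weighted_grad_norm_less[OF this]
  obtain H where H: "weak_gradient p H" "AE x in lebesgue. norm (H x) \<le> b + d" by auto
  have "AE x in lebesgue. norm (G x) \<le> \<epsilon>" using G(2) by eventually_elim (use d b in linarith)
  then show "\<exists>G. weak_gradient v0 G \<and> (AE x in lebesgue. norm (G x) \<le> \<epsilon>)" using G(1) by blast
  have m: "v0 \<in> borel_measurable lebesgue" "p \<in> borel_measurable lebesgue"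
    using weak_gradient_imp_lipschitz_representative[OF G] weak_gradient_imp_lipschitz_representative[OF H] by blast+
  have wg: "weak_gradient (\<lambda>x. v0 x + p x) (\<lambda>x. G x + H x)" by (rule weak_gradient_add[OF G(1) H(1) m])
  have AE: "AE x in lebesgue. norm (G x + H x) \<le> (a + d) + (b + d)"
    using G(2) H(2)
  proof eventually_elim
    case (elim x)
    then show ?case using norm_triangle_ineq[of "G x" "H x"] by linarith
  qed
  have "AE x in lebesgue. norm (G x + H x) \<le> \<epsilon>" using AE by eventually_elim (use d in linarith)
  then show "\<exists>G. weak_gradient (\<lambda>x. v0 x + p x) G \<and> (AE x in lebesgue. norm (G x) \<le> \<epsilon>)" using wg by blast
  show "grad_norm v0 < ennreal \<epsilon>" using a b ab by (simp add: ennreal_less_iff)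
  have "grad_norm (\<lambda>x. v0 x + p x) \<le> ennreal ((a + d) + (b + d))"
    by (rule grad_norm_le[OF wg weak_gradient_measurable[OF wg] AE])
  also have "\<dots> < ennreal \<epsilon>" using a b d by (intro ennreal_lessI) linarith+
  finally show "grad_norm (\<lambda>x. v0 x + p x) < ennreal \<epsilon>" .
qed

section \<open>Uniqueness of solutions\<close>

context flow_form
begin

lemma lipschitz_by_grad_norm:
  fixes L :: real
  assumes "lipschitz_by L f" shows "grad_norm f \<le> ennreal (CARD('n) * L)"
proof -
  obtain G where "weak_gradient f G" "G \<in> borel_measurable lebesgue" "\<forall>x. norm (G x) \<le> CARD('n) * L"
    using lipschitz_imp_weak_gradient[of f L] assms unfolding lipschitz_by_def by blast
  then show ?thesis by (intro grad_norm_le AE_I2) blast+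
qed

lemma integrand_eq: "duhamel_integrand F N u x t s y = integrand (Gr u) (He u) x t s y"
  unfolding integrand_def kern_def by (rule duhamel_integrand_expand[OF form])

lemma kernel_eq: "kernel F z t = kern [] z t"
  by (simp add: kern_def pd_list_def)

lemma indicator_Times_UNIV: "indicator (A \<times> UNIV) z = (indicator A (fst z) :: real)"
  by (cases z) (simp add: indicator_def)

text \<open>
  All integrands are Borel measurable, so integrals over \<open>lebesgue\<close> and \<open>lborel\<close> agree.
\<close>

lemma duhamel_lebesgue:
  assumes A: "admissible_fields \<delta> (Gr u) (He u)" and t: "t > 0"
  shows "set_integrable lebesgue ({0<..<t} \<times> UNIV) (\<lambda>(s, y). duhamel_integrand F N u x t s y)"
    and "(LINT s:{0<..<t}|lebesgue. (LINT y|lebesgue. duhamel_integrand F N u x t s y)) = duhamel (Gr u) (He u) x t"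
proof -
  let ?J = "spacetime_integrand (Gr u) (He u) x t"
  have Jm: "?J \<in> borel_measurable borel" by (rule spacetime_integrand_measurable[OF A])
  have "integrable lborel ?J" using spacetime_integrand_integrable[OF A t, of x] unfolding lborel_prod .
  then have "integrable lebesgue ?J" using Jm by (subst integrable_completion) auto
  moreover have "(\<lambda>z. indicator ({0<..<t} \<times> UNIV) z *\<^sub>R (case z of (s, y) \<Rightarrow> duhamel_integrand F N u x t s y)) = ?J"
    by (auto simp: fun_eq_iff spacetime_integrand_def integrand_eq indicator_Times_UNIV)
  ultimately show "set_integrable lebesgue ({0<..<t} \<times> UNIV) (\<lambda>(s, y). duhamel_integrand F N u x t s y)"
    by (simp add: set_integrable_def)
  have sec: "integrand (Gr u) (He u) x t s \<in> borel_measurable borel" if "0 < s" "s < t" for s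
  proof -
    have "(\<lambda>y. ?J (s, y)) \<in> borel_measurable borel" by (rule measurable_compose[OF _ Jm]) simp
    moreover have "(\<lambda>y. ?J (s, y)) = integrand (Gr u) (He u) x t s" using that by (simp add: spacetime_integrand_def fun_eq_iff)
    ultimately show ?thesis by simp
  qed
  have inner: "(LINT y|lebesgue. integrand (Gr u) (He u) x t s y) = (\<integral>y. integrand (Gr u) (He u) x t s y \<partial>lborel)"
    if "0 < s" "s < t" for s
    using sec[OF that] by (subst integral_completion) auto
  let ?g = "\<lambda>s. indicator {0<..<t} s * (\<integral>y. integrand (Gr u) (He u) x t s y \<partial>lborel)"
  have gm: "?g \<in> borel_measurable borel"
  proof -
    have "(\<lambda>(s, y). ?J (s, y)) \<in> borel_measurable (lborel \<Otimes>\<^sub>M lborel)" unfolding lborel_prod using Jm by simp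
    from lborel.borel_measurable_lebesgue_integral[OF this]
    have "(\<lambda>s. \<integral>y. ?J (s, y) \<partial>lborel) \<in> borel_measurable lborel" .
    then show ?thesis by (simp add: spacetime_integrand_def)
  qed
  have "(LINT s:{0<..<t}|lebesgue. (LINT y|lebesgue. duhamel_integrand F N u x t s y)) = (LINT s|lebesgue. ?g s)"
    unfolding set_lebesgue_integral_def integrand_eq
    by (intro Bochner_Integration.integral_cong refl) (auto simp: indicator_def inner)
  also have "\<dots> = (\<integral>s. ?g s \<partial>lborel)" using gm by (subst integral_completion) auto
  finally show "(LINT s:{0<..<t}|lebesgue. (LINT y|lebesgue. duhamel_integrand F N u x t s y)) = duhamel (Gr u) (He u) x t"
    by (simp add: duhamel_def)
qed

lemma linear_lebesgue:
  assumes f: "lipschitz_by L f" and t: "t > 0"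
  shows "integrable lebesgue (\<lambda>y. kernel F (x - y) t * f y)"
    and "(LINT y|lebesgue. kernel F (x - y) t * f y) = linear_part f x t"
proof -
  have i: "integrable lborel (\<lambda>y. kern [] (x - y) t * f y)"
    by (rule linear_part_integrable[OF t lipschitz_by_measurable[OF f] lipschitz_by_growth[OF f]])
  have m: "(\<lambda>y. kern [] (x - y) t * f y) \<in> borel_measurable lborel" by (rule borel_measurable_integrable[OF i])
  show "integrable lebesgue (\<lambda>y. kernel F (x - y) t * f y)"
    unfolding kernel_eq using i integrable_completion[OF m] by blast
  show "(LINT y|lebesgue. kernel F (x - y) t * f y) = linear_part f x t"
    unfolding kernel_eq linear_part_def by (rule integral_completion[OF m])
qed

lemma mild_imp_solves:
  assumes m: "mild_solution F N u0 u" and f: "lipschitz_by L f" and eq: "AE x in lebesgue. f x = u0 x"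
    and u0: "u0 \<in> borel_measurable lebesgue" and b: "fields_bounded \<delta> B (Gr u) (He u)"
  shows "solves L \<delta> B f u"
proof -
  have C2: "spatially_C2 u" using m by (simp add: mild_solution_def)
  have "u x t = linear_part f x t + duhamel (Gr u) (He u) x t" if t: "t > 0" for x t
  proof -
    have km: "(\<lambda>y. kernel F (x - y) t) \<in> borel_measurable lebesgue"
      unfolding kernel_eq by (rule measurable_completion) (use kern_measurable[OF Nil_deriv_lists t] in simp)
    have fm: "f \<in> borel_measurable lebesgue" by (rule measurable_completion) (use lipschitz_by_measurable[OF f] in simp)
    have "u x t = (LINT y|lebesgue. kernel F (x - y) t * u0 y)
                + (LINT s:{0<..<t}|lebesgue. (LINT y|lebesgue. duhamel_integrand F N u x t s y))"
      using m t by (simp add: mild_solution_def)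
    also have "(LINT y|lebesgue. kernel F (x - y) t * u0 y) = (LINT y|lebesgue. kernel F (x - y) t * f y)"
      using eq by (intro integral_cong_AE borel_measurable_times km fm u0) (auto elim!: eventually_mono)
    finally show ?thesis using linear_lebesgue(2)[OF f t] duhamel_lebesgue(2)[OF C2_admissible_fields[OF C2 b] t] by simp
  qed
  then show ?thesis using f C2 b by (simp add: solves_def duhamel_formula_def)
qed

text \<open>
  Mild solutions take the value of their datum at time zero, while \<open>solves\<close> speaks of positive times.
\<close>

definition with_data :: "(real^'n \<Rightarrow> real) \<Rightarrow> (real^'n \<Rightarrow> real \<Rightarrow> real) \<Rightarrow> real^'n \<Rightarrow> real \<Rightarrow> real" where
  "with_data f u x t = (if t = 0 then f x else u x t)"

lemma with_data_pos: "t > 0 \<Longrightarrow> (\<lambda>x. with_data f u x t) = (\<lambda>x. u x t)"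
  by (simp add: with_data_def fun_eq_iff)

lemma spatially_C2_cong:
  fixes u w :: "real^'n \<Rightarrow> real \<Rightarrow> real"
  assumes C: "spatially_C2 u" and eq: "\<And>t. t > 0 \<Longrightarrow> (\<lambda>x. w x t) = (\<lambda>x. u x t)"
  shows "spatially_C2 w"
  unfolding spatially_C2_def
proof (intro conjI allI impI)
  show "Ck 2 (\<lambda>x. w x t)" if "t > 0" for t using C that by (simp add: eq spatially_C2_def)
  have "continuous_on (UNIV \<times> {0<..}) (\<lambda>(x, t). u x t)" using C by (simp add: spatially_C2_def)
  then show "continuous_on (UNIV \<times> {0<..}) (\<lambda>(x, t). w x t)"
    by (rule continuous_on_eq) (use eq in \<open>auto simp: fun_eq_iff\<close>)
  have "continuous_on (UNIV \<times> {0<..}) (\<lambda>(x, t). Gr u x t)" using C by (simp add: spatially_C2_def)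
  then show "continuous_on (UNIV \<times> {0<..}) (\<lambda>(x, t). Gr w x t)"
    by (rule continuous_on_eq) (auto simp: eq)
  have "continuous_on (UNIV \<times> {0<..}) (\<lambda>(x, t). He u x t)" using C by (simp add: spatially_C2_def)
  then show "continuous_on (UNIV \<times> {0<..}) (\<lambda>(x, t). He w x t)"
    by (rule continuous_on_eq) (auto simp: eq)
qed

lemma solves_imp_mild:
  assumes S: "solves L \<delta> B f u"
  shows "mild_solution F N f (with_data f u)"
proof -
  let ?w = "with_data f u"
  have f: "lipschitz_by L f" and C2: "spatially_C2 u" and b: "fields_bounded \<delta> B (Gr u) (He u)" and re: "duhamel_formula f u"
    using S by (auto simp: solves_def)
  have C2': "spatially_C2 ?w" by (rule spatially_C2_cong[OF C2]) (rule with_data_pos)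
  have b': "fields_bounded \<delta> B (Gr ?w) (He ?w)" using b unfolding fields_bounded_def by (simp add: with_data_pos)
  have A: "admissible_fields \<delta> (Gr ?w) (He ?w)" by (rule C2_admissible_fields[OF C2' b'])
  have duhamel: "duhamel (Gr ?w) (He ?w) x t = duhamel (Gr u) (He u) x t" for x t
    by (rule duhamel_cong) (simp_all add: with_data_pos)
  have w: "?w x t = u x t" if "t > 0" for x t using that by (simp add: with_data_def)
  show ?thesis
    unfolding mild_solution_def
  proof (intro conjI allI impI C2')
    show "?w x 0 = f x" for x by (simp add: with_data_def)
    fix x and t :: real assume t: "t > 0"
    show "integrable lebesgue (\<lambda>y. kernel F (x - y) t * f y)" by (rule linear_lebesgue(1)[OF f t])
    show "set_integrable lebesgue ({0<..<t} \<times> UNIV) (\<lambda>(s, y). duhamel_integrand F N ?w x t s y)"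
      by (rule duhamel_lebesgue(1)[OF A t])
    have "u x t = linear_part f x t + duhamel (Gr u) (He u) x t" using re t by (simp add: duhamel_formula_def)
    then show "?w x t = (LINT y|lebesgue. kernel F (x - y) t * f y)
        + (LINT s:{0<..<t}|lebesgue. (LINT y|lebesgue. duhamel_integrand F N ?w x t s y))"
      unfolding linear_lebesgue(2)[OF f t] duhamel_lebesgue(2)[OF A t] duhamel w[OF t] .
  qed
qed

definition X_exponent :: real where "X_exponent = real CARD('n) + \<alpha> + 2"

text \<open>
  The Hessian part of the norm of a field bounded by \<open>\<delta> t powr (- 1 / \<alpha>)\<close>: on the cylinder
  \<open>B\<^sub>R \<times> (R\<^sup>\<alpha> / 2, R\<^sup>\<alpha>)\<close> the field is at most \<open>\<delta> 2\<^sup>1\<^sup>/\<^sup>\<alpha> / R\<close>, and the volume is the volume of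
  the unit ball times \<open>R\<^sup>n\<^sup>+\<^sup>\<alpha> / 2\<close>.  The powers of \<open>R\<close> cancel.  The summand one accounts for the
  gradient.
\<close>

definition X_const :: real where
  "X_const = 1 + (2 powr (X_exponent / \<alpha>) * unit_ball_vol (real CARD('n)) / 2) powr (1 / X_exponent)"

lemma X_exponent_pos: "X_exponent > 0" using alpha_pos by (simp add: X_exponent_def)

lemma Lq_bound:
  assumes R: "R > 0" and \<delta>: "\<delta> \<ge> 0" and g: "\<And>x t. t > 0 \<Longrightarrow> norm (g (x, t)) \<le> \<delta> * t powr (- 1 / \<alpha>)"
  shows "ennreal (R powr (2 / X_exponent)) * Lq_norm X_exponent (ball (x :: real^'n) R \<times> {R powr \<alpha> / 2 <..< R powr \<alpha>}) g \<le> ennreal ((X_const - 1) * \<delta>)"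
proof -
  let ?S = "ball x R \<times> {R powr \<alpha> / 2 <..< R powr \<alpha>}"
  let ?\<omega> = "unit_ball_vol (real CARD('n))"
  let ?q = X_exponent
  define c where "c = \<delta> * (2 powr (1 / \<alpha>) / R)"
  have c: "c \<ge> 0" using \<delta> R by (simp add: c_def)
  have Ra: "R powr \<alpha> > 0" using R by simp
  have gb: "norm (g z) \<le> c" if z: "z \<in> ?S" for z
  proof -
    have t: "snd z > R powr \<alpha> / 2" using z by auto
    have t0: "snd z > 0" using t Ra by linarith
    have "norm (g z) \<le> \<delta> * snd z powr (- 1 / \<alpha>)" using g[OF t0, of "fst z"] by simp
    also have "\<dots> \<le> \<delta> * (R powr \<alpha> / 2) powr (- 1 / \<alpha>)"
      using t Ra alpha_pos by (intro mult_left_mono \<delta> powr_mono2') (auto simp: divide_nonpos_pos)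
    also have "(R powr \<alpha> / 2) powr (- 1 / \<alpha>) = 2 powr (1 / \<alpha>) / R"
    proof -
      have "(R powr \<alpha> / 2) powr (- 1 / \<alpha>) = (R powr \<alpha>) powr (- 1 / \<alpha>) / 2 powr (- 1 / \<alpha>)"
        by (rule powr_divide)
      also have "(R powr \<alpha>) powr (- 1 / \<alpha>) = R powr (- 1)" using alpha_pos by (simp add: powr_powr)
      also have "R powr (- 1) = 1 / R" by (rule powr_neg_one[OF R])
      also have "2 powr (- 1 / \<alpha>) = 1 / (2::real) powr (1 / \<alpha>)" by (simp add: powr_minus_divide)
      finally show ?thesis by simp
    qed
    finally show ?thesis by (simp add: c_def)
  qed
  define V where "V = ?\<omega> * R ^ CARD('n) * (R powr \<alpha> / 2)"
  have V: "V \<ge> 0" using R by (simp add: V_def)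
  have Sb: "?S \<in> sets borel" by (intro borel_open open_Times) auto
  have Sm: "?S \<in> sets lebesgue" using Sb by simp
  have eS: "emeasure lebesgue ?S = ennreal V"
  proof -
    have "emeasure lebesgue ?S = emeasure lborel ?S" using Sb by simp
    also have "\<dots> = emeasure (lborel \<Otimes>\<^sub>M lborel) ?S" by (simp add: lborel_prod)
    also have "\<dots> = emeasure lborel (ball x R) * emeasure lborel {R powr \<alpha> / 2 <..< R powr \<alpha>}"
      by (rule lborel.emeasure_pair_measure_Times) auto
    also have "\<dots> = ennreal (?\<omega> * R ^ CARD('n)) * ennreal (R powr \<alpha> / 2)"
      using R Ra by (simp add: emeasure_ball)
    also have "\<dots> = ennreal V" unfolding V_def using R by (intro ennreal_mult[symmetric]) simp_all
    finally show ?thesis .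
  qed
  define I where "I = (\<integral>\<^sup>+ z\<in>?S. ennreal (norm (g z) powr ?q) \<partial>lebesgue)"
  have I: "I \<le> ennreal (c powr ?q * V)"
  proof -
    have "I \<le> (\<integral>\<^sup>+ z. ennreal (c powr ?q) * indicator ?S z \<partial>lebesgue)"
      unfolding I_def
    proof (intro nn_integral_mono)
      fix z :: "(real^'n) \<times> real"
      show "ennreal (norm (g z) powr ?q) * indicator ?S z \<le> ennreal (c powr ?q) * indicator ?S z"
      proof (cases "z \<in> ?S")
        case True
        have "norm (g z) powr ?q \<le> c powr ?q" using gb[OF True] X_exponent_pos by (intro powr_mono2) auto
        then show ?thesis using True by (simp add: ennreal_leI)
      qed simp
    qed
    also have "\<dots> = ennreal (c powr ?q) * emeasure lebesgue ?S" by (rule nn_integral_cmult_indicator[OF Sm])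
    also have "\<dots> = ennreal (c powr ?q * V)" unfolding eS using V by (simp add: ennreal_mult)
    finally show ?thesis .
  qed
  then have fin: "I \<noteq> \<infinity>" by (auto simp: top_unique)
  have "Lq_norm ?q ?S g = ennreal (enn2real I powr (1 / ?q))"
    unfolding Lq_norm_def I_def[symmetric] using fin by simp
  also have "\<dots> \<le> ennreal ((c powr ?q * V) powr (1 / ?q))"
    using I X_exponent_pos V by (intro ennreal_leI powr_mono2) (auto intro!: enn2real_leI)
  finally have "ennreal (R powr (2 / ?q)) * Lq_norm ?q ?S g \<le> ennreal (R powr (2 / ?q)) * ennreal ((c powr ?q * V) powr (1 / ?q))"
    by (intro mult_left_mono) auto
  also have "\<dots> = ennreal (R powr (2 / ?q) * (c powr ?q * V) powr (1 / ?q))" by (simp add: ennreal_mult)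
  also have "R powr (2 / ?q) * (c powr ?q * V) powr (1 / ?q) = (X_const - 1) * \<delta>"
  proof (cases "\<delta> = 0")
    case False
    then have \<delta>: "\<delta> > 0" using \<delta> by simp
    let ?W = "2 powr (?q / \<alpha>) * ?\<omega> / 2"
    have cq: "c powr ?q = \<delta> powr ?q * (2 powr (?q / \<alpha>) * R powr (- ?q))"
      using \<delta> R by (simp add: c_def powr_mult powr_divide powr_powr powr_minus_divide)
    have Rn: "R ^ CARD('n) = R powr real CARD('n)" using R by (simp add: powr_realpow)
    have "R powr (- ?q) * (R powr real CARD('n) * R powr \<alpha>) = R powr (- 2)"
      unfolding X_exponent_def by (simp flip: powr_add)
    then have "c powr ?q * V = \<delta> powr ?q * (?W * R powr (- 2))"
      unfolding cq V_def Rn by (simp add: mult_ac)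
    then have "(c powr ?q * V) powr (1 / ?q) = (\<delta> powr ?q * (?W * R powr (- 2))) powr (1 / ?q)" by (rule arg_cong)
    also have "\<dots> = (\<delta> powr ?q) powr (1 / ?q) * (?W powr (1 / ?q) * (R powr (- 2)) powr (1 / ?q))"
      by (simp only: powr_mult)
    also have "\<dots> = \<delta> powr (?q * (1 / ?q)) * (?W powr (1 / ?q) * R powr (- 2 * (1 / ?q)))"
      by (simp only: powr_powr)
    also have "\<dots> = \<delta> * (?W powr (1 / ?q) * R powr (- 2 / ?q))" using X_exponent_pos \<delta> by simp
    finally have "R powr (2 / ?q) * (c powr ?q * V) powr (1 / ?q) = \<delta> * ?W powr (1 / ?q) * (R powr (2 / ?q) * R powr (- 2 / ?q))"
      by (simp add: mult_ac)
    also have "R powr (2 / ?q) * R powr (- 2 / ?q) = 1" using R by (simp flip: powr_add)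
    finally show ?thesis by (simp add: X_const_def mult.commute)
  qed (simp add: c_def)
  finally show ?thesis .
qed

lemma X_norm_bound:
  assumes C: "spatially_C2 u" and b: "fields_bounded \<delta> B (Gr u) (He u)"
  shows "X_norm F \<infinity> u \<le> ennreal (X_const * \<delta>)"
proof -
  have \<delta>: "\<delta> \<ge> 0" by (rule fields_boundedD(1)[OF b])
  have G: "Linf (grad (\<lambda>x. u x t)) \<le> ennreal \<delta>" if t: "t > 0" for t
  proof (rule Linf_le)
    have "continuous_on (UNIV \<times> {0<..}) (\<lambda>(x, t). Gr u x t)" using C by (simp add: spatially_C2_def)
    then have "continuous_on UNIV (\<lambda>x. case (x, t) of (x, t) \<Rightarrow> Gr u x t)"
      by (rule continuous_on_compose2) (use t in \<open>auto intro!: continuous_intros\<close>)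
    then have "(\<lambda>x. Gr u x t) \<in> borel_measurable borel" by (simp add: borel_measurable_continuous_onI)
    then show "grad (\<lambda>x. u x t) \<in> borel_measurable lebesgue" by (intro measurable_completion) simp
    show "AE x in lebesgue. norm (grad (\<lambda>x. u x t) x) \<le> \<delta>" using fields_boundedD(3)[OF b t] by simp
  qed
  have Xc: "X_const - 1 \<ge> 0" by (simp add: X_const_def)
  have "X_norm F \<infinity> u \<le> ennreal \<delta> + ennreal ((X_const - 1) * \<delta>)"
    unfolding X_norm_def Let_def X_exponent_def[symmetric]
  proof (intro add_mono SUP_least)
    show "Linf (grad (\<lambda>x. u x t)) \<le> ennreal \<delta>" if "t \<in> {t. 0 < t \<and> ereal t < \<infinity>}" for t using that G by simp
    fix x :: "real^'n" and R assume "R \<in> {R. 0 < R \<and> ereal (R powr \<alpha>) < \<infinity>}"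
    then show "ennreal (R powr (2 / X_exponent)) * Lq_norm X_exponent (ball x R \<times> {R powr \<alpha> / 2<..<R powr \<alpha>}) (\<lambda>(y, t). He u y t) \<le> ennreal ((X_const - 1) * \<delta>)"
      using fields_boundedD(4)[OF b] by (intro Lq_bound \<delta>) auto
  qed
  also have "\<dots> = ennreal (\<delta> + (X_const - 1) * \<delta>)" using \<delta> Xc by (simp add: ennreal_plus del: ennreal_plus flip: ennreal_plus)
  also have "\<delta> + (X_const - 1) * \<delta> = X_const * \<delta>" by (simp add: left_diff_distrib)
  finally show ?thesis .
qed

text \<open>
  A small solution, given its datum at time zero, lies in the ball of the \<open>X\<close> norm where the
  Koch--Lamm theorem asserts uniqueness.
\<close>

lemma solutions_unique:
  fixes L \<delta> eps0 C :: real
  assumes kl: "koch_lamm F N eps0 C" and S: "solves L \<delta> B f u" "solves L \<delta> B f v"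
    and small: "CARD('n) * L < eps0" "X_const * \<delta> \<le> C * eps0" and t: "t > 0"
  shows "u x t = v x t"
proof -
  have f: "lipschitz_by L f" using S by (simp add: solves_def)
  have "CARD('n) * L \<ge> 0" using f by (simp add: lipschitz_by_def)
  then have "ennreal (CARD('n) * L) < ennreal eps0" using small(1) by (simp add: ennreal_less_iff)
  then have gf: "grad_norm f < ennreal eps0" by (rule order.strict_trans1[OF lipschitz_by_grad_norm[OF f]])
  then obtain w where w: "\<And>u' x t. mild_solution F N f u' \<Longrightarrow> X_norm F \<infinity> u' \<le> ennreal (C * eps0) \<Longrightarrow> t \<ge> 0 \<Longrightarrow> u' x t = w x t"
  proof -
    obtain w where "\<forall>u'. mild_solution F N f u' \<and> X_norm F \<infinity> u' \<le> ennreal (C * eps0) \<longrightarrow> (\<forall>x. \<forall>t\<ge>0. u' x t = w x t)"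
      using kl gf unfolding koch_lamm_def by blast
    then show ?thesis using that by blast
  qed
  have "u x t = w x t" if S: "solves L \<delta> B f u" for u
  proof -
    have C2: "spatially_C2 u" and b: "fields_bounded \<delta> B (Gr u) (He u)" using S by (auto simp: solves_def)
    have b': "fields_bounded \<delta> B (Gr (with_data f u)) (He (with_data f u))"
      using b unfolding fields_bounded_def by (simp add: with_data_pos)
    have "X_norm F \<infinity> (with_data f u) \<le> ennreal (X_const * \<delta>)"
      by (rule X_norm_bound[OF _ b'], rule spatially_C2_cong[OF C2], rule with_data_pos)
    also have "\<dots> \<le> ennreal (C * eps0)" using small(2) by (rule ennreal_leI)
    finally have "with_data f u x t = w x t" using w[OF solves_imp_mild[OF S]] t by simp
    then show ?thesis using t by (simp add: with_data_def)
  qed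
  from this[OF S(1)] this[OF S(2)] show ?thesis by simp
qed

section \<open>Merging at large scales\<close>

text \<open>
  Both solutions are recentred at \<open>x k\<close>, rescaled by \<open>c k\<close> and shifted by the same constant \<open>\<kappa> k\<close>, which
  normalises \<open>g\<close> at the origin.  The rescaled data differ by at most \<open>K / c k\<close>, so the limits have
  the same datum and coincide by uniqueness; evaluate at the origin at time one.
\<close>

lemma rescaled_solutions_merge:
  fixes L \<delta> eps0 C K :: real and c :: "nat \<Rightarrow> real" and x :: "nat \<Rightarrow> real^'n"
  assumes kl: "koch_lamm F N eps0 C" and S: "solves L \<delta> B f u" "solves L \<delta> B g v"
    and small: "CARD('n) * L < eps0" "X_const * \<delta> \<le> C * eps0"
    and K: "\<And>y. \<bar>f y - g y\<bar> \<le> K" and c: "\<And>k. c k > 0" "filterlim c at_top sequentially"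
  shows "\<exists>r. strict_mono r \<and>
    (\<lambda>k. (u (x (r k)) (c (r k) powr \<alpha>) - v (x (r k)) (c (r k) powr \<alpha>)) / c (r k)) \<longlonglongrightarrow> 0 \<and>
    (\<lambda>k. Gr u (x (r k)) (c (r k) powr \<alpha>) - Gr v (x (r k)) (c (r k) powr \<alpha>)) \<longlonglongrightarrow> 0"
proof -
  define \<kappa> where "\<kappa> k = g (x k) / c k" for k
  define fk where "fk k y = f (x k + c k *\<^sub>R y) / c k - \<kappa> k" for k y
  define gk where "gk k y = g (x k + c k *\<^sub>R y) / c k - \<kappa> k" for k y
  define uk where "uk k y s = u (x k + c k *\<^sub>R y) (c k powr \<alpha> * s) / c k - mass * \<kappa> k" for k y s
  define vk where "vk k y s = v (x k + c k *\<^sub>R y) (c k powr \<alpha> * s) / c k - mass * \<kappa> k" for k y s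
  have Su: "solves L \<delta> B (fk k) (uk k)" "s > 0 \<Longrightarrow> Gr (uk k) y s = Gr u (x k + c k *\<^sub>R y) (c k powr \<alpha> * s)" for k y s
    unfolding fk_def uk_def by (rule solves_rescale[OF S(1) c(1)], rule solves_rescale[OF S(1) c(1)])
  have Sv: "solves L \<delta> B (gk k) (vk k)" "s > 0 \<Longrightarrow> Gr (vk k) y s = Gr v (x k + c k *\<^sub>R y) (c k powr \<alpha> * s)" for k y s
    unfolding gk_def vk_def by (rule solves_rescale[OF S(2) c(1)], rule solves_rescale[OF S(2) c(1)])
  have diff: "\<bar>fk k y - gk k y\<bar> \<le> K / c k" for k y
    using divide_right_mono[OF K[of "x k + c k *\<^sub>R y"], of "c k"] c(1)[of k]
    by (simp add: fk_def gk_def abs_divide flip: diff_divide_distrib)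
  have Kc: "(\<lambda>k. K / c k) \<longlonglongrightarrow> 0"
    by (rule tendsto_divide_0[OF tendsto_const filterlim_at_top_imp_at_infinity[OF c(2)]])
  obtain A where A: "\<And>k. \<bar>K / c k\<bar> \<le> A"
    using convergent_imp_Bseq[OF convergentI[OF Kc]] by (auto simp: Bseq_def)
  have g0: "gk k 0 = 0" for k by (simp add: gk_def \<kappa>_def)
  have f0: "\<bar>fk k 0\<bar> \<le> A" for k using diff[of k 0] A[of k] g0[of k] by linarith
  obtain r1 f' u' where r1: "strict_mono r1" "solves L \<delta> B f' u'" "\<And>y. (\<lambda>k. fk (r1 k) y) \<longlonglongrightarrow> f' y"
    "\<And>x t. t > 0 \<Longrightarrow> (\<lambda>k. uk (r1 k) x t) \<longlonglongrightarrow> u' x t" "\<And>x t. t > 0 \<Longrightarrow> (\<lambda>k. Gr (uk (r1 k)) x t) \<longlonglongrightarrow> Gr u' x t"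
    using solutions_compact[of L \<delta> B fk uk A, OF Su(1) f0] by blast
  have g00: "\<bar>gk (r1 k) 0\<bar> \<le> 0" for k using g0 by simp
  obtain r2 g' v' where r2: "strict_mono r2" "solves L \<delta> B g' v'" "\<And>y. (\<lambda>k. gk (r1 (r2 k)) y) \<longlonglongrightarrow> g' y"
    "\<And>x t. t > 0 \<Longrightarrow> (\<lambda>k. vk (r1 (r2 k)) x t) \<longlonglongrightarrow> v' x t" "\<And>x t. t > 0 \<Longrightarrow> (\<lambda>k. Gr (vk (r1 (r2 k))) x t) \<longlonglongrightarrow> Gr v' x t"
    using solutions_compact[of L \<delta> B "\<lambda>k. gk (r1 k)" "\<lambda>k. vk (r1 k)" 0, OF Sv(1) g00] by blast
  define r where "r k = r1 (r2 k)" for k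
  have r: "strict_mono r" using strict_mono_o[OF r1(1) r2(1)] by (simp add: r_def[abs_def] comp_def)
  have sub: "(\<lambda>k. X (r k)) \<longlonglongrightarrow> l" if "(\<lambda>k. X (r1 k)) \<longlonglongrightarrow> l" for X :: "nat \<Rightarrow> 'z::topological_space" and l
    using LIMSEQ_subseq_LIMSEQ[OF that r2(1)] by (simp add: r_def comp_def)
  have fg: "f' y = g' y" for y
  proof -
    have "(\<lambda>k. fk (r k) y - gk (r k) y) \<longlonglongrightarrow> f' y - g' y"
      using r2(3) by (intro tendsto_diff sub[OF r1(3)]) (simp add: r_def)
    moreover have "(\<lambda>k. fk (r k) y - gk (r k) y) \<longlonglongrightarrow> 0"
    proof (rule Lim_null_comparison)
      show "\<forall>\<^sub>F k in sequentially. norm (fk (r k) y - gk (r k) y) \<le> K / c (r k)" using diff by simp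
      show "(\<lambda>k. K / c (r k)) \<longlonglongrightarrow> 0" using LIMSEQ_subseq_LIMSEQ[OF Kc r] by (simp add: comp_def)
    qed
    ultimately have "f' y - g' y = 0" by (rule LIMSEQ_unique)
    then show ?thesis by simp
  qed
  then have "f' = g'" by blast
  then have eq: "u' y s = v' y s" if "s > 0" for y s
    using solutions_unique[OF kl r1(2) _ small that] r2(2) by simp
  then have "(\<lambda>z. u' z 1) = (\<lambda>z. v' z 1)" by simp
  then have eqG: "Gr u' 0 1 = Gr v' 0 1" by simp
  have "(\<lambda>k. uk (r k) 0 1 - vk (r k) 0 1) \<longlonglongrightarrow> u' 0 1 - v' 0 1"
    using r2(4)[OF zero_less_one, of 0] by (intro tendsto_diff sub[OF r1(4)]) (simp_all add: r_def)
  moreover have "uk k 0 1 - vk k 0 1 = (u (x k) (c k powr \<alpha>) - v (x k) (c k powr \<alpha>)) / c k" for k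
    by (simp add: uk_def vk_def diff_divide_distrib)
  ultimately have 1: "(\<lambda>k. (u (x (r k)) (c (r k) powr \<alpha>) - v (x (r k)) (c (r k) powr \<alpha>)) / c (r k)) \<longlonglongrightarrow> 0"
    using eq by simp
  have "(\<lambda>k. Gr (uk (r k)) 0 1 - Gr (vk (r k)) 0 1) \<longlonglongrightarrow> Gr u' 0 1 - Gr v' 0 1"
    using r2(5)[OF zero_less_one, of 0] by (intro tendsto_diff sub[OF r1(5)]) (simp_all add: r_def)
  then have 2: "(\<lambda>k. Gr u (x (r k)) (c (r k) powr \<alpha>) - Gr v (x (r k)) (c (r k) powr \<alpha>)) \<longlonglongrightarrow> 0"
    using eqG by (simp add: Su(2)[OF zero_less_one] Sv(2)[OF zero_less_one])
  show ?thesis using r 1 2 by blast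
qed

end

lemma AE_lebesgue_negligible:
  fixes Q :: "real^'n::finite \<Rightarrow> bool"
  shows "(AE x in lebesgue. Q x) \<longleftrightarrow> negligible {x. \<not> Q x}"
proof
  assume "AE x in lebesgue. Q x"
  then obtain S where "{x. \<not> Q x} \<subseteq> S" "S \<in> null_sets lebesgue"
    by (rule AE_E) (simp add: null_sets_def)
  then show "negligible {x. \<not> Q x}" using negligible_subset negligible_iff_null_sets by blast
next
  assume "negligible {x. \<not> Q x}"
  then show "AE x in lebesgue. Q x" by (intro AE_I'[of "{x. \<not> Q x}"]) (simp_all add: negligible_iff_null_sets)
qed

lemma continuous_AE_le:
  fixes h :: "real^'n::finite \<Rightarrow> real"
  assumes h: "continuous_on UNIV h" and AE: "AE x in lebesgue. h x \<le> K"
  shows "h x \<le> K"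
proof -
  have "open (h -` {K<..})" using h by (intro open_vimage) auto
  moreover have "negligible (h -` {K<..})"
    using AE unfolding AE_lebesgue_negligible vimage_def by (simp add: not_le)
  ultimately have "h -` {K<..} = {}" using open_not_negligible by blast
  then show ?thesis by (auto simp: not_less[symmetric])
qed

lemma AE_lebesgue_scaleR:
  fixes Q :: "real^'n::finite \<Rightarrow> bool"
  assumes AE: "AE x in lebesgue. Q x" and c: "c \<noteq> 0"
  shows "AE x in lebesgue. Q (c *\<^sub>R x)"
proof -
  have "negligible ((\<lambda>x. inverse c *\<^sub>R x) ` {x. \<not> Q x})"
    by (rule negligible_differentiable_image_negligible[OF order_refl AE[unfolded AE_lebesgue_negligible]])
      (intro derivative_intros)
  moreover have "{x. \<not> Q (c *\<^sub>R x)} \<subseteq> (\<lambda>x. inverse c *\<^sub>R x) ` {x. \<not> Q x}"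
  proof
    fix x assume "x \<in> {x. \<not> Q (c *\<^sub>R x)}"
    then have "c *\<^sub>R x \<in> {x. \<not> Q x}" by simp
    moreover have "x = inverse c *\<^sub>R (c *\<^sub>R x)" using c by simp
    ultimately show "x \<in> (\<lambda>x. inverse c *\<^sub>R x) ` {x. \<not> Q x}" by (rule rev_image_eqI)
  qed
  ultimately show ?thesis unfolding AE_lebesgue_negligible by (rule negligible_subset)
qed

context flow_form
begin

text \<open>
  By uniqueness \<open>u\<close> is the solution of the Koch--Lamm theorem, whose analytic bounds are linear in the
  size of the data.  The constants \<open>A\<close> and \<open>B\<close> are therefore independent of \<open>\<epsilon>\<close>, which can be chosen
  afterwards.
\<close>

lemma global_solution_solves:
  assumes kl: "koch_lamm F N eps0 C"
  shows "\<exists>A>0. \<exists>B>0. \<forall>\<epsilon> L u0 u f. 0 < \<epsilon> \<longrightarrow> \<epsilon> \<le> eps0 \<longrightarrow> grad_norm u0 < ennreal \<epsilon> \<longrightarrow>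
    global_mild_solution F N C u0 u \<longrightarrow> u0 \<in> borel_measurable lebesgue \<longrightarrow>
    lipschitz_by L f \<longrightarrow> (AE x in lebesgue. f x = u0 x) \<longrightarrow> solves L (A * \<epsilon>) (B * \<epsilon>) f u"
proof -
  obtain c R where c: "c > 0" and R: "R > 0" and E: "\<And>u0. grad_norm u0 < ennreal eps0 \<Longrightarrow>
      (\<exists>u. mild_solution F N u0 u \<and> X_norm F \<infinity> u \<le> ennreal C * grad_norm u0 \<and>
           (\<forall>u'. mild_solution F N u0 u' \<and> X_norm F \<infinity> u' \<le> ennreal (C * eps0) \<longrightarrow>
                   (\<forall>x. \<forall>t\<ge>0. u' x t = u x t)) \<and>
             analytic_pos_time u \<and> analytic_bounds F c R (enn2real (grad_norm u0)) u)"
    and C: "C > 0" and e0: "eps0 > 0"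
    using kl unfolding koch_lamm_def by auto
  define A where "A = c * (1 + CARD('n) * R)"
  define B where "B = c * (2 * R\<^sup>2 + R)"
  have A: "A > 0" "c \<le> A" "CARD('n) * (c * R) \<le> A"
    using c R by (simp_all add: A_def add_pos_nonneg distrib_left)
  have B: "B > 0" "2 * c * R\<^sup>2 \<le> B" "c * R \<le> B"
    using c R by (simp_all add: B_def add_pos_pos distrib_left)
  have "solves L (A * \<epsilon>) (B * \<epsilon>) f u"
    if \<epsilon>: "0 < \<epsilon>" "\<epsilon> \<le> eps0" and small: "grad_norm u0 < ennreal \<epsilon>" and gm: "global_mild_solution F N C u0 u"
      and m: "u0 \<in> borel_measurable lebesgue" and f: "lipschitz_by L f" and eq: "AE x in lebesgue. f x = u0 x"
    for \<epsilon> L u0 u f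
  proof (rule mild_imp_solves[OF _ f eq m])
    have mu: "mild_solution F N u0 u" and Xu: "X_norm F \<infinity> u \<le> ennreal C * grad_norm u0"
      using gm by (auto simp: global_mild_solution_def)
    show "mild_solution F N u0 u" by (rule mu)
    have lt: "grad_norm u0 < ennreal eps0" by (rule order.strict_trans2[OF small ennreal_leI[OF \<epsilon>(2)]])
    obtain w where w: "\<forall>u'. mild_solution F N u0 u' \<and> X_norm F \<infinity> u' \<le> ennreal (C * eps0) \<longrightarrow>
                   (\<forall>x. \<forall>t\<ge>0. u' x t = w x t)"
      and an: "analytic_pos_time w" and ab: "analytic_bounds F c R (enn2real (grad_norm u0)) w"
      using E[OF lt] by blast
    have "ennreal C * grad_norm u0 \<le> ennreal C * ennreal eps0" using lt by (intro mult_left_mono) auto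
    also have "\<dots> = ennreal (C * eps0)" using C e0 by (simp add: ennreal_mult)
    finally have "X_norm F \<infinity> u \<le> ennreal (C * eps0)" using Xu by (rule order_trans[rotated])
    then have "\<forall>x. \<forall>t\<ge>0. u x t = w x t" using w mu by blast
    then have uw: "(\<lambda>x. u x t) = (\<lambda>x. w x t)" if "t > 0" for t using that by (simp add: fun_eq_iff)
    define m where "m = enn2real (grad_norm u0)"
    have m: "0 \<le> m" "m \<le> \<epsilon>" using small \<epsilon> by (auto simp: m_def intro!: enn2real_leI)
    note an = analytic_consequences[OF an ab[folded m_def]]
    have mono: "a * m * r \<le> D * \<epsilon> * r" if "a \<le> D" "0 \<le> D" "0 \<le> r" for a D r
      using that m by (intro mult_right_mono mult_mono) auto
    show "fields_bounded (A * \<epsilon>) (B * \<epsilon>) (Gr u) (He u)"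
      unfolding fields_bounded_def
    proof (intro conjI allI impI)
      show "0 \<le> A * \<epsilon>" "0 \<le> B * \<epsilon>" using A B \<epsilon> by simp_all
      fix t :: real and x :: "real^'n" assume t: "t > 0"
      have "norm (Gr w x t) \<le> c * m" by (rule an(1)[OF t])
      also have "\<dots> \<le> A * \<epsilon>" using mono[OF A(2), of 1] A(1) by simp
      finally show "norm (Gr u x t) \<le> A * \<epsilon>" by (simp add: uw[OF t])
      have "norm (He w x t) \<le> CARD('n) * (c * m * R) * t powr (- 1 / \<alpha>)" by (rule an(2)[OF t])
      also have "\<dots> = CARD('n) * (c * R) * m * t powr (- 1 / \<alpha>)" by (simp add: mult_ac)
      also have "\<dots> \<le> A * \<epsilon> * t powr (- 1 / \<alpha>)" using A by (intro mono) auto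
      finally show "norm (He u x t) \<le> A * \<epsilon> * t powr (- 1 / \<alpha>)" by (simp add: uw[OF t])
      fix h i j
      have "\<bar>He w (x + h *\<^sub>R axis i 1) t $ i $ j - He w x t $ i $ j\<bar> \<le> 2 * c * m * R\<^sup>2 * t powr (- 2 / \<alpha>) * \<bar>h\<bar>"
        by (rule an(3)[OF t])
      also have "\<dots> = 2 * c * R\<^sup>2 * m * (t powr (- 2 / \<alpha>) * \<bar>h\<bar>)" by (simp add: mult_ac)
      also have "\<dots> \<le> B * \<epsilon> * (t powr (- 2 / \<alpha>) * \<bar>h\<bar>)" using B by (intro mono) auto
      finally show "\<bar>He u (x + h *\<^sub>R axis i 1) t $ i $ j - He u x t $ i $ j\<bar> \<le> B * \<epsilon> * t powr (- 2 / \<alpha>) * \<bar>h\<bar>"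
        by (simp add: uw[OF t] mult.assoc)
    next
      fix s t :: real and x :: "real^'n" and j assume t: "t > 0" and s: "s > 0"
      have "\<bar>Gr w x t $ j - Gr w x s $ j\<bar> \<le> c * m * R / min s t * \<bar>t - s\<bar>" by (rule an(4)[OF t s])
      also have "\<dots> = c * R * m * (\<bar>t - s\<bar> / min s t)" by simp
      also have "\<dots> \<le> B * \<epsilon> * (\<bar>t - s\<bar> / min s t)" using B s t by (intro mono) auto
      finally show "\<bar>Gr u x t $ j - Gr u x s $ j\<bar> \<le> B * \<epsilon> / min s t * \<bar>t - s\<bar>"
        by (simp add: uw[OF t] uw[OF s])
    qed
  qed
  then show ?thesis using A(1) B(1) by blast
qed

text \<open>
  Otherwise there are bad points at arbitrarily late times, to which \<open>rescaled_solutions_merge\<close>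
  applies; passing to a subsequence is harmless because all points of the sequence are bad.
\<close>

lemma solutions_merge:
  fixes L \<delta> eps0 C K e :: real
  assumes kl: "koch_lamm F N eps0 C" and S: "solves L \<delta> B f u" "solves L \<delta> B g v"
    and small: "CARD('n) * L < eps0" "X_const * \<delta> \<le> C * eps0"
    and K: "\<And>y. \<bar>f y - g y\<bar> \<le> K" and e: "e > 0"
  shows "\<exists>T>0. \<forall>t\<ge>T. \<forall>x. \<bar>u x t - v x t\<bar> / t powr (1 / \<alpha>) \<le> e \<and> norm (Gr u x t - Gr v x t) \<le> e"
proof (rule ccontr)
  assume neg: "\<not> ?thesis"
  have "\<exists>t x. t \<ge> real (Suc k) \<and> \<not> (\<bar>u x t - v x t\<bar> / t powr (1 / \<alpha>) \<le> e \<and> norm (Gr u x t - Gr v x t) \<le> e)" for k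
  proof (rule ccontr)
    assume "\<not> ?thesis"
    then show False using neg by (meson of_nat_0_less_iff zero_less_Suc)
  qed
  then obtain t x where t: "\<And>k. t k \<ge> real (Suc k)"
    and bad: "\<And>k. \<not> (\<bar>u (x k) (t k) - v (x k) (t k)\<bar> / t k powr (1 / \<alpha>) \<le> e \<and> norm (Gr u (x k) (t k) - Gr v (x k) (t k)) \<le> e)"
    by metis
  have t0: "t k > 0" for k using t[of k] by (simp add: order.strict_trans2)
  define c where "c k = t k powr (1 / \<alpha>)" for k
  have c0: "c k > 0" for k using t0[of k] by (simp add: c_def)
  have ct: "c k powr \<alpha> = t k" for k using t0[of k] alpha_pos by (simp add: c_def powr_powr)
  have "filterlim (\<lambda>k. real (Suc k)) at_top sequentially"
    by (rule filterlim_compose[OF filterlim_real_sequentially filterlim_Suc])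
  then have "filterlim t at_top sequentially"
    by (rule filterlim_at_top_mono) (use t in simp)
  moreover have "filterlim (\<lambda>s::real. s powr (1 / \<alpha>)) at_top at_top"
    unfolding filterlim_at_top
  proof (intro allI eventually_at_top_linorderI)
    fix Z s :: real assume s: "(max Z 1) powr \<alpha> \<le> s"
    have "max Z 1 = ((max Z 1) powr \<alpha>) powr (1 / \<alpha>)" using alpha_pos by (simp add: powr_powr)
    also have "\<dots> \<le> s powr (1 / \<alpha>)" using s alpha_pos by (intro powr_mono2) auto
    finally show "Z \<le> s powr (1 / \<alpha>)" by simp
  qed
  ultimately have c1: "filterlim c at_top sequentially"
    unfolding c_def by (rule filterlim_compose[rotated])
  obtain r where r1: "(\<lambda>k. (u (x (r k)) (c (r k) powr \<alpha>) - v (x (r k)) (c (r k) powr \<alpha>)) / c (r k)) \<longlonglongrightarrow> 0"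
    and r2: "(\<lambda>k. Gr u (x (r k)) (c (r k) powr \<alpha>) - Gr v (x (r k)) (c (r k) powr \<alpha>)) \<longlonglongrightarrow> 0"
    using rescaled_solutions_merge[OF kl S small K c0 c1, of x] by blast
  have "\<forall>\<^sub>F k in sequentially. norm ((u (x (r k)) (c (r k) powr \<alpha>) - v (x (r k)) (c (r k) powr \<alpha>)) / c (r k)) < e"
    "\<forall>\<^sub>F k in sequentially. norm (Gr u (x (r k)) (c (r k) powr \<alpha>) - Gr v (x (r k)) (c (r k) powr \<alpha>)) < e"
    using r1 r2 e unfolding tendsto_iff by (simp_all add: dist_norm)
  then have "\<forall>\<^sub>F k in sequentially. False"
  proof eventually_elim
    case (elim k)
    have "\<bar>u (x (r k)) (t (r k)) - v (x (r k)) (t (r k))\<bar> / c (r k) \<le> e"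
      using elim(1) c0[of "r k"] unfolding ct by (simp add: abs_divide)
    moreover have "norm (Gr u (x (r k)) (t (r k)) - Gr v (x (r k)) (t (r k))) \<le> e" using elim(2) unfolding ct by simp
    ultimately show ?case using bad[of "r k"] unfolding c_def by blast
  qed
  then show False by simp
qed

text \<open>
  The datum is invariant under the scaling, so by uniqueness the solution is.  Self-similarity of the
  Lipschitz representative \<open>g\<close> is inherited from \<open>v0\<close> almost everywhere, and then everywhere by
  continuity.
\<close>

lemma self_similar_solution:
  fixes L \<delta> eps0 C :: real
  assumes kl: "koch_lamm F N eps0 C" and S: "solves L \<delta> B g v"
    and small: "CARD('n) * L < eps0" "X_const * \<delta> \<le> C * eps0"
    and ss: "self_similar v0" and AE: "AE x in lebesgue. g x = v0 x" and t: "t > 0"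
  shows "v x t = t powr (1 / \<alpha>) * v (t powr (- 1 / \<alpha>) *\<^sub>R x) 1"
proof -
  have g: "continuous_on UNIV g" using S lipschitz_by_continuous by (auto simp: solves_def)
  define c where "c = t powr (1 / \<alpha>)"
  have c: "c > 0" using t by (simp add: c_def)
  have ct: "c powr \<alpha> = t" using t alpha_pos by (simp add: c_def powr_powr)
  have AE': "AE x in lebesgue. \<bar>g (c *\<^sub>R x) / c - g x\<bar> \<le> 0"
    using AE AE_lebesgue_scaleR[OF AE c[THEN less_imp_neq, symmetric]]
  proof eventually_elim
    case (elim x)
    have "v0 x = (1 / c) * v0 (c *\<^sub>R x)" using ss c unfolding self_similar_def by blast
    then show ?case using elim by simp
  qed
  have "\<bar>g (c *\<^sub>R x) / c - g x\<bar> \<le> 0" for x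
    by (rule continuous_AE_le[OF _ AE'])
      (use c in \<open>auto intro!: continuous_intros continuous_on_compose2[OF g]\<close>)
  then have "(\<lambda>y. g (0 + c *\<^sub>R y) / c - 0) = g" by (simp add: fun_eq_iff)
  then have S': "solves L \<delta> B g (\<lambda>y s. v (0 + c *\<^sub>R y) (c powr \<alpha> * s) / c - mass * 0)"
    using solves_rescale(1)[OF S c, of 0 0] by simp
  have "v (0 + c *\<^sub>R y) (c powr \<alpha> * 1) / c - mass * 0 = v y 1" for y
    by (rule solutions_unique[OF kl S' S small zero_less_one])
  from this[of "(1 / c) *\<^sub>R x"] have "v x t = c * v ((1 / c) *\<^sub>R x) 1" using c by (simp add: ct field_simps)
  moreover have "1 / c = t powr (- 1 / \<alpha>)" by (simp add: c_def powr_minus_divide)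
  ultimately show ?thesis by (simp add: c_def)
qed

lemma rescaled_difference_C1:
  assumes C2: "spatially_C2 u" "spatially_C2 v" and t: "t > 0" and c: "c > 0"
    and b: "\<And>x. \<bar>u x t - v x t\<bar> / c \<le> e" "\<And>x. norm (Gr u x t - Gr v x t) \<le> e"
  shows "C1_norm (\<lambda>x. u (c *\<^sub>R x) t / c - v (c *\<^sub>R x) t / c) \<le> ennreal (2 * e)"
proof -
  let ?D = "\<lambda>x. u (c *\<^sub>R x) t / c - v (c *\<^sub>R x) t / c"
  have e: "e \<ge> 0" using b(2) order_trans[OF norm_ge_zero] by blast
  have D: "\<bar>?D x\<bar> \<le> e" for x
    using b(1)[of "c *\<^sub>R x"] c by (simp add: abs_divide flip: diff_divide_distrib)
  have "grad ?D x = Gr u (c *\<^sub>R x) t - Gr v (c *\<^sub>R x) t" for x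
  proof (rule vec_eq_iff[THEN iffD2, rule_format])
    fix i
    have sc: "has_pd i (\<lambda>x. w (c *\<^sub>R x) t / c) x (Gr w (c *\<^sub>R x) t $ i)" if C2: "spatially_C2 w" for w
      using DERIV_cdivide[OF has_pd_scale[OF C2_pd(1)[OF C2 t, of i "c *\<^sub>R x"], of 1, unfolded has_pd_def], of c] c
      by (simp add: has_pd_def)
    have "has_pd i ?D x (Gr u (c *\<^sub>R x) t $ i - Gr v (c *\<^sub>R x) t $ i)"
      using sc[OF C2(1)] sc[OF C2(2)] unfolding has_pd_def by (rule DERIV_diff)
    then show "grad ?D x $ i = (Gr u (c *\<^sub>R x) t - Gr v (c *\<^sub>R x) t) $ i"
      by (simp add: grad_def has_pd_imp_pd)
  qed
  then have G: "norm (grad ?D x) \<le> e" for x using b(2) by simp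
  have "C1_norm ?D \<le> ennreal e + ennreal e"
    unfolding C1_norm_def using D G by (intro add_mono SUP_least ennreal_leI)
  also have "ennreal e + ennreal e = ennreal (e + e)" by (rule ennreal_plus[OF e e, symmetric])
  finally show ?thesis by (simp only: mult_2)
qed

lemma lipschitz_data:
  fixes u0 :: "real^'n \<Rightarrow> real" and \<epsilon> :: real
  assumes "\<exists>G. weak_gradient u0 G \<and> (AE x in lebesgue. norm (G x) \<le> \<epsilon>)" "\<epsilon> > 0"
  shows "\<exists>f. lipschitz_by (CARD('n) * \<epsilon>) f \<and> (AE x in lebesgue. f x = u0 x) \<and> u0 \<in> borel_measurable lebesgue"
  using weak_gradient_imp_lipschitz_representative[of u0 _ \<epsilon>] assms unfolding lipschitz_by_def by fastforce

end

theorem theorem2p3: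
  fixes F :: flow and N :: "('n::finite) nonlin" and \<beta> eps0 C :: real
  assumes "F = WF \<Longrightarrow> CARD('n) = 2"
    and "rewriting F N"
    and "koch_lamm F N eps0 C"
    and "0 < \<beta>"
  shows "\<exists>\<epsilon>>0. \<epsilon> \<le> eps0 \<and>
    (\<forall>(v0 :: real^'n \<Rightarrow> real) (p :: real^'n \<Rightarrow> real)
       (u :: real^'n \<Rightarrow> real \<Rightarrow> real) (v :: real^'n \<Rightarrow> real \<Rightarrow> real) (\<Psi> :: real^'n \<Rightarrow> real).
       self_similar v0 \<and>
       Linf p < \<infinity> \<and>
       grad_norm v0 + weighted_grad_norm (\<lambda>x. 1 + norm x powr \<beta>) p < ennreal \<epsilon> \<and>
       global_mild_solution F N C (\<lambda>x. v0 x + p x) u \<and>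
       global_mild_solution F N C v0 v \<and>
       \<Psi> = (\<lambda>x. v x 1) \<longrightarrow>
         (\<forall>x. \<forall>t>0. v x t = t powr (1 / alpha F) * \<Psi> (t powr (- 1 / alpha F) *\<^sub>R x)) \<and>
         ((\<lambda>t. C1_norm (\<lambda>x. t powr (- 1 / alpha F) * u (t powr (1 / alpha F) *\<^sub>R x) t - \<Psi> x))
            \<longlongrightarrow> 0) at_top)"
proof -
  interpret flow_form F N
    by unfold_locales (use assms(2) in \<open>simp add: rewriting_def\<close>)
  note kl = assms(3)
  have pos: "eps0 > 0" "C > 0" using kl by (auto simp: koch_lamm_def)
  obtain A B where A: "A > 0" and gs: "\<And>\<epsilon> L u0 u f. 0 < \<epsilon> \<Longrightarrow> \<epsilon> \<le> eps0 \<Longrightarrow> grad_norm u0 < ennreal \<epsilon> \<Longrightarrow>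
    global_mild_solution F N C u0 u \<Longrightarrow> u0 \<in> borel_measurable lebesgue \<Longrightarrow>
    lipschitz_by L f \<Longrightarrow> (AE x in lebesgue. f x = u0 x) \<Longrightarrow> solves L (A * \<epsilon>) (B * \<epsilon>) f u"
    using global_solution_solves[OF kl] by blast
  let ?n = "real CARD('n)"
  have n: "?n \<ge> 1" by simp
  have X: "X_const > 0" by (simp add: X_const_def add_pos_nonneg)
  \<comment> \<open>The Lipschitz constant of the representatives is \<open>n \<epsilon>\<close>, and weak gradients of such functions are
    bounded by \<open>n\<close> times that; the second entry puts the solutions into the uniqueness ball.\<close>
  define \<epsilon> where "\<epsilon> = min (eps0 / (2 * (?n * ?n))) (C * eps0 / (X_const * A))"
  have \<epsilon>: "\<epsilon> > 0" using pos X A by (simp add: \<epsilon>_def)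
  have nn: "?n * ?n \<ge> 1" using mult_mono[OF n n] by simp
  have "\<epsilon> * (2 * (?n * ?n)) \<le> eps0 / (2 * (?n * ?n)) * (2 * (?n * ?n))"
    by (intro mult_right_mono) (simp_all add: \<epsilon>_def)
  then have e1: "2 * (?n * (?n * \<epsilon>)) \<le> eps0" by (simp add: mult_ac)
  have "\<epsilon> * (X_const * A) \<le> C * eps0 / (X_const * A) * (X_const * A)"
    using X A by (intro mult_right_mono) (simp_all add: \<epsilon>_def)
  then have small2: "X_const * (A * \<epsilon>) \<le> C * eps0" using X A by (simp add: mult_ac)
  have "1 * \<epsilon> \<le> (?n * ?n) * \<epsilon>" using nn \<epsilon> by (intro mult_right_mono) simp_all
  then have small1: "?n * (?n * \<epsilon>) < eps0" and le: "\<epsilon> \<le> eps0"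
    using e1 \<epsilon> unfolding mult.assoc by linarith+
  show ?thesis
  proof (intro exI[of _ \<epsilon>] conjI allI impI \<epsilon> le, goal_cases)
    case (1 v0 p u v \<Psi> x t)
    then have ss: "self_similar v0" and lt: "grad_norm v0 + weighted_grad_norm (\<lambda>x. 1 + norm x powr \<beta>) p < ennreal \<epsilon>"
      and gv: "global_mild_solution F N C v0 v" and \<Psi>: "\<Psi> = (\<lambda>x. v x 1)" and t: "t > 0" by auto
    note pd = perturbed_data_gradient[OF lt]
    obtain g where g: "lipschitz_by (?n * \<epsilon>) g" "AE x in lebesgue. g x = v0 x" "v0 \<in> borel_measurable lebesgue"
      using lipschitz_data[OF pd(1) \<epsilon>] by blast
    have S: "solves (?n * \<epsilon>) (A * \<epsilon>) (B * \<epsilon>) g v" by (rule gs[OF \<epsilon> le pd(3) gv g(3,1,2)])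
    show ?case unfolding \<Psi> by (rule self_similar_solution[OF kl S small1 small2 ss g(2) t])
  next
    case (2 v0 p u v \<Psi>)
    then have ss: "self_similar v0" and lt: "grad_norm v0 + weighted_grad_norm (\<lambda>x. 1 + norm x powr \<beta>) p < ennreal \<epsilon>"
      and gu: "global_mild_solution F N C (\<lambda>x. v0 x + p x) u" and p: "Linf p < \<infinity>"
      and gv: "global_mild_solution F N C v0 v" and \<Psi>: "\<Psi> = (\<lambda>x. v x 1)" by auto
    note pd = perturbed_data_gradient[OF lt]
    obtain g where g: "lipschitz_by (?n * \<epsilon>) g" "AE x in lebesgue. g x = v0 x" "v0 \<in> borel_measurable lebesgue"
      using lipschitz_data[OF pd(1) \<epsilon>] by blast
    obtain f where f: "lipschitz_by (?n * \<epsilon>) f" "AE x in lebesgue. f x = v0 x + p x" "(\<lambda>x. v0 x + p x) \<in> borel_measurable lebesgue"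
      using lipschitz_data[OF pd(2) \<epsilon>] by blast
    have Sv: "solves (?n * \<epsilon>) (A * \<epsilon>) (B * \<epsilon>) g v" by (rule gs[OF \<epsilon> le pd(3) gv g(3,1,2)])
    have Su: "solves (?n * \<epsilon>) (A * \<epsilon>) (B * \<epsilon>) f u" by (rule gs[OF \<epsilon> le pd(4) gu f(3,1,2)])
    have C2: "spatially_C2 u" "spatially_C2 v" using Su Sv by (auto simp: solves_def)
    obtain K0 where "Linf p = ennreal K0" "K0 \<ge> 0" using p by (cases "Linf p") auto
    then have "Linf p < ennreal (K0 + 1)" by (simp add: ennreal_less_iff)
    then obtain K where "Linf p < ennreal K" by blast
    then have pK: "AE x in lebesgue. norm (p x) \<le> K" by (rule Linf_less_imp_AE)
    have "AE x in lebesgue. \<bar>f x - g x\<bar> \<le> K" using pK f(2) g(2) by eventually_elim simp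
    then have K: "\<bar>f y - g y\<bar> \<le> K" for y
      by (rule continuous_AE_le[rotated]) (intro continuous_intros lipschitz_by_continuous[OF f(1)] lipschitz_by_continuous[OF g(1)])
    have le2: "\<forall>\<^sub>F t in at_top. C1_norm (\<lambda>x. t powr (- 1 / \<alpha>) * u (t powr (1 / \<alpha>) *\<^sub>R x) t - \<Psi> x) \<le> ennreal (2 * e)" if e: "e > 0" for e
    proof -
      obtain T where T: "T > 0" "\<And>t x. t \<ge> T \<Longrightarrow> \<bar>u x t - v x t\<bar> / t powr (1 / \<alpha>) \<le> e \<and> norm (Gr u x t - Gr v x t) \<le> e"
        using solutions_merge[OF kl Su Sv small1 small2 K e] by blast
      show ?thesis
      proof (rule eventually_at_top_linorderI[of T])
        fix t assume t: "T \<le> t"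
        then have t0: "t > 0" using T(1) by simp
        let ?c = "t powr (1 / \<alpha>)"
        have c: "?c > 0" "t powr (- 1 / \<alpha>) = 1 / ?c" using t0 by (simp_all add: powr_minus_divide)
        have "v (?c *\<^sub>R x) t = ?c * \<Psi> x" for x
          using self_similar_solution[OF kl Sv small1 small2 ss g(2) t0, of "?c *\<^sub>R x"] c by (simp add: \<Psi>)
        then have "(\<lambda>x. t powr (- 1 / \<alpha>) * u (?c *\<^sub>R x) t - \<Psi> x) = (\<lambda>x. u (?c *\<^sub>R x) t / ?c - v (?c *\<^sub>R x) t / ?c)"
          using c by (simp add: fun_eq_iff)
        then show "C1_norm (\<lambda>x. t powr (- 1 / \<alpha>) * u (?c *\<^sub>R x) t - \<Psi> x) \<le> ennreal (2 * e)"
          using rescaled_difference_C1[OF C2 t0 c(1)] T(2)[OF t] by simp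
      qed
    qed
    show ?case
    proof (rule order_tendstoI)
      fix a :: ennreal assume a: "0 < a"
      obtain z where z: "0 < z" "z < a" using dense[OF a] by blast
      then have "z < top" by (auto intro: order.strict_trans2)
      then obtain d where d: "0 < d" "ennreal d < a" using z by (cases z) auto
      have "\<forall>\<^sub>F t in at_top. C1_norm (\<lambda>x. t powr (- 1 / \<alpha>) * u (t powr (1 / \<alpha>) *\<^sub>R x) t - \<Psi> x) \<le> ennreal (2 * (d / 2))"
        using d by (intro le2) simp
      then show "\<forall>\<^sub>F t in at_top. C1_norm (\<lambda>x. t powr (- 1 / \<alpha>) * u (t powr (1 / \<alpha>) *\<^sub>R x) t - \<Psi> x) < a"
        by eventually_elim (use d in \<open>auto intro: order.strict_trans1\<close>)
    qed simp
  qed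
qed

end
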